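(* Let $A$ be an abelian category and $F:J\to B(A)$ a contravariant differential graded functor, with the associated functors $E$, $G$, $G_b$, $F_N^b$, spectral sequences $S$, $S_N^b$ and weight filtration $W$ on $H^*(E(X))$. Suppose that there are no maps between different weights, i.e. for any $P,P',Q,Q'\in SmPrVar$, $f\in SmCor(P,P')$, $g\in SmCor(Q,Q')$, and $i\neq j$, $$A\Big(\ker\big(H^i(E([P']))\xrightarrow{f^*}H^i(E([P]))\big),\ \mathrm{Coker}\big(H^j(E([Q']))\xrightarrow{g^*}H^j(E([Q]))\big)\Big)=0.$$ Then $S$ and all $S_N^b$ degenerate at $E_1$. Therefore, for any $X\in\mathrm{Obj}\,\mathfrak{H}$, $j,b\in\mathbb{Z}$ and $N\ge0$, $$H^j(F_N^b(X))=W_b(H^j(E(X)))/W_{b-N-1}(H^j(E(X)));$$ in particular, the functor $X\mapsto W_b(H^j(E(X)))/W_{b-N-1}(H^j(E(X)))$ factors through $t_N$.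
   Context: $k$ is a field of characteristic $0$; $SmPrVar$ are the smooth projective varieties over $k$; $SmCor$ is the category of smooth varieties and finite correspondences. $A(-,-)$ denotes the morphism groups of $A$. Cubical Suslin complexes. For $P,Y$ smooth, $i\le 0$ put $C'^i(P)(Y)=SmCor(\mathbb{A}^{-i}\times Y,P)$. For $1\le j\le -i$, $x\in\{0,1\}$ let $d_{jx}:C'^i\to C'^{i+1}$ be composition with the map induced by $(x_1,\dots,x_{-1-i})\mapsto(x_1,\dots,x_{j-1},x,x_j,\dots,x_{-1-i})$. Put $C^i(P)(Y)=\bigcap_j\ker d_{j0}$, $\delta^i=\sum_{1\le j\le -i}(-1)^jd_{j1}$, $C^i=0$ for $i>0$. For $f\in C^i(P)(Y)$, $l\le 0$ let $f^l:C^l(Y)\to C^{l+i}(P)$ send $h\in SmCor(\mathbb{A}^{-l}\times Z,Y)$ to $(-1)^{li}f\circ(\mathrm{id}_{\mathbb{A}^{-i}}\otimes h)$. $J$ is the differential graded category with objects $[P]$, $P\in SmPrVar$, $J^i([P],[Q])=C^i(Q)(P)$, composition of $g\in C^j(Y)(Z)$, $f\in C^i(X)(Y)$ equal to $f^j(g)$, differential $\delta$; it has no morphisms of positive degree. Twisted complexes. For a differential graded category $C$, $\mathrm{PreTr}(C)$ has objects $(P^i,q_{ij})$, $P^i\in\mathrm{Obj}\,C$ almost all $0$, $q_{ij}\in C^{i-j+1}(P^i,P^j)$, $\delta q_{ij}+\sum_lq_{lj}\circ q_{il}=0$, and $\mathrm{PreTr}(C)^l((P^i,q_{ij}),(P'^i,q'_{ij}))=\bigoplus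 C^{l+i-j}(P^i,P'^j)$ with differential $\delta_Cf+\sum_m(q'_{jm}\circ f-(-1)^{(i-m)l}f\circ q_{mi})$ for $f\in C^{l+i-j}(P^i,P'^j)$; $\mathrm{Tr}(C)$ is its homotopy category. $J'=\mathrm{PreTr}(J)$, $\mathfrak{H}=\mathrm{Tr}(J)$. $B(A)$ is the differential graded category of unbounded complexes over $A$ and $K(A)$ its homotopy category; $\mathrm{PreTr}(B(A))\cong B(A)$ by total complexes. $G=\mathrm{PreTr}(F):J'\to B(A)$ and $E=\mathrm{Tr}(F):\mathfrak{H}\to K(A)$ (contravariant). For a complex $Y$ over $A$: $\tau_{\le b}Y=(\dots\to Y^{b-1}\to\ker(Y^b\to Y^{b+1}))$; the canonical $[a,b]$-truncation is $Y^a/dY^{a-1}\to Y^{a+1}\to\dots\to Y^{b-1}\to\ker(Y^b\to Y^{b+1})$ (and $H^a(Y)$ in degree $a$ if $a=b$). $G_b=\mathrm{PreTr}(\tau_{\le b}F)$; $F_N^b:\mathfrak{H}\to K(A)$ is $\mathrm{Tr}$ of the functor sending $[P]$ to the canonical $[b-N,b]$-truncation of $F([P])$. The complexes $G_b(X)$ form an increasing filtration of $G(X)$, and $G_b(X)/G_{b-N-1}(X)$ is naturally quasi-isomorphic to $F_N^b(X)$. $S$ is the spectral sequence of this filtered complex, $E_1^{ij}(S)=H^{i+j}(G_j(X)/G_{j-1}(X))=H^{i+j}(F_0^j(X))\Rightarrow H^{i+j}(E(X))$ ($j$ is the filtration index and $i+j$ the total degree); $S_N^b$ is the analogous spectral sequence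 for the induced filtration of $G_b(X)/G_{b-N-1}(X)$, converging to $H^{i+j}(F_N^b(X))$. $W_l(H^s(E(X)))$ is the image of $H^s(G_l(X))$ in $H^s(G(X))=H^s(E(X))$. Truncation functors $t_N$. For $N\ge0$ let $C_N(P)$ be the quotient complex of $C(P)$ with $C_N^i=C^i$ for $i>-N$, $C_N^{-N}=C^{-N}/\delta C^{-N-1}$, and $0$ below; $J_N$ has objects $[P]$, $J_N^i([P],[Q])=C_N^i(Q)(P)$ with composition and differential induced from $J$; $\mathfrak{H}_N=\mathrm{Tr}(J_N)$, $t_N:\mathfrak{H}\to\mathfrak{H}_N$ is induced by $J\to J_N$.
   Formalization: In PreTr(C), δ carries the shift sign (-1)^i in the equation for q_ij and in the differential, with the other signs adjusted to match, because with the formulas as written the differential does not square to zero, so Tr(C) is undefined. *)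

theory Defs
  imports
    "HOL-Library.Poly_Mapping"
    "HOL-Algebra.Algebraic_Closure_Type"
    "HOL-Algebra.Ideal_Product"
    "HOL-Algebra.FiniteProduct"
    "HOL-Algebra.Coset"
begin

no_notation var (\<open>X\<index>\<close>)  (* frees the identifier X *)

section \<open>Varieties over a field of characteristic zero\<close>

text \<open>
  The only varieties entering the Suslin complexes below are products of affine spaces with
  smooth projective varieties. We work with the reduced closed subschemes of products of affine
  lines and projective spaces over \<open>k\<close>. As \<open>k\<close> is perfect, such a scheme is the same thing as a
  set of geometric points (points over the algebraic closure) cut out by multihomogeneous
  polynomials with coefficients in \<open>k\<close>.

  A geometric point is a list of coordinate vectors, one for each factor of the ambient space;
  homogeneous coordinates are normalised by requiring the first non-zero one to be \<open>1\<close>, so that a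
  point has exactly one representative. A product of ambient spaces is the concatenation of the
  lists, hence products are strictly associative. The polynomial variable \<open>(a, i)\<close> is the
  coordinate number \<open>i\<close> of the factor number \<open>a\<close>.
\<close>

datatype factor = Aff | Proj nat

type_synonym ambient = "factor list"
type_synonym 'k point = "'k alg_closure list list"
type_synonym monomial = "nat \<times> nat \<Rightarrow>\<^sub>0 nat"
type_synonym 'k mpoly = "monomial \<Rightarrow>\<^sub>0 'k"
type_synonym 'k variety = "ambient \<times> 'k point set"

fun ncoords :: "factor \<Rightarrow> nat" where
  "ncoords Aff = 1"
| "ncoords (Proj n) = Suc n"

fun factor_points :: "factor \<Rightarrow> 'k::field alg_closure list set" where
  "factor_points Aff = {c. length c = 1}"
| "factor_points (Proj n) =
     {c. length c = Suc n \<and> (\<exists>i\<le>n. c ! i = 1 \<and> (\<forall>j<i. c ! j = 0))}"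

definition amb_points :: "ambient \<Rightarrow> 'k::field point set" where
  "amb_points fs = {x. list_all2 (\<lambda>F c. c \<in> factor_points F) fs x}"

definition variables :: "ambient \<Rightarrow> (nat \<times> nat) set" where
  "variables fs = {(a, i). a < length fs \<and> i < ncoords (fs ! a)}"

definition mpolys :: "ambient \<Rightarrow> 'k::field mpoly set" where
  "mpolys fs = {f. \<forall>m\<in>Poly_Mapping.keys f. Poly_Mapping.keys m \<subseteq> variables fs}"

definition monom_eval :: "monomial \<Rightarrow> 'k::field point \<Rightarrow> 'k alg_closure" where
  "monom_eval m x =
     (\<Prod>v\<in>Poly_Mapping.keys m. (x ! fst v ! snd v) ^ Poly_Mapping.lookup m v)"

definition meval :: "'k::field mpoly \<Rightarrow> 'k point \<Rightarrow> 'k alg_closure" where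
  "meval f x = (\<Sum>m\<in>Poly_Mapping.keys f. to_ac (Poly_Mapping.lookup f m) * monom_eval m x)"

text \<open>The partial derivative with respect to the variable \<open>v\<close>, evaluated at a point.\<close>

definition pderiv_eval :: "nat \<times> nat \<Rightarrow> 'k::field mpoly \<Rightarrow> 'k point \<Rightarrow> 'k alg_closure" where
  "pderiv_eval v f x =
     (\<Sum>m\<in>Poly_Mapping.keys f. to_ac (Poly_Mapping.lookup f m) *
        of_nat (Poly_Mapping.lookup m v) * monom_eval (m - Poly_Mapping.single v 1) x)"

text \<open>
  Multihomogeneous polynomials: homogeneous of degree \<open>d a\<close> in the coordinates of each projective
  factor \<open>a\<close>; there is no condition on the affine coordinates.
\<close>

definition mhomog :: "ambient \<Rightarrow> (nat \<Rightarrow> nat) \<Rightarrow> 'k::field mpoly \<Rightarrow> bool" where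
  "mhomog fs d f \<longleftrightarrow> f \<in> mpolys fs \<and>
     (\<forall>m\<in>Poly_Mapping.keys f. \<forall>a<length fs. fs ! a \<noteq> Aff \<longrightarrow>
        (\<Sum>i<ncoords (fs ! a). Poly_Mapping.lookup m (a, i)) = d a)"

definition zclosed :: "ambient \<Rightarrow> 'k::field point set \<Rightarrow> bool" where
  "zclosed fs Z \<longleftrightarrow> (\<exists>S. S \<subseteq> {f. \<exists>d. mhomog fs d f} \<and>
     Z = {x \<in> amb_points fs. \<forall>f\<in>S. meval f x = 0})"

definition zopen_in :: "ambient \<Rightarrow> 'k::field point set \<Rightarrow> 'k point set \<Rightarrow> bool" where
  "zopen_in fs U U' \<longleftrightarrow> (\<exists>C. zclosed fs C \<and> U' = U - C)"

text \<open>Irreducibility is over \<open>k\<close>: these sets are the integral closed subschemes.\<close>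

definition zirred :: "ambient \<Rightarrow> 'k::field point set \<Rightarrow> bool" where
  "zirred fs Z \<longleftrightarrow> zclosed fs Z \<and> Z \<noteq> {} \<and>
     (\<forall>C D. zclosed fs C \<and> zclosed fs D \<and> Z = C \<union> D \<longrightarrow> Z = C \<or> Z = D)"

definition irred_comps :: "ambient \<Rightarrow> 'k::field point set \<Rightarrow> 'k point set set" where
  "irred_comps fs Z = {T. zirred fs T \<and> T \<subseteq> Z \<and> (\<forall>T'. zirred fs T' \<and> T \<subseteq> T' \<and> T' \<subseteq> Z \<longrightarrow> T' = T)}"


subsection \<open>Local rings\<close>

text \<open>
  The multihomogeneous coordinate ring of the ambient space, and the multihomogeneous vanishing
  ideal of a set of points, i.e. the ideal of the cone over it. Let \<open>p\<close> be the ideal of an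
  irreducible \<open>T \<subseteq> Z\<close> and \<open>I\<close> the ideal of \<open>Z\<close>. Then the local ring of the cone of \<open>Z\<close> at \<open>p\<close>, the
  localisation of \<open>R / I\<close> at \<open>p\<close>, is flat over the local ring of \<open>Z\<close> along \<open>T\<close>: it is
  obtained from it by adjoining a unit for each projective factor and localising at the extension
  of the maximal ideal. Dimension, lengths and multiplicities are therefore the same for
  both rings.
\<close>

definition coord_ring :: "ambient \<Rightarrow> 'k::field mpoly ring" where
  "coord_ring fs = \<lparr>carrier = mpolys fs, monoid.mult = (*), one = 1, ring.zero = 0, add = (+)\<rparr>"

definition scalings :: "ambient \<Rightarrow> 'k::field alg_closure list set" where
  "scalings fs = {cs. list_all2 (\<lambda>F c. if F = Aff then c = 1 else c \<noteq> 0) fs cs}"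

definition vanishing_ideal :: "ambient \<Rightarrow> 'k::field point set \<Rightarrow> 'k mpoly set" where
  "vanishing_ideal fs Z =
     {f \<in> mpolys fs. \<forall>x\<in>Z. \<forall>cs\<in>scalings fs. meval f (map2 (\<lambda>c. map ((*) c)) cs x) = 0}"

text \<open>Krull dimension of the localisation of \<open>R / I\<close> at the prime ideal \<open>p\<close>.\<close>

definition loc_dim :: "'r ring \<Rightarrow> 'r set \<Rightarrow> 'r set \<Rightarrow> nat" where
  "loc_dim R I p = Sup {n. \<exists>c::nat \<Rightarrow> 'r set. (\<forall>i\<le>n. primeideal (c i) R) \<and> I \<subseteq> c 0 \<and> c n \<subseteq> p \<and>
     (\<forall>i<n. c i \<subset> c (Suc i))}"

text \<open>
  Length of the localisation of \<open>R / I\<close> at \<open>p\<close> as a module over itself. The ideals of the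
  localisation correspond to the ideals of \<open>R\<close> that contain \<open>I\<close> and are saturated with respect
  to the complement of \<open>p\<close>.
\<close>

definition loc_length :: "'r ring \<Rightarrow> 'r set \<Rightarrow> 'r set \<Rightarrow> nat" where
  "loc_length R I p = Sup {n. \<exists>c::nat \<Rightarrow> 'r set.
     (\<forall>i\<le>n. ideal (c i) R \<and> I \<subseteq> c i \<and>
        (\<forall>s\<in>carrier R - p. \<forall>a\<in>carrier R. s \<otimes>\<^bsub>R\<^esub> a \<in> c i \<longrightarrow> a \<in> c i)) \<and>
     (\<forall>i<n. c i \<subset> c (Suc i))}"

primrec ideal_pow :: "'r ring \<Rightarrow> 'r set \<Rightarrow> nat \<Rightarrow> 'r set" where
  "ideal_pow R q 0 = carrier R"
| "ideal_pow R q (Suc n) = ideal_prod R (ideal_pow R q n) q"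

text \<open>
  Samuel multiplicity of the ideal \<open>q\<close> on the local ring \<open>B\<close> obtained by localising \<open>R / I\<close>
  at \<open>p\<close>: the limit of \<open>d! * length(B / q^n) / n^d\<close>, where \<open>d = dim B\<close>.
\<close>

definition samuel_mult :: "'r ring \<Rightarrow> 'r set \<Rightarrow> 'r set \<Rightarrow> 'r set \<Rightarrow> nat" where
  "samuel_mult R I p q = (let d = loc_dim R I p in
     THE e. (\<lambda>n. fact d * real (loc_length R (I <+>\<^bsub>R\<^esub> ideal_pow R q n) p) / real n ^ d)
              \<longlonglongrightarrow> real e)"


subsection \<open>Smooth projective varieties\<close>

text \<open>
  Jacobian criterion on the cone (the cone minus its irrelevant loci is a torus bundle
  over the variety): near each of its points the cone, of dimension \<open>d\<close> there, satisfies \<open>N - d\<close>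
  equations with linearly independent differentials, where \<open>N\<close> is the number of variables.
  Varieties need not be connected or non-empty.
\<close>

definition smooth_variety :: "'k::field variety \<Rightarrow> bool" where
  "smooth_variety X \<longleftrightarrow> (case X of (fs, S) \<Rightarrow> zclosed fs S \<and> (\<forall>x\<in>S.
     let I = vanishing_ideal fs S;
         r = card (variables fs) - loc_dim (coord_ring fs) I {f \<in> mpolys fs. meval f x = 0}
     in \<exists>f::nat \<Rightarrow> 'k mpoly. (\<forall>l<r. f l \<in> I) \<and>
          (\<forall>c. (\<forall>v\<in>variables fs. (\<Sum>l<r. c l * pderiv_eval v (f l) x) = 0) \<longrightarrow>
               (\<forall>l<r. c l = 0))))"

definition SmPrVar :: "'k::field_char_0 variety set" where
  "SmPrVar = {X. smooth_variety X \<and> (\<exists>n. fst X = [Proj n])}"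

definition affine_times :: "nat \<Rightarrow> 'k::field variety \<Rightarrow> 'k variety" where
  "affine_times m X = (replicate m Aff @ fst X,
     {a @ x |a x. a \<in> amb_points (replicate m Aff) \<and> x \<in> snd X})"


subsection \<open>Regular functions and finite morphisms\<close>

definition regular_on :: "ambient \<Rightarrow> 'k::field point set \<Rightarrow> ('k point \<Rightarrow> 'k alg_closure) \<Rightarrow> bool" where
  "regular_on fs U \<phi> \<longleftrightarrow> (\<forall>x\<in>U. \<exists>d g h. mhomog fs d g \<and> mhomog fs d h \<and> meval h x \<noteq> 0 \<and>
     (\<forall>y\<in>U. meval h y \<noteq> 0 \<longrightarrow> \<phi> y = meval g y / meval h y))"

definition is_morphism ::
    "ambient \<Rightarrow> 'k::field point set \<Rightarrow> ambient \<Rightarrow> 'k point set \<Rightarrow> ('k point \<Rightarrow> 'k point) \<Rightarrow> bool" where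
  "is_morphism fs U gs V \<psi> \<longleftrightarrow> \<psi> ` U \<subseteq> V \<and> (\<forall>V'. zopen_in gs V V' \<longrightarrow>
     zopen_in fs U (U \<inter> \<psi> -` V') \<and>
     (\<forall>\<theta>. regular_on gs V' \<theta> \<longrightarrow> regular_on fs (U \<inter> \<psi> -` V') (\<theta> \<circ> \<psi>)))"

definition is_affine :: "ambient \<Rightarrow> 'k::field point set \<Rightarrow> bool" where
  "is_affine fs U \<longleftrightarrow> (\<exists>n V \<phi> \<psi>. zclosed (replicate n Aff) V \<and>
     is_morphism fs U (replicate n Aff) V \<phi> \<and> is_morphism (replicate n Aff) V fs U \<psi> \<and>
     (\<forall>x\<in>U. \<psi> (\<phi> x) = x) \<and> (\<forall>y\<in>V. \<phi> (\<psi> y) = y))"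

definition finite_morphism ::
    "ambient \<Rightarrow> 'k::field point set \<Rightarrow> ambient \<Rightarrow> 'k point set \<Rightarrow> ('k point \<Rightarrow> 'k point) \<Rightarrow> bool" where
  "finite_morphism gs Z fs X \<pi> \<longleftrightarrow> is_morphism gs Z fs X \<pi> \<and> (\<forall>x\<in>X. \<exists>U. zopen_in fs X U \<and> x \<in> U \<and>
     is_affine fs U \<and> is_affine gs (Z \<inter> \<pi> -` U) \<and>
     (\<exists>B. finite B \<and> (\<forall>b\<in>B. regular_on gs (Z \<inter> \<pi> -` U) b) \<and>
        (\<forall>\<phi>. regular_on gs (Z \<inter> \<pi> -` U) \<phi> \<longrightarrow>
           (\<exists>c. (\<forall>b\<in>B. regular_on fs U (c b)) \<and>
                (\<forall>z\<in>Z \<inter> \<pi> -` U. \<phi> z = (\<Sum>b\<in>B. c b (\<pi> z) * b z))))))"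


section \<open>Finite correspondences\<close>

type_synonym 'k cycle = "'k point set \<Rightarrow>\<^sub>0 int"

definition elem_corr :: "'k::field variety \<Rightarrow> 'k variety \<Rightarrow> 'k point set \<Rightarrow> bool" where
  "elem_corr X Y Z \<longleftrightarrow> zirred (fst X @ fst Y) Z \<and>
     Z \<subseteq> {x @ y |x y. x \<in> snd X \<and> y \<in> snd Y} \<and>
     finite_morphism (fst X @ fst Y) Z (fst X) (snd X) (take (length (fst X))) \<and>
     take (length (fst X)) ` Z \<in> irred_comps (fst X) (snd X)"

definition SmCor :: "'k::field variety \<Rightarrow> 'k variety \<Rightarrow> 'k cycle set" where
  "SmCor X Y = {\<alpha>. \<forall>Z\<in>Poly_Mapping.keys \<alpha>. elem_corr X Y Z}"

definition graph_corr :: "'k::field variety \<Rightarrow> ('k point \<Rightarrow> 'k point) \<Rightarrow> 'k cycle" where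
  "graph_corr X \<phi> =
     (\<Sum>T\<in>irred_comps (fst X) (snd X). Poly_Mapping.single ((\<lambda>x. x @ \<phi> x) ` T) 1)"

text \<open>
  The composite of \<open>V\<close> from \<open>X\<close> to \<open>Y\<close> and \<open>W\<close> from \<open>Y\<close> to \<open>Z\<close> is the push-forward to \<open>X \<times> Z\<close> of the
  intersection of \<open>V \<times> Z\<close> and \<open>X \<times> W\<close> in \<open>X \<times> Y \<times> Z\<close>. The intersection is proper,
  and its support is the fibre product of \<open>V\<close> and \<open>W\<close> over \<open>Y\<close>. The multiplicity of a component
  \<open>T\<close> is computed by reduction to the diagonal: it is the Samuel multiplicity of the
  ideal of the diagonal of \<open>Y\<close> on the local ring of \<open>V \<times> W\<close> along \<open>T\<close>. It agrees with Serre's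
  alternating sum of lengths of Tor modules, as the diagonal of a smooth \<open>Y\<close> is regularly embedded.
\<close>

definition fibre_prod ::
    "nat \<Rightarrow> nat \<Rightarrow> 'k::field point set \<Rightarrow> 'k point set \<Rightarrow> 'k point set" where
  "fibre_prod l m V W = {x @ y @ z |x y z. length x = l \<and> length y = m \<and> x @ y \<in> V \<and> y @ z \<in> W}"

definition int_mult ::
    "ambient \<Rightarrow> ambient \<Rightarrow> ambient \<Rightarrow> 'k::field point set \<Rightarrow> 'k point set \<Rightarrow> 'k point set \<Rightarrow> nat" where
  "int_mult fs gs hs V W T = (let ks = fs @ gs @ gs @ hs in
     samuel_mult (coord_ring ks)
       (vanishing_ideal ks {v @ w |v w. v \<in> V \<and> w \<in> W})
       (vanishing_ideal ks
          ((\<lambda>u. take (length fs + length gs) u @ drop (length fs) u) ` T))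
       (vanishing_ideal ks {x @ y @ y @ z |x y z.
          x \<in> amb_points fs \<and> y \<in> amb_points gs \<and> z \<in> amb_points hs}))"

text \<open>
  Degree of the extension of function fields \<open>k(T) / k(T')\<close> for the projection
  \<open>\<pi> : T \<rightarrow> T' = \<pi> T\<close>, as a maximal number of elements of \<open>k(T)\<close> linearly independent over
  \<open>k(T')\<close>. Finitely many elements of \<open>k(T)\<close> have a common denominator, so their linear independence
  is a property of the numerators \<open>g i\<close>, which have a common multidegree; likewise for the
  coefficients of a linear relation.
\<close>

definition field_degree :: "ambient \<Rightarrow> 'k::field point set \<Rightarrow> ambient \<Rightarrow> ('k point \<Rightarrow> 'k point) \<Rightarrow> nat" where
  "field_degree fs T gs \<pi> = Sup {n. \<exists>d (g::nat \<Rightarrow> 'k mpoly). (\<forall>i<n. mhomog fs d (g i)) \<and>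
     (\<forall>e a. (\<forall>i<n. mhomog gs e (a i)) \<and>
            (\<forall>u\<in>T. (\<Sum>i<n. meval (a i) (\<pi> u) * meval (g i) u) = 0) \<longrightarrow>
            (\<forall>i<n. \<forall>w\<in>\<pi> ` T. meval (a i) w = 0))}"

definition corr_comp ::
    "'k::field variety \<Rightarrow> 'k variety \<Rightarrow> 'k variety \<Rightarrow> 'k cycle \<Rightarrow> 'k cycle \<Rightarrow> 'k cycle" where
  "corr_comp X Y Z \<beta> \<alpha> = (let fs = fst X; gs = fst Y; hs = fst Z;
       pr = (\<lambda>u. take (length fs) u @ drop (length fs + length gs) u)
     in \<Sum>V\<in>Poly_Mapping.keys \<alpha>. \<Sum>W\<in>Poly_Mapping.keys \<beta>.
          \<Sum>T\<in>irred_comps (fs @ gs @ hs) (fibre_prod (length fs) (length gs) V W).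
            Poly_Mapping.single (pr ` T)
              (Poly_Mapping.lookup \<alpha> V * Poly_Mapping.lookup \<beta> W *
               int (int_mult fs gs hs V W T) * int (field_degree (fs @ gs @ hs) T (fs @ hs) pr)))"

text \<open>For \<open>h\<close> from \<open>U\<close> to \<open>Y\<close>, the product of the identity of affine \<open>m\<close>-space with \<open>h\<close>.\<close>

definition id_tensor :: "nat \<Rightarrow> 'k::field variety \<Rightarrow> 'k cycle \<Rightarrow> 'k cycle" where
  "id_tensor m U h = (\<Sum>Z\<in>Poly_Mapping.keys h. Poly_Mapping.single
     {a @ u @ a @ y |a u y. a \<in> amb_points (replicate m Aff) \<and> length u = length (fst U) \<and> u @ y \<in> Z}
     (Poly_Mapping.lookup h Z))"


section \<open>Differential graded categories\<close>

text \<open>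
  Sign conventions. The composition of the category \<open>J\<close> below, with its sign \<open>(-1)^(l i)\<close>,
  satisfies the Leibniz rule \<open>\<delta>(g \<circ> f) = g \<circ> \<delta>f + (-1)^deg f (\<delta>g \<circ> f)\<close>, which is taken as
  part of the definition. The category of complexes satisfies
  \<open>\<delta>(g \<circ> f) = \<delta>g \<circ> f + (-1)^deg g (g \<circ> \<delta>f)\<close>, so its opposite (without signs)
  satisfies the former rule. Hence a contravariant functor from \<open>J\<close> to complexes is an
  unsigned functor from \<open>J\<close> to the opposite category.

  The groups of morphisms are records of the group library, written multiplicatively there. The
  composition takes the degrees of its two arguments and the three objects.
\<close>

record ('o, 'm) dgcat =
  dg_obj :: "'o set"
  dg_hom :: "int \<Rightarrow> 'o \<Rightarrow> 'o \<Rightarrow> 'm monoid"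
  dg_id :: "'o \<Rightarrow> 'm"
  dg_comp :: "int \<Rightarrow> int \<Rightarrow> 'o \<Rightarrow> 'o \<Rightarrow> 'o \<Rightarrow> 'm \<Rightarrow> 'm \<Rightarrow> 'm"
  dg_diff :: "int \<Rightarrow> 'o \<Rightarrow> 'o \<Rightarrow> 'm \<Rightarrow> 'm"

definition signed :: "('m, 'x) monoid_scheme \<Rightarrow> int \<Rightarrow> 'm \<Rightarrow> 'm" where
  "signed G n x = (if even n then x else inv\<^bsub>G\<^esub> x)"

locale dg_category =
  fixes C :: "('o, 'm) dgcat"
  assumes hom_group: "P \<in> dg_obj C \<Longrightarrow> Q \<in> dg_obj C \<Longrightarrow> comm_group (dg_hom C i P Q)"
    and id_closed: "P \<in> dg_obj C \<Longrightarrow> dg_id C P \<in> carrier (dg_hom C 0 P P)"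
    and comp_closed: "P \<in> dg_obj C \<Longrightarrow> Q \<in> dg_obj C \<Longrightarrow> R \<in> dg_obj C \<Longrightarrow>
      g \<in> carrier (dg_hom C i Q R) \<Longrightarrow> f \<in> carrier (dg_hom C j P Q) \<Longrightarrow>
      dg_comp C i j P Q R g f \<in> carrier (dg_hom C (i + j) P R)"
    and comp_add_left: "P \<in> dg_obj C \<Longrightarrow> Q \<in> dg_obj C \<Longrightarrow> R \<in> dg_obj C \<Longrightarrow>
      f \<in> carrier (dg_hom C j P Q) \<Longrightarrow>
      (\<lambda>g. dg_comp C i j P Q R g f) \<in> hom (dg_hom C i Q R) (dg_hom C (i + j) P R)"
    and comp_add_right: "P \<in> dg_obj C \<Longrightarrow> Q \<in> dg_obj C \<Longrightarrow> R \<in> dg_obj C \<Longrightarrow>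
      g \<in> carrier (dg_hom C i Q R) \<Longrightarrow>
      dg_comp C i j P Q R g \<in> hom (dg_hom C j P Q) (dg_hom C (i + j) P R)"
    and comp_assoc: "P \<in> dg_obj C \<Longrightarrow> Q \<in> dg_obj C \<Longrightarrow> R \<in> dg_obj C \<Longrightarrow> S \<in> dg_obj C \<Longrightarrow>
      h \<in> carrier (dg_hom C l R S) \<Longrightarrow> g \<in> carrier (dg_hom C i Q R) \<Longrightarrow>
      f \<in> carrier (dg_hom C j P Q) \<Longrightarrow>
      dg_comp C l (i + j) P R S h (dg_comp C i j P Q R g f) =
      dg_comp C (l + i) j P Q S (dg_comp C l i Q R S h g) f"
    and comp_id_left: "P \<in> dg_obj C \<Longrightarrow> Q \<in> dg_obj C \<Longrightarrow> f \<in> carrier (dg_hom C i P Q) \<Longrightarrow>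
      dg_comp C 0 i P Q Q (dg_id C Q) f = f"
    and comp_id_right: "P \<in> dg_obj C \<Longrightarrow> Q \<in> dg_obj C \<Longrightarrow> f \<in> carrier (dg_hom C i P Q) \<Longrightarrow>
      dg_comp C i 0 P P Q f (dg_id C P) = f"
    and diff_hom: "P \<in> dg_obj C \<Longrightarrow> Q \<in> dg_obj C \<Longrightarrow>
      dg_diff C i P Q \<in> hom (dg_hom C i P Q) (dg_hom C (i + 1) P Q)"
    and diff_diff: "P \<in> dg_obj C \<Longrightarrow> Q \<in> dg_obj C \<Longrightarrow> f \<in> carrier (dg_hom C i P Q) \<Longrightarrow>
      dg_diff C (i + 1) P Q (dg_diff C i P Q f) = \<one>\<^bsub>dg_hom C (i + 2) P Q\<^esub>"
    and leibniz: "P \<in> dg_obj C \<Longrightarrow> Q \<in> dg_obj C \<Longrightarrow> R \<in> dg_obj C \<Longrightarrow>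
      g \<in> carrier (dg_hom C i Q R) \<Longrightarrow> f \<in> carrier (dg_hom C j P Q) \<Longrightarrow>
      dg_diff C (i + j) P R (dg_comp C i j P Q R g f) =
      dg_comp C i (j + 1) P Q R g (dg_diff C j P Q f) \<otimes>\<^bsub>dg_hom C (i + j + 1) P R\<^esub>
      signed (dg_hom C (i + j + 1) P R) j (dg_comp C (i + 1) j P Q R (dg_diff C i Q R g) f)"

definition dg_opp :: "('o, 'm) dgcat \<Rightarrow> ('o, 'm) dgcat" where
  "dg_opp C = \<lparr>dg_obj = dg_obj C, dg_hom = (\<lambda>i P Q. dg_hom C i Q P), dg_id = dg_id C,
     dg_comp = (\<lambda>i j P Q R g f. dg_comp C j i R Q P f g), dg_diff = (\<lambda>i P Q. dg_diff C i Q P)\<rparr>"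

record ('o, 'm, 'p, 'n) dgfun =
  fun_obj :: "'o \<Rightarrow> 'p"
  fun_hom :: "int \<Rightarrow> 'o \<Rightarrow> 'o \<Rightarrow> 'm \<Rightarrow> 'n"

locale dg_functor = C: dg_category C + D: dg_category D
  for C :: "('o, 'm) dgcat" and D :: "('p, 'n) dgcat" +
  fixes F :: "('o, 'm, 'p, 'n) dgfun"
  assumes obj_closed: "P \<in> dg_obj C \<Longrightarrow> fun_obj F P \<in> dg_obj D"
    and hom_hom: "P \<in> dg_obj C \<Longrightarrow> Q \<in> dg_obj C \<Longrightarrow>
      fun_hom F i P Q \<in> hom (dg_hom C i P Q) (dg_hom D i (fun_obj F P) (fun_obj F Q))"
    and pres_id: "P \<in> dg_obj C \<Longrightarrow> fun_hom F 0 P P (dg_id C P) = dg_id D (fun_obj F P)"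
    and pres_comp: "P \<in> dg_obj C \<Longrightarrow> Q \<in> dg_obj C \<Longrightarrow> R \<in> dg_obj C \<Longrightarrow>
      g \<in> carrier (dg_hom C i Q R) \<Longrightarrow> f \<in> carrier (dg_hom C j P Q) \<Longrightarrow>
      fun_hom F (i + j) P R (dg_comp C i j P Q R g f) =
      dg_comp D i j (fun_obj F P) (fun_obj F Q) (fun_obj F R) (fun_hom F i Q R g) (fun_hom F j P Q f)"
    and pres_diff: "P \<in> dg_obj C \<Longrightarrow> Q \<in> dg_obj C \<Longrightarrow> f \<in> carrier (dg_hom C i P Q) \<Longrightarrow>
      fun_hom F (i + 1) P Q (dg_diff C i P Q f) =
      dg_diff D i (fun_obj F P) (fun_obj F Q) (fun_hom F i P Q f)"

text \<open>The quotient by a differential graded ideal \<open>D\<close>; morphisms are cosets.\<close>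

definition dg_quotient :: "('o, 'm) dgcat \<Rightarrow> (int \<Rightarrow> 'o \<Rightarrow> 'o \<Rightarrow> 'm set) \<Rightarrow> ('o, 'm set) dgcat" where
  "dg_quotient C D = \<lparr>dg_obj = dg_obj C,
     dg_hom = (\<lambda>i P Q. dg_hom C i P Q Mod D i P Q),
     dg_id = (\<lambda>P. D 0 P P #>\<^bsub>dg_hom C 0 P P\<^esub> dg_id C P),
     dg_comp = (\<lambda>i j P Q R c' c. \<Union>g\<in>c'. \<Union>f\<in>c.
        D (i + j) P R #>\<^bsub>dg_hom C (i + j) P R\<^esub> dg_comp C i j P Q R g f),
     dg_diff = (\<lambda>i P Q c. \<Union>f\<in>c.
        D (i + 1) P Q #>\<^bsub>dg_hom C (i + 1) P Q\<^esub> dg_diff C i P Q f)\<rparr>"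


subsection \<open>Twisted complexes\<close>

type_synonym ('o, 'm) twisted = "(int \<Rightarrow> 'o) \<times> (int \<Rightarrow> int \<Rightarrow> 'm)"

definition dg_zero_obj :: "('o, 'm) dgcat \<Rightarrow> 'o \<Rightarrow> bool" where
  "dg_zero_obj C P \<longleftrightarrow> dg_id C P = \<one>\<^bsub>dg_hom C 0 P P\<^esub>"

definition tw_supp :: "('o, 'm) dgcat \<Rightarrow> ('o, 'm) twisted \<Rightarrow> int set" where
  "tw_supp C X = {i. \<not> dg_zero_obj C (fst X i)}"

text \<open>
  With the Leibniz rule above, \<open>\<delta>\<close> has to enter the Maurer-Cartan equation and the differential
  of a family \<open>f i j\<close> with the sign \<open>(-1)^i\<close> of the shift of \<open>P i\<close>: without it neither the
  equation is compatible with \<open>\<delta>\<delta> = 0\<close> nor does the differential square to zero. With it, a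
  contravariant functor to complexes carries a twisted complex to the total complex of the
  shifted complexes \<open>(F (P i))[i]\<close>, whose differentials have the usual signs \<open>(-1)^i\<close>.
\<close>

definition twisted_complex :: "('o, 'm) dgcat \<Rightarrow> ('o, 'm) twisted \<Rightarrow> bool" where
  "twisted_complex C X \<longleftrightarrow> (case X of (P, q) \<Rightarrow>
     (\<forall>i. P i \<in> dg_obj C) \<and> finite (tw_supp C X) \<and>
     (\<forall>i j. q i j \<in> carrier (dg_hom C (i - j + 1) (P i) (P j))) \<and>
     (\<forall>i j. signed (dg_hom C (i - j + 2) (P i) (P j)) i (dg_diff C (i - j + 1) (P i) (P j) (q i j))
        \<otimes>\<^bsub>dg_hom C (i - j + 2) (P i) (P j)\<^esub>
        finprod (dg_hom C (i - j + 2) (P i) (P j))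
          (\<lambda>l. dg_comp C (l - j + 1) (i - l + 1) (P i) (P l) (P j) (q l j) (q i l)) (tw_supp C X)
        = \<one>\<^bsub>dg_hom C (i - j + 2) (P i) (P j)\<^esub>))"

definition PreTr :: "('o, 'm) dgcat \<Rightarrow> (('o, 'm) twisted, int \<Rightarrow> int \<Rightarrow> 'm) dgcat" where
  "PreTr C = \<lparr>
     dg_obj = {X. twisted_complex C X},
     dg_hom = (\<lambda>l (P, q) (P', q'). \<lparr>
        carrier = {f. \<forall>i j. f i j \<in> carrier (dg_hom C (l + i - j) (P i) (P' j))},
        monoid.mult = (\<lambda>f g i j. f i j \<otimes>\<^bsub>dg_hom C (l + i - j) (P i) (P' j)\<^esub> g i j),
        one = (\<lambda>i j. \<one>\<^bsub>dg_hom C (l + i - j) (P i) (P' j)\<^esub>)\<rparr>),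
     dg_id = (\<lambda>(P, q) i j. if i = j then dg_id C (P i) else \<one>\<^bsub>dg_hom C (i - j) (P i) (P j)\<^esub>),
     dg_comp = (\<lambda>l l' (P, q) (P', q') (P'', q'') g f i j.
        finprod (dg_hom C (l + l' + i - j) (P i) (P'' j))
          (\<lambda>m. dg_comp C (l + m - j) (l' + i - m) (P i) (P' m) (P'' j) (g m j) (f i m))
          (tw_supp C (P', q'))),
     dg_diff = (\<lambda>l (P, q) (P', q') f i j. let H = dg_hom C (l + 1 + i - j) (P i) (P' j) in
        signed H i (dg_diff C (l + i - j) (P i) (P' j) (f i j)) \<otimes>\<^bsub>H\<^esub>
        (finprod H (\<lambda>m. dg_comp C (l + m - j) (i - m + 1) (P i) (P m) (P' j) (f m j) (q i m))
           (tw_supp C (P, q)) \<otimes>\<^bsub>H\<^esub>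
         signed H (l + 1)
           (finprod H (\<lambda>m. dg_comp C (m - j + 1) (l + i - m) (P i) (P' m) (P' j) (q' m j) (f i m))
              (tw_supp C (P', q')))))\<rparr>"


section \<open>Categories and abelian categories\<close>

record ('o, 'a) category =
  cat_obj :: "'o set"
  cat_arr :: "'a set"
  cat_dom :: "'a \<Rightarrow> 'o"
  cat_cod :: "'a \<Rightarrow> 'o"
  cat_id :: "'o \<Rightarrow> 'a"
  cat_comp :: "'a \<Rightarrow> 'a \<Rightarrow> 'a"  (infixl "\<star>\<index>" 70)

record ('o, 'a) addcat = "('o, 'a) category" +
  cat_add :: "'a \<Rightarrow> 'a \<Rightarrow> 'a"
  cat_zero :: "'o \<Rightarrow> 'o \<Rightarrow> 'a"

definition cat_hom :: "('o, 'a, 'x) category_scheme \<Rightarrow> 'o \<Rightarrow> 'o \<Rightarrow> 'a set" where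
  "cat_hom A X Y = {f \<in> cat_arr A. cat_dom A f = X \<and> cat_cod A f = Y}"

definition hom_group :: "('o, 'a) addcat \<Rightarrow> 'o \<Rightarrow> 'o \<Rightarrow> 'a monoid" where
  "hom_group A X Y = \<lparr>carrier = cat_hom A X Y, monoid.mult = cat_add A, one = cat_zero A X Y\<rparr>"

definition cat_mono :: "('o, 'a, 'x) category_scheme \<Rightarrow> 'a \<Rightarrow> bool" where
  "cat_mono A m \<longleftrightarrow> m \<in> cat_arr A \<and> (\<forall>W\<in>cat_obj A. \<forall>g\<in>cat_hom A W (cat_dom A m).
     \<forall>h\<in>cat_hom A W (cat_dom A m). m \<star>\<^bsub>A\<^esub> g = m \<star>\<^bsub>A\<^esub> h \<longrightarrow> g = h)"

definition cat_epi :: "('o, 'a, 'x) category_scheme \<Rightarrow> 'a \<Rightarrow> bool" where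
  "cat_epi A e \<longleftrightarrow> e \<in> cat_arr A \<and> (\<forall>W\<in>cat_obj A. \<forall>g\<in>cat_hom A (cat_cod A e) W.
     \<forall>h\<in>cat_hom A (cat_cod A e) W. g \<star>\<^bsub>A\<^esub> e = h \<star>\<^bsub>A\<^esub> e \<longrightarrow> g = h)"

definition cat_iso :: "('o, 'a, 'x) category_scheme \<Rightarrow> 'a \<Rightarrow> bool" where
  "cat_iso A f \<longleftrightarrow> f \<in> cat_arr A \<and> (\<exists>g\<in>cat_hom A (cat_cod A f) (cat_dom A f).
     g \<star>\<^bsub>A\<^esub> f = cat_id A (cat_dom A f) \<and> f \<star>\<^bsub>A\<^esub> g = cat_id A (cat_cod A f))"

definition is_kernel :: "('o, 'a) addcat \<Rightarrow> 'a \<Rightarrow> 'a \<Rightarrow> bool" where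
  "is_kernel A f k \<longleftrightarrow> k \<in> cat_arr A \<and> cat_cod A k = cat_dom A f \<and>
     f \<star>\<^bsub>A\<^esub> k = cat_zero A (cat_dom A k) (cat_cod A f) \<and>
     (\<forall>W\<in>cat_obj A. \<forall>g\<in>cat_hom A W (cat_dom A f). f \<star>\<^bsub>A\<^esub> g = cat_zero A W (cat_cod A f) \<longrightarrow>
        (\<exists>!h. h \<in> cat_hom A W (cat_dom A k) \<and> k \<star>\<^bsub>A\<^esub> h = g))"

definition is_cokernel :: "('o, 'a) addcat \<Rightarrow> 'a \<Rightarrow> 'a \<Rightarrow> bool" where
  "is_cokernel A f c \<longleftrightarrow> c \<in> cat_arr A \<and> cat_dom A c = cat_cod A f \<and>
     c \<star>\<^bsub>A\<^esub> f = cat_zero A (cat_dom A f) (cat_cod A c) \<and>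
     (\<forall>W\<in>cat_obj A. \<forall>g\<in>cat_hom A (cat_cod A f) W. g \<star>\<^bsub>A\<^esub> f = cat_zero A (cat_dom A f) W \<longrightarrow>
        (\<exists>!h. h \<in> cat_hom A (cat_cod A c) W \<and> h \<star>\<^bsub>A\<^esub> c = g))"

text \<open>A direct sum of the finite family \<open>X i\<close>, \<open>i \<in> I\<close>, with injections and projections.\<close>

definition is_biproduct ::
    "('o, 'a) addcat \<Rightarrow> 'i set \<Rightarrow> ('i \<Rightarrow> 'o) \<Rightarrow> 'o \<times> ('i \<Rightarrow> 'a) \<times> ('i \<Rightarrow> 'a) \<Rightarrow> bool" where
  "is_biproduct A I X = (\<lambda>(S, inj, proj). finite I \<and> S \<in> cat_obj A \<and>
     (\<forall>i\<in>I. inj i \<in> cat_hom A (X i) S \<and> proj i \<in> cat_hom A S (X i)) \<and>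
     (\<forall>i\<in>I. \<forall>j\<in>I. proj i \<star>\<^bsub>A\<^esub> inj j =
        (if i = j then cat_id A (X i) else cat_zero A (X j) (X i))) \<and>
     finprod (hom_group A S S) (\<lambda>i. inj i \<star>\<^bsub>A\<^esub> proj i) I = cat_id A S)"

locale abelian_category =
  fixes A :: "('o, 'a) addcat"
  assumes dom_cod: "f \<in> cat_arr A \<Longrightarrow> cat_dom A f \<in> cat_obj A \<and> cat_cod A f \<in> cat_obj A"
    and id_hom: "X \<in> cat_obj A \<Longrightarrow> cat_id A X \<in> cat_hom A X X"
    and comp_hom: "f \<in> cat_hom A X Y \<Longrightarrow> g \<in> cat_hom A Y Z \<Longrightarrow> g \<star>\<^bsub>A\<^esub> f \<in> cat_hom A X Z"
    and comp_id: "f \<in> cat_hom A X Y \<Longrightarrow> cat_id A Y \<star>\<^bsub>A\<^esub> f = f \<and> f \<star>\<^bsub>A\<^esub> cat_id A X = f"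
    and comp_assoc: "f \<in> cat_hom A W X \<Longrightarrow> g \<in> cat_hom A X Y \<Longrightarrow> h \<in> cat_hom A Y Z \<Longrightarrow>
      h \<star>\<^bsub>A\<^esub> (g \<star>\<^bsub>A\<^esub> f) = h \<star>\<^bsub>A\<^esub> g \<star>\<^bsub>A\<^esub> f"
    and group: "X \<in> cat_obj A \<Longrightarrow> Y \<in> cat_obj A \<Longrightarrow> comm_group (hom_group A X Y)"
    and distrib_left: "f \<in> cat_hom A X Y \<Longrightarrow> g \<in> cat_hom A Y Z \<Longrightarrow> h \<in> cat_hom A Y Z \<Longrightarrow>
      cat_add A g h \<star>\<^bsub>A\<^esub> f = cat_add A (g \<star>\<^bsub>A\<^esub> f) (h \<star>\<^bsub>A\<^esub> f)"
    and distrib_right: "f \<in> cat_hom A X Y \<Longrightarrow> g \<in> cat_hom A X Y \<Longrightarrow> h \<in> cat_hom A Y Z \<Longrightarrow>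
      h \<star>\<^bsub>A\<^esub> cat_add A f g = cat_add A (h \<star>\<^bsub>A\<^esub> f) (h \<star>\<^bsub>A\<^esub> g)"
    and zero_object: "\<exists>X\<in>cat_obj A. cat_id A X = cat_zero A X X"
    and biproducts: "X \<in> cat_obj A \<Longrightarrow> Y \<in> cat_obj A \<Longrightarrow>
      \<exists>S. is_biproduct A UNIV (\<lambda>b. if b then X else Y) S"
    and kernels: "f \<in> cat_arr A \<Longrightarrow> \<exists>k. is_kernel A f k"
    and cokernels: "f \<in> cat_arr A \<Longrightarrow> \<exists>c. is_cokernel A f c"
    and mono_kernel: "cat_mono A m \<Longrightarrow> \<exists>f\<in>cat_arr A. is_kernel A f m"
    and epi_cokernel: "cat_epi A e \<Longrightarrow> \<exists>f\<in>cat_arr A. is_cokernel A f e"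

text \<open>Chosen (co)kernels, images, zero object and direct sums, and the maps they induce.\<close>

definition ker_arr :: "('o, 'a) addcat \<Rightarrow> 'a \<Rightarrow> 'a" where
  "ker_arr A f = (SOME k. is_kernel A f k)"

definition coker_arr :: "('o, 'a) addcat \<Rightarrow> 'a \<Rightarrow> 'a" where
  "coker_arr A f = (SOME c. is_cokernel A f c)"

definition im_arr :: "('o, 'a) addcat \<Rightarrow> 'a \<Rightarrow> 'a" where
  "im_arr A f = ker_arr A (coker_arr A f)"

definition zero_obj :: "('o, 'a) addcat \<Rightarrow> 'o" where
  "zero_obj A = (SOME X. X \<in> cat_obj A \<and> cat_id A X = cat_zero A X X)"

definition biprod ::
    "('o, 'a) addcat \<Rightarrow> 'i set \<Rightarrow> ('i \<Rightarrow> 'o) \<Rightarrow> 'o \<times> ('i \<Rightarrow> 'a) \<times> ('i \<Rightarrow> 'a)" where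
  "biprod A I X = (SOME S. is_biproduct A I X S)"

definition sum_obj :: "('o, 'a) addcat \<Rightarrow> 'i set \<Rightarrow> ('i \<Rightarrow> 'o) \<Rightarrow> 'o" where
  "sum_obj A I X = fst (biprod A I X)"

definition sum_inj :: "('o, 'a) addcat \<Rightarrow> 'i set \<Rightarrow> ('i \<Rightarrow> 'o) \<Rightarrow> 'i \<Rightarrow> 'a" where
  "sum_inj A I X = fst (snd (biprod A I X))"

definition sum_proj :: "('o, 'a) addcat \<Rightarrow> 'i set \<Rightarrow> ('i \<Rightarrow> 'o) \<Rightarrow> 'i \<Rightarrow> 'a" where
  "sum_proj A I X = snd (snd (biprod A I X))"

text \<open>The arrow of direct sums with entries \<open>f i j : X j \<rightarrow> Y i\<close>.\<close>

definition mat_arr ::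
    "('o, 'a) addcat \<Rightarrow> 'j set \<Rightarrow> ('j \<Rightarrow> 'o) \<Rightarrow> 'i set \<Rightarrow> ('i \<Rightarrow> 'o) \<Rightarrow> ('i \<Rightarrow> 'j \<Rightarrow> 'a) \<Rightarrow> 'a" where
  "mat_arr A J X I Y f = finprod (hom_group A (sum_obj A J X) (sum_obj A I Y))
     (\<lambda>(i, j). sum_inj A I Y i \<star>\<^bsub>A\<^esub> f i j \<star>\<^bsub>A\<^esub> sum_proj A J X j) (I \<times> J)"

definition lift_arr :: "('o, 'a) addcat \<Rightarrow> 'a \<Rightarrow> 'a \<Rightarrow> 'a" where
  "lift_arr A m g = (THE h. h \<in> cat_hom A (cat_dom A g) (cat_dom A m) \<and> m \<star>\<^bsub>A\<^esub> h = g)"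

definition desc_arr :: "('o, 'a) addcat \<Rightarrow> 'a \<Rightarrow> 'a \<Rightarrow> 'a" where
  "desc_arr A e g = (THE h. h \<in> cat_hom A (cat_cod A e) (cat_cod A g) \<and> h \<star>\<^bsub>A\<^esub> e = g)"


subsection \<open>Contravariant functors\<close>

type_synonym ('o, 'a, 'p, 'b) funct = "('o \<Rightarrow> 'p) \<times> ('a \<Rightarrow> 'b)"

definition contra_functor ::
    "('o, 'a, 'x) category_scheme \<Rightarrow> ('p, 'b, 'y) category_scheme \<Rightarrow> ('o, 'a, 'p, 'b) funct \<Rightarrow> bool" where
  "contra_functor C D \<Phi> \<longleftrightarrow>
     (\<forall>X\<in>cat_obj C. fst \<Phi> X \<in> cat_obj D) \<and>
     (\<forall>X\<in>cat_obj C. \<forall>Y\<in>cat_obj C. \<forall>f\<in>cat_hom C X Y. snd \<Phi> f \<in> cat_hom D (fst \<Phi> Y) (fst \<Phi> X)) \<and>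
     (\<forall>X\<in>cat_obj C. snd \<Phi> (cat_id C X) = cat_id D (fst \<Phi> X)) \<and>
     (\<forall>X\<in>cat_obj C. \<forall>Y\<in>cat_obj C. \<forall>Z\<in>cat_obj C. \<forall>f\<in>cat_hom C X Y. \<forall>g\<in>cat_hom C Y Z.
        snd \<Phi> (g \<star>\<^bsub>C\<^esub> f) = snd \<Phi> f \<star>\<^bsub>D\<^esub> snd \<Phi> g)"

definition natural_iso ::
    "('o, 'a, 'x) category_scheme \<Rightarrow> ('p, 'b, 'y) category_scheme \<Rightarrow> ('o, 'a, 'p, 'b) funct \<Rightarrow>
     ('o, 'a, 'p, 'b) funct \<Rightarrow> ('o \<Rightarrow> 'b) \<Rightarrow> bool" where
  "natural_iso C D \<Phi> \<Psi> \<eta> \<longleftrightarrow> contra_functor C D \<Phi> \<and> contra_functor C D \<Psi> \<and>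
     (\<forall>X\<in>cat_obj C. \<eta> X \<in> cat_hom D (fst \<Phi> X) (fst \<Psi> X) \<and> cat_iso D (\<eta> X)) \<and>
     (\<forall>X\<in>cat_obj C. \<forall>Y\<in>cat_obj C. \<forall>f\<in>cat_hom C X Y.
        \<eta> X \<star>\<^bsub>D\<^esub> snd \<Phi> f = snd \<Psi> f \<star>\<^bsub>D\<^esub> \<eta> Y)"


subsection \<open>Homotopy categories\<close>

definition dg_cocycles :: "('o, 'm) dgcat \<Rightarrow> 'o \<Rightarrow> 'o \<Rightarrow> 'm set" where
  "dg_cocycles C X Y =
     {f \<in> carrier (dg_hom C 0 X Y). dg_diff C 0 X Y f = \<one>\<^bsub>dg_hom C 1 X Y\<^esub>}"

definition dg_coboundaries :: "('o, 'm) dgcat \<Rightarrow> 'o \<Rightarrow> 'o \<Rightarrow> 'm set" where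
  "dg_coboundaries C X Y = dg_diff C (-1) X Y ` carrier (dg_hom C (-1) X Y)"

definition homotopy_class :: "('o, 'm) dgcat \<Rightarrow> 'o \<Rightarrow> 'o \<Rightarrow> 'm \<Rightarrow> 'm set" where
  "homotopy_class C X Y f = dg_coboundaries C X Y #>\<^bsub>dg_hom C 0 X Y\<^esub> f"

text \<open>
  An arrow of the homotopy category is a homotopy class of cocycles of degree \<open>0\<close>, together with its
  domain and codomain.
\<close>

definition homotopy_cat :: "('o, 'm) dgcat \<Rightarrow> ('o, 'o \<times> 'o \<times> 'm set) category" where
  "homotopy_cat C = \<lparr>cat_obj = dg_obj C,
     cat_arr = {(X, Y, c). X \<in> dg_obj C \<and> Y \<in> dg_obj C \<and> c \<in> homotopy_class C X Y ` dg_cocycles C X Y},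
     cat_dom = fst, cat_cod = fst \<circ> snd,
     cat_id = (\<lambda>X. (X, X, homotopy_class C X X (dg_id C X))),
     cat_comp = (\<lambda>(Y', Z, c') (X, Y, c).
        (X, Z, \<Union>g\<in>c'. \<Union>f\<in>c. homotopy_class C X Z (dg_comp C 0 0 X Y Z g f)))\<rparr>"

definition Tr :: "('o, 'm) dgcat \<Rightarrow>
    (('o, 'm) twisted, ('o, 'm) twisted \<times> ('o, 'm) twisted \<times> (int \<Rightarrow> int \<Rightarrow> 'm) set) category" where
  "Tr C = homotopy_cat (PreTr C)"

text \<open>The functor of homotopy categories induced by a contravariant functor to \<open>D\<close>.\<close>

definition homotopy_fun ::
    "('p, 'n) dgcat \<Rightarrow> ('o, 'm, 'p, 'n) dgfun \<Rightarrow> ('o, 'o \<times> 'o \<times> 'm set, 'p, 'p \<times> 'p \<times> 'n set) funct" where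
  "homotopy_fun D F = (fun_obj F, \<lambda>(X, Y, c). (fun_obj F Y, fun_obj F X,
     \<Union>f\<in>c. homotopy_class D (fun_obj F Y) (fun_obj F X) (fun_hom F 0 X Y f)))"


section \<open>Complexes over an abelian category\<close>

type_synonym ('o, 'a) cpx = "(int \<Rightarrow> 'o) \<times> (int \<Rightarrow> 'a)"

definition is_complex :: "('o, 'a) addcat \<Rightarrow> ('o, 'a) cpx \<Rightarrow> bool" where
  "is_complex A Y \<longleftrightarrow> (\<forall>n. fst Y n \<in> cat_obj A \<and> snd Y n \<in> cat_hom A (fst Y n) (fst Y (n + 1)) \<and>
     snd Y (n + 1) \<star>\<^bsub>A\<^esub> snd Y n = cat_zero A (fst Y n) (fst Y (n + 2)))"

text \<open>The differential graded category \<open>B(A)\<close>.\<close>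

definition complexes :: "('o, 'a) addcat \<Rightarrow> (('o, 'a) cpx, int \<Rightarrow> 'a) dgcat" where
  "complexes A = \<lparr>
     dg_obj = {Y. is_complex A Y},
     dg_hom = (\<lambda>i Y Z. \<lparr>carrier = {f. \<forall>n. f n \<in> cat_hom A (fst Y n) (fst Z (n + i))},
        monoid.mult = (\<lambda>f g n. cat_add A (f n) (g n)),
        one = (\<lambda>n. cat_zero A (fst Y n) (fst Z (n + i)))\<rparr>),
     dg_id = (\<lambda>Y n. cat_id A (fst Y n)),
     dg_comp = (\<lambda>i j X Y Z g f n. g (n + j) \<star>\<^bsub>A\<^esub> f n),
     dg_diff = (\<lambda>i Y Z f n. cat_add A (snd Z (n + i) \<star>\<^bsub>A\<^esub> f n)
        (signed (hom_group A (fst Y n) (fst Z (n + i + 1))) (i + 1) (f (n + 1) \<star>\<^bsub>A\<^esub> snd Y n)))\<rparr>"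

definition cocyc :: "('o, 'a) addcat \<Rightarrow> ('o, 'a) cpx \<Rightarrow> int \<Rightarrow> 'a" where
  "cocyc A Y n = ker_arr A (snd Y n)"

definition to_cohom :: "('o, 'a) addcat \<Rightarrow> ('o, 'a) cpx \<Rightarrow> int \<Rightarrow> 'a" where
  "to_cohom A Y n = coker_arr A (lift_arr A (cocyc A Y n) (snd Y (n - 1)))"

definition cohom :: "('o, 'a) addcat \<Rightarrow> int \<Rightarrow> ('o, 'a) cpx \<Rightarrow> 'o" where
  "cohom A n Y = cat_cod A (to_cohom A Y n)"

definition cohom_map ::
    "('o, 'a) addcat \<Rightarrow> int \<Rightarrow> ('o, 'a) cpx \<Rightarrow> ('o, 'a) cpx \<Rightarrow> (int \<Rightarrow> 'a) \<Rightarrow> 'a" where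
  "cohom_map A n Y Z f = desc_arr A (to_cohom A Y n)
     (to_cohom A Z n \<star>\<^bsub>A\<^esub> lift_arr A (cocyc A Z n) (f n \<star>\<^bsub>A\<^esub> cocyc A Y n))"

text \<open>Cohomology on arrows of the homotopy category \<open>K(A)\<close>.\<close>

definition cohom_htpy ::
    "('o, 'a) addcat \<Rightarrow> int \<Rightarrow> ('o, 'a) cpx \<times> ('o, 'a) cpx \<times> (int \<Rightarrow> 'a) set \<Rightarrow> 'a" where
  "cohom_htpy A n = (\<lambda>(Y, Z, c). THE h. h \<in> cohom_map A n Y Z ` c)"


subsection \<open>Truncations\<close>

definition trunc_le_obj :: "('o, 'a) addcat \<Rightarrow> int \<Rightarrow> ('o, 'a) cpx \<Rightarrow> int \<Rightarrow> 'o" where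
  "trunc_le_obj A b Y n =
     (if n < b then fst Y n else if n = b then cat_dom A (cocyc A Y b) else zero_obj A)"

definition trunc_le_incl :: "('o, 'a) addcat \<Rightarrow> int \<Rightarrow> ('o, 'a) cpx \<Rightarrow> int \<Rightarrow> 'a" where
  "trunc_le_incl A b Y n = (if n < b then cat_id A (fst Y n)
     else if n = b then cocyc A Y b else cat_zero A (zero_obj A) (fst Y n))"

definition trunc_le :: "('o, 'a) addcat \<Rightarrow> int \<Rightarrow> ('o, 'a) cpx \<Rightarrow> ('o, 'a) cpx" where
  "trunc_le A b Y = (trunc_le_obj A b Y,
     \<lambda>n. lift_arr A (trunc_le_incl A b Y (n + 1)) (snd Y n \<star>\<^bsub>A\<^esub> trunc_le_incl A b Y n))"

definition trunc_ge_obj :: "('o, 'a) addcat \<Rightarrow> int \<Rightarrow> ('o, 'a) cpx \<Rightarrow> int \<Rightarrow> 'o" where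
  "trunc_ge_obj A a Y n = (if n > a then fst Y n
     else if n = a then cat_cod A (coker_arr A (snd Y (a - 1))) else zero_obj A)"

definition trunc_ge_proj :: "('o, 'a) addcat \<Rightarrow> int \<Rightarrow> ('o, 'a) cpx \<Rightarrow> int \<Rightarrow> 'a" where
  "trunc_ge_proj A a Y n = (if n > a then cat_id A (fst Y n)
     else if n = a then coker_arr A (snd Y (a - 1)) else cat_zero A (fst Y n) (zero_obj A))"

definition trunc_ge :: "('o, 'a) addcat \<Rightarrow> int \<Rightarrow> ('o, 'a) cpx \<Rightarrow> ('o, 'a) cpx" where
  "trunc_ge A a Y = (trunc_ge_obj A a Y,
     \<lambda>n. desc_arr A (trunc_ge_proj A a Y n) (trunc_ge_proj A a Y (n + 1) \<star>\<^bsub>A\<^esub> snd Y n))"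

text \<open>
  The functors \<open>\<tau>\<^sub>\<le>\<^sub>b F\<close> and \<open>\<tau>\<^sub>\<ge>\<^sub>a F\<close> for a contravariant functor \<open>F\<close> to complexes; the canonical
  \<open>[a,b]\<close>-truncation is \<open>\<tau>\<^sub>\<ge>\<^sub>a \<tau>\<^sub>\<le>\<^sub>b\<close>, which is the cohomology object in degree \<open>a\<close> if \<open>a = b\<close>.
\<close>

type_synonym ('o, 'm, 'p, 'a) cpx_fun = "('o, 'm, ('p, 'a) cpx, int \<Rightarrow> 'a) dgfun"

definition fun_le :: "('p, 'a) addcat \<Rightarrow> int \<Rightarrow> ('o, 'm, 'p, 'a) cpx_fun \<Rightarrow> ('o, 'm, 'p, 'a) cpx_fun" where
  "fun_le A b F = \<lparr>fun_obj = (\<lambda>P. trunc_le A b (fun_obj F P)),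
     fun_hom = (\<lambda>i P Q f n. lift_arr A (trunc_le_incl A b (fun_obj F P) (n + i))
        (fun_hom F i P Q f n \<star>\<^bsub>A\<^esub> trunc_le_incl A b (fun_obj F Q) n))\<rparr>"

definition fun_ge :: "('p, 'a) addcat \<Rightarrow> int \<Rightarrow> ('o, 'm, 'p, 'a) cpx_fun \<Rightarrow> ('o, 'm, 'p, 'a) cpx_fun" where
  "fun_ge A a F = \<lparr>fun_obj = (\<lambda>P. trunc_ge A a (fun_obj F P)),
     fun_hom = (\<lambda>i P Q f n. desc_arr A (trunc_ge_proj A a (fun_obj F Q) n)
        (trunc_ge_proj A a (fun_obj F P) (n + i) \<star>\<^bsub>A\<^esub> fun_hom F i P Q f n))\<rparr>"

definition fun_trunc ::
    "('p, 'a) addcat \<Rightarrow> int \<Rightarrow> int \<Rightarrow> ('o, 'm, 'p, 'a) cpx_fun \<Rightarrow> ('o, 'm, 'p, 'a) cpx_fun" where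
  "fun_trunc A a b F = fun_ge A a (fun_le A b F)"


subsection \<open>Total complexes\<close>

text \<open>
  The composite of \<open>PreTr F\<close> with the totalisation of twisted complexes over \<open>B(A)\<close>, for a
  contravariant functor \<open>F\<close> from \<open>C\<close>: the total complex has in degree \<open>n\<close> the sum of the
  \<open>F(P i)\<close> in degree \<open>n + i\<close>.
\<close>

definition tot_summand :: "('o, 'm, 'p, 'a) cpx_fun \<Rightarrow> ('o, 'm) twisted \<Rightarrow> int \<Rightarrow> int \<Rightarrow> 'p" where
  "tot_summand F X n i = fst (fun_obj F (fst X i)) (n + i)"

definition tot_fun :: "('p, 'a) addcat \<Rightarrow> ('o, 'm) dgcat \<Rightarrow> ('o, 'm, 'p, 'a) cpx_fun \<Rightarrow>
    (('o, 'm) twisted, int \<Rightarrow> int \<Rightarrow> 'm, 'p, 'a) cpx_fun" where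
  "tot_fun A C F = \<lparr>
     fun_obj = (\<lambda>X. (\<lambda>n. sum_obj A (tw_supp C X) (tot_summand F X n),
        \<lambda>n. mat_arr A (tw_supp C X) (tot_summand F X n) (tw_supp C X) (tot_summand F X (n + 1))
          (\<lambda>i j. let P = fst X; q = fun_hom F (i - j + 1) (P i) (P j) (snd X i j) (n + j) in
             if i = j
             then cat_add A (signed (hom_group A (tot_summand F X n i) (tot_summand F X (n + 1) i)) i
                     (snd (fun_obj F (P i)) (n + i))) q
             else q))),
     fun_hom = (\<lambda>l X Y f n.
        mat_arr A (tw_supp C Y) (tot_summand F Y n) (tw_supp C X) (tot_summand F X (n + l))
          (\<lambda>i j. fun_hom F (l + i - j) (fst X i) (fst Y j) (f i j) (n + j)))\<rparr>"

text \<open>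
  The map of total complexes of \<open>X\<close> induced by maps \<open>\<theta> P\<close> from \<open>F P\<close> to \<open>F' P\<close>
  that are natural in \<open>P\<close>.
\<close>

definition tot_trans :: "('p, 'a) addcat \<Rightarrow> ('o, 'm) dgcat \<Rightarrow> ('o, 'm, 'p, 'a) cpx_fun \<Rightarrow>
    ('o, 'm, 'p, 'a) cpx_fun \<Rightarrow> ('o \<Rightarrow> int \<Rightarrow> 'a) \<Rightarrow> ('o, 'm) twisted \<Rightarrow> int \<Rightarrow> 'a" where
  "tot_trans A C F F' \<theta> X n =
     mat_arr A (tw_supp C X) (tot_summand F X n) (tw_supp C X) (tot_summand F' X n)
       (\<lambda>i j. if i = j then \<theta> (fst X i) (n + i)
              else cat_zero A (tot_summand F X n j) (tot_summand F' X n i))"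

text \<open>The functor \<open>H\<^sup>s \<circ> Tr F\<close> on \<open>Tr C\<close>.\<close>

definition cohom_Tr :: "('p, 'a) addcat \<Rightarrow> ('o, 'm) dgcat \<Rightarrow> ('o, 'm, 'p, 'a) cpx_fun \<Rightarrow> int \<Rightarrow>
    (('o, 'm) twisted, ('o, 'm) twisted \<times> ('o, 'm) twisted \<times> (int \<Rightarrow> int \<Rightarrow> 'm) set, 'p, 'a) funct" where
  "cohom_Tr A C F s = (let E = homotopy_fun (complexes A) (tot_fun A C F) in
     (cohom A s \<circ> fst E, cohom_htpy A s \<circ> snd E))"


section \<open>The spectral sequence of a filtered complex\<close>

text \<open>
  An increasing filtration of a complex \<open>K\<close> is given by monomorphisms \<open>\<iota> p n\<close> to \<open>K\<close> in degree
  \<open>n\<close>, with domain \<open>F\<^sub>p\<close>. In terms of elements, \<open>ss_Z\<close> is the subobject of those \<open>x\<close> in \<open>F\<^sub>p\<close> whose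
  differential is in \<open>F\<^sub>p\<^sub>-\<^sub>r\<close>, and the term \<open>E\<^sub>r\<close> is the quotient of \<open>Z\<^sub>r\<^sup>p\<close> by the sum of \<open>Z\<^sub>r\<^sub>-\<^sub>1\<^sup>p\<^sup>-\<^sup>1\<close> and
  the differential of \<open>Z\<^sub>r\<^sub>-\<^sub>1\<^sup>p\<^sup>+\<^sup>r\<^sup>-\<^sup>1\<close>. Here \<open>p\<close> is the filtration index and \<open>n\<close> the total degree,
  that is, \<open>j = p\<close> and \<open>i + j = n\<close> in the notation \<open>E\<^sub>r\<^sup>i\<^sup>j\<close>.
\<close>

type_synonym 'a filtration = "int \<Rightarrow> int \<Rightarrow> 'a"

definition ss_Z :: "('o, 'a) addcat \<Rightarrow> ('o, 'a) cpx \<Rightarrow> 'a filtration \<Rightarrow> int \<Rightarrow> int \<Rightarrow> int \<Rightarrow> 'a" where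
  "ss_Z A K \<iota> r p n =
     \<iota> p n \<star>\<^bsub>A\<^esub> ker_arr A (coker_arr A (\<iota> (p - r) (n + 1)) \<star>\<^bsub>A\<^esub> (snd K n \<star>\<^bsub>A\<^esub> \<iota> p n))"

definition ss_quot :: "('o, 'a) addcat \<Rightarrow> ('o, 'a) cpx \<Rightarrow> 'a filtration \<Rightarrow> int \<Rightarrow> int \<Rightarrow> int \<Rightarrow> 'a" where
  "ss_quot A K \<iota> r p n = (let z = ss_Z A K \<iota> r p n;
       u = lift_arr A z (ss_Z A K \<iota> (r - 1) (p - 1) n);
       v = lift_arr A z (snd K (n - 1) \<star>\<^bsub>A\<^esub> ss_Z A K \<iota> (r - 1) (p + r - 1) (n - 1));
       X = (\<lambda>b. cat_dom A (if b then u else v))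
     in coker_arr A (cat_add A (u \<star>\<^bsub>A\<^esub> sum_proj A UNIV X True) (v \<star>\<^bsub>A\<^esub> sum_proj A UNIV X False)))"

definition ss_E :: "('o, 'a) addcat \<Rightarrow> ('o, 'a) cpx \<Rightarrow> 'a filtration \<Rightarrow> int \<Rightarrow> int \<Rightarrow> int \<Rightarrow> 'o" where
  "ss_E A K \<iota> r p n = cat_cod A (ss_quot A K \<iota> r p n)"

definition ss_diff :: "('o, 'a) addcat \<Rightarrow> ('o, 'a) cpx \<Rightarrow> 'a filtration \<Rightarrow> int \<Rightarrow> int \<Rightarrow> int \<Rightarrow> 'a" where
  "ss_diff A K \<iota> r p n = desc_arr A (ss_quot A K \<iota> r p n)
     (ss_quot A K \<iota> r (p - r) (n + 1) \<star>\<^bsub>A\<^esub>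
      lift_arr A (ss_Z A K \<iota> r (p - r) (n + 1)) (snd K n \<star>\<^bsub>A\<^esub> ss_Z A K \<iota> r p n))"

definition degenerates_at_E1 :: "('o, 'a) addcat \<Rightarrow> ('o, 'a) cpx \<Rightarrow> 'a filtration \<Rightarrow> bool" where
  "degenerates_at_E1 A K \<iota> \<longleftrightarrow> (\<forall>r\<ge>1. \<forall>p n.
     ss_diff A K \<iota> r p n = cat_zero A (ss_E A K \<iota> r p n) (ss_E A K \<iota> r (p - r) (n + 1)))"


section \<open>The weight filtration\<close>

text \<open>The inclusion of \<open>G\<^sub>b X\<close> in \<open>G X\<close>, and the filtration of \<open>G X\<close> defining \<open>S\<close>.\<close>

definition G_incl :: "('p, 'a) addcat \<Rightarrow> ('o, 'm) dgcat \<Rightarrow> ('o, 'm, 'p, 'a) cpx_fun \<Rightarrow>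
    ('o, 'm) twisted \<Rightarrow> 'a filtration" where
  "G_incl A C F X b = tot_trans A C (fun_le A b F) F (\<lambda>P. trunc_le_incl A b (fun_obj F P)) X"

text \<open>The projection from \<open>G\<^sub>b X\<close> to \<open>G\<^sub>b X / G\<^sub>a X\<close> for \<open>a \<le> b\<close>, and this quotient complex.\<close>

definition G_proj :: "('p, 'a) addcat \<Rightarrow> ('o, 'm) dgcat \<Rightarrow> ('o, 'm, 'p, 'a) cpx_fun \<Rightarrow>
    ('o, 'm) twisted \<Rightarrow> int \<Rightarrow> int \<Rightarrow> int \<Rightarrow> 'a" where
  "G_proj A C F X b a n = coker_arr A (lift_arr A (G_incl A C F X b n) (G_incl A C F X a n))"

definition G_quot :: "('p, 'a) addcat \<Rightarrow> ('o, 'm) dgcat \<Rightarrow> ('o, 'm, 'p, 'a) cpx_fun \<Rightarrow>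
    ('o, 'm) twisted \<Rightarrow> int \<Rightarrow> int \<Rightarrow> ('p, 'a) cpx" where
  "G_quot A C F X b a = (\<lambda>n. cat_cod A (G_proj A C F X b a n),
     \<lambda>n. desc_arr A (G_proj A C F X b a n)
       (G_proj A C F X b a (n + 1) \<star>\<^bsub>A\<^esub> snd (fun_obj (tot_fun A C (fun_le A b F)) X) n))"

text \<open>
  The filtration induced on \<open>G\<^sub>b X / G\<^sub>a X\<close>: its step \<open>p\<close> is the image of the intersection of
  \<open>G\<^sub>p X\<close> and \<open>G\<^sub>b X\<close>, which is \<open>G\<^bsub>min p b\<^esub> X\<close>.
\<close>

definition G_quot_filt :: "('p, 'a) addcat \<Rightarrow> ('o, 'm) dgcat \<Rightarrow> ('o, 'm, 'p, 'a) cpx_fun \<Rightarrow>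
    ('o, 'm) twisted \<Rightarrow> int \<Rightarrow> int \<Rightarrow> 'a filtration" where
  "G_quot_filt A C F X b a p n = im_arr A (G_proj A C F X b a n \<star>\<^bsub>A\<^esub>
     lift_arr A (G_incl A C F X b n) (G_incl A C F X (min p b) n))"

text \<open>\<open>S\<close> and \<open>S\<^sub>N\<^sup>b\<close> degenerate at \<open>E\<^sub>1\<close>.\<close>

definition S_degenerates :: "('p, 'a) addcat \<Rightarrow> ('o, 'm) dgcat \<Rightarrow> ('o, 'm, 'p, 'a) cpx_fun \<Rightarrow>
    ('o, 'm) twisted \<Rightarrow> bool" where
  "S_degenerates A C F X \<longleftrightarrow>
     degenerates_at_E1 A (fun_obj (tot_fun A C F) X) (G_incl A C F X)"

definition SN_degenerates :: "('p, 'a) addcat \<Rightarrow> ('o, 'm) dgcat \<Rightarrow> ('o, 'm, 'p, 'a) cpx_fun \<Rightarrow>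
    int \<Rightarrow> nat \<Rightarrow> ('o, 'm) twisted \<Rightarrow> bool" where
  "SN_degenerates A C F b N X \<longleftrightarrow>
     degenerates_at_E1 A (G_quot A C F X b (b - int N - 1)) (G_quot_filt A C F X b (b - int N - 1))"

text \<open>
  \<open>W\<^sub>l H\<^sup>s(E X)\<close> as a subobject of \<open>H\<^sup>s(E X)\<close>, the quotient \<open>W\<^sub>b / W\<^sub>a\<close>, and the functor
  this quotient defines on \<open>Tr C\<close>.
\<close>

definition G_cohom_incl :: "('p, 'a) addcat \<Rightarrow> ('o, 'm) dgcat \<Rightarrow> ('o, 'm, 'p, 'a) cpx_fun \<Rightarrow>
    int \<Rightarrow> int \<Rightarrow> ('o, 'm) twisted \<Rightarrow> 'a" where
  "G_cohom_incl A C F s l X = cohom_map A s (fun_obj (tot_fun A C (fun_le A l F)) X)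
     (fun_obj (tot_fun A C F) X) (G_incl A C F X l)"

definition W_incl :: "('p, 'a) addcat \<Rightarrow> ('o, 'm) dgcat \<Rightarrow> ('o, 'm, 'p, 'a) cpx_fun \<Rightarrow>
    int \<Rightarrow> int \<Rightarrow> ('o, 'm) twisted \<Rightarrow> 'a" where
  "W_incl A C F s l X = im_arr A (G_cohom_incl A C F s l X)"

definition W_proj :: "('p, 'a) addcat \<Rightarrow> ('o, 'm) dgcat \<Rightarrow> ('o, 'm, 'p, 'a) cpx_fun \<Rightarrow>
    int \<Rightarrow> int \<Rightarrow> int \<Rightarrow> ('o, 'm) twisted \<Rightarrow> 'a" where
  "W_proj A C F s b a X = coker_arr A (lift_arr A (W_incl A C F s b X) (W_incl A C F s a X))"

definition W_quot :: "('p, 'a) addcat \<Rightarrow> ('o, 'm) dgcat \<Rightarrow> ('o, 'm, 'p, 'a) cpx_fun \<Rightarrow>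
    int \<Rightarrow> int \<Rightarrow> int \<Rightarrow>
    (('o, 'm) twisted, ('o, 'm) twisted \<times> ('o, 'm) twisted \<times> (int \<Rightarrow> int \<Rightarrow> 'm) set, 'p, 'a) funct" where
  "W_quot A C F s b a = (\<lambda>X. cat_cod A (W_proj A C F s b a X),
     \<lambda>\<alpha>. let X = cat_dom (Tr C) \<alpha>; Y = cat_cod (Tr C) \<alpha> in
       desc_arr A (W_proj A C F s b a Y) (W_proj A C F s b a X \<star>\<^bsub>A\<^esub>
         lift_arr A (W_incl A C F s b X) (snd (cohom_Tr A C F s) \<alpha> \<star>\<^bsub>A\<^esub> W_incl A C F s b Y)))"

text \<open>
  The two canonical maps from \<open>H\<^sup>s(G\<^sub>b X)\<close>: to \<open>W\<^sub>b / W\<^sub>a\<close>, and to the cohomology of the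
  total complex of the canonical \<open>[a + 1, b]\<close>-truncation.
\<close>

definition G_to_W_quot :: "('p, 'a) addcat \<Rightarrow> ('o, 'm) dgcat \<Rightarrow> ('o, 'm, 'p, 'a) cpx_fun \<Rightarrow>
    int \<Rightarrow> int \<Rightarrow> int \<Rightarrow> ('o, 'm) twisted \<Rightarrow> 'a" where
  "G_to_W_quot A C F s b a X =
     W_proj A C F s b a X \<star>\<^bsub>A\<^esub> lift_arr A (W_incl A C F s b X) (G_cohom_incl A C F s b X)"

definition G_to_trunc :: "('p, 'a) addcat \<Rightarrow> ('o, 'm) dgcat \<Rightarrow> ('o, 'm, 'p, 'a) cpx_fun \<Rightarrow>
    int \<Rightarrow> int \<Rightarrow> int \<Rightarrow> ('o, 'm) twisted \<Rightarrow> 'a" where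
  "G_to_trunc A C F s b a X = cohom_map A s (fun_obj (tot_fun A C (fun_le A b F)) X)
     (fun_obj (tot_fun A C (fun_trunc A (a + 1) b F)) X)
     (tot_trans A C (fun_le A b F) (fun_trunc A (a + 1) b F)
        (\<lambda>P. trunc_ge_proj A (a + 1) (fun_obj (fun_le A b F) P)) X)"


section \<open>Suslin complexes, the categories \<open>J\<close> and \<open>J\<^sub>N\<close>\<close>

definition Suslin' :: "int \<Rightarrow> 'k::field variety \<Rightarrow> 'k variety \<Rightarrow> 'k cycle set" where
  "Suslin' i P Y = SmCor (affine_times (nat (- i)) Y) P"

definition face_map :: "nat \<Rightarrow> 'k::field alg_closure \<Rightarrow> 'k point \<Rightarrow> 'k point" where
  "face_map j x u = take (j - 1) u @ [[x]] @ drop (j - 1) u"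

definition face :: "int \<Rightarrow> nat \<Rightarrow> 'k::field alg_closure \<Rightarrow> 'k variety \<Rightarrow> 'k variety \<Rightarrow> 'k cycle \<Rightarrow> 'k cycle" where
  "face i j x P Y f =
     (let U = affine_times (nat (- i - 1)) Y; U' = affine_times (nat (- i)) Y
      in corr_comp U U' P f (graph_corr U (face_map j x)))"

definition Suslin :: "int \<Rightarrow> 'k::field variety \<Rightarrow> 'k variety \<Rightarrow> 'k cycle set" where
  "Suslin i P Y = (if i > 0 then {0}
     else {f \<in> Suslin' i P Y. \<forall>j\<in>{1..nat (- i)}. face i j 0 P Y f = 0})"

definition Suslin_diff :: "int \<Rightarrow> 'k::field variety \<Rightarrow> 'k variety \<Rightarrow> 'k cycle \<Rightarrow> 'k cycle" where
  "Suslin_diff i P Y f =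
     (\<Sum>j\<in>{1..nat (- i)}. if even j then face i j 1 P Y f else - face i j 1 P Y f)"

text \<open>\<open>dg_comp J i l Z Y X f h\<close> is \<open>f\<^sup>l(h) = (-1)\<^sup>l\<^sup>i f \<circ> (id \<otimes> h)\<close>.\<close>

definition J :: "('k::field_char_0 variety, 'k cycle) dgcat" where
  "J = \<lparr>
     dg_obj = SmPrVar,
     dg_hom = (\<lambda>i P Q. \<lparr>carrier = Suslin i Q P, monoid.mult = (+), one = 0\<rparr>),
     dg_id = (\<lambda>P. graph_corr P id),
     dg_comp = (\<lambda>i l Z Y X f h.
        let c = corr_comp (affine_times (nat (- i)) (affine_times (nat (- l)) Z))
                  (affine_times (nat (- i)) Y) X f
                  (id_tensor (nat (- i)) (affine_times (nat (- l)) Z) h)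
        in if even (l * i) then c else - c),
     dg_diff = (\<lambda>i P Q. Suslin_diff i Q P)\<rparr>"

definition J_ideal :: "nat \<Rightarrow> int \<Rightarrow> 'k::field_char_0 variety \<Rightarrow> 'k variety \<Rightarrow> 'k cycle set" where
  "J_ideal N i P Q = (if i > - int N then {0}
     else if i = - int N then Suslin_diff (i - 1) Q P ` Suslin (i - 1) Q P
     else Suslin i Q P)"

definition JN :: "nat \<Rightarrow> ('k::field_char_0 variety, 'k cycle set) dgcat" where
  "JN N = dg_quotient J (J_ideal N)"

text \<open>The functor \<open>t\<^sub>N\<close> from \<open>Tr J\<close> to \<open>Tr J\<^sub>N\<close> induced by the projection of \<open>J\<close> to \<open>J\<^sub>N\<close>.\<close>

definition J_class :: "nat \<Rightarrow> int \<Rightarrow> 'k::field_char_0 variety \<Rightarrow> 'k variety \<Rightarrow> 'k cycle \<Rightarrow> 'k cycle set" where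
  "J_class N i P Q f = J_ideal N i P Q #>\<^bsub>dg_hom J i P Q\<^esub> f"

definition tN_obj :: "nat \<Rightarrow> ('k::field_char_0 variety, 'k cycle) twisted \<Rightarrow>
    ('k variety, 'k cycle set) twisted" where
  "tN_obj N = (\<lambda>(P, q). (P, \<lambda>i j. J_class N (i - j + 1) (P i) (P j) (q i j)))"

definition tN :: "nat \<Rightarrow> (('k::field_char_0 variety, 'k cycle) twisted,
    ('k variety, 'k cycle) twisted \<times> ('k variety, 'k cycle) twisted \<times> (int \<Rightarrow> int \<Rightarrow> 'k cycle) set,
    ('k variety, 'k cycle set) twisted,
    ('k variety, 'k cycle set) twisted \<times> ('k variety, 'k cycle set) twisted \<times>
      (int \<Rightarrow> int \<Rightarrow> 'k cycle set) set) funct" where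
  "tN N = (tN_obj N, \<lambda>(X, Y, c). (tN_obj N X, tN_obj N Y, \<Union>f\<in>c.
     homotopy_class (PreTr (JN N)) (tN_obj N X) (tN_obj N Y)
       (\<lambda>i j. J_class N (i - j) (fst X i) (fst Y j) (f i j))))"

definition funct_comp :: "('p, 'b, 'q, 'c) funct \<Rightarrow> ('o, 'a, 'p, 'b) funct \<Rightarrow> ('o, 'a, 'q, 'c) funct" where
  "funct_comp \<Psi> \<Phi> = (fst \<Psi> \<circ> fst \<Phi>, snd \<Psi> \<circ> snd \<Phi>)"

text \<open>
  There are no maps between different weights. The complex \<open>E([P])\<close> is \<open>F([P])\<close>, and \<open>f\<^sup>*\<close> is the
  map of cohomology induced by \<open>F(f)\<close>; \<open>J\<^sup>0([P],[P'])\<close> is \<open>SmCor(P, P')\<close>.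
\<close>

definition pullback :: "('p, 'a) addcat \<Rightarrow> ('k::field_char_0 variety, 'k cycle, 'p, 'a) cpx_fun \<Rightarrow>
    int \<Rightarrow> 'k variety \<Rightarrow> 'k variety \<Rightarrow> 'k cycle \<Rightarrow> 'a" where
  "pullback A F s P P' f = cohom_map A s (fun_obj F P') (fun_obj F P) (fun_hom F 0 P P' f)"

definition no_maps_between_weights ::
    "('p, 'a) addcat \<Rightarrow> ('k::field_char_0 variety, 'k cycle, 'p, 'a) cpx_fun \<Rightarrow> bool" where
  "no_maps_between_weights A F \<longleftrightarrow>
     (\<forall>P\<in>SmPrVar. \<forall>P'\<in>SmPrVar. \<forall>Q\<in>SmPrVar. \<forall>Q'\<in>SmPrVar. \<forall>f\<in>SmCor P P'. \<forall>g\<in>SmCor Q Q'.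
      \<forall>i j. i \<noteq> j \<longrightarrow>
       (let K = cat_dom A (ker_arr A (pullback A F i P P' f));
            L = cat_cod A (coker_arr A (pullback A F j Q Q' g))
        in cat_hom A K L = {cat_zero A K L}))"

end

theory Submission
  imports Defs
begin

text \<open>
  Degeneration of \<open>S\<close> and of all \<open>S\<^sub>N\<^sup>b\<close> means that the differential of \<open>G(X)\<close> is strict: a boundary
  lying in \<open>G\<^sub>b(X)\<close> is the boundary of an element of \<open>G\<^sub>b(X)\<close>. Up to quasi-isomorphism the graded
  piece of weight \<open>b\<close> is the complex of the \<open>H\<^sup>b(F[P\<^sup>i])\<close>, whose differentials are pullbacks along
  correspondences \<open>P\<^sup>i \<rightarrow> P\<^sup>i\<^sup>+\<^sup>1\<close>. So its cocycles are kernels of pullbacks, and its cohomology embeds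
  into cokernels of pullbacks. By induction on \<open>b\<close>, every map from such a kernel of weight \<open>w > b\<close> to
  the cohomology of \<open>G\<^sub>b(X)\<close> is zero: its component of weight \<open>b\<close> vanishes by hypothesis, hence it
  comes from \<open>G\<^sub>b\<^sub>-\<^sub>1(X)\<close>. In particular the connecting map from the weight \<open>b\<close> to the cohomology of
  \<open>G\<^sub>b\<^sub>-\<^sub>1(X)\<close> is zero, which gives strictness.

  By strictness the maps from the cohomology of \<open>G\<^sub>b(X)\<close> to \<open>W\<^sub>b / W\<^sub>b\<^sub>-\<^sub>N\<^sub>-\<^sub>1\<close> and to the cohomology of
  \<open>F\<^sub>N\<^sup>b(X)\<close> are epimorphisms with the same kernel. Finally, the canonical \<open>[b - N, b]\<close>-truncation has
  length \<open>N + 1\<close>, so it kills the morphisms of \<open>J\<close> that become zero in \<open>J\<^sub>N\<close>.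
\<close>


text \<open>The hypothesis only speaks of arrows out of kernels of pullbacks, whereas a chase
  produces cocycles with arbitrary source. A map from such a kernel to the cohomology of G_b(X) need
  not come from a cocycle on the kernel itself. A cocycle exists only on a cover of the kernel, and
  it defines a map on the kernel exactly when it becomes locally a boundary of G_b(X) on the kernel
  of the cover. The induction statement has this shape; it is applied to one universal cocycle, with
  which all others are compared.

  The quotient of a step by a smaller one is modelled by the total complex of a truncation. The
  kernel of the projection to this model exceeds the smaller step by an acyclic part, so every
  passage to a smaller step costs a correction by a boundary. The correction stays under control
  because morphisms of positive degree vanish, which makes the total differential triangular. The
  complexes F([P]) may be unbounded; the inductions are finite because a twisted complex has
  finitely many nonzero terms, so that in a fixed degree the filtration is zero for small b and
  everything for large b.\<close>

section \<open>Arrows of an abelian category: composition, sums, negatives and zero arrows\<close>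

locale abelian = abelian_category A for A :: "('o, 'a) addcat" (structure)
begin

abbreviation arr :: "'a \<Rightarrow> bool" where "arr f \<equiv> f \<in> cat_arr A"
abbreviation obj :: "'o \<Rightarrow> bool" where "obj X \<equiv> X \<in> cat_obj A"
abbreviation src :: "'a \<Rightarrow> 'o" where "src \<equiv> cat_dom A"
abbreviation tgt :: "'a \<Rightarrow> 'o" where "tgt \<equiv> cat_cod A"
abbreviation idt :: "'o \<Rightarrow> 'a" where "idt \<equiv> cat_id A"
abbreviation zr :: "'o \<Rightarrow> 'o \<Rightarrow> 'a" where "zr \<equiv> cat_zero A"
abbreviation Hom :: "'o \<Rightarrow> 'o \<Rightarrow> 'a set" where "Hom \<equiv> cat_hom A"
abbreviation plus_arr :: "'a \<Rightarrow> 'a \<Rightarrow> 'a" (infixl \<open>\<boxplus>\<close> 65) where "f \<boxplus> g \<equiv> cat_add A f g"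
text \<open>Taking the group from the source and target of the arrow itself leaves a unary operation
  without object arguments, so that bilinearity can be given as rewrite rules.\<close>

definition neg :: "'a \<Rightarrow> 'a" where "neg f = inv\<^bsub>hom_group A (src f) (tgt f)\<^esub> f"
abbreviation minus_arr :: "'a \<Rightarrow> 'a \<Rightarrow> 'a" (infixl \<open>\<boxminus>\<close> 65) where "f \<boxminus> g \<equiv> f \<boxplus> neg g"

lemma Hom_iff: "f \<in> Hom X Y \<longleftrightarrow> arr f \<and> src f = X \<and> tgt f = Y"
  by (auto simp: cat_hom_def)

lemma HomI [intro]: "arr f \<Longrightarrow> src f = X \<Longrightarrow> tgt f = Y \<Longrightarrow> f \<in> Hom X Y"
  by (simp add: Hom_iff)

lemma HomD: "f \<in> Hom X Y \<Longrightarrow> arr f" "f \<in> Hom X Y \<Longrightarrow> src f = X" "f \<in> Hom X Y \<Longrightarrow> tgt f = Y"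
  by (simp_all add: Hom_iff)

lemma obj_src [simp]: "arr f \<Longrightarrow> obj (src f)" and obj_tgt [simp]: "arr f \<Longrightarrow> obj (tgt f)"
  using dom_cod by auto

lemma Hom_obj: "f \<in> Hom X Y \<Longrightarrow> obj X" "f \<in> Hom X Y \<Longrightarrow> obj Y"
  by (auto simp: Hom_iff)

lemma idt_simps [simp]:
  assumes "obj X"
  shows "arr (idt X)" "src (idt X) = X" "tgt (idt X) = X"
  using id_hom[OF assms] by (auto simp: Hom_iff)

lemma comp_simps [simp]:
  assumes "arr f" "arr g" "src g = tgt f"
  shows "arr (g \<star> f)" "src (g \<star> f) = src f" "tgt (g \<star> f) = tgt g"
  using comp_hom[of f "src f" "tgt f" g "tgt g"] assms by (auto simp: Hom_iff)

lemma idt_comp [simp]: "arr f \<Longrightarrow> tgt f = Y \<Longrightarrow> idt Y \<star> f = f"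
  and comp_idt [simp]: "arr f \<Longrightarrow> src f = X \<Longrightarrow> f \<star> idt X = f"
  using comp_id by (auto simp: Hom_iff)

lemma assoc [simp]:
  assumes "arr f" "arr g" "arr h" "src g = tgt f" "src h = tgt g"
  shows "(h \<star> g) \<star> f = h \<star> (g \<star> f)"
  using comp_assoc[of f "src f" "tgt f" g "tgt g" h "tgt h"] assms by (auto simp: Hom_iff)

text \<open>Composites are normalised to the right, so a known equation for
  \<open>g \<star> f\<close> no longer occurs as a subterm of
  \<open>g \<star> (f \<star> x)\<close>; this rule applies it there.\<close>

lemma comp_reduce:
  assumes "g \<star> f = h" "arr f" "arr g" "arr x" "src g = tgt f" "src f = tgt x"
  shows "g \<star> (f \<star> x) = h \<star> x"
  using assms assoc[of x f g] by simp

lemma hg: "obj X \<Longrightarrow> obj Y \<Longrightarrow> comm_group (hom_group A X Y)"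
  by (rule group)

lemma hg_simps [simp]: "carrier (hom_group A X Y) = Hom X Y" "monoid.mult (hom_group A X Y) = cat_add A"
  "one (hom_group A X Y) = zr X Y"
  by (simp_all add: hom_group_def)

lemma zr_simps [simp]:
  assumes "obj X" "obj Y"
  shows "arr (zr X Y)" "src (zr X Y) = X" "tgt (zr X Y) = Y"
  using monoid.one_closed[of "hom_group A X Y"] hg[OF assms]
  by (auto simp: Hom_iff comm_group_def comm_monoid_def)

lemma add_simps [simp]:
  assumes "arr f" "arr g" "src f = src g" "tgt f = tgt g"
  shows "arr (f \<boxplus> g)" "src (f \<boxplus> g) = src g" "tgt (f \<boxplus> g) = tgt g"
  using monoid.m_closed[of "hom_group A (src g) (tgt g)" f g] hg[of "src g" "tgt g"] assms
  by (auto simp: Hom_iff comm_group_def comm_monoid_def)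

lemma neg_simps [simp]:
  assumes "arr f"
  shows "arr (neg f)" "src (neg f) = src f" "tgt (neg f) = tgt f"
  using group.inv_closed[of "hom_group A (src f) (tgt f)" f] hg[of "src f" "tgt f"] assms
  by (auto simp: Hom_iff comm_group_def neg_def)

lemma neg_eq_inv: "f \<in> Hom X Y \<Longrightarrow> inv\<^bsub>hom_group A X Y\<^esub> f = neg f"
  by (auto simp: Hom_iff neg_def)

lemma add_comm: "arr f \<Longrightarrow> arr g \<Longrightarrow> src f = src g \<Longrightarrow> tgt f = tgt g \<Longrightarrow> f \<boxplus> g = g \<boxplus> f"
  using comm_monoid.m_comm[of "hom_group A (src g) (tgt g)" f g] hg[of "src g" "tgt g"]
  by (auto simp: Hom_iff comm_group_def)

lemma add_assoc: "arr f \<Longrightarrow> arr g \<Longrightarrow> arr h \<Longrightarrow> src f = src g \<Longrightarrow> tgt f = tgt g \<Longrightarrow>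
   src g = src h \<Longrightarrow> tgt g = tgt h \<Longrightarrow> f \<boxplus> g \<boxplus> h = f \<boxplus> (g \<boxplus> h)"
  using monoid.m_assoc[of "hom_group A (src g) (tgt g)" f g h] hg[of "src g" "tgt g"]
  by (auto simp: Hom_iff comm_group_def comm_monoid_def)

lemma add_lcomm: "arr f \<Longrightarrow> arr g \<Longrightarrow> arr h \<Longrightarrow> src f = src g \<Longrightarrow> tgt f = tgt g \<Longrightarrow>
   src g = src h \<Longrightarrow> tgt g = tgt h \<Longrightarrow> f \<boxplus> (g \<boxplus> h) = g \<boxplus> (f \<boxplus> h)"
  using comm_monoid.m_lcomm[of "hom_group A (src g) (tgt g)" f g h] hg[of "src g" "tgt g"]
  by (auto simp: Hom_iff comm_group_def)

lemma add_zr [simp]: "arr f \<Longrightarrow> src f = X \<Longrightarrow> tgt f = Y \<Longrightarrow> f \<boxplus> zr X Y = f"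
  and zr_add [simp]: "arr f \<Longrightarrow> src f = X \<Longrightarrow> tgt f = Y \<Longrightarrow> zr X Y \<boxplus> f = f"
  using monoid.r_one[of "hom_group A X Y" f] monoid.l_one[of "hom_group A X Y" f] hg[of "src f" "tgt f"]
  by (auto simp: Hom_iff comm_group_def comm_monoid_def)

lemma add_neg [simp]: "arr f \<Longrightarrow> f \<boxplus> neg f = zr (src f) (tgt f)"
  and neg_add [simp]: "arr f \<Longrightarrow> neg f \<boxplus> f = zr (src f) (tgt f)"
  using group.r_inv[of "hom_group A (src f) (tgt f)" f] group.l_inv[of "hom_group A (src f) (tgt f)" f]
    hg[of "src f" "tgt f"]
  by (auto simp: Hom_iff comm_group_def neg_def)

lemma add_cancel:
  assumes "f \<boxplus> g = f \<boxplus> h" "arr f" "arr g" "arr h" "src f = src g" "tgt f = tgt g" "src g = src h" "tgt g = tgt h"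
  shows "g = h"
proof -
  have "neg f \<boxplus> (f \<boxplus> g) = neg f \<boxplus> (f \<boxplus> h)" using assms(1) by simp
  then show ?thesis using assms(2-) by (simp add: add_assoc[symmetric])
qed

lemma neg_add_cancel [simp]: "arr f \<Longrightarrow> arr g \<Longrightarrow> src f = src g \<Longrightarrow> tgt f = tgt g \<Longrightarrow> neg f \<boxplus> (f \<boxplus> g) = g"
  by (simp add: add_assoc[symmetric])

lemma neg_unique: "f \<boxplus> g = zr (src f) (tgt f) \<Longrightarrow> arr f \<Longrightarrow> arr g \<Longrightarrow> src f = src g \<Longrightarrow> tgt f = tgt g \<Longrightarrow> g = neg f"
  by (rule add_cancel[of f]) simp_all

lemma neg_neg [simp]: "arr f \<Longrightarrow> neg (neg f) = f"
  by (rule neg_unique[symmetric]) simp_all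

lemma neg_zr [simp]: "obj X \<Longrightarrow> obj Y \<Longrightarrow> neg (zr X Y) = zr X Y"
  by (rule neg_unique[symmetric]) simp_all

lemma neg_plus: "arr f \<Longrightarrow> arr g \<Longrightarrow> src f = src g \<Longrightarrow> tgt f = tgt g \<Longrightarrow> neg (f \<boxplus> g) = neg f \<boxplus> neg g"
  by (rule neg_unique[symmetric]) (simp_all add: add_assoc add_lcomm[of g "neg f"])

text \<open>Source and target stay implicit, so vanishing can be passed along composites, kernels
  and covers without naming the two objects at every step.\<close>

definition nul :: "'a \<Rightarrow> bool" where "nul f \<longleftrightarrow> arr f \<and> f = zr (src f) (tgt f)"

lemma nul_arr: "nul f \<Longrightarrow> arr f" by (simp add: nul_def)

lemma nul_eq: "nul f \<Longrightarrow> src f = X \<Longrightarrow> tgt f = Y \<Longrightarrow> f = zr X Y" by (simp add: nul_def)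

lemma nul_zr [simp]: "obj X \<Longrightarrow> obj Y \<Longrightarrow> nul (zr X Y)" by (simp add: nul_def)

lemma nul_eq2: "nul f \<Longrightarrow> nul g \<Longrightarrow> src f = src g \<Longrightarrow> tgt f = tgt g \<Longrightarrow> f = g"
  unfolding nul_def by metis

lemma nul_minus_iff: assumes "arr f" "arr g" "src f = src g" "tgt f = tgt g"
  shows "nul (f \<boxminus> g) \<longleftrightarrow> f = g"
proof
  assume "nul (f \<boxminus> g)"
  then have "f \<boxminus> g = zr (src g) (tgt g)" using assms nul_eq by simp
  then have "f \<boxminus> g \<boxplus> g = zr (src g) (tgt g) \<boxplus> g" by simp
  then show "f = g" using assms by (simp add: add_assoc)
qed (use assms in simp)

lemma plus_comp: "arr f \<Longrightarrow> arr g \<Longrightarrow> arr h \<Longrightarrow> src g = src h \<Longrightarrow> tgt g = tgt h \<Longrightarrow> src g = tgt f \<Longrightarrow>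
    (g \<boxplus> h) \<star> f = g \<star> f \<boxplus> h \<star> f"
  using distrib_left[of f "src f" "tgt f" g "tgt g" h] by (auto simp: Hom_iff)

lemma comp_plus: "arr f \<Longrightarrow> arr g \<Longrightarrow> arr h \<Longrightarrow> src f = src g \<Longrightarrow> tgt f = tgt g \<Longrightarrow> src h = tgt f \<Longrightarrow>
    h \<star> (f \<boxplus> g) = h \<star> f \<boxplus> h \<star> g"
  using distrib_right[of f "src f" "tgt f" g h "tgt h"] by (auto simp: Hom_iff)

lemma add_self_zr: "f \<boxplus> f = f \<Longrightarrow> arr f \<Longrightarrow> f = zr (src f) (tgt f)"
  by (rule add_cancel[of f]) simp_all

lemma zr_comp [simp]: assumes "arr f" "tgt f = X" "obj Y" shows "zr X Y \<star> f = zr (src f) Y"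
proof -
  have "zr X Y \<star> f \<boxplus> zr X Y \<star> f = zr X Y \<star> f"
    using assms plus_comp[of f "zr X Y" "zr X Y"] by force
  from add_self_zr[OF this] show ?thesis using assms by force
qed

lemma comp_zr [simp]: assumes "arr f" "src f = Y" "obj X" shows "f \<star> zr X Y = zr X (tgt f)"
proof -
  have "f \<star> zr X Y \<boxplus> f \<star> zr X Y = f \<star> zr X Y"
    using assms comp_plus[of "zr X Y" "zr X Y" f] by force
  from add_self_zr[OF this] show ?thesis using assms by force
qed

lemma nul_comp [simp]: "nul f \<Longrightarrow> arr f \<Longrightarrow> arr g \<Longrightarrow> src g = tgt f \<Longrightarrow> nul (g \<star> f)"
  using comp_zr[of g "tgt f" "src f"] unfolding nul_def by (metis comp_simps obj_src)

lemma comp_nul [simp]: "nul g \<Longrightarrow> arr g \<Longrightarrow> arr f \<Longrightarrow> src g = tgt f \<Longrightarrow> nul (g \<star> f)"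
  using zr_comp[of f "src g" "tgt g"] unfolding nul_def by (metis comp_simps obj_tgt)

lemma neg_comp: "arr f \<Longrightarrow> arr g \<Longrightarrow> src g = tgt f \<Longrightarrow> neg g \<star> f = neg (g \<star> f)"
  by (rule neg_unique) (simp_all add: plus_comp[symmetric])

lemma comp_neg: "arr f \<Longrightarrow> arr g \<Longrightarrow> src g = tgt f \<Longrightarrow> g \<star> neg f = neg (g \<star> f)"
  by (rule neg_unique) (simp_all add: comp_plus[symmetric])

lemmas bilin = plus_comp comp_plus neg_comp comp_neg neg_plus

lemma add_minus_cancel [simp]: "arr f \<Longrightarrow> arr g \<Longrightarrow> src f = src g \<Longrightarrow> tgt f = tgt g \<Longrightarrow> (f \<boxplus> g) \<boxminus> g = f"
  and minus_add_cancel [simp]: "arr f \<Longrightarrow> arr g \<Longrightarrow> src f = src g \<Longrightarrow> tgt f = tgt g \<Longrightarrow> (f \<boxminus> g) \<boxplus> g = f"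
  by (simp_all add: add_assoc)

lemma nul_neg [simp]: "nul f \<Longrightarrow> arr f \<Longrightarrow> nul (neg f)"
  by (metis nul_def neg_zr obj_src obj_tgt)

lemma add_nul [simp]: "nul g \<Longrightarrow> arr g \<Longrightarrow> arr f \<Longrightarrow> src f = src g \<Longrightarrow> tgt f = tgt g \<Longrightarrow> f \<boxplus> g = f"
  and nul_add_eq [simp]: "nul g \<Longrightarrow> arr g \<Longrightarrow> arr f \<Longrightarrow> src f = src g \<Longrightarrow> tgt f = tgt g \<Longrightarrow> g \<boxplus> f = f"
  by (metis nul_def add_zr, metis nul_def zr_add)

subsection \<open>Monomorphisms, epimorphisms, kernels and cokernels\<close>

abbreviation mono where "mono \<equiv> cat_mono A"
abbreviation epi where "epi \<equiv> cat_epi A"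

lemma mono_arr [simp]: "mono m \<Longrightarrow> arr m" and epi_arr [simp]: "epi e \<Longrightarrow> arr e"
  by (auto simp: cat_mono_def cat_epi_def)

lemma mono_cancel:
  assumes "mono m" "m \<star> g = m \<star> h" "arr g" "arr h" "src g = src h" "tgt g = src m" "tgt h = src m"
  shows "g = h"
proof -
  have "g \<in> Hom (src g) (src m)" "h \<in> Hom (src g) (src m)" "obj (src g)" using assms by auto
  then show ?thesis using assms(1,2) unfolding cat_mono_def by blast
qed

lemma epi_cancel:
  assumes "epi e" "g \<star> e = h \<star> e" "arr g" "arr h" "tgt g = tgt h" "src g = tgt e" "src h = tgt e"
  shows "g = h"
proof -
  have "g \<in> Hom (tgt e) (tgt g)" "h \<in> Hom (tgt e) (tgt g)" "obj (tgt g)" using assms by auto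
  then show ?thesis using assms(1,2) unfolding cat_epi_def by blast
qed

lemma mono_nul: "mono m \<Longrightarrow> nul (m \<star> g) \<Longrightarrow> arr g \<Longrightarrow> tgt g = src m \<Longrightarrow> nul g"
  unfolding nul_def by (rule conjI, assumption, rule mono_cancel[of m]) auto

lemma epi_nul: "epi e \<Longrightarrow> nul (g \<star> e) \<Longrightarrow> arr g \<Longrightarrow> src g = tgt e \<Longrightarrow> nul g"
  unfolding nul_def by (rule conjI, assumption, rule epi_cancel[of e]) auto

lemma mono_nul_iff: "mono m \<Longrightarrow> arr g \<Longrightarrow> tgt g = src m \<Longrightarrow> nul (m \<star> g) \<longleftrightarrow> nul g"
  using mono_nul[of m g] nul_comp[of g m] by fastforce

lemma epi_nul_iff: "epi e \<Longrightarrow> arr g \<Longrightarrow> src g = tgt e \<Longrightarrow> nul (g \<star> e) \<longleftrightarrow> nul g"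
  using epi_nul[of e g] comp_nul[of g e] by fastforce

text \<open>In an additive category it is enough to cancel zero arrows, because two arrows with
  equal composites differ by an arrow that \<open>m\<close> kills.\<close>

lemma monoI:
  assumes "arr m" "\<And>g. arr g \<Longrightarrow> tgt g = src m \<Longrightarrow> nul (m \<star> g) \<Longrightarrow> nul g"
  shows "mono m"
  unfolding cat_mono_def
proof (intro conjI ballI impI)
  fix W g h assume *: "obj W" "g \<in> Hom W (src m)" "h \<in> Hom W (src m)" "m \<star> g = m \<star> h"
  have "nul (g \<boxminus> h)"
    by (rule assms(2)) (use assms(1) * in \<open>auto simp: Hom_iff bilin\<close>)
  then show "g = h" using * nul_minus_iff[of g h] by (auto simp: Hom_iff)
qed (use assms in auto)

lemma epiI:
  assumes "arr e" "\<And>g. arr g \<Longrightarrow> src g = tgt e \<Longrightarrow> nul (g \<star> e) \<Longrightarrow> nul g"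
  shows "epi e"
  unfolding cat_epi_def
proof (intro conjI ballI impI)
  fix W g h assume *: "obj W" "g \<in> Hom (tgt e) W" "h \<in> Hom (tgt e) W" "g \<star> e = h \<star> e"
  have "nul (g \<boxminus> h)"
    by (rule assms(2)) (use assms(1) * in \<open>auto simp: Hom_iff bilin\<close>)
  then show "g = h" using * nul_minus_iff[of g h] by (auto simp: Hom_iff)
qed (use assms in auto)

lemma mono_comp: assumes "mono f" "mono g" "src g = tgt f" shows "mono (g \<star> f)"
proof (rule monoI)
  fix h assume "arr h" "tgt h = src (g \<star> f)" "nul (g \<star> f \<star> h)"
  then show "nul h" using assms by (simp add: mono_nul_iff)
qed (use assms in auto)

lemma epi_comp: assumes "epi f" "epi g" "src g = tgt f" shows "epi (g \<star> f)"
proof (rule epiI)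
  fix h assume h: "arr h" "src h = tgt (g \<star> f)" "nul (h \<star> (g \<star> f))"
  have "nul (h \<star> g)" by (rule epi_nul[OF assms(1)]) (use assms h in auto)
  then show "nul h" by (rule epi_nul[OF assms(2)]) (use assms h in auto)
qed (use assms in auto)

lemma epi_idt [simp]: "obj X \<Longrightarrow> epi (idt X)" and mono_idt [simp]: "obj X \<Longrightarrow> mono (idt X)"
  by (auto intro!: epiI monoI)

lemma epi_left: assumes "epi (g \<star> f)" "arr f" "arr g" "src g = tgt f" shows "epi g"
proof (rule epiI)
  fix h assume h: "arr h" "src h = tgt g" "nul (h \<star> g)"
  have "nul ((h \<star> g) \<star> f)" by (rule comp_nul) (use assms h in auto)
  then have "nul (h \<star> (g \<star> f))" using assms h by simp
  then show "nul h" by (rule epi_nul[OF assms(1)]) (use assms h in auto)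
qed (use assms in simp)

lemma is_kernel_mono: assumes "is_kernel A f k" "arr f" shows "mono k"
proof (rule monoI)
  show "arr k" using assms by (simp add: is_kernel_def)
  fix g assume g: "arr g" "tgt g = src k" "nul (k \<star> g)"
  have k: "arr k" "tgt k = src f" "f \<star> k = zr (src k) (tgt f)" using assms by (auto simp: is_kernel_def)
  have "zr (src g) (src f) \<in> Hom (src g) (src f)" "obj (src g)" "f \<star> zr (src g) (src f) = zr (src g) (tgt f)"
    using g assms by auto
  then have "\<exists>!h. h \<in> Hom (src g) (src k) \<and> k \<star> h = zr (src g) (src f)"
    using assms(1) unfolding is_kernel_def by blast
  moreover have "k \<star> g = zr (src g) (src f)" using g k by (simp add: nul_eq)
  moreover have "k \<star> zr (src g) (src k) = zr (src g) (src f)" using g k by simp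
  ultimately have "g = zr (src g) (src k)" using g k unfolding Hom_iff by (metis zr_simps obj_src)
  then show "nul g" using g unfolding nul_def by simp
qed

lemma is_cokernel_epi: assumes "is_cokernel A f k" "arr f" shows "epi k"
proof (rule epiI)
  show "arr k" using assms by (simp add: is_cokernel_def)
  fix g assume g: "arr g" "src g = tgt k" "nul (g \<star> k)"
  have k: "arr k" "src k = tgt f" "k \<star> f = zr (src f) (tgt k)" using assms by (auto simp: is_cokernel_def)
  have "zr (tgt f) (tgt g) \<in> Hom (tgt f) (tgt g)" "obj (tgt g)" "zr (tgt f) (tgt g) \<star> f = zr (src f) (tgt g)"
    using g assms by auto
  then have "\<exists>!h. h \<in> Hom (tgt k) (tgt g) \<and> h \<star> k = zr (tgt f) (tgt g)"
    using assms(1) unfolding is_cokernel_def by blast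
  moreover have "g \<star> k = zr (tgt f) (tgt g)" using g k by (simp add: nul_eq)
  moreover have "zr (tgt k) (tgt g) \<star> k = zr (tgt f) (tgt g)" using g k by simp
  ultimately have "g = zr (tgt k) (tgt g)" using g k unfolding Hom_iff by (metis zr_simps obj_tgt)
  then show "nul g" using g unfolding nul_def by simp
qed

lemma ker_arr: "arr f \<Longrightarrow> is_kernel A f (ker_arr A f)"
  unfolding ker_arr_def using kernels by (metis someI_ex)

lemma coker_arr: "arr f \<Longrightarrow> is_cokernel A f (coker_arr A f)"
  unfolding coker_arr_def using cokernels by (metis someI_ex)

abbreviation ker where "ker \<equiv> ker_arr A"
abbreviation cok where "cok \<equiv> coker_arr A"

lemma ker_simps [simp]:
  assumes "arr f"
  shows "mono (ker f)" "tgt (ker f) = src f" "f \<star> ker f = zr (src (ker f)) (tgt f)"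
  using ker_arr[OF assms] is_kernel_mono[OF ker_arr[OF assms] assms] by (auto simp: is_kernel_def)

lemma cok_simps [simp]:
  assumes "arr f"
  shows "epi (cok f)" "src (cok f) = tgt f" "cok f \<star> f = zr (src f) (tgt (cok f))"
  using coker_arr[OF assms] is_cokernel_epi[OF coker_arr[OF assms] assms] by (auto simp: is_cokernel_def)

text \<open>\<open>lift_arr\<close> is a definite description and says nothing unless a lift exists.
  This predicate supplies existence; uniqueness comes from the monomorphism.
  \<open>cofactors\<close> does the same for \<open>desc_arr\<close>.\<close>

definition factors :: "'a \<Rightarrow> 'a \<Rightarrow> bool" where
  "factors m g \<longleftrightarrow> (\<exists>h. arr h \<and> src h = src g \<and> tgt h = src m \<and> m \<star> h = g)"

definition cofactors :: "'a \<Rightarrow> 'a \<Rightarrow> bool" where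
  "cofactors e g \<longleftrightarrow> (\<exists>h. arr h \<and> src h = tgt e \<and> tgt h = tgt g \<and> h \<star> e = g)"

lemma factorsE:
  assumes "factors m g"
  obtains h where "arr h" "src h = src g" "tgt h = src m" "m \<star> h = g"
  using assms unfolding factors_def by blast

lemma cofactorsE:
  assumes "cofactors e g"
  obtains h where "arr h" "src h = tgt e" "tgt h = tgt g" "h \<star> e = g"
  using assms unfolding cofactors_def by blast

lemma factorsI: "m \<star> h = g \<Longrightarrow> arr m \<Longrightarrow> arr h \<Longrightarrow> tgt h = src m \<Longrightarrow> factors m g"
  unfolding factors_def by auto

lemma cofactorsI: "h \<star> e = g \<Longrightarrow> arr e \<Longrightarrow> arr h \<Longrightarrow> src h = tgt e \<Longrightarrow> cofactors e g"
  unfolding cofactors_def by auto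

lemma is_kernel_factor:
  assumes "is_kernel A f k" "arr f" "arr g" "tgt g = src f" "nul (f \<star> g)"
  shows "factors k g"
proof -
  have "g \<in> Hom (src g) (src f)" "obj (src g)" "f \<star> g = zr (src g) (tgt f)" using assms by (auto simp: nul_eq)
  then have "\<exists>!h. h \<in> Hom (src g) (src k) \<and> k \<star> h = g"
    using assms(1) unfolding is_kernel_def by blast
  then show ?thesis by (auto simp: Hom_iff factors_def)
qed

lemma is_cokernel_factor:
  assumes "is_cokernel A f k" "arr f" "arr g" "src g = tgt f" "nul (g \<star> f)"
  shows "cofactors k g"
proof -
  have "g \<in> Hom (tgt f) (tgt g)" "obj (tgt g)" "g \<star> f = zr (src f) (tgt g)" using assms by (auto simp: nul_eq)
  then have "\<exists>!h. h \<in> Hom (tgt k) (tgt g) \<and> h \<star> k = g"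
    using assms(1) unfolding is_cokernel_def by blast
  then show ?thesis by (auto simp: Hom_iff cofactors_def)
qed

lemma lift_eqI:
  assumes "mono m" "m \<star> h = g" "arr h" "tgt h = src m"
  shows "lift_arr A m g = h"
  unfolding lift_arr_def
proof (rule the_equality)
  show "h \<in> Hom (src g) (src m) \<and> m \<star> h = g" using assms by (auto simp: Hom_iff)
next
  fix h' assume "h' \<in> Hom (src g) (src m) \<and> m \<star> h' = g"
  then show "h' = h" using assms mono_cancel[of m h' h] by (auto simp: Hom_iff)
qed

lemma desc_eqI:
  assumes "epi e" "h \<star> e = g" "arr h" "src h = tgt e"
  shows "desc_arr A e g = h"
  unfolding desc_arr_def
proof (rule the_equality)
  show "h \<in> Hom (tgt e) (tgt g) \<and> h \<star> e = g" using assms by (auto simp: Hom_iff)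
next
  fix h' assume "h' \<in> Hom (tgt e) (tgt g) \<and> h' \<star> e = g"
  then show "h' = h" using assms epi_cancel[of e h' h] by (auto simp: Hom_iff)
qed

lemma lift_simps [simp]:
  assumes "mono m" "factors m g"
  shows "arr (lift_arr A m g)" "src (lift_arr A m g) = src g" "tgt (lift_arr A m g) = src m"
    "m \<star> lift_arr A m g = g"
  using assms lift_eqI unfolding factors_def by metis+

lemma desc_simps [simp]:
  assumes "epi m" "cofactors m g"
  shows "arr (desc_arr A m g)" "src (desc_arr A m g) = tgt m" "tgt (desc_arr A m g) = tgt g"
    "desc_arr A m g \<star> m = g"
  using assms desc_eqI unfolding cofactors_def by metis+

lemma factors_ker: assumes "arr f" "arr g" "tgt g = src f" shows "factors (ker f) g \<longleftrightarrow> nul (f \<star> g)"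
proof
  assume "factors (ker f) g"
  then obtain h where h: "arr h" "src h = src g" "tgt h = src (ker f)" "ker f \<star> h = g" by (rule factorsE)
  have "nul ((f \<star> ker f) \<star> h)" using assms h by (simp del: assoc)
  moreover have "(f \<star> ker f) \<star> h = f \<star> (ker f \<star> h)" by (rule assoc) (use assms h in auto)
  ultimately show "nul (f \<star> g)" using h(4) by simp
qed (use is_kernel_factor[OF ker_arr] assms in blast)

lemma cofactors_cok: assumes "arr f" "arr g" "src g = tgt f" shows "cofactors (cok f) g \<longleftrightarrow> nul (g \<star> f)"
proof
  assume "cofactors (cok f) g"
  then obtain h where h: "arr h" "src h = tgt (cok f)" "tgt h = tgt g" "h \<star> cok f = g" by (rule cofactorsE)
  have "nul (h \<star> (cok f \<star> f))" using assms h by simp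
  moreover have "(h \<star> cok f) \<star> f = h \<star> (cok f \<star> f)" by (rule assoc) (use assms h in auto)
  ultimately show "nul (g \<star> f)" using h(4) by simp
qed (use is_cokernel_factor[OF coker_arr] assms in blast)

text \<open>In an abelian category \<open>e\<close> is the cokernel of some \<open>f\<close>. The
  test condition applied to \<open>s = f\<close> shows that \<open>g\<close> kills \<open>f\<close>,
  so the universal property applies.\<close>

lemma epi_cofactor:
  assumes "epi e" "arr g" "src g = src e"
    and "\<And>s. arr s \<Longrightarrow> tgt s = src e \<Longrightarrow> nul (e \<star> s) \<Longrightarrow> nul (g \<star> s)"
  shows "cofactors e g"
proof -
  obtain f where f: "arr f" "is_cokernel A f e" using epi_cokernel[OF assms(1)] by auto
  then have *: "src e = tgt f" "e \<star> f = zr (src f) (tgt e)" by (auto simp: is_cokernel_def)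
  have "nul (e \<star> f)" using f *(1) assms(1) by (simp add: *(2))
  then have "nul (g \<star> f)" using assms(4)[of f] f * by simp
  then show ?thesis using is_cokernel_factor[OF f(2,1) assms(2)] assms(3) * by simp
qed

text \<open>The monomorphism is the kernel of some \<open>f\<close>. As \<open>f\<close> kills
  \<open>m\<close>, it is induced from \<open>cok m\<close>; whatever \<open>cok m\<close> kills is
  therefore killed by \<open>f\<close> and lies in its kernel \<open>m\<close>.\<close>

lemma mono_factor:
  assumes "mono m" "arr g" "tgt g = tgt m" "nul (cok m \<star> g)"
  shows "factors m g"
proof -
  obtain f where f: "arr f" "is_kernel A f m" using mono_kernel[OF assms(1)] by auto
  then have *: "tgt m = src f" "f \<star> m = zr (src m) (tgt f)" by (auto simp: is_kernel_def)
  have "nul (f \<star> m)" using f *(1) assms(1) by (simp add: *(2))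
  then have "cofactors (cok m) f" using assms(1) * f by (simp add: cofactors_cok)
  then obtain t where t: "arr t" "src t = tgt (cok m)" "tgt t = tgt f" "t \<star> cok m = f" by (rule cofactorsE)
  have "nul (t \<star> (cok m \<star> g))" using assms t by simp
  moreover have "(t \<star> cok m) \<star> g = t \<star> (cok m \<star> g)" by (rule assoc) (use assms t in auto)
  ultimately have "nul (f \<star> g)" using t(4) by simp
  then show ?thesis using is_kernel_factor[OF f(2,1) assms(2)] assms(3) * by simp
qed

subsection \<open>Finite sums of arrows and direct sums\<close>

abbreviation hsum where "hsum X Y \<equiv> finprod (hom_group A X Y)"

lemma hg_monoid: "obj X \<Longrightarrow> obj Y \<Longrightarrow> comm_monoid (hom_group A X Y)"
  using hg by (simp add: comm_group_def)

lemma hsum_in: assumes "obj X" "obj Y" "\<And>i. i \<in> I \<Longrightarrow> f i \<in> Hom X Y" shows "hsum X Y f I \<in> Hom X Y"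
  using comm_monoid.finprod_closed[OF hg_monoid[OF assms(1,2)], of f I] assms(3) by auto

lemma hsum_simps [simp]:
  assumes "obj X" "obj Y" "\<And>i. i \<in> I \<Longrightarrow> f i \<in> Hom X Y"
  shows "arr (hsum X Y f I)" "src (hsum X Y f I) = X" "tgt (hsum X Y f I) = Y"
proof -
  have "hsum X Y f I \<in> Hom X Y" by (rule hsum_in) (use assms in auto)
  then show "arr (hsum X Y f I)" "src (hsum X Y f I) = X" "tgt (hsum X Y f I) = Y" by (auto dest: HomD)
qed

lemma hsum_empty [simp]: "obj X \<Longrightarrow> obj Y \<Longrightarrow> hsum X Y f {} = zr X Y"
  using comm_monoid.finprod_empty[OF hg_monoid] by simp

lemma hsum_insert:
  assumes "finite I" "i \<notin> I" "\<And>j. j \<in> insert i I \<Longrightarrow> f j \<in> Hom X Y"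
  shows "hsum X Y f (insert i I) = f i \<boxplus> hsum X Y f I"
  using comm_monoid.finprod_insert[OF hg_monoid, of X Y I i f] assms Hom_obj[of "f i" X Y] by auto

lemma hsum_cong:
  assumes "obj X" "obj Y" "\<And>i. i \<in> I \<Longrightarrow> f i = g i" "\<And>i. i \<in> I \<Longrightarrow> g i \<in> Hom X Y"
  shows "hsum X Y f I = hsum X Y g I"
  using comm_monoid.finprod_cong'[OF hg_monoid[OF assms(1,2)], of I I g f] assms(3,4) by auto

lemma hsum_comp:
  assumes "finite I" "arr g" "obj Y" "\<And>i. i \<in> I \<Longrightarrow> f i \<in> Hom (tgt g) Y"
  shows "hsum (tgt g) Y f I \<star> g = hsum (src g) Y (\<lambda>i. f i \<star> g) I"
  using assms(1,4)
proof (induction I)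
  case (insert i I)
  then have f: "\<And>j. j \<in> insert i I \<Longrightarrow> arr (f j) \<and> src (f j) = tgt g \<and> tgt (f j) = Y"
    by (simp add: Hom_iff)
  have "hsum (src g) Y (\<lambda>i. f i \<star> g) (insert i I) = f i \<star> g \<boxplus> hsum (src g) Y (\<lambda>i. f i \<star> g) I"
    by (rule hsum_insert) (use insert.hyps f assms(2) in \<open>auto simp: Hom_iff\<close>)
  moreover have "hsum (tgt g) Y f (insert i I) = f i \<boxplus> hsum (tgt g) Y f I"
    by (rule hsum_insert) (use insert in auto)
  ultimately show ?case using insert f assms(2,3) by (simp add: plus_comp Hom_iff)
qed (use assms in simp)

lemma comp_hsum:
  assumes "finite I" "arr g" "obj X" "\<And>i. i \<in> I \<Longrightarrow> f i \<in> Hom X (src g)"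
  shows "g \<star> hsum X (src g) f I = hsum X (tgt g) (\<lambda>i. g \<star> f i) I"
  using assms(1,4)
proof (induction I)
  case (insert i I)
  then have f: "\<And>j. j \<in> insert i I \<Longrightarrow> arr (f j) \<and> src (f j) = X \<and> tgt (f j) = src g"
    by (simp add: Hom_iff)
  have "hsum X (tgt g) (\<lambda>i. g \<star> f i) (insert i I) = g \<star> f i \<boxplus> hsum X (tgt g) (\<lambda>i. g \<star> f i) I"
    by (rule hsum_insert) (use insert.hyps f assms(2) in \<open>auto simp: Hom_iff\<close>)
  moreover have "hsum X (src g) f (insert i I) = f i \<boxplus> hsum X (src g) f I"
    by (rule hsum_insert) (use insert in auto)
  ultimately show ?case using insert f assms(2,3) by (simp add: comp_plus Hom_iff)
qed (use assms in simp)

lemma hsum_add: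
  assumes "obj X" "obj Y" "\<And>i. i \<in> I \<Longrightarrow> f i \<in> Hom X Y" "\<And>i. i \<in> I \<Longrightarrow> g i \<in> Hom X Y"
  shows "hsum X Y (\<lambda>i. f i \<boxplus> g i) I = hsum X Y f I \<boxplus> hsum X Y g I"
  using comm_monoid.finprod_multf[OF hg_monoid[OF assms(1,2)], of f I g] assms(3,4) by auto

lemma hsum_zr:
  assumes "obj X" "obj Y" "\<And>i. i \<in> I \<Longrightarrow> f i = zr X Y"
  shows "hsum X Y f I = zr X Y"
  using comm_monoid.finprod_one_eqI[OF hg_monoid[OF assms(1,2)], of I f] assms(3) by auto

lemma hsum_single:
  assumes "finite I" "i \<in> I" "f i \<in> Hom X Y" "\<And>j. j \<in> I \<Longrightarrow> j \<noteq> i \<Longrightarrow> f j = zr X Y"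
  shows "hsum X Y f I = f i"
proof -
  have o: "obj X" "obj Y" using assms(3) Hom_obj by blast+
  have I: "I = insert i (I - {i})" using assms by auto
  have f: "f j \<in> Hom X Y" if "j \<in> I" for j
    using that assms(3,4) o by (cases "j = i") (auto simp: Hom_iff)
  have "hsum X Y f I = f i \<boxplus> hsum X Y f (I - {i})"
    by (subst I, rule hsum_insert) (use assms(1,2) f in auto)
  also have "hsum X Y f (I - {i}) = zr X Y" by (rule hsum_zr) (use o assms in auto)
  finally show ?thesis using assms(3) by (simp add: Hom_iff)
qed

abbreviation objs :: "'i set \<Rightarrow> ('i \<Rightarrow> 'o) \<Rightarrow> bool" where "objs I X \<equiv> finite I \<and> (\<forall>i\<in>I. obj (X i))"

lemma is_biproductD:
  fixes inj proj :: "'i \<Rightarrow> 'a"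
  assumes "is_biproduct A I X (S, inj, proj)"
  shows "finite I" "obj S" "i \<in> I \<Longrightarrow> arr (inj i) \<and> src (inj i) = X i \<and> tgt (inj i) = S"
    "i \<in> I \<Longrightarrow> arr (proj i) \<and> src (proj i) = S \<and> tgt (proj i) = X i"
    "i \<in> I \<Longrightarrow> j \<in> I \<Longrightarrow> proj i \<star> inj j = (if i = j then idt (X i) else zr (X j) (X i))"
    "hsum S S (\<lambda>i. inj i \<star> proj i) I = idt S"
  using assms unfolding is_biproduct_def Hom_iff by blast+

text \<open>Induction on the index set: a direct sum over the smaller set is joined to
  \<open>X a\<close> by a binary direct sum. The sums chosen by \<open>biprod\<close> have their
  defining properties only because of this existence.\<close>

lemma biproduct_exists:
  assumes "objs I X"
  shows "\<exists>S. is_biproduct A I X S"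
  using conjunct1[OF assms] conjunct2[OF assms]
proof (induction I)
  case empty
  obtain Z where "obj Z" "idt Z = zr Z Z" using zero_object by auto
  then have "is_biproduct A {} X (Z, undefined, undefined)" by (simp add: is_biproduct_def)
  then show ?case ..
next
  case (insert a I)
  then obtain S inj proj where S: "is_biproduct A I X (S, inj, proj)" by (metis insertCI prod_cases3)
  note S = is_biproductD[OF S]
  obtain T where "is_biproduct A UNIV (\<lambda>b. if b then X a else S) T"
    using biproducts[of "X a" S] insert.prems S(2) by auto
  then obtain T i2 p2 where T: "is_biproduct A UNIV (\<lambda>b. if b then X a else S) (T, i2, p2)" by (metis prod_cases3)
  note T = is_biproductD[OF T]
  have t: "arr (i2 True)" "src (i2 True) = X a" "tgt (i2 True) = T" "arr (i2 False)" "src (i2 False) = S" "tgt (i2 False) = T"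
     "arr (p2 True)" "tgt (p2 True) = X a" "src (p2 True) = T" "arr (p2 False)" "tgt (p2 False) = S" "src (p2 False) = T"
    using T(3)[of True] T(3)[of False] T(4)[of True] T(4)[of False] by auto
  have t': "i2 b \<star> p2 b \<in> Hom T T" for b using t by (cases b) (auto simp: Hom_iff)
  have pp: "p2 True \<star> i2 True = idt (X a)" "p2 False \<star> i2 False = idt S" "p2 True \<star> i2 False = zr S (X a)"
     "p2 False \<star> i2 True = zr (X a) S"
    using T(5)[of True True] T(5)[of True False] T(5)[of False True] T(5)[of False False] by auto
  have su: "i2 True \<star> p2 True \<boxplus> i2 False \<star> p2 False = idt T"
  proof -
    have "hsum T T (\<lambda>i. i2 i \<star> p2 i) (insert True {False}) = i2 True \<star> p2 True \<boxplus> hsum T T (\<lambda>i. i2 i \<star> p2 i) {False}"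
      by (rule hsum_insert) (use t' in auto)
    also have "hsum T T (\<lambda>i. i2 i \<star> p2 i) {False} = i2 False \<star> p2 False"
      by (rule hsum_single) (use t in \<open>auto simp: Hom_iff\<close>)
    finally show ?thesis using T(6) by (simp add: UNIV_bool insert_commute)
  qed
  define inj' where "inj' = (\<lambda>i. if i = a then i2 True else i2 False \<star> inj i)"
  define proj' where "proj' = (\<lambda>i. if i = a then p2 True else proj i \<star> p2 False)"
  have na: "i \<in> I \<Longrightarrow> i \<noteq> a" for i using insert by auto
  have ij: "arr (inj' i) \<and> src (inj' i) = X i \<and> tgt (inj' i) = T \<and> arr (proj' i) \<and> src (proj' i) = T \<and> tgt (proj' i) = X i"
    if "i \<in> insert a I" for i
    using that t S(3,4)[of i] unfolding inj'_def proj'_def by auto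
  have "is_biproduct A (insert a I) X (T, inj', proj')"
    unfolding is_biproduct_def prod.case
  proof (intro conjI ballI)
    show "finite (insert a I)" "obj T" using insert T(2) by auto
    fix i assume "i \<in> insert a I"
    then show "inj' i \<in> Hom (X i) T" "proj' i \<in> Hom T (X i)" using ij by (auto simp: Hom_iff)
  next
    fix i j assume ij: "i \<in> insert a I" "j \<in> insert a I"
    have c1: "(proj i \<star> p2 False) \<star> i2 True = proj i \<star> (p2 False \<star> i2 True)" if "i \<in> I"
      by (rule assoc) (use that t S(4) in auto)
    have c2: "p2 True \<star> (i2 False \<star> inj j) = (p2 True \<star> i2 False) \<star> inj j" if "j \<in> I"
      by (rule assoc[symmetric]) (use that t S(3) in auto)
    have c3: "(proj i \<star> p2 False) \<star> (i2 False \<star> inj j) = proj i \<star> inj j" if "i \<in> I" "j \<in> I"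
    proof -
      have "p2 False \<star> (i2 False \<star> inj j) = idt S \<star> inj j"
        by (rule comp_reduce[OF pp(2)]) (use that t S(3) in auto)
      then show ?thesis using that t S(3,4) by simp
    qed
    show "proj' i \<star> inj' j = (if i = j then idt (X i) else zr (X j) (X i))"
      using ij na c1 c2 c3 pp S(3)[of j] S(4)[of i] S(5)[of i j] insert.prems unfolding inj'_def proj'_def by auto
  next
    have "hsum T T (\<lambda>i. inj' i \<star> proj' i) (insert a I) = inj' a \<star> proj' a \<boxplus> hsum T T (\<lambda>i. inj' i \<star> proj' i) I"
      by (rule hsum_insert) (use insert ij in \<open>auto simp: Hom_iff\<close>)
    also have "hsum T T (\<lambda>i. inj' i \<star> proj' i) I = hsum T T (\<lambda>i. i2 False \<star> (inj i \<star> proj i) \<star> p2 False) I"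
    proof (rule hsum_cong)
      fix i assume i: "i \<in> I"
      show "inj' i \<star> proj' i = i2 False \<star> (inj i \<star> proj i) \<star> p2 False"
        using i t S(3,4)[of i] na by (auto simp: inj'_def proj'_def)
      show "i2 False \<star> (inj i \<star> proj i) \<star> p2 False \<in> Hom T T"
        using i t S(3,4)[of i] by (auto simp: Hom_iff)
    qed (use T in auto)
    also have "\<dots> = hsum S T (\<lambda>i. i2 False \<star> (inj i \<star> proj i)) I \<star> p2 False"
      using hsum_comp[of I "p2 False" T "\<lambda>i. i2 False \<star> (inj i \<star> proj i)"] t S(1,3,4) T(2) insert.hyps by (simp add: Hom_iff)
    also have "\<dots> = i2 False \<star> hsum S S (\<lambda>i. (inj i \<star> proj i)) I \<star> p2 False"
      using comp_hsum[of I "i2 False" S "\<lambda>i. inj i \<star> proj i"] t S(1-4) by (simp add: Hom_iff)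
    also have "inj' a \<star> proj' a \<boxplus> \<dots> = idt T" using S(2,6) t su by (simp add: inj'_def proj'_def)
    finally show "hsum T T (\<lambda>i. inj' i \<star> proj' i) (insert a I) = idt T" .
  qed
  then show ?case ..
qed

abbreviation dsum where "dsum \<equiv> sum_obj A"
abbreviation sinj where "sinj \<equiv> sum_inj A"
abbreviation sprj where "sprj \<equiv> sum_proj A"
abbreviation mat where "mat \<equiv> mat_arr A"

lemma biprod: "objs I X \<Longrightarrow> is_biproduct A I X (dsum I X, sinj I X, sprj I X)"
  unfolding sum_obj_def sum_inj_def sum_proj_def biprod_def
  using someI_ex[OF biproduct_exists] by auto

lemma dsum_simps [simp]:
  assumes "objs I X"
  shows "obj (dsum I X)"
    "i \<in> I \<Longrightarrow> arr (sinj I X i)" "i \<in> I \<Longrightarrow> src (sinj I X i) = X i" "i \<in> I \<Longrightarrow> tgt (sinj I X i) = dsum I X"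
    "i \<in> I \<Longrightarrow> arr (sprj I X i)" "i \<in> I \<Longrightarrow> src (sprj I X i) = dsum I X" "i \<in> I \<Longrightarrow> tgt (sprj I X i) = X i"
    "i \<in> I \<Longrightarrow> sprj I X i \<star> sinj I X i = idt (X i)"
    "i \<in> I \<Longrightarrow> j \<in> I \<Longrightarrow> i \<noteq> j \<Longrightarrow> sprj I X i \<star> sinj I X j = zr (X j) (X i)"
  using is_biproductD[OF biprod[OF assms]] by auto

lemma dsum_id: "objs I X \<Longrightarrow> hsum (dsum I X) (dsum I X) (\<lambda>i. sinj I X i \<star> sprj I X i) I = idt (dsum I X)"
  by (rule is_biproductD(6)[OF biprod])

lemma sprj_sinj:
  assumes "objs I X" "i \<in> I" "j \<in> I" "arr x" "tgt x = X j"
  shows "sprj I X i \<star> (sinj I X j \<star> x) = (if i = j then x else zr (src x) (X i))"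
proof -
  have "sprj I X i \<star> (sinj I X j \<star> x) = (sprj I X i \<star> sinj I X j) \<star> x"
    by (rule assoc[symmetric]) (use assms in auto)
  also have "\<dots> = (if i = j then x else zr (src x) (X i))" using assms by (auto simp del: assoc)
  finally show ?thesis .
qed

lemma dsum_decomp:
  assumes "objs I X" "arr x" "tgt x = dsum I X"
  shows "x = hsum (src x) (dsum I X) (\<lambda>i. sinj I X i \<star> (sprj I X i \<star> x)) I"
proof -
  have "x = hsum (dsum I X) (dsum I X) (\<lambda>i. sinj I X i \<star> sprj I X i) I \<star> x"
    using assms by (simp add: dsum_id)
  also have "\<dots> = hsum (src x) (dsum I X) (\<lambda>i. (sinj I X i \<star> sprj I X i) \<star> x) I"
    using hsum_comp[of I x "dsum I X" "\<lambda>i. sinj I X i \<star> sprj I X i"] assms by (simp add: Hom_iff del: assoc)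
  also have "\<dots> = hsum (src x) (dsum I X) (\<lambda>i. sinj I X i \<star> (sprj I X i \<star> x)) I"
    by (rule hsum_cong) (use assms in \<open>auto simp: Hom_iff\<close>)
  finally show ?thesis .
qed

lemma dsum_eqI:
  assumes "objs I X" "arr x" "arr y" "tgt x = dsum I X" "tgt y = dsum I X" "src x = src y"
    and "\<And>i. i \<in> I \<Longrightarrow> sprj I X i \<star> x = sprj I X i \<star> y"
  shows "x = y"
proof -
  have "hsum (src x) (dsum I X) (\<lambda>i. sinj I X i \<star> (sprj I X i \<star> x)) I
     = hsum (src y) (dsum I X) (\<lambda>i. sinj I X i \<star> (sprj I X i \<star> y)) I"
    unfolding assms(6) by (rule hsum_cong) (use assms in \<open>auto simp: Hom_iff\<close>)
  then show ?thesis using dsum_decomp[of I X x] dsum_decomp[of I X y] assms(1-5) by simp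
qed

lemma dsum_nulI:
  assumes "objs I X" "arr x" "tgt x = dsum I X" "\<And>i. i \<in> I \<Longrightarrow> nul (sprj I X i \<star> x)"
  shows "nul x"
proof -
  have "x = zr (src x) (dsum I X)"
    by (rule dsum_eqI[OF assms(1)]) (use assms in \<open>auto intro: nul_eq\<close>)
  then show ?thesis using assms(1-3) unfolding nul_def by auto
qed

lemma dsum_coeqI:
  assumes "objs I X" "arr x" "arr y" "src x = dsum I X" "src y = dsum I X" "tgt x = tgt y"
    and "\<And>i. i \<in> I \<Longrightarrow> x \<star> sinj I X i = y \<star> sinj I X i"
  shows "x = y"
proof -
  have *: "z = hsum (dsum I X) (tgt z) (\<lambda>i. (z \<star> sinj I X i) \<star> sprj I X i) I" if "arr z" "src z = dsum I X" for z
  proof -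
    have "z = z \<star> hsum (dsum I X) (dsum I X) (\<lambda>i. sinj I X i \<star> sprj I X i) I"
      using assms(1) that by (simp add: dsum_id)
    also have "\<dots> = hsum (dsum I X) (tgt z) (\<lambda>i. z \<star> (sinj I X i \<star> sprj I X i)) I"
      using comp_hsum[of I z "dsum I X" "\<lambda>i. sinj I X i \<star> sprj I X i"] assms(1) that by (simp add: Hom_iff)
    also have "\<dots> = hsum (dsum I X) (tgt z) (\<lambda>i. (z \<star> sinj I X i) \<star> sprj I X i) I"
      by (rule hsum_cong) (use assms(1) that in \<open>auto simp: Hom_iff\<close>)
    finally show ?thesis .
  qed
  have "hsum (dsum I X) (tgt x) (\<lambda>i. (x \<star> sinj I X i) \<star> sprj I X i) I =
     hsum (dsum I X) (tgt y) (\<lambda>i. (y \<star> sinj I X i) \<star> sprj I X i) I"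
    unfolding assms(6) by (rule hsum_cong) (use assms in \<open>auto simp: Hom_iff simp del: assoc\<close>)
  then show ?thesis using *[of x] *[of y] assms by simp
qed

definition tuple :: "'i set \<Rightarrow> ('i \<Rightarrow> 'o) \<Rightarrow> 'o \<Rightarrow> ('i \<Rightarrow> 'a) \<Rightarrow> 'a" where
  "tuple I X W x = hsum W (dsum I X) (\<lambda>i. sinj I X i \<star> x i) I"

lemma tuple_simps:
  assumes "objs I X" "obj W" "\<And>i. i \<in> I \<Longrightarrow> x i \<in> Hom W (X i)"
  shows "arr (tuple I X W x)" "src (tuple I X W x) = W" "tgt (tuple I X W x) = dsum I X"
    "i \<in> I \<Longrightarrow> sprj I X i \<star> tuple I X W x = x i"
proof -
  have *: "\<And>i. i \<in> I \<Longrightarrow> sinj I X i \<star> x i \<in> Hom W (dsum I X)" using assms by (auto simp: Hom_iff)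
  show "arr (tuple I X W x)" "src (tuple I X W x) = W" "tgt (tuple I X W x) = dsum I X"
    unfolding tuple_def using * assms(1,2) by auto
  assume i: "i \<in> I"
  have "sprj I X i \<star> tuple I X W x = hsum W (X i) (\<lambda>j. sprj I X i \<star> (sinj I X j \<star> x j)) I"
    unfolding tuple_def using comp_hsum[of I "sprj I X i" W "\<lambda>j. sinj I X j \<star> x j"] assms(1,2) * i by simp
  also have "\<dots> = sprj I X i \<star> (sinj I X i \<star> x i)"
    by (rule hsum_single) (use assms i in \<open>auto simp: Hom_iff sprj_sinj\<close>)
  finally show "sprj I X i \<star> tuple I X W x = x i" using assms(1) assms(3)[OF i] i by (auto simp: sprj_sinj Hom_iff)
qed

abbreviation mtyp where "mtyp K X I Y f \<equiv> objs K X \<and> objs I Y \<and> (\<forall>i\<in>I. \<forall>j\<in>K. f i j \<in> Hom (X j) (Y i))"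

lemma mat_simps:
  assumes "mtyp K X I Y f"
  shows "arr (mat K X I Y f)" "src (mat K X I Y f) = dsum K X" "tgt (mat K X I Y f) = dsum I Y"
proof -
  have t: "\<And>p. p \<in> I \<times> K \<Longrightarrow> (\<lambda>(i, j). sinj I Y i \<star> f i j \<star> sprj K X j) p \<in> Hom (dsum K X) (dsum I Y)"
    using assms by (force simp: Hom_iff)
  show "arr (mat K X I Y f)" "src (mat K X I Y f) = dsum K X" "tgt (mat K X I Y f) = dsum I Y"
    unfolding mat_arr_def using assms by (intro hsum_simps t; simp)+
qed

lemma mat_entry:
  assumes "mtyp K X I Y f" "i \<in> I" "j \<in> K"
  shows "sprj I Y i \<star> (mat K X I Y f \<star> sinj K X j) = f i j"
proof -
  let ?m = "\<lambda>(i, j). sinj I Y i \<star> f i j \<star> sprj K X j"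
  have f: "\<And>i j. i \<in> I \<Longrightarrow> j \<in> K \<Longrightarrow> arr (f i j) \<and> src (f i j) = X j \<and> tgt (f i j) = Y i"
    using assms(1) by (auto simp: Hom_iff)
  have t: "\<And>p. p \<in> I \<times> K \<Longrightarrow> ?m p \<in> Hom (dsum K X) (dsum I Y)"
    using assms(1) f by (force simp: Hom_iff)
  have "mat K X I Y f \<star> sinj K X j = hsum (X j) (dsum I Y) (\<lambda>p. ?m p \<star> sinj K X j) (I \<times> K)"
    unfolding mat_arr_def using hsum_comp[of "I \<times> K" "sinj K X j" "dsum I Y" ?m] t assms by simp
  then have "sprj I Y i \<star> (mat K X I Y f \<star> sinj K X j) = hsum (X j) (Y i) (\<lambda>p. sprj I Y i \<star> (?m p \<star> sinj K X j)) (I \<times> K)"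
    using comp_hsum[of "I \<times> K" "sprj I Y i" "X j" "\<lambda>p. ?m p \<star> sinj K X j"] t assms by (simp add: Hom_iff)
  also have "\<dots> = hsum (X j) (Y i) (\<lambda>p. if p = (i, j) then f i j else zr (X j) (Y i)) (I \<times> K)"
  proof (rule hsum_cong)
    fix p assume "p \<in> I \<times> K"
    then obtain k l where p: "p = (k, l)" "k \<in> I" "l \<in> K" by auto
    then have "sprj I Y i \<star> (?m p \<star> sinj K X j) = sprj I Y i \<star> (sinj I Y k \<star> (f k l \<star> (sprj K X l \<star> sinj K X j)))"
      using assms f by simp
    also have "\<dots> = (if p = (i, j) then f i j else zr (X j) (Y i))"
      using p assms f by (cases "l = j"; cases "k = i") (simp_all add: sprj_sinj)
    finally show "sprj I Y i \<star> (?m p \<star> sinj K X j) = (if p = (i, j) then f i j else zr (X j) (Y i))" .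
    show "(if p = (i, j) then f i j else zr (X j) (Y i)) \<in> Hom (X j) (Y i)"
      using assms f by (auto simp: Hom_iff)
  qed (use assms in auto)
  also have "\<dots> = f i j"
    using hsum_single[of "I \<times> K" "(i,j)" "\<lambda>p. if p = (i, j) then f i j else zr (X j) (Y i)" "X j" "Y i"] assms f by auto
  finally show ?thesis .
qed

text \<open>Identities between maps of total complexes are reduced by this rule to their entries,
  that is, to identities between arrows of the single complexes.\<close>

lemma mat_eqI:
  assumes "objs K X" "objs I Y" "arr g" "arr h" "src g = dsum K X" "src h = dsum K X"
    "tgt g = dsum I Y" "tgt h = dsum I Y"
    and "\<And>i j. i \<in> I \<Longrightarrow> j \<in> K \<Longrightarrow> sprj I Y i \<star> (g \<star> sinj K X j) = sprj I Y i \<star> (h \<star> sinj K X j)"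
  shows "g = h"
proof (rule dsum_coeqI[OF assms(1,3,4,5,6)])
  fix j assume "j \<in> K"
  show "g \<star> sinj K X j = h \<star> sinj K X j"
    by (rule dsum_eqI[OF assms(2)]) (use assms \<open>j \<in> K\<close> in auto)
qed (use assms in auto)

lemma sprj_mat:
  assumes "mtyp K X I Y f" "i \<in> I" "arr x" "tgt x = dsum K X"
  shows "sprj I Y i \<star> (mat K X I Y f \<star> x) = hsum (src x) (Y i) (\<lambda>j. f i j \<star> (sprj K X j \<star> x)) K"
proof -
  have f: "\<And>i j. i \<in> I \<Longrightarrow> j \<in> K \<Longrightarrow> arr (f i j) \<and> src (f i j) = X j \<and> tgt (f i j) = Y i"
    using assms(1) by (auto simp: Hom_iff)
  note m = mat_simps[OF assms(1)]
  have g: "arr (sprj I Y i \<star> mat K X I Y f)" "src (sprj I Y i \<star> mat K X I Y f) = dsum K X"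
    "tgt (sprj I Y i \<star> mat K X I Y f) = Y i" using assms m by auto
  have t: "\<And>j. j \<in> K \<Longrightarrow> sinj K X j \<star> (sprj K X j \<star> x) \<in> Hom (src x) (dsum K X)"
    using assms by (auto simp: Hom_iff)
  have "sprj I Y i \<star> (mat K X I Y f \<star> x) = (sprj I Y i \<star> mat K X I Y f) \<star> x"
    using assms m by simp
  also have "\<dots> = (sprj I Y i \<star> mat K X I Y f) \<star> hsum (src x) (dsum K X) (\<lambda>j. sinj K X j \<star> (sprj K X j \<star> x)) K"
    using dsum_decomp[of K X x] assms by simp
  also have "\<dots> =
     hsum (src x) (Y i) (\<lambda>j. (sprj I Y i \<star> mat K X I Y f) \<star> (sinj K X j \<star> (sprj K X j \<star> x))) K"
    using comp_hsum[of K "sprj I Y i \<star> mat K X I Y f" "src x" "\<lambda>j. sinj K X j \<star> (sprj K X j \<star> x)"] g t assms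
    by (simp del: assoc)
  also have "\<dots> = hsum (src x) (Y i) (\<lambda>j. f i j \<star> (sprj K X j \<star> x)) K"
  proof (rule hsum_cong)
    fix j assume j: "j \<in> K"
    have "(sprj I Y i \<star> mat K X I Y f) \<star> (sinj K X j \<star> (sprj K X j \<star> x)) =
      (sprj I Y i \<star> (mat K X I Y f \<star> sinj K X j)) \<star> (sprj K X j \<star> x)"
      using assms m j by simp
    then show "(sprj I Y i \<star> mat K X I Y f) \<star> (sinj K X j \<star> (sprj K X j \<star> x)) = f i j \<star> (sprj K X j \<star> x)"
      using mat_entry[OF assms(1,2) j] by simp
    show "f i j \<star> (sprj K X j \<star> x) \<in> Hom (src x) (Y i)" using assms j f by (auto simp: Hom_iff)
  qed (use assms in auto)
  finally show ?thesis .
qed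

subsection \<open>Local lifting\<close>

text \<open>
  Diagram chases are carried out with generalised elements: an arrow \<open>x\<close> into the codomain of
  \<open>f\<close> is locally in the image of \<open>f\<close> if it lifts to the domain of \<open>f\<close> after composition with an
  epimorphism.
\<close>

definition cov :: "'a \<Rightarrow> 'a \<Rightarrow> bool" where
  "cov f x \<longleftrightarrow> (\<exists>e y. epi e \<and> tgt e = src x \<and> arr y \<and> src y = src e \<and> tgt y = src f \<and> f \<star> y = x \<star> e)"

lemma covE:
  assumes "cov f x"
  obtains e y where "epi e" "arr e" "tgt e = src x" "arr y" "src y = src e" "tgt y = src f" "f \<star> y = x \<star> e"
  using assms epi_arr unfolding cov_def by blast

lemma covI:
  assumes "f \<star> y = x \<star> e" "epi e" "tgt e = src x" "arr y" "src y = src e" "tgt y = src f"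
  shows "cov f x"
  using assms unfolding cov_def by blast

lemma cov_factor: "f \<star> y = x \<Longrightarrow> arr f \<Longrightarrow> arr y \<Longrightarrow> tgt y = src f \<Longrightarrow> cov f x"
  by (rule covI[of f y x "idt (src x)"]) auto

text \<open>Epimorphisms are stable under pullback in an abelian category. This is the fact that
  makes chases with covers possible.\<close>

lemma cov_epi:
  assumes "epi e" "arr f" "tgt f = tgt e"
  shows "cov e f"
proof -
  define X where "X = (\<lambda>b. if b then src f else src e)"
  have X: "objs UNIV X" "X True = src f" "X False = src e" using assms by (auto simp: X_def)
  note [simp] = X(2,3) dsum_simps[OF X(1)]
  define pf pe where "pf = sprj UNIV X True" and "pe = sprj UNIV X False"
  define jf je where "jf = sinj UNIV X True" and "je = sinj UNIV X False"
  have t: "arr pf" "src pf = dsum UNIV X" "tgt pf = src f" "arr pe" "src pe = dsum UNIV X" "tgt pe = src e"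
     "arr jf" "tgt jf = dsum UNIV X" "src jf = src f" "arr je" "tgt je = dsum UNIV X" "src je = src e"
     "pf \<star> jf = idt (src f)" "pe \<star> je = idt (src e)" "pf \<star> je = zr (src e) (src f)" "pe \<star> jf = zr (src f) (src e)"
    unfolding pf_def pe_def jf_def je_def by simp_all
  \<comment> \<open>The kernel \<open>k\<close> of this arrow is the fibre product of
    \<open>f\<close> and \<open>e\<close>, with \<open>pf \<star> k\<close> and
    \<open>pe \<star> k\<close> as its two projections.\<close>
  define s where "s = f \<star> pf \<boxminus> e \<star> pe"
  have s: "arr s" "src s = dsum UNIV X" "tgt s = tgt e" using assms t by (auto simp: s_def)
  have sje: "s \<star> je = neg e" unfolding s_def using assms t by (simp add: bilin)
  have "epi s"
  proof (rule epiI)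
    fix g assume g: "arr g" "src g = tgt s" "nul (g \<star> s)"
    have "nul ((g \<star> s) \<star> je)" by (rule comp_nul) (use g s t in auto)
    moreover have "(g \<star> s) \<star> je = neg (g \<star> e)" using g s t assms sje by (simp add: bilin)
    ultimately have "nul (neg (g \<star> e))" by simp
    then have "nul (neg (neg (g \<star> e)))" by (rule nul_neg) (use g s assms in auto)
    then have "nul (g \<star> e)" using g s assms by simp
    then show "nul g" by (rule epi_nul[OF assms(1)]) (use g s in auto)
  qed (use s in simp)
  define k where "k = ker s"
  have k: "mono k" "arr k" "tgt k = dsum UNIV X" using s by (auto simp: k_def)
  have sk: "nul (s \<star> k)" unfolding k_def using s assms by simp
  have eq: "f \<star> (pf \<star> k) = e \<star> (pe \<star> k)"
  proof -
    have "s \<star> k = f \<star> (pf \<star> k) \<boxminus> e \<star> (pe \<star> k)"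
      unfolding s_def using assms t k by (simp add: bilin)
    then have "nul (f \<star> (pf \<star> k) \<boxminus> e \<star> (pe \<star> k))" using sk by simp
    then show ?thesis by (subst (asm) nul_minus_iff) (use assms t k in auto)
  qed
  have "epi (pf \<star> k)"
  proof (rule epiI)
    fix g assume g: "arr g" "src g = tgt (pf \<star> k)" "nul (g \<star> (pf \<star> k))"
    then have g': "src g = src f" using t k by simp
    \<comment> \<open>If \<open>g\<close> kills the projection to \<open>src f\<close>, then
      \<open>g \<star> pf\<close> kills the kernel of the epimorphism \<open>s\<close>, so it equals
      \<open>h \<star> s\<close>. On the summand \<open>src e\<close> this shows that
      \<open>h \<star> e\<close> vanishes, hence \<open>h\<close> and finally
      \<open>g\<close>.\<close>
    have "cofactors s (g \<star> pf)"
    proof (rule epi_cofactor[OF \<open>epi s\<close>])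
      fix w assume w: "arr w" "tgt w = src s" "nul (s \<star> w)"
      then have "factors k w" unfolding k_def using s by (subst factors_ker) auto
      then obtain h where h: "arr h" "src h = src w" "tgt h = src k" "k \<star> h = w" by (rule factorsE)
      have "nul ((g \<star> (pf \<star> k)) \<star> h)" by (rule comp_nul) (use g g' t k h in auto)
      moreover have "(g \<star> (pf \<star> k)) \<star> h = (g \<star> pf) \<star> (k \<star> h)" using g g' t k h(1,2,3) by simp
      ultimately show "nul ((g \<star> pf) \<star> w)" by (simp only: h(4))
    qed (use g g' t s in auto)
    then obtain h where h: "arr h" "src h = tgt s" "tgt h = tgt (g \<star> pf)" "h \<star> s = g \<star> pf" by (rule cofactorsE)
    then have h': "tgt h = tgt g" using g g' t by simp
    have "(h \<star> s) \<star> je = neg (h \<star> e)" using h(1,2) s t assms sje by (simp add: bilin)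
    moreover have "(h \<star> s) \<star> je = zr (src e) (tgt g)" unfolding h(4) using g g' t assms by simp
    ultimately have "neg (h \<star> e) = zr (src e) (tgt g)" by simp
    then have "nul (neg (h \<star> e))" by (rule ssubst) (use g assms in simp)
    then have "nul (neg (neg (h \<star> e)))" by (rule nul_neg) (use h s assms in auto)
    then have "nul (h \<star> e)" using h s assms by simp
    then have "nul h" by (rule epi_nul[OF assms(1)]) (use h s in auto)
    then have "nul (h \<star> s)" by (rule comp_nul) (use h(1-3) s in auto)
    then have "nul (g \<star> pf)" by (simp only: h(4))
    then have "nul ((g \<star> pf) \<star> jf)" by (rule comp_nul) (use g g' t in auto)
    moreover have "(g \<star> pf) \<star> jf = g" using g g' t by simp
    ultimately show "nul g" by (simp only:)
  qed (use t k in auto)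
  then show ?thesis by (rule covI[of e "pe \<star> k" f "pf \<star> k", OF eq[symmetric]]) (use t k assms in auto)
qed

section \<open>Images and the criterion for local lifting\<close>

abbreviation im where "im \<equiv> im_arr A"

lemma im_simps [simp]: "arr f \<Longrightarrow> mono (im f)" "arr f \<Longrightarrow> tgt (im f) = tgt f"
  unfolding im_arr_def by auto

lemma factors_im: "arr f \<Longrightarrow> arr x \<Longrightarrow> tgt x = tgt f \<Longrightarrow> factors (im f) x \<longleftrightarrow> nul (cok f \<star> x)"
  unfolding im_arr_def by (subst factors_ker) auto

lemma factors_im_self [simp]: "arr f \<Longrightarrow> factors (im f) f"
  by (simp add: factors_im)

text \<open>If \<open>g\<close> kills the arrow onto the image, then \<open>f\<close> already
  factors through the subobject \<open>ker g\<close> of the image. The cokernel of that subobject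
  kills \<open>f\<close>, so it factors through \<open>cok f\<close> and kills the image as well;
  thus \<open>ker g\<close> is the whole image and \<open>g\<close> is zero.\<close>

lemma lift_im_epi: assumes "arr f" shows "epi (lift_arr A (im f) f)"
proof (rule epiI)
  define e0 where "e0 = lift_arr A (im f) f"
  have e0: "arr e0" "src e0 = src f" "tgt e0 = src (im f)" "im f \<star> e0 = f"
    unfolding e0_def using assms by auto
  then show "arr (lift_arr A (im f) f)" by (simp add: e0_def)
  fix g assume "arr g" "src g = tgt (lift_arr A (im f) f)" "nul (g \<star> lift_arr A (im f) f)"
  then have g: "arr g" "src g = src (im f)" "nul (g \<star> e0)" using e0 by (auto simp: e0_def[symmetric])
  define m k where "m = im f" and "k = ker g"
  have m: "mono m" "arr m" "tgt m = tgt f" "m \<star> e0 = f" "tgt e0 = src m" "src g = src m" using assms e0 g by (auto simp: m_def)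
  have k: "mono k" "arr k" "tgt k = src m" "nul (g \<star> k)" using g m by (auto simp: k_def)
  have "factors k e0" unfolding k_def using g e0 by (subst factors_ker) auto
  then obtain e1 where e1: "arr e1" "src e1 = src e0" "tgt e1 = src k" "k \<star> e1 = e0" by (rule factorsE)
  have mk: "mono (m \<star> k)" using m k by (intro mono_comp) auto
  define c where "c = cok (m \<star> k)"
  have c: "epi c" "arr c" "src c = tgt f" "nul (c \<star> (m \<star> k))" using m k by (auto simp: c_def)
  have "f = (m \<star> k) \<star> e1" using m k e1 by simp
  moreover have "nul ((c \<star> (m \<star> k)) \<star> e1)" by (rule comp_nul) (use c m k e1 in auto)
  ultimately have "nul (c \<star> f)" using c m k e1 by simp
  then have "cofactors (cok f) c" using assms c by (subst cofactors_cok) auto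
  then obtain t where t: "arr t" "src t = tgt (cok f)" "tgt t = tgt c" "t \<star> cok f = c" by (rule cofactorsE)
  have "nul (cok f \<star> m)" unfolding m_def im_arr_def using assms by simp
  then have "nul (t \<star> (cok f \<star> m))" by (rule nul_comp) (use t m assms in auto)
  moreover have "t \<star> (cok f \<star> m) = c \<star> m" using t m assms by (simp add: comp_reduce[OF t(4)] del: assoc flip: assoc)
  ultimately have "nul (c \<star> m)" by simp
  then have "factors (m \<star> k) m" by (intro mono_factor[OF mk]) (use m k in \<open>auto simp: c_def\<close>)
  then obtain s where s: "arr s" "src s = src m" "tgt s = src (m \<star> k)" "(m \<star> k) \<star> s = m" by (rule factorsE)
  then have s': "tgt s = src k" using m k by simp
  have "k \<star> s = idt (src m)" by (rule mono_cancel[OF m(1)]) (use s s' m k in auto)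
  moreover have "nul ((g \<star> k) \<star> s)" by (rule comp_nul) (use g k s s' m in auto)
  moreover have "(g \<star> k) \<star> s = g \<star> (k \<star> s)" by (rule assoc) (use g k s s' m in auto)
  ultimately show "nul g" using g m by simp
qed

text \<open>Local lifting depends on the image alone. A cover can be cancelled because it is an
  epimorphism; conversely an arrow into the image is lifted by pulling back the epimorphism from
  \<open>src f\<close> onto the image.\<close>

lemma cov_iff:
  assumes "arr f" "arr x" "tgt x = tgt f"
  shows "cov f x \<longleftrightarrow> nul (cok f \<star> x)"
proof
  assume "cov f x"
  then obtain e y where e: "epi e" "arr e" "tgt e = src x" "arr y" "src y = src e" "tgt y = src f" "f \<star> y = x \<star> e"
    by (rule covE)
  have "nul ((cok f \<star> f) \<star> y)" by (rule comp_nul) (use assms e in auto)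
  moreover have "(cok f \<star> f) \<star> y = cok f \<star> (f \<star> y)" by (rule assoc) (use assms e in auto)
  ultimately have "nul (cok f \<star> (x \<star> e))" by (simp only: e(7))
  then have "nul ((cok f \<star> x) \<star> e)" using assms e(1-6) by simp
  then show "nul (cok f \<star> x)" by (rule epi_nul[OF e(1)]) (use assms e in auto)
next
  assume n: "nul (cok f \<star> x)"
  define e0 where "e0 = lift_arr A (im f) f"
  have e0: "epi e0" "arr e0" "src e0 = src f" "tgt e0 = src (im f)" "im f \<star> e0 = f"
    unfolding e0_def using assms lift_im_epi by auto
  obtain x' where x': "arr x'" "src x' = src x" "tgt x' = src (im f)" "im f \<star> x' = x"
    using factors_im[of f x] assms n by (auto elim: factorsE)
  have "cov e0 x'" by (rule cov_epi[OF e0(1)]) (use x' e0 in auto)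
  then obtain e y where e: "epi e" "arr e" "tgt e = src x'" "arr y" "src y = src e" "tgt y = src e0" "e0 \<star> y = x' \<star> e"
    by (rule covE)
  have m: "arr (im f)" using assms by simp
  have "f \<star> y = im f \<star> (e0 \<star> y)" using comp_reduce[OF e0(5), of y] e e0 m by simp
  also have "\<dots> = im f \<star> (x' \<star> e)" by (simp only: e(7))
  also have "\<dots> = x \<star> e" using comp_reduce[OF x'(4), of e] e x' m by simp
  finally show "cov f x" by (rule covI) (use e e0 x' in auto)
qed

lemma factors_im_cov: "arr f \<Longrightarrow> arr x \<Longrightarrow> tgt x = tgt f \<Longrightarrow> factors (im f) x \<longleftrightarrow> cov f x"
  by (simp add: cov_iff factors_im)

lemma cov_comp: "cov f x \<Longrightarrow> arr f \<Longrightarrow> arr x \<Longrightarrow> tgt x = tgt f \<Longrightarrow> arr y \<Longrightarrow> tgt y = src x \<Longrightarrow> cov f (x \<star> y)"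
  using comp_nul[of "cok f \<star> x" y] by (simp add: cov_iff)

lemma cov_epi_iff: assumes "epi e" "arr f" "arr x" "tgt x = tgt f" "tgt e = src x"
  shows "cov f (x \<star> e) \<longleftrightarrow> cov f x"
proof
  assume "cov f (x \<star> e)"
  then have "nul ((cok f \<star> x) \<star> e)" using assms by (simp add: cov_iff)
  then have "nul (cok f \<star> x)" by (rule epi_nul[OF assms(1)]) (use assms in auto)
  then show "cov f x" using assms by (simp add: cov_iff)
qed (use assms in \<open>auto intro: cov_comp\<close>)

text \<open>Lifting the identity of the target gives a cover of the target that factors through
  \<open>f\<close>.\<close>

lemma epi_covI:
  assumes "arr f" "\<And>x. arr x \<Longrightarrow> tgt x = tgt f \<Longrightarrow> cov f x"
  shows "epi f"
proof -
  have "cov f (idt (tgt f))" using assms by simp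
  then obtain e y where e: "epi e" "arr e" "tgt e = src (idt (tgt f))" "arr y" "src y = src e" "tgt y = src f"
    "f \<star> y = idt (tgt f) \<star> e" by (rule covE)
  then have "epi (f \<star> y)" using assms(1) by simp
  then show ?thesis by (rule epi_left) (use e assms in auto)
qed

subsection \<open>Complexes and their cohomology\<close>

abbreviation cpx where "cpx Y \<equiv> is_complex A Y"

lemma cpx_simps [simp]:
  assumes "cpx Y"
  shows "obj (fst Y n)" "arr (snd Y n)" "src (snd Y n) = fst Y n" "tgt (snd Y n) = fst Y (n + 1)"
  using assms unfolding is_complex_def Hom_iff by auto

lemma cpx_dd: assumes "cpx Y" "m = n + 1" shows "nul (snd Y m \<star> snd Y n)"
proof -
  have "snd Y (n + 1) \<star> snd Y n = zr (fst Y n) (fst Y (n + 2))" using assms(1) unfolding is_complex_def by blast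
  then show ?thesis using assms by simp
qed

lemma cpx_ddx: assumes "cpx Y" "m = n + 1" "arr x" "tgt x = fst Y n" shows "nul (snd Y m \<star> (snd Y n \<star> x))"
proof -
  have "nul ((snd Y m \<star> snd Y n) \<star> x)" by (rule comp_nul[OF cpx_dd]) (use assms in auto)
  then show ?thesis using assms by simp
qed

lemma cpxI:
  assumes "\<And>n. obj (fst Y n)" "\<And>n. arr (snd Y n)" "\<And>n. src (snd Y n) = fst Y n" "\<And>n. tgt (snd Y n) = fst Y (n + 1)"
    "\<And>n. nul (snd Y (n + 1) \<star> snd Y n)"
  shows "cpx Y"
  unfolding is_complex_def Hom_iff
proof (intro allI conjI)
  fix n show "snd Y (n + 1) \<star> snd Y n = zr (fst Y n) (fst Y (n + 2))"
    by (rule nul_eq[OF assms(5)]) (use assms in \<open>auto simp: algebra_simps\<close>)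
qed (use assms in auto)

definition cmap :: "('o, 'a) cpx \<Rightarrow> ('o, 'a) cpx \<Rightarrow> (int \<Rightarrow> 'a) \<Rightarrow> bool" where
  "cmap Y Z f \<longleftrightarrow> cpx Y \<and> cpx Z \<and> (\<forall>n. arr (f n) \<and> src (f n) = fst Y n \<and> tgt (f n) = fst Z n \<and>
     snd Z n \<star> f n = f (n + 1) \<star> snd Y n)"

lemma cmapD:
  assumes "cmap Y Z f"
  shows "cpx Y" "cpx Z" "arr (f n)" "src (f n) = fst Y n" "tgt (f n) = fst Z n"
    "snd Z n \<star> f n = f (n + 1) \<star> snd Y n"
  using assms unfolding cmap_def by auto

lemma cmap_dx:
  assumes "cmap Y Z f" "arr x" "tgt x = fst Y n"
  shows "snd Z n \<star> (f n \<star> x) = f (n + 1) \<star> (snd Y n \<star> x)"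
proof -
  note f = cmapD[OF assms(1)]
  have "snd Z n \<star> (f n \<star> x) = (f (n + 1) \<star> snd Y n) \<star> x"
    by (rule comp_reduce) (use f assms in auto)
  then show ?thesis using f(1-5) assms(2,3) by simp
qed

lemma cmapI:
  assumes "cpx Y" "cpx Z" "\<And>n. arr (f n)" "\<And>n. src (f n) = fst Y n" "\<And>n. tgt (f n) = fst Z n"
    "\<And>n. snd Z n \<star> f n = f (n + 1) \<star> snd Y n"
  shows "cmap Y Z f"
  using assms unfolding cmap_def by auto

lemma cmap_comp:
  assumes "cmap X Y f" "cmap Y Z g"
  shows "cmap X Z (\<lambda>n. g n \<star> f n)"
proof (rule cmapI)
  note f = cmapD[OF assms(1)] and g = cmapD[OF assms(2)]
  fix n
  show "snd Z n \<star> (g n \<star> f n) = (g (n + 1) \<star> f (n + 1)) \<star> snd X n"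
    using cmap_dx[OF assms(2), of "f n" n] f g(1-5) by simp
qed (use cmapD[OF assms(1)] cmapD[OF assms(2)] in auto)

definition cyc :: "('o, 'a) cpx \<Rightarrow> int \<Rightarrow> 'a \<Rightarrow> bool" where
  "cyc Y n z \<longleftrightarrow> arr z \<and> tgt z = fst Y n \<and> nul (snd Y n \<star> z)"

lemma cycD: "cyc Y n z \<Longrightarrow> arr z" "cyc Y n z \<Longrightarrow> tgt z = fst Y n" "cyc Y n z \<Longrightarrow> nul (snd Y n \<star> z)"
  by (auto simp: cyc_def)

lemma cyc_comp: "cpx Y \<Longrightarrow> cyc Y n z \<Longrightarrow> arr e \<Longrightarrow> tgt e = src z \<Longrightarrow> cyc Y n (z \<star> e)"
  unfolding cyc_def using comp_nul[of "snd Y n \<star> z" e] by auto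

lemma cyc_plus: "cpx Y \<Longrightarrow> cyc Y n z \<Longrightarrow> cyc Y n w \<Longrightarrow> src z = src w \<Longrightarrow> cyc Y n (z \<boxplus> w)"
  unfolding cyc_def by (auto simp: bilin)

lemma cyc_neg: "cpx Y \<Longrightarrow> cyc Y n z \<Longrightarrow> cyc Y n (neg z)"
  unfolding cyc_def by (auto simp: bilin)

lemma cyc_bdry: "cpx Y \<Longrightarrow> arr x \<Longrightarrow> tgt x = fst Y (n - 1) \<Longrightarrow> cyc Y n (snd Y (n - 1) \<star> x)"
  unfolding cyc_def by (auto intro: cpx_ddx)

lemma cyc_cmap: "cmap Y Z f \<Longrightarrow> cyc Y n z \<Longrightarrow> cyc Z n (f n \<star> z)"
  unfolding cyc_def using cmap_dx[of Y Z f z n] by (auto dest: cmapD simp: cmapD)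

lemma cocyc_simps [simp]:
  assumes "cpx Y"
  shows "mono (cocyc A Y n)" "tgt (cocyc A Y n) = fst Y n" "nul (snd Y n \<star> cocyc A Y n)"
  using assms unfolding cocyc_def by auto

lemma factors_cocyc: "cpx Y \<Longrightarrow> arr z \<Longrightarrow> tgt z = fst Y n \<Longrightarrow> factors (cocyc A Y n) z \<longleftrightarrow> nul (snd Y n \<star> z)"
  unfolding cocyc_def by (simp add: factors_ker)

lemma cyc_factors [simp]: "cpx Y \<Longrightarrow> cyc Y n z \<Longrightarrow> factors (cocyc A Y n) z"
  by (simp add: factors_cocyc cyc_def)

lemma cyc_d: "cpx Y \<Longrightarrow> cyc Y n (snd Y (n - 1))"
  unfolding cyc_def by (auto intro: cpx_dd)

lemma to_cohom_simps [simp]: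
  assumes "cpx Y"
  shows "epi (to_cohom A Y n)" "src (to_cohom A Y n) = src (cocyc A Y n)" "tgt (to_cohom A Y n) = cohom A n Y"
  using assms cyc_d[of Y n] unfolding to_cohom_def cohom_def by auto

lemma cohom_obj [simp]: "cpx Y \<Longrightarrow> obj (cohom A n Y)"
  using obj_tgt[of "to_cohom A Y n"] by simp

text \<open>The class of a generalised cocycle. Arrows into cohomology are locally of this form
  (\<open>cls_ex\<close>), and arrows out of cohomology are determined by their values on such
  classes (\<open>cohom_ext\<close>), so cohomology can be handled through cocycles.\<close>

definition cls :: "('o, 'a) cpx \<Rightarrow> int \<Rightarrow> 'a \<Rightarrow> 'a" where
  "cls Y n z = to_cohom A Y n \<star> lift_arr A (cocyc A Y n) z"

lemma cls_simps [simp]: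
  assumes "cpx Y" "cyc Y n z"
  shows "arr (cls Y n z)" "src (cls Y n z) = src z" "tgt (cls Y n z) = cohom A n Y"
  using assms unfolding cls_def by auto

lemma lift_comp: assumes "mono m" "factors m z" "arr z" "arr e" "tgt e = src z"
  shows "lift_arr A m (z \<star> e) = lift_arr A m z \<star> e"
proof (rule lift_eqI[OF assms(1)])
  have "m \<star> (lift_arr A m z \<star> e) = (m \<star> lift_arr A m z) \<star> e" by (rule assoc[symmetric]) (use assms in auto)
  then show "m \<star> (lift_arr A m z \<star> e) = z \<star> e" using assms by (simp del: assoc)
qed (use assms in auto)

lemma lift_plus: assumes "mono m" "factors m z" "factors m w" "src z = src w"
  shows "lift_arr A m (z \<boxplus> w) = lift_arr A m z \<boxplus> lift_arr A m w"
  by (rule lift_eqI[OF assms(1)]) (use assms in \<open>auto simp: bilin\<close>)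

lemma lift_neg: assumes "mono m" "factors m z"
  shows "lift_arr A m (neg z) = neg (lift_arr A m z)"
  by (rule lift_eqI[OF assms(1)]) (use assms in \<open>auto simp: bilin\<close>)

lemma cls_comp: "cpx Y \<Longrightarrow> cyc Y n z \<Longrightarrow> arr e \<Longrightarrow> tgt e = src z \<Longrightarrow> cls Y n (z \<star> e) = cls Y n z \<star> e"
  unfolding cls_def by (subst lift_comp) (auto dest: cycD)

lemma cls_plus: "cpx Y \<Longrightarrow> cyc Y n z \<Longrightarrow> cyc Y n w \<Longrightarrow> src z = src w \<Longrightarrow>
    cls Y n (z \<boxplus> w) = cls Y n z \<boxplus> cls Y n w"
  unfolding cls_def by (subst lift_plus) (auto simp: bilin)

lemma cls_neg: "cpx Y \<Longrightarrow> cyc Y n z \<Longrightarrow> cls Y n (neg z) = neg (cls Y n z)"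
  unfolding cls_def by (subst lift_neg) (auto simp: bilin)

lemma cov_mono_comp:
  assumes "mono m" "arr f" "arr x" "tgt f = src m" "tgt x = src m"
  shows "cov (m \<star> f) (m \<star> x) \<longleftrightarrow> cov f x"
proof
  assume "cov (m \<star> f) (m \<star> x)"
  then obtain e y where e: "epi e" "arr e" "tgt e = src (m \<star> x)" "arr y" "src y = src e" "tgt y = src (m \<star> f)"
    "(m \<star> f) \<star> y = (m \<star> x) \<star> e" by (rule covE)
  have "f \<star> y = x \<star> e" by (rule mono_cancel[OF assms(1)]) (use e assms in auto)
  then show "cov f x" by (rule covI) (use e assms in auto)
next
  assume "cov f x"
  then obtain e y where e: "epi e" "arr e" "tgt e = src x" "arr y" "src y = src e" "tgt y = src f" "f \<star> y = x \<star> e"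
    by (rule covE)
  have "(m \<star> f) \<star> y = (m \<star> x) \<star> e" using e assms by simp
  then show "cov (m \<star> f) (m \<star> x)" by (rule covI) (use e assms in auto)
qed

text \<open>\<open>to_cohom\<close> is a cokernel, so vanishing is local lifting to the boundaries
  inside the object of cocycles; the inclusion of the cocycles is a monomorphism and can be composed
  on both sides.\<close>

lemma cls_nul: assumes "cpx Y" "cyc Y n z" shows "nul (cls Y n z) \<longleftrightarrow> cov (snd Y (n - 1)) z"
proof -
  let ?m = "cocyc A Y n"
  let ?g = "lift_arr A ?m (snd Y (n - 1))" and ?w = "lift_arr A ?m z"
  have t: "arr ?g" "tgt ?g = src ?m" "?m \<star> ?g = snd Y (n - 1)" "arr ?w" "tgt ?w = src ?m" "?m \<star> ?w = z"
    using assms cyc_d[of Y n] by auto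
  have "nul (cls Y n z) \<longleftrightarrow> cov ?g ?w"
    unfolding cls_def to_cohom_def using t by (subst cov_iff) auto
  also have "\<dots> \<longleftrightarrow> cov (?m \<star> ?g) (?m \<star> ?w)" by (rule cov_mono_comp[symmetric]) (use t assms in auto)
  finally show ?thesis by (simp only: t(3,6))
qed

lemma cls_eq_iff:
  assumes "cpx Y" "cyc Y n z" "cyc Y n w" "src z = src w"
  shows "cls Y n z = cls Y n w \<longleftrightarrow> cov (snd Y (n - 1)) (z \<boxminus> w)"
proof -
  have "cov (snd Y (n - 1)) (z \<boxminus> w) \<longleftrightarrow> nul (cls Y n (z \<boxminus> w))"
    using assms cyc_neg[of Y n w] by (intro cls_nul[symmetric] cyc_plus) (auto dest: cycD)
  also have "cls Y n (z \<boxminus> w) = cls Y n z \<boxminus> cls Y n w"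
    using assms cyc_neg[of Y n w] cycD(1)[of Y n w] by (simp add: cls_plus cls_neg)
  also have "nul \<dots> \<longleftrightarrow> cls Y n z = cls Y n w" by (rule nul_minus_iff) (use assms in auto)
  finally show ?thesis by simp
qed

lemma cls_ex:
  assumes "cpx Y" "arr h" "tgt h = cohom A n Y"
  obtains e z where "epi e" "arr e" "tgt e = src h" "cyc Y n z" "src z = src e" "cls Y n z = h \<star> e"
proof -
  have "cov (to_cohom A Y n) h" by (rule cov_epi) (use assms in auto)
  then obtain e y where e: "epi e" "arr e" "tgt e = src h" "arr y" "src y = src e" "tgt y = src (to_cohom A Y n)"
     "to_cohom A Y n \<star> y = h \<star> e" by (rule covE)
  have y: "tgt y = src (cocyc A Y n)" using e assms by simp
  have "nul ((snd Y n \<star> cocyc A Y n) \<star> y)" by (rule comp_nul) (use e y assms in auto)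
  then have c: "cyc Y n (cocyc A Y n \<star> y)" unfolding cyc_def using assms e y by simp
  have "lift_arr A (cocyc A Y n) (cocyc A Y n \<star> y) = y" by (rule lift_eqI) (use assms e y in auto)
  then have "cls Y n (cocyc A Y n \<star> y) = h \<star> e" unfolding cls_def using e by simp
  with that[of e "cocyc A Y n \<star> y"] c e y assms show thesis by simp
qed

text \<open>The universal cocycle \<open>cocyc A Y n\<close> has \<open>to_cohom A Y n\<close> as
  its class, and this is an epimorphism; the condition for this one cocycle decides.\<close>

lemma cohom_ext:
  assumes "cpx Y" "arr g" "arr h" "src g = cohom A n Y" "src h = cohom A n Y" "tgt g = tgt h"
    and "\<And>z. cyc Y n z \<Longrightarrow> g \<star> cls Y n z = h \<star> cls Y n z"
  shows "g = h"
proof -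
  have "cyc Y n (cocyc A Y n)" using assms(1) by (simp add: cyc_def)
  moreover have "cls Y n (cocyc A Y n) = to_cohom A Y n"
  proof -
    have "lift_arr A (cocyc A Y n) (cocyc A Y n) = idt (src (cocyc A Y n))"
      by (rule lift_eqI) (use assms(1) in auto)
    then show ?thesis unfolding cls_def using assms(1) by simp
  qed
  ultimately have "g \<star> to_cohom A Y n = h \<star> to_cohom A Y n" using assms(7) by metis
  then show ?thesis by (rule epi_cancel[rotated]) (use assms in auto)
qed

text \<open>The class of the image of the universal cocycle kills boundaries, since \<open>f\<close>
  carries boundaries to boundaries; hence the description in \<open>cohom_map\<close> denotes an
  actual arrow.\<close>

lemma cohom_map:
  assumes "cmap Y Z f"
  shows "arr (cohom_map A n Y Z f)" "src (cohom_map A n Y Z f) = cohom A n Y" "tgt (cohom_map A n Y Z f) = cohom A n Z"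
    "cyc Y n z \<Longrightarrow> cohom_map A n Y Z f \<star> cls Y n z = cls Z n (f n \<star> z)"
proof -
  note f = cmapD[OF assms]
  let ?w = "cocyc A Y n"
  have cw: "cyc Y n ?w" using f by (simp add: cyc_def)
  have cf: "cyc Z n (f n \<star> ?w)" by (rule cyc_cmap[OF assms cw])
  let ?k = "to_cohom A Z n \<star> lift_arr A (cocyc A Z n) (f n \<star> ?w)"
  have k: "?k = cls Z n (f n \<star> ?w)" by (simp add: cls_def)
  have tk: "arr ?k" "src ?k = src ?w" "tgt ?k = cohom A n Z" unfolding k using f cf by auto
  let ?g = "lift_arr A ?w (snd Y (n - 1))"
  have g: "arr ?g" "tgt ?g = src ?w" "src ?g = fst Y (n - 1)" "?w \<star> ?g = snd Y (n - 1)" using f cyc_d[of Y n] by auto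
  have "?k \<star> ?g = cls Z n ((f n \<star> ?w) \<star> ?g)" unfolding k using cls_comp[OF f(2) cf, of ?g] g f by simp
  also have "(f n \<star> ?w) \<star> ?g = f n \<star> (?w \<star> ?g)" by (rule assoc) (use f g in auto)
  also have "\<dots> = snd Z (n - 1) \<star> f (n - 1)" using cmapD(6)[OF assms, of "n - 1"] by (simp add: g(4))
  finally have kg: "?k \<star> ?g = cls Z n (snd Z (n - 1) \<star> f (n - 1))" .
  have "cov (snd Z (n - 1)) (snd Z (n - 1) \<star> f (n - 1))" by (rule cov_factor) (use f in auto)
  then have "nul (?k \<star> ?g)" unfolding kg using f cyc_bdry[of Z "f (n - 1)" n] by (subst cls_nul) auto
  then have co: "cofactors (to_cohom A Y n) ?k"
    unfolding to_cohom_def[of A Y] using g f tk cofactors_cok[of ?g ?k] by (simp del: assoc)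
  show t: "arr (cohom_map A n Y Z f)" "src (cohom_map A n Y Z f) = cohom A n Y" "tgt (cohom_map A n Y Z f) = cohom A n Z"
    unfolding cohom_map_def using co f tk by auto
  have eq: "cohom_map A n Y Z f \<star> to_cohom A Y n = cls Z n (f n \<star> ?w)"
    unfolding cohom_map_def using co f k by simp
  assume z: "cyc Y n z"
  let ?l = "lift_arr A ?w z"
  have l: "arr ?l" "tgt ?l = src ?w" "src ?l = src z" "?w \<star> ?l = z" using f z by auto
  have "cohom_map A n Y Z f \<star> cls Y n z = (cohom_map A n Y Z f \<star> to_cohom A Y n) \<star> ?l"
    unfolding cls_def using t f l by simp
  also have "\<dots> = cls Z n (f n \<star> ?w) \<star> ?l" by (simp only: eq)
  also have "\<dots> = cls Z n ((f n \<star> ?w) \<star> ?l)" using cls_comp[OF f(2) cf, of ?l] l f by simp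
  also have "(f n \<star> ?w) \<star> ?l = f n \<star> (?w \<star> ?l)" by (rule assoc) (use f l in auto)
  finally show "cohom_map A n Y Z f \<star> cls Y n z = cls Z n (f n \<star> z)" by (simp only: l(4))
qed

lemma cohom_map_id: assumes "cpx Y" "\<And>n. f n = idt (fst Y n)" shows "cohom_map A n Y Y f = idt (cohom A n Y)"
proof (rule cohom_ext[OF assms(1)])
  have f: "cmap Y Y f" using assms by (intro cmapI) auto
  note m = cohom_map[OF f, of n]
  show "arr (cohom_map A n Y Y f)" "src (cohom_map A n Y Y f) = cohom A n Y"
    "tgt (cohom_map A n Y Y f) = tgt (idt (cohom A n Y))" using m assms by auto
  fix z assume "cyc Y n z"
  then show "cohom_map A n Y Y f \<star> cls Y n z = idt (cohom A n Y) \<star> cls Y n z" using m(4)[of z] assms by (simp add: cycD)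
qed (use assms in auto)

lemma cohom_map_comp:
  assumes "cmap X Y f" "cmap Y Z g"
  shows "cohom_map A n X Z (\<lambda>n. g n \<star> f n) = cohom_map A n Y Z g \<star> cohom_map A n X Y f"
proof (rule cohom_ext)
  note f = cohom_map[OF assms(1), of n] and g = cohom_map[OF assms(2), of n]
    and gf = cohom_map[OF cmap_comp[OF assms], of n]
  note f' = cmapD[OF assms(1)] and g' = cmapD[OF assms(2)]
  show "cpx X" by (rule f')
  fix z assume z: "cyc X n z"
  note fz = cyc_cmap[OF assms(1) z]
  have "(g n \<star> f n) \<star> z = g n \<star> (f n \<star> z)" by (rule assoc) (use f' g' cycD[OF z] in auto)
  moreover have "(cohom_map A n Y Z g \<star> cohom_map A n X Y f) \<star> cls X n z = cohom_map A n Y Z g \<star> (cohom_map A n X Y f \<star> cls X n z)"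
    by (rule assoc) (use f g f' z in auto)
  ultimately show "cohom_map A n X Z (\<lambda>n. g n \<star> f n) \<star> cls X n z = (cohom_map A n Y Z g \<star> cohom_map A n X Y f) \<star> cls X n z"
    by (simp only: f(4)[OF z] g(4)[OF fz] gf(4)[OF z])
qed (use cohom_map[OF assms(1), of n] cohom_map[OF assms(2), of n] cohom_map[OF cmap_comp[OF assms], of n] in auto)

lemma cohom_map_htpy:
  assumes "cmap Y Z f" "cmap Y Z g" "\<And>z. cyc Y n z \<Longrightarrow> cov (snd Z (n - 1)) (f n \<star> z \<boxminus> g n \<star> z)"
  shows "cohom_map A n Y Z f = cohom_map A n Y Z g"
proof (rule cohom_ext)
  note f = cohom_map[OF assms(1), of n] and g = cohom_map[OF assms(2), of n]
  note f' = cmapD[OF assms(1)] and g' = cmapD[OF assms(2)]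
  show "cpx Y" by (rule f')
  fix z assume z: "cyc Y n z"
  have "cls Z n (f n \<star> z) = cls Z n (g n \<star> z)"
    using assms(3)[OF z] cyc_cmap[OF assms(1) z] cyc_cmap[OF assms(2) z] f' g' cycD[OF z]
    by (subst cls_eq_iff) auto
  then show "cohom_map A n Y Z f \<star> cls Y n z = cohom_map A n Y Z g \<star> cls Y n z"
    by (simp only: f(4)[OF z] g(4)[OF z])
qed (use cohom_map[OF assms(1), of n] cohom_map[OF assms(2), of n] in auto)

definition sg :: "int \<Rightarrow> 'a \<Rightarrow> 'a" where "sg n f = (if even n then f else neg f)"

lemma sg_simps [simp]: "arr f \<Longrightarrow> arr (sg n f)" "arr f \<Longrightarrow> src (sg n f) = src f" "arr f \<Longrightarrow> tgt (sg n f) = tgt f"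
  by (auto simp: sg_def)

lemma sg_comp: "arr f \<Longrightarrow> arr g \<Longrightarrow> src g = tgt f \<Longrightarrow> sg n g \<star> f = sg n (g \<star> f)"
  and comp_sg: "arr f \<Longrightarrow> arr g \<Longrightarrow> src g = tgt f \<Longrightarrow> g \<star> sg n f = sg n (g \<star> f)"
  by (auto simp: sg_def bilin)

lemma sg_plus: "arr f \<Longrightarrow> arr g \<Longrightarrow> src f = src g \<Longrightarrow> tgt f = tgt g \<Longrightarrow> sg n (f \<boxplus> g) = sg n f \<boxplus> sg n g"
  by (auto simp: sg_def bilin)

lemma sg_sg: "arr f \<Longrightarrow> sg m (sg n f) = sg (m + n) f"
  by (auto simp: sg_def)

lemma sg_nul_iff [simp]: "arr f \<Longrightarrow> nul (sg n f) \<longleftrightarrow> nul f"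
  using nul_neg[of "neg f"] by (auto simp: sg_def)

lemma signed_hom: "f \<in> Hom X Y \<Longrightarrow> signed (hom_group A X Y) n f = sg n f"
  by (simp add: signed_def sg_def neg_eq_inv)

lemma zero_obj_simps [simp]: "obj (zero_obj A)" "idt (zero_obj A) = zr (zero_obj A) (zero_obj A)"
  using someI_ex[of "\<lambda>X. obj X \<and> idt X = zr X X"] zero_object unfolding zero_obj_def by blast+

lemma nul_to: assumes "nul (idt X)" "arr f" "tgt f = X" shows "nul f"
proof -
  have "nul (idt X \<star> f)" by (rule comp_nul) (use assms in auto)
  then show ?thesis using assms by simp
qed

lemma nul_from: assumes "nul (idt X)" "arr f" "src f = X" shows "nul f"
proof -
  have "nul (f \<star> idt X)" by (rule nul_comp) (use assms in auto)
  then show ?thesis using assms by simp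
qed

lemma nul_to_zero_obj: "arr f \<Longrightarrow> tgt f = zero_obj A \<Longrightarrow> nul f"
  and nul_from_zero_obj: "arr f \<Longrightarrow> src f = zero_obj A \<Longrightarrow> nul f"
  using nul_to[of "zero_obj A" f] nul_from[of "zero_obj A" f] nul_zr[of "zero_obj A" "zero_obj A"] by simp_all

end

subsection \<open>Contravariant functors to complexes\<close>

text \<open>
  Weaker than a differential graded functor to the opposite of the category of complexes. This
  saves showing that the quotients \<open>JN N\<close> are differential graded categories.
\<close>

locale cpx_functor = abelian A for A :: "('o, 'a) addcat" (structure) +
  fixes C :: "('c, 'm) dgcat" and F :: "('c, 'm, 'o, 'a) cpx_fun"
  assumes Cgrp: "P \<in> dg_obj C \<Longrightarrow> Q \<in> dg_obj C \<Longrightarrow> comm_group (dg_hom C i P Q)"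
    and Cid: "P \<in> dg_obj C \<Longrightarrow> dg_id C P \<in> carrier (dg_hom C 0 P P)"
    and Ccomp: "P \<in> dg_obj C \<Longrightarrow> Q \<in> dg_obj C \<Longrightarrow> R \<in> dg_obj C \<Longrightarrow>
      g \<in> carrier (dg_hom C i Q R) \<Longrightarrow> f \<in> carrier (dg_hom C j P Q) \<Longrightarrow>
      dg_comp C i j P Q R g f \<in> carrier (dg_hom C (i + j) P R)"
    and Cdiff: "P \<in> dg_obj C \<Longrightarrow> Q \<in> dg_obj C \<Longrightarrow> f \<in> carrier (dg_hom C i P Q) \<Longrightarrow>
      dg_diff C i P Q f \<in> carrier (dg_hom C (i + 1) P Q)"
    and Fobj: "P \<in> dg_obj C \<Longrightarrow> is_complex A (fun_obj F P)"
    and Fhom: "P \<in> dg_obj C \<Longrightarrow> Q \<in> dg_obj C \<Longrightarrow> f \<in> carrier (dg_hom C i P Q) \<Longrightarrow>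
      fun_hom F i P Q f n \<in> cat_hom A (fst (fun_obj F Q) n) (fst (fun_obj F P) (n + i))"
    and Fadd: "P \<in> dg_obj C \<Longrightarrow> Q \<in> dg_obj C \<Longrightarrow> f \<in> carrier (dg_hom C i P Q) \<Longrightarrow>
      g \<in> carrier (dg_hom C i P Q) \<Longrightarrow>
      fun_hom F i P Q (f \<otimes>\<^bsub>dg_hom C i P Q\<^esub> g) n = fun_hom F i P Q f n \<boxplus> fun_hom F i P Q g n"
    and Fid: "P \<in> dg_obj C \<Longrightarrow> fun_hom F 0 P P (dg_id C P) n = cat_id A (fst (fun_obj F P) n)"
    and Fcomp: "P \<in> dg_obj C \<Longrightarrow> Q \<in> dg_obj C \<Longrightarrow> R \<in> dg_obj C \<Longrightarrow>
      g \<in> carrier (dg_hom C i Q R) \<Longrightarrow> f \<in> carrier (dg_hom C j P Q) \<Longrightarrow>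
      fun_hom F (i + j) P R (dg_comp C i j P Q R g f) n = fun_hom F j P Q f (n + i) \<star> fun_hom F i Q R g n"
    and Fdiff: "P \<in> dg_obj C \<Longrightarrow> Q \<in> dg_obj C \<Longrightarrow> f \<in> carrier (dg_hom C i P Q) \<Longrightarrow>
      fun_hom F (i + 1) P Q (dg_diff C i P Q f) n =
      snd (fun_obj F P) (n + i) \<star> fun_hom F i P Q f n \<boxplus> sg (i + 1) (fun_hom F i P Q f (n + 1) \<star> snd (fun_obj F Q) n)"
begin

lemma Fhom_simps:
  assumes "P \<in> dg_obj C" "Q \<in> dg_obj C" "f \<in> carrier (dg_hom C i P Q)"
  shows "arr (fun_hom F i P Q f n)" "src (fun_hom F i P Q f n) = fst (fun_obj F Q) n"
    "tgt (fun_hom F i P Q f n) = fst (fun_obj F P) (n + i)"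
  using Fhom[OF assms] by (auto simp: Hom_iff)

lemma Cgrp': "P \<in> dg_obj C \<Longrightarrow> Q \<in> dg_obj C \<Longrightarrow> group (dg_hom C i P Q)"
  and Cmon: "P \<in> dg_obj C \<Longrightarrow> Q \<in> dg_obj C \<Longrightarrow> comm_monoid (dg_hom C i P Q)"
  using Cgrp by (simp_all add: comm_group_def)

lemma Cone: "P \<in> dg_obj C \<Longrightarrow> Q \<in> dg_obj C \<Longrightarrow> \<one>\<^bsub>dg_hom C i P Q\<^esub> \<in> carrier (dg_hom C i P Q)"
  using Cmon comm_monoid.axioms(1) monoid.one_closed by blast

lemma Fone:
  assumes "P \<in> dg_obj C" "Q \<in> dg_obj C"
  shows "fun_hom F i P Q \<one>\<^bsub>dg_hom C i P Q\<^esub> n = zr (fst (fun_obj F Q) n) (fst (fun_obj F P) (n + i))"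
proof -
  note c = Cone[OF assms, of i]
  note t = Fhom_simps[OF assms c, of n]
  have "\<one>\<^bsub>dg_hom C i P Q\<^esub> \<otimes>\<^bsub>dg_hom C i P Q\<^esub> \<one>\<^bsub>dg_hom C i P Q\<^esub> = \<one>\<^bsub>dg_hom C i P Q\<^esub>"
    using Cmon[OF assms] by (simp add: comm_monoid.axioms(1) monoid.l_one[OF _ c])
  then have "fun_hom F i P Q \<one>\<^bsub>dg_hom C i P Q\<^esub> n \<boxplus> fun_hom F i P Q \<one>\<^bsub>dg_hom C i P Q\<^esub> n = fun_hom F i P Q \<one>\<^bsub>dg_hom C i P Q\<^esub> n"
    using Fadd[OF assms c c, of n] by simp
  from add_self_zr[OF this t(1)] show ?thesis using t by simp
qed

lemma Finv:
  assumes "P \<in> dg_obj C" "Q \<in> dg_obj C" "f \<in> carrier (dg_hom C i P Q)"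
  shows "fun_hom F i P Q (inv\<^bsub>dg_hom C i P Q\<^esub> f) n = neg (fun_hom F i P Q f n)"
proof -
  interpret H: group "dg_hom C i P Q" by (rule Cgrp'[OF assms(1,2)])
  note t = Fhom_simps[OF assms, of n] Fhom_simps[OF assms(1,2) H.inv_closed[OF assms(3)], of n]
  have "fun_hom F i P Q f n \<boxplus> fun_hom F i P Q (inv\<^bsub>dg_hom C i P Q\<^esub> f) n = zr (src (fun_hom F i P Q f n)) (tgt (fun_hom F i P Q f n))"
    using Fadd[OF assms H.inv_closed[OF assms(3)], of n] Fone[OF assms(1,2), of i n] assms(3) t by simp
  then show ?thesis by (rule neg_unique) (use t in auto)
qed

lemma signed_closed:
  assumes "P \<in> dg_obj C" "Q \<in> dg_obj C" "f \<in> carrier (dg_hom C i P Q)"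
  shows "signed (dg_hom C i P Q) k f \<in> carrier (dg_hom C i P Q)"
  using Cgrp'[OF assms(1,2), of i] assms(3) by (simp add: signed_def group.inv_closed)

lemma Fsigned:
  assumes "P \<in> dg_obj C" "Q \<in> dg_obj C" "f \<in> carrier (dg_hom C i P Q)"
  shows "fun_hom F i P Q (signed (dg_hom C i P Q) k f) n = sg k (fun_hom F i P Q f n)"
  using Finv[OF assms] by (simp add: signed_def sg_def)

lemma Ffinprod:
  assumes "P \<in> dg_obj C" "Q \<in> dg_obj C" "finite I" "\<And>k. k \<in> I \<Longrightarrow> f k \<in> carrier (dg_hom C i P Q)"
  shows "fun_hom F i P Q (finprod (dg_hom C i P Q) f I) n =
    hsum (fst (fun_obj F Q) n) (fst (fun_obj F P) (n + i)) (\<lambda>k. fun_hom F i P Q (f k) n) I"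
  using assms(3,4)
proof (induction I)
  case empty
  have "obj (fst (fun_obj F Q) n)" "obj (fst (fun_obj F P) (n + i))" using Fobj assms(1,2) by auto
  then show ?case using Fone[OF assms(1,2)] by (simp add: comm_monoid.finprod_empty[OF Cmon[OF assms(1,2)]])
next
  case (insert k I)
  interpret H: comm_monoid "dg_hom C i P Q" by (rule Cmon[OF assms(1,2)])
  have f: "f \<in> I \<rightarrow> carrier (dg_hom C i P Q)" "f k \<in> carrier (dg_hom C i P Q)" using insert by auto
  have "finprod (dg_hom C i P Q) f (insert k I) = f k \<otimes>\<^bsub>dg_hom C i P Q\<^esub> finprod (dg_hom C i P Q) f I"
    by (rule H.finprod_insert) (use insert f in auto)
  then have "fun_hom F i P Q (finprod (dg_hom C i P Q) f (insert k I)) n =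
    fun_hom F i P Q (f k) n \<boxplus> hsum (fst (fun_obj F Q) n) (fst (fun_obj F P) (n + i)) (\<lambda>k. fun_hom F i P Q (f k) n) I"
    using Fadd[OF assms(1,2) f(2) H.finprod_closed[OF f(1)], of n] insert by simp
  also have "\<dots> = hsum (fst (fun_obj F Q) n) (fst (fun_obj F P) (n + i)) (\<lambda>k. fun_hom F i P Q (f k) n) (insert k I)"
    by (rule hsum_insert[symmetric]) (use insert Fhom[OF assms(1,2)] in auto)
  finally show ?case .
qed

section \<open>Subfunctors and quotient functors\<close>

text \<open>Each identity required of \<open>F'\<close> holds after composition with a monomorphism
  \<open>\<iota> P n\<close>, where it becomes the identity for \<open>F\<close>. The input is that
  the family is stable under the differentials and under all arrows given by the functor.\<close>

lemma sub_functor: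
  assumes mono: "\<And>P n. P \<in> dg_obj C \<Longrightarrow> mono (\<iota> P n)" "\<And>P n. P \<in> dg_obj C \<Longrightarrow> tgt (\<iota> P n) = fst (fun_obj F P) n"
    and fd: "\<And>P n. P \<in> dg_obj C \<Longrightarrow> factors (\<iota> P (n + 1)) (snd (fun_obj F P) n \<star> \<iota> P n)"
    and fh: "\<And>i P Q f n. P \<in> dg_obj C \<Longrightarrow> Q \<in> dg_obj C \<Longrightarrow> f \<in> carrier (dg_hom C i P Q) \<Longrightarrow>
      factors (\<iota> P (n + i)) (fun_hom F i P Q f n \<star> \<iota> Q n)"
    and F'o: "\<And>P n. P \<in> dg_obj C \<Longrightarrow> fst (fun_obj F' P) n = src (\<iota> P n)"
      "\<And>P n. P \<in> dg_obj C \<Longrightarrow> snd (fun_obj F' P) n = lift_arr A (\<iota> P (n + 1)) (snd (fun_obj F P) n \<star> \<iota> P n)"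
    and F'h: "\<And>i P Q f n. fun_hom F' i P Q f n = lift_arr A (\<iota> P (n + i)) (fun_hom F i P Q f n \<star> \<iota> Q n)"
  shows "cpx_functor A C F'"
    and "P \<in> dg_obj C \<Longrightarrow> \<iota> P (n + 1) \<star> snd (fun_obj F' P) n = snd (fun_obj F P) n \<star> \<iota> P n"
    and "P \<in> dg_obj C \<Longrightarrow> Q \<in> dg_obj C \<Longrightarrow> f \<in> carrier (dg_hom C i P Q) \<Longrightarrow>
      \<iota> P (n + i) \<star> fun_hom F' i P Q f n = fun_hom F i P Q f n \<star> \<iota> Q n"
proof -
  have D: "arr (snd (fun_obj F' P) n)" "src (snd (fun_obj F' P) n) = src (\<iota> P n)" "tgt (snd (fun_obj F' P) n) = src (\<iota> P (n + 1))"
    "\<iota> P (n + 1) \<star> snd (fun_obj F' P) n = snd (fun_obj F P) n \<star> \<iota> P n" if "P \<in> dg_obj C" for P n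
    unfolding F'o(2)[OF that] using mono[OF that] fd[OF that] Fobj[OF that] by auto
  have H: "arr (fun_hom F' i P Q f n)" "src (fun_hom F' i P Q f n) = src (\<iota> Q n)" "tgt (fun_hom F' i P Q f n) = src (\<iota> P (n + i))"
    "\<iota> P (n + i) \<star> fun_hom F' i P Q f n = fun_hom F i P Q f n \<star> \<iota> Q n"
    if "P \<in> dg_obj C" "Q \<in> dg_obj C" "f \<in> carrier (dg_hom C i P Q)" for i P Q f n
    unfolding F'h using mono[OF that(1)] mono[OF that(2)] fh[OF that] Fhom_simps[OF that] by auto
  note S = Fhom_simps
  show "P \<in> dg_obj C \<Longrightarrow> \<iota> P (n + 1) \<star> snd (fun_obj F' P) n = snd (fun_obj F P) n \<star> \<iota> P n" by (rule D(4))
  show "P \<in> dg_obj C \<Longrightarrow> Q \<in> dg_obj C \<Longrightarrow> f \<in> carrier (dg_hom C i P Q) \<Longrightarrow>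
      \<iota> P (n + i) \<star> fun_hom F' i P Q f n = fun_hom F i P Q f n \<star> \<iota> Q n" by (rule H(4))
  show "cpx_functor A C F'"
  proof (intro cpx_functor.intro cpx_functor_axioms.intro)
    fix P assume P: "P \<in> dg_obj C"
    note m = mono[OF P] and d = D[OF P] and FP = Fobj[OF P]
    show "cpx (fun_obj F' P)"
    proof (rule cpxI)
      fix n
      have "nul (\<iota> P (n + 1 + 1) \<star> (snd (fun_obj F' P) (n + 1) \<star> snd (fun_obj F' P) n))"
      proof -
        have "\<iota> P (n + 1 + 1) \<star> (snd (fun_obj F' P) (n + 1) \<star> snd (fun_obj F' P) n) =
          (snd (fun_obj F P) (n + 1) \<star> \<iota> P (n + 1)) \<star> snd (fun_obj F' P) n"
          by (rule comp_reduce[OF d(4)]) (use m d in auto)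
        also have "\<dots> = snd (fun_obj F P) (n + 1) \<star> (\<iota> P (n + 1) \<star> snd (fun_obj F' P) n)"
          by (rule assoc) (use m d FP in auto)
        also have "\<dots> = snd (fun_obj F P) (n + 1) \<star> (snd (fun_obj F P) n \<star> \<iota> P n)" by (simp only: d(4))
        finally show ?thesis using cpx_ddx[OF FP, of "n + 1" n "\<iota> P n"] m by simp
      qed
      then show "nul (snd (fun_obj F' P) (n + 1) \<star> snd (fun_obj F' P) n)"
        by (rule mono_nul[OF m(1)]) (use d in auto)
    qed (use d F'o[OF P] m in auto)
    fix n show "fun_hom F' 0 P P (dg_id C P) n = idt (fst (fun_obj F' P) n)"
      by (rule mono_cancel[OF m(1)[of "n + 0"]]) (use H[OF P P Cid[OF P]] m F'o[OF P] Fid[OF P] in auto)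
  next
    fix P Q f i n assume *: "P \<in> dg_obj C" "Q \<in> dg_obj C" "f \<in> carrier (dg_hom C i P Q)"
    show "fun_hom F' i P Q f n \<in> Hom (fst (fun_obj F' Q) n) (fst (fun_obj F' P) (n + i))"
      using H[OF *] F'o * by (auto simp: Hom_iff)
    { fix g assume g: "g \<in> carrier (dg_hom C i P Q)"
      have fg: "f \<otimes>\<^bsub>dg_hom C i P Q\<^esub> g \<in> carrier (dg_hom C i P Q)"
        by (rule monoid.m_closed[OF comm_monoid.axioms(1)[OF Cmon[OF *(1,2)]] *(3) g])
      show "fun_hom F' i P Q (f \<otimes>\<^bsub>dg_hom C i P Q\<^esub> g) n = fun_hom F' i P Q f n \<boxplus> fun_hom F' i P Q g n"
      proof (rule mono_cancel[OF mono(1)[OF *(1), of "n + i"]])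
        have "\<iota> P (n + i) \<star> fun_hom F' i P Q (f \<otimes>\<^bsub>dg_hom C i P Q\<^esub> g) n = (fun_hom F i P Q f n \<boxplus> fun_hom F i P Q g n) \<star> \<iota> Q n"
          by (simp only: H(4)[OF *(1,2) fg] Fadd[OF * g])
        also have "\<dots> = fun_hom F i P Q f n \<star> \<iota> Q n \<boxplus> fun_hom F i P Q g n \<star> \<iota> Q n"
          by (rule plus_comp) (simp_all add: S[OF *] S[OF *(1,2) g] mono[OF *(2)])
        also have "\<dots> = \<iota> P (n + i) \<star> fun_hom F' i P Q f n \<boxplus> \<iota> P (n + i) \<star> fun_hom F' i P Q g n"
          by (simp only: H(4)[OF *] H(4)[OF *(1,2) g])
        also have "\<dots> = \<iota> P (n + i) \<star> (fun_hom F' i P Q f n \<boxplus> fun_hom F' i P Q g n)"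
          by (rule comp_plus[symmetric]) (simp_all add: H(1-3)[OF *] H(1-3)[OF *(1,2) g] mono[OF *(1)])
        finally show "\<iota> P (n + i) \<star> fun_hom F' i P Q (f \<otimes>\<^bsub>dg_hom C i P Q\<^esub> g) n = \<iota> P (n + i) \<star> (fun_hom F' i P Q f n \<boxplus> fun_hom F' i P Q g n)" .
      qed (simp_all add: H(1-3)[OF *] H(1-3)[OF *(1,2) g] H(1-3)[OF *(1,2) fg]) }
    have e: "n + (i + 1) = n + i + 1" by simp
    note d = D[OF *(1)] D[OF *(2)]
    have e1: "\<iota> P (n + i + 1) \<star> (snd (fun_obj F' P) (n + i) \<star> fun_hom F' i P Q f n) =
      snd (fun_obj F P) (n + i) \<star> (fun_hom F i P Q f n \<star> \<iota> Q n)"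
      using comp_reduce[OF D(4)[OF *(1)], of "n + i" "fun_hom F' i P Q f n"] d(1-3) H[OF *] mono[OF *(1)] Fobj[OF *(1)] by simp
    have e2: "\<iota> P (n + 1 + i) \<star> (fun_hom F' i P Q f (n + 1) \<star> snd (fun_obj F' Q) n) =
      fun_hom F i P Q f (n + 1) \<star> (snd (fun_obj F Q) n \<star> \<iota> Q n)"
      using comp_reduce[OF H(4)[OF *], of "n + 1" "snd (fun_obj F' Q) n"] d(5-8) H(1-3)[OF *] mono[OF *(1)] mono[OF *(2)] S[OF *] by simp
    have c: "n + 1 + i = n + i + 1" by simp
    show "fun_hom F' (i + 1) P Q (dg_diff C i P Q f) n = snd (fun_obj F' P) (n + i) \<star> fun_hom F' i P Q f n \<boxplus>
      sg (i + 1) (fun_hom F' i P Q f (n + 1) \<star> snd (fun_obj F' Q) n)"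
    proof (rule mono_cancel[OF mono(1)[OF *(1), of "n + i + 1"]])
      show "\<iota> P (n + i + 1) \<star> fun_hom F' (i + 1) P Q (dg_diff C i P Q f) n = \<iota> P (n + i + 1) \<star>
        (snd (fun_obj F' P) (n + i) \<star> fun_hom F' i P Q f n \<boxplus> sg (i + 1) (fun_hom F' i P Q f (n + 1) \<star> snd (fun_obj F' Q) n))"
        using H(4)[OF *(1,2) Cdiff[OF *], of n] Fdiff[OF *] e1 e2 c
          S[OF *] H(1-3)[OF *] d(1-3,5-7) mono[OF *(1)] mono[OF *(2)] Fobj[OF *(1)] Fobj[OF *(2)]
        by (simp add: e c bilin sg_comp comp_sg)
    qed (simp_all add: H(1-3)[OF *] H(1-3)[OF *(1,2) Cdiff[OF *]] d(1-3,5-7) c e)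
  next
    fix P Q R g f i j n
    assume *: "P \<in> dg_obj C" "Q \<in> dg_obj C" "R \<in> dg_obj C" "g \<in> carrier (dg_hom C i Q R)" "f \<in> carrier (dg_hom C j P Q)"
    note hf = H[OF *(1,2,5)] and hg = H[OF *(2,3,4)] and hc = H[OF *(1,3) Ccomp[OF *]]
    have e: "n + (i + j) = n + i + j" by simp
    show "fun_hom F' (i + j) P R (dg_comp C i j P Q R g f) n = fun_hom F' j P Q f (n + i) \<star> fun_hom F' i Q R g n"
    proof (rule mono_cancel[OF mono(1)[OF *(1), of "n + i + j"]])
      have "\<iota> P (n + i + j) \<star> (fun_hom F' j P Q f (n + i) \<star> fun_hom F' i Q R g n) =
        fun_hom F j P Q f (n + i) \<star> (fun_hom F i Q R g n \<star> \<iota> R n)"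
        using comp_reduce[OF hf(4), of "n + i" "fun_hom F' i Q R g n"] hf(1-3) hg mono[OF *(1)] mono[OF *(2)] S[OF *(1,2,5)] by simp
      then show "\<iota> P (n + i + j) \<star> fun_hom F' (i + j) P R (dg_comp C i j P Q R g f) n =
        \<iota> P (n + i + j) \<star> (fun_hom F' j P Q f (n + i) \<star> fun_hom F' i Q R g n)"
        using hc(4)[of n] Fcomp[OF *] S[OF *(1,2,5)] S[OF *(2,3,4)] mono[OF *(3)] by (simp add: e)
    qed (simp_all add: hf(1-3) hg(1-3) hc(1-3) e)
  qed (blast intro: abelian_axioms Cgrp Cid Ccomp Cdiff)+
qed

text \<open>Dual to \<open>sub_functor\<close>: the identities are checked after precomposition with
  the epimorphisms \<open>\<pi> P n\<close>.\<close>

lemma quot_functor: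
  assumes epi: "\<And>P n. P \<in> dg_obj C \<Longrightarrow> epi (\<pi> P n)" "\<And>P n. P \<in> dg_obj C \<Longrightarrow> src (\<pi> P n) = fst (fun_obj F P) n"
    and fd: "\<And>P n. P \<in> dg_obj C \<Longrightarrow> cofactors (\<pi> P n) (\<pi> P (n + 1) \<star> snd (fun_obj F P) n)"
    and fh: "\<And>i P Q f n. P \<in> dg_obj C \<Longrightarrow> Q \<in> dg_obj C \<Longrightarrow> f \<in> carrier (dg_hom C i P Q) \<Longrightarrow>
      cofactors (\<pi> Q n) (\<pi> P (n + i) \<star> fun_hom F i P Q f n)"
    and F'o: "\<And>P n. P \<in> dg_obj C \<Longrightarrow> fst (fun_obj F' P) n = tgt (\<pi> P n)"
      "\<And>P n. P \<in> dg_obj C \<Longrightarrow> snd (fun_obj F' P) n = desc_arr A (\<pi> P n) (\<pi> P (n + 1) \<star> snd (fun_obj F P) n)"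
    and F'h: "\<And>i P Q f n. fun_hom F' i P Q f n = desc_arr A (\<pi> Q n) (\<pi> P (n + i) \<star> fun_hom F i P Q f n)"
  shows "cpx_functor A C F'"
    and "P \<in> dg_obj C \<Longrightarrow> snd (fun_obj F' P) n \<star> \<pi> P n = \<pi> P (n + 1) \<star> snd (fun_obj F P) n"
    and "P \<in> dg_obj C \<Longrightarrow> Q \<in> dg_obj C \<Longrightarrow> f \<in> carrier (dg_hom C i P Q) \<Longrightarrow>
      fun_hom F' i P Q f n \<star> \<pi> Q n = \<pi> P (n + i) \<star> fun_hom F i P Q f n"
proof -
  have D: "arr (snd (fun_obj F' P) n)" "src (snd (fun_obj F' P) n) = tgt (\<pi> P n)" "tgt (snd (fun_obj F' P) n) = tgt (\<pi> P (n + 1))"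
    "snd (fun_obj F' P) n \<star> \<pi> P n = \<pi> P (n + 1) \<star> snd (fun_obj F P) n" if "P \<in> dg_obj C" for P n
    unfolding F'o(2)[OF that] using epi[OF that] fd[OF that] Fobj[OF that] by auto
  have H: "arr (fun_hom F' i P Q f n)" "src (fun_hom F' i P Q f n) = tgt (\<pi> Q n)" "tgt (fun_hom F' i P Q f n) = tgt (\<pi> P (n + i))"
    "fun_hom F' i P Q f n \<star> \<pi> Q n = \<pi> P (n + i) \<star> fun_hom F i P Q f n"
    if "P \<in> dg_obj C" "Q \<in> dg_obj C" "f \<in> carrier (dg_hom C i P Q)" for i P Q f n
    unfolding F'h using epi[OF that(1)] epi[OF that(2)] fh[OF that] Fhom_simps[OF that] by auto
  note S = Fhom_simps
  show "P \<in> dg_obj C \<Longrightarrow> snd (fun_obj F' P) n \<star> \<pi> P n = \<pi> P (n + 1) \<star> snd (fun_obj F P) n" by (rule D(4))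
  show "P \<in> dg_obj C \<Longrightarrow> Q \<in> dg_obj C \<Longrightarrow> f \<in> carrier (dg_hom C i P Q) \<Longrightarrow>
      fun_hom F' i P Q f n \<star> \<pi> Q n = \<pi> P (n + i) \<star> fun_hom F i P Q f n" by (rule H(4))
  show "cpx_functor A C F'"
  proof (intro cpx_functor.intro cpx_functor_axioms.intro)
    fix P assume P: "P \<in> dg_obj C"
    note m = epi[OF P] and d = D[OF P] and FP = Fobj[OF P]
    show "cpx (fun_obj F' P)"
    proof (rule cpxI)
      fix n
      have "(snd (fun_obj F' P) (n + 1) \<star> snd (fun_obj F' P) n) \<star> \<pi> P n =
        snd (fun_obj F' P) (n + 1) \<star> (snd (fun_obj F' P) n \<star> \<pi> P n)"
        by (rule assoc) (use m d in auto)
      also have "\<dots> = snd (fun_obj F' P) (n + 1) \<star> (\<pi> P (n + 1) \<star> snd (fun_obj F P) n)" by (simp only: d(4))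
      also have "\<dots> = (\<pi> P (n + 1 + 1) \<star> snd (fun_obj F P) (n + 1)) \<star> snd (fun_obj F P) n"
        by (rule comp_reduce[OF d(4)]) (use m d FP in auto)
      also have "\<dots> = \<pi> P (n + 1 + 1) \<star> (snd (fun_obj F P) (n + 1) \<star> snd (fun_obj F P) n)"
        by (rule assoc) (use m d FP in auto)
      finally have e: "(snd (fun_obj F' P) (n + 1) \<star> snd (fun_obj F' P) n) \<star> \<pi> P n =
        \<pi> P (n + 1 + 1) \<star> (snd (fun_obj F P) (n + 1) \<star> snd (fun_obj F P) n)" .
      have "nul ((snd (fun_obj F' P) (n + 1) \<star> snd (fun_obj F' P) n) \<star> \<pi> P n)"
        unfolding e by (rule nul_comp[OF cpx_dd[OF FP]]) (use m FP in auto)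
      then show "nul (snd (fun_obj F' P) (n + 1) \<star> snd (fun_obj F' P) n)"
        by (rule epi_nul[OF m(1)]) (use d in auto)
    qed (use d F'o[OF P] m in auto)
    fix n show "fun_hom F' 0 P P (dg_id C P) n = idt (fst (fun_obj F' P) n)"
      by (rule epi_cancel[OF m(1)[of n]]) (use H[OF P P Cid[OF P]] m F'o[OF P] Fid[OF P] in auto)
  next
    fix P Q f i n assume *: "P \<in> dg_obj C" "Q \<in> dg_obj C" "f \<in> carrier (dg_hom C i P Q)"
    show "fun_hom F' i P Q f n \<in> Hom (fst (fun_obj F' Q) n) (fst (fun_obj F' P) (n + i))"
      using H[OF *] F'o * by (auto simp: Hom_iff)
    { fix g assume g: "g \<in> carrier (dg_hom C i P Q)"
      have fg: "f \<otimes>\<^bsub>dg_hom C i P Q\<^esub> g \<in> carrier (dg_hom C i P Q)"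
        by (rule monoid.m_closed[OF comm_monoid.axioms(1)[OF Cmon[OF *(1,2)]] *(3) g])
      show "fun_hom F' i P Q (f \<otimes>\<^bsub>dg_hom C i P Q\<^esub> g) n = fun_hom F' i P Q f n \<boxplus> fun_hom F' i P Q g n"
      proof (rule epi_cancel[OF epi(1)[OF *(2), of "n"]])
        have "fun_hom F' i P Q (f \<otimes>\<^bsub>dg_hom C i P Q\<^esub> g) n \<star> \<pi> Q n = \<pi> P (n + i) \<star> (fun_hom F i P Q f n \<boxplus> fun_hom F i P Q g n)"
          by (simp only: H(4)[OF *(1,2) fg] Fadd[OF * g])
        also have "\<dots> = \<pi> P (n + i) \<star> fun_hom F i P Q f n \<boxplus> \<pi> P (n + i) \<star> fun_hom F i P Q g n"
          by (rule comp_plus) (simp_all add: S[OF *] S[OF *(1,2) g] epi[OF *(1)])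
        also have "\<dots> = fun_hom F' i P Q f n \<star> \<pi> Q n \<boxplus> fun_hom F' i P Q g n \<star> \<pi> Q n"
          by (simp only: H(4)[OF *] H(4)[OF *(1,2) g])
        also have "\<dots> = (fun_hom F' i P Q f n \<boxplus> fun_hom F' i P Q g n) \<star> \<pi> Q n"
          by (rule plus_comp[symmetric]) (simp_all add: H(1-3)[OF *] H(1-3)[OF *(1,2) g] epi[OF *(2)])
        finally show "fun_hom F' i P Q (f \<otimes>\<^bsub>dg_hom C i P Q\<^esub> g) n \<star> \<pi> Q n = (fun_hom F' i P Q f n \<boxplus> fun_hom F' i P Q g n) \<star> \<pi> Q n" .
      qed (simp_all add: H(1-3)[OF *] H(1-3)[OF *(1,2) g] H(1-3)[OF *(1,2) fg]) }
    have e: "n + (i + 1) = n + i + 1" and c: "n + 1 + i = n + i + 1" by simp_all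
    note d = D[OF *(1)] D[OF *(2)]
    have e1: "snd (fun_obj F' P) (n + i) \<star> (fun_hom F' i P Q f n \<star> \<pi> Q n) =
      \<pi> P (n + i + 1) \<star> (snd (fun_obj F P) (n + i) \<star> fun_hom F i P Q f n)"
    proof -
      have "snd (fun_obj F' P) (n + i) \<star> (\<pi> P (n + i) \<star> fun_hom F i P Q f n) =
        (\<pi> P (n + i + 1) \<star> snd (fun_obj F P) (n + i)) \<star> fun_hom F i P Q f n"
        by (rule comp_reduce[OF D(4)[OF *(1)]]) (use d(1-3) S[OF *] epi[OF *(1)] in auto)
      then show ?thesis unfolding H(4)[OF *] using S[OF *] epi[OF *(1)] Fobj[OF *(1)] by simp
    qed
    have e2: "fun_hom F' i P Q f (n + 1) \<star> (snd (fun_obj F' Q) n \<star> \<pi> Q n) =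
      \<pi> P (n + 1 + i) \<star> (fun_hom F i P Q f (n + 1) \<star> snd (fun_obj F Q) n)"
    proof -
      have "fun_hom F' i P Q f (n + 1) \<star> (\<pi> Q (n + 1) \<star> snd (fun_obj F Q) n) =
        (\<pi> P (n + 1 + i) \<star> fun_hom F i P Q f (n + 1)) \<star> snd (fun_obj F Q) n"
        by (rule comp_reduce[OF H(4)[OF *]]) (use H(1-3)[OF *] epi[OF *(2)] Fobj[OF *(2)] in auto)
      then show ?thesis unfolding D(4)[OF *(2)] using S[OF *] epi[OF *(1)] Fobj[OF *(2)] by simp
    qed
    show "fun_hom F' (i + 1) P Q (dg_diff C i P Q f) n = snd (fun_obj F' P) (n + i) \<star> fun_hom F' i P Q f n \<boxplus>
      sg (i + 1) (fun_hom F' i P Q f (n + 1) \<star> snd (fun_obj F' Q) n)"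
    proof (rule epi_cancel[OF epi(1)[OF *(2), of "n"]])
      show "fun_hom F' (i + 1) P Q (dg_diff C i P Q f) n \<star> \<pi> Q n =
        (snd (fun_obj F' P) (n + i) \<star> fun_hom F' i P Q f n \<boxplus> sg (i + 1) (fun_hom F' i P Q f (n + 1) \<star> snd (fun_obj F' Q) n)) \<star> \<pi> Q n"
        using H(4)[OF *(1,2) Cdiff[OF *], of n] Fdiff[OF *] e1 e2
          S[OF *] H(1-3)[OF *] d(1-3,5-7) epi[OF *(1)] epi[OF *(2)] Fobj[OF *(1)] Fobj[OF *(2)]
        by (simp add: e c bilin sg_comp comp_sg)
    qed (simp_all add: H(1-3)[OF *] H(1-3)[OF *(1,2) Cdiff[OF *]] d(1-3,5-7) c e)
  next
    fix P Q R g f i j n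
    assume *: "P \<in> dg_obj C" "Q \<in> dg_obj C" "R \<in> dg_obj C" "g \<in> carrier (dg_hom C i Q R)" "f \<in> carrier (dg_hom C j P Q)"
    note hf = H[OF *(1,2,5)] and hg = H[OF *(2,3,4)] and hc = H[OF *(1,3) Ccomp[OF *]]
    have e: "n + (i + j) = n + i + j" by simp
    show "fun_hom F' (i + j) P R (dg_comp C i j P Q R g f) n = fun_hom F' j P Q f (n + i) \<star> fun_hom F' i Q R g n"
    proof (rule epi_cancel[OF epi(1)[OF *(3), of "n"]])
      have "fun_hom F' j P Q f (n + i) \<star> (\<pi> Q (n + i) \<star> fun_hom F i Q R g n) =
        (\<pi> P (n + i + j) \<star> fun_hom F j P Q f (n + i)) \<star> fun_hom F i Q R g n"
        by (rule comp_reduce[OF hf(4)]) (use hf(1-3) epi[OF *(2)] S[OF *(2,3,4)] in auto)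
      then have "fun_hom F' j P Q f (n + i) \<star> (fun_hom F' i Q R g n \<star> \<pi> R n) =
        \<pi> P (n + i + j) \<star> (fun_hom F j P Q f (n + i) \<star> fun_hom F i Q R g n)"
        unfolding hg(4) using epi[OF *(1)] S[OF *(1,2,5)] S[OF *(2,3,4)] by simp
      then show "fun_hom F' (i + j) P R (dg_comp C i j P Q R g f) n \<star> \<pi> R n =
        (fun_hom F' j P Q f (n + i) \<star> fun_hom F' i Q R g n) \<star> \<pi> R n"
        using hc(4)[of n] Fcomp[OF *] hf(1-3) hg(1-3) S[OF *(1,2,5)] S[OF *(2,3,4)] epi[OF *(3)] by (simp add: e)
    qed (simp_all add: hf(1-3) hg(1-3) hc(1-3) e)
  qed (blast intro: abelian_axioms Cgrp Cid Ccomp Cdiff)+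
qed

end

context abelian
begin

subsection \<open>Canonical truncations\<close>

abbreviation tli where "tli \<equiv> trunc_le_incl A"
abbreviation tgp where "tgp \<equiv> trunc_ge_proj A"

lemma mono_from_zero_obj: "arr f \<Longrightarrow> src f = zero_obj A \<Longrightarrow> mono f"
  by (rule monoI) (auto intro: nul_to_zero_obj)

lemma epi_to_zero_obj: "arr f \<Longrightarrow> tgt f = zero_obj A \<Longrightarrow> epi f"
  by (rule epiI) (auto intro: nul_from_zero_obj)

lemma nul_factors: assumes "nul x" "arr m" "tgt m = tgt x" shows "factors m x"
  by (rule factorsI[of m "zr (src x) (src m)"]) (use assms nul_arr[OF assms(1)] in \<open>auto intro: nul_eq[symmetric]\<close>)

lemma nul_cofactors: assumes "nul x" "arr e" "src e = src x" shows "cofactors e x"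
  by (rule cofactorsI[of "zr (tgt e) (tgt x)"]) (use assms nul_arr[OF assms(1)] in \<open>auto intro: nul_eq[symmetric]\<close>)

lemma tli_simps [simp]:
  assumes "cpx Y"
  shows "mono (tli b Y n)" "tgt (tli b Y n) = fst Y n" "src (tli b Y n) = trunc_le_obj A b Y n"
  using assms unfolding trunc_le_incl_def trunc_le_obj_def by (auto intro: mono_from_zero_obj)

lemma trunc_le_obj_obj [simp]: "cpx Y \<Longrightarrow> obj (trunc_le_obj A b Y n)"
  using obj_src[of "tli b Y n"] by simp

lemma factors_refl [simp]: "arr m \<Longrightarrow> factors m m"
  by (rule factorsI[of m "idt (src m)"]) auto

text \<open>The truncation agrees with \<open>Y\<close> below \<open>b\<close>, consists of the
  cocycles in degree \<open>b\<close>, and is zero above. This turns membership in a truncation into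
  a condition on generalised elements.\<close>

lemma factors_tli:
  assumes "cpx Y" "arr x" "tgt x = fst Y n"
  shows "factors (tli b Y n) x \<longleftrightarrow> n < b \<or> (n = b \<and> nul (snd Y n \<star> x)) \<or> nul x"
proof -
  consider "n < b" | "n = b" | "n > b" by linarith
  then show ?thesis
  proof cases
    case 1 then show ?thesis using assms by (auto intro: factorsI[of _ x] simp: trunc_le_incl_def)
  next
    case 2 then show ?thesis using assms factors_cocyc[of Y x n] by (auto simp: trunc_le_incl_def)
  next
    case 3
    have "nul x" if "factors (tli b Y n) x"
    proof -
      from that obtain h where h: "arr h" "tgt h = src (tli b Y n)" "tli b Y n \<star> h = x" by (rule factorsE)
      then have "nul (tli b Y n \<star> h)"
        by (intro nul_comp nul_to_zero_obj) (use assms 3 in \<open>auto simp: trunc_le_obj_def\<close>)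
      then show ?thesis by (simp only: h(3))
    qed
    then show ?thesis using 3 nul_factors[of x "tli b Y n"] assms by auto
  qed
qed

lemma tgp_simps [simp]:
  assumes "cpx Y"
  shows "epi (tgp a Y n)" "src (tgp a Y n) = fst Y n" "tgt (tgp a Y n) = trunc_ge_obj A a Y n"
  using assms unfolding trunc_ge_proj_def trunc_ge_obj_def by (auto intro: epi_to_zero_obj)

lemma trunc_ge_obj_lt: "n < a \<Longrightarrow> trunc_ge_obj A a Y n = zero_obj A"
  by (simp add: trunc_ge_obj_def)

lemma nul_tgp:
  assumes "cpx Y" "arr x" "tgt x = fst Y n"
  shows "nul (tgp a Y n \<star> x) \<longleftrightarrow> (n > a \<longrightarrow> nul x) \<and> (n = a \<longrightarrow> cov (snd Y (a - 1)) x)"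
proof -
  consider "n < a" | "n = a" | "n > a" by linarith
  then show ?thesis
  proof cases
    case 1
    have "nul (tgp a Y n \<star> x)" by (rule nul_to_zero_obj) (use assms 1 in \<open>auto simp: trunc_ge_obj_lt\<close>)
    then show ?thesis using 1 by simp
  next
    case 2 then show ?thesis using assms by (simp add: trunc_ge_proj_def cov_iff)
  next
    case 3 then show ?thesis using assms by (simp add: trunc_ge_proj_def)
  qed
qed

lemma cofactors_tgp:
  assumes "cpx Y" "arr g" "src g = fst Y n" "n = a \<Longrightarrow> nul (g \<star> snd Y (n - 1))" "n < a \<Longrightarrow> nul g"
  shows "cofactors (tgp a Y n) g"
proof -
  consider "n < a" | "n = a" | "n > a" by linarith
  then show ?thesis
  proof cases
    case 1 then show ?thesis using assms by (auto intro: nul_cofactors)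
  next
    case 2 then show ?thesis using assms by (simp add: trunc_ge_proj_def cofactors_cok)
  next
    case 3 then show ?thesis using assms by (auto simp: trunc_ge_proj_def intro: cofactorsI[of g])
  qed
qed

text \<open>Naturality is demanded for morphisms of every degree, since all entries of a twisted
  differential, not only those of degree 0, have to commute with the transformation.\<close>

definition cpx_nat :: "('c, 'm) dgcat \<Rightarrow> ('c, 'm, 'o, 'a) cpx_fun \<Rightarrow> ('c, 'm, 'o, 'a) cpx_fun \<Rightarrow> ('c \<Rightarrow> int \<Rightarrow> 'a) \<Rightarrow> bool" where
  "cpx_nat C F F' \<theta> \<longleftrightarrow> cpx_functor A C F \<and> cpx_functor A C F' \<and>
     (\<forall>P\<in>dg_obj C. \<forall>n. \<theta> P n \<in> Hom (fst (fun_obj F P) n) (fst (fun_obj F' P) n) \<and>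
        snd (fun_obj F' P) n \<star> \<theta> P n = \<theta> P (n + 1) \<star> snd (fun_obj F P) n) \<and>
     (\<forall>P\<in>dg_obj C. \<forall>Q\<in>dg_obj C. \<forall>i n. \<forall>f\<in>carrier (dg_hom C i P Q).
        \<theta> P (n + i) \<star> fun_hom F i P Q f n = fun_hom F' i P Q f n \<star> \<theta> Q n)"

end

text \<open>Vanishing in positive degrees lets the canonical truncations act on functors: a morphism
  of negative degree strictly lowers degrees, so the conditions at the two ends of the truncation
  are met automatically, and a morphism of degree 0 is a chain map.\<close>

locale nonpos_functor = cpx_functor +
  assumes Cpos: "P \<in> dg_obj C \<Longrightarrow> Q \<in> dg_obj C \<Longrightarrow> i > 0 \<Longrightarrow> f \<in> carrier (dg_hom C i P Q) \<Longrightarrow>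
    f = \<one>\<^bsub>dg_hom C i P Q\<^esub>"
begin

lemma Fpos_nul:
  assumes "P \<in> dg_obj C" "Q \<in> dg_obj C" "f \<in> carrier (dg_hom C i P Q)" "i > 0"
  shows "nul (fun_hom F i P Q f n)"
  using Cpos[OF assms(1,2,4,3)] Fone[OF assms(1,2), of i n] Fobj assms(1,2) by simp

text \<open>The differential of a morphism of degree 0 has degree 1, so it vanishes; its image under
  \<open>F\<close> is the commutator with the differentials.\<close>

lemma F0_commute:
  assumes "P \<in> dg_obj C" "Q \<in> dg_obj C" "f \<in> carrier (dg_hom C 0 P Q)"
  shows "snd (fun_obj F P) n \<star> fun_hom F 0 P Q f n = fun_hom F 0 P Q f (n + 1) \<star> snd (fun_obj F Q) n"
proof -
  note t = Fhom_simps[OF assms] and o = Fobj[OF assms(1)] Fobj[OF assms(2)]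
  have "nul (fun_hom F (0 + 1) P Q (dg_diff C 0 P Q f) n)"
    by (rule Fpos_nul[OF assms(1,2) Cdiff[OF assms]]) simp
  then have "nul (snd (fun_obj F P) (n + 0) \<star> fun_hom F 0 P Q f n \<boxplus> sg (0 + 1) (fun_hom F 0 P Q f (n + 1) \<star> snd (fun_obj F Q) n))"
    by (simp only: Fdiff[OF assms])
  then have "nul (snd (fun_obj F P) n \<star> fun_hom F 0 P Q f n \<boxminus> fun_hom F 0 P Q f (n + 1) \<star> snd (fun_obj F Q) n)"
    by (simp add: sg_def)
  then show ?thesis by (subst (asm) nul_minus_iff) (use t o in auto)
qed

lemma cmap_F0:
  assumes "P \<in> dg_obj C" "Q \<in> dg_obj C" "f \<in> carrier (dg_hom C 0 P Q)"
  shows "cmap (fun_obj F Q) (fun_obj F P) (fun_hom F 0 P Q f)"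
  by (rule cmapI) (use Fobj assms Fhom_simps[OF assms] F0_commute[OF assms] in auto)

lemma fun_le_nat: "cpx_nat C (fun_le A b F) F (\<lambda>P. tli b (fun_obj F P))"
proof -
  let ?\<iota> = "\<lambda>P. tli b (fun_obj F P)"
  have m: "mono (?\<iota> P n)" "tgt (?\<iota> P n) = fst (fun_obj F P) n" if "P \<in> dg_obj C" for P n using Fobj[OF that] by auto
  have fd: "factors (?\<iota> P (n + 1)) (snd (fun_obj F P) n \<star> ?\<iota> P n)" if "P \<in> dg_obj C" for P n
  proof -
    note o = Fobj[OF that]
    have f: "factors (?\<iota> P n) (?\<iota> P n)" using o by simp
    have "nul (snd (fun_obj F P) n \<star> ?\<iota> P n)" if "n \<ge> b"
      using f factors_tli[OF o, of "?\<iota> P n" n b] o that by auto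
    moreover have "nul (snd (fun_obj F P) (n + 1) \<star> (snd (fun_obj F P) n \<star> ?\<iota> P n))"
      by (rule cpx_ddx) (use o in auto)
    ultimately have "n + 1 < b \<or> n + 1 = b \<and> nul (snd (fun_obj F P) (n + 1) \<star> (snd (fun_obj F P) n \<star> ?\<iota> P n)) \<or>
      nul (snd (fun_obj F P) n \<star> ?\<iota> P n)" by (meson add1_zle_eq not_le order_le_less)
    then show ?thesis using o by (subst factors_tli) auto
  qed
  have fh: "factors (?\<iota> P (n + i)) (fun_hom F i P Q f n \<star> ?\<iota> Q n)"
    if *: "P \<in> dg_obj C" "Q \<in> dg_obj C" "f \<in> carrier (dg_hom C i P Q)" for i P Q f n
  proof -
    note o = Fobj[OF *(1)] Fobj[OF *(2)] and t = Fhom_simps[OF *]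
    have f: "factors (?\<iota> Q n) (?\<iota> Q n)" using o by simp
    have n: "nul (?\<iota> Q n)" if "n > b"
      using f factors_tli[OF o(2), of "?\<iota> Q n" n b] o that by auto
    have n': "nul (snd (fun_obj F Q) n \<star> ?\<iota> Q n)" if "n \<ge> b"
      using f factors_tli[OF o(2), of "?\<iota> Q n" n b] o that by auto
    \<comment> \<open>Below degree \<open>b\<close> there is no condition, and above it the source
      is zero. What remains is a morphism of degree 0 at the top, and a chain map carries cocycles
      to cocycles.\<close>
    consider "i > 0" | "n + i < b" | "n > b" | "i = 0" "n = b" by linarith
    then show ?thesis
    proof cases
      case 1
      then show ?thesis using Fpos_nul[OF *] o t by (intro nul_factors) auto
    next
      case 2 then show ?thesis using o t by (subst factors_tli) auto
    next
      case 3 then show ?thesis using o t n by (intro nul_factors) auto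
    next
      case 4
      have "snd (fun_obj F P) n \<star> (fun_hom F i P Q f n \<star> ?\<iota> Q n) =
        (fun_hom F i P Q f (n + 1) \<star> snd (fun_obj F Q) n) \<star> ?\<iota> Q n"
        using * 4 by (intro comp_reduce) (use o t 4 F0_commute in auto)
      also have "\<dots> = fun_hom F i P Q f (n + 1) \<star> (snd (fun_obj F Q) n \<star> ?\<iota> Q n)"
        using o t by simp
      finally have e: "snd (fun_obj F P) n \<star> (fun_hom F i P Q f n \<star> ?\<iota> Q n) =
        fun_hom F i P Q f (n + 1) \<star> (snd (fun_obj F Q) n \<star> ?\<iota> Q n)" .
      have "nul (snd (fun_obj F P) n \<star> (fun_hom F i P Q f n \<star> ?\<iota> Q n))"
        unfolding e by (rule nul_comp[OF n']) (use o t 4 in auto)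
      then show ?thesis using o t 4 by (subst factors_tli) auto
    qed
  qed
  have o1: "fst (fun_obj (fun_le A b F) P) n = src (?\<iota> P n)"
    "snd (fun_obj (fun_le A b F) P) n = lift_arr A (?\<iota> P (n + 1)) (snd (fun_obj F P) n \<star> ?\<iota> P n)" if "P \<in> dg_obj C" for P n
    using Fobj[OF that] by (auto simp: fun_le_def trunc_le_def)
  have h1: "fun_hom (fun_le A b F) i P Q f n = lift_arr A (?\<iota> P (n + i)) (fun_hom F i P Q f n \<star> ?\<iota> Q n)" for i P Q f n
    by (simp add: fun_le_def)
  note S = sub_functor[of ?\<iota> "fun_le A b F", OF m fd fh o1 h1]
  have "cpx_functor A C (fun_le A b F)" by (rule S(1))
  then show ?thesis unfolding cpx_nat_def
    using cpx_functor_axioms S(2,3) m o1 by (auto simp: Hom_iff)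
qed

lemma fun_ge_nat: "cpx_nat C F (fun_ge A a F) (\<lambda>P. tgp a (fun_obj F P))"
proof -
  let ?\<pi> = "\<lambda>P. tgp a (fun_obj F P)"
  have m: "epi (?\<pi> P n)" "src (?\<pi> P n) = fst (fun_obj F P) n" if "P \<in> dg_obj C" for P n using Fobj[OF that] by auto
  have n0: "nul (?\<pi> P n)" if "P \<in> dg_obj C" "n < a" for P n
    by (rule nul_to_zero_obj) (use Fobj that in \<open>auto simp: trunc_ge_obj_lt\<close>)
  have na: "nul (?\<pi> P n \<star> snd (fun_obj F P) (n - 1))" if "P \<in> dg_obj C" "n \<le> a" for P n
    using nul_tgp[OF Fobj, of P "snd (fun_obj F P) (n - 1)" n a] Fobj that
      cov_factor[of "snd (fun_obj F P) (n - 1)" "idt (fst (fun_obj F P) (n - 1))"] by auto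
  have fd: "cofactors (?\<pi> P n) (?\<pi> P (n + 1) \<star> snd (fun_obj F P) n)" if "P \<in> dg_obj C" for P n
  proof (rule cofactors_tgp)
    note o = Fobj[OF that]
    show "cpx (fun_obj F P)" "arr (?\<pi> P (n + 1) \<star> snd (fun_obj F P) n)" "src (?\<pi> P (n + 1) \<star> snd (fun_obj F P) n) = fst (fun_obj F P) n"
      using o by auto
    show "nul (?\<pi> P (n + 1) \<star> snd (fun_obj F P) n)" if "n < a" using na[of P "n + 1"] \<open>P \<in> dg_obj C\<close> that by simp
    have "nul (?\<pi> P (n + 1) \<star> (snd (fun_obj F P) n \<star> snd (fun_obj F P) (n - 1)))"
      by (rule nul_comp[OF cpx_dd[OF o]]) (use o in auto)
    then show "nul ((?\<pi> P (n + 1) \<star> snd (fun_obj F P) n) \<star> snd (fun_obj F P) (n - 1))" using o by simp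
  qed
  have fh: "cofactors (?\<pi> Q n) (?\<pi> P (n + i) \<star> fun_hom F i P Q f n)"
    if *: "P \<in> dg_obj C" "Q \<in> dg_obj C" "f \<in> carrier (dg_hom C i P Q)" for i P Q f n
  proof -
    note o = Fobj[OF *(1)] Fobj[OF *(2)] and t = Fhom_simps[OF *]
    \<comment> \<open>In the last case a chain map carries boundaries to boundaries. In the others
      the arrow vanishes, the target is zero, or nothing is divided out of the source.\<close>
    consider "i > 0" | "n + i < a" | "n > a" | "i = 0" "n = a" by linarith
    then show ?thesis
    proof cases
      case 1
      then show ?thesis using Fpos_nul[OF *] o t by (intro nul_cofactors) auto
    next
      case 2 then show ?thesis using o t n0[OF *(1)] by (intro nul_cofactors) auto
    next
      case 3 then show ?thesis using o t by (intro cofactors_tgp) auto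
    next
      case 4
      have "(?\<pi> P (n + i) \<star> fun_hom F i P Q f n) \<star> snd (fun_obj F Q) (n - 1) =
        ?\<pi> P n \<star> (fun_hom F 0 P Q f n \<star> snd (fun_obj F Q) (n - 1))"
        using o t[of n] 4 by simp
      also have "fun_hom F 0 P Q f n \<star> snd (fun_obj F Q) (n - 1) = snd (fun_obj F P) (n - 1) \<star> fun_hom F 0 P Q f (n - 1)"
        using F0_commute[OF *(1,2), of f "n - 1"] * 4 by simp
      also have "?\<pi> P n \<star> \<dots> = (?\<pi> P n \<star> snd (fun_obj F P) (n - 1)) \<star> fun_hom F 0 P Q f (n - 1)"
        using o t[of "n - 1"] 4 by simp
      finally have e: "(?\<pi> P (n + i) \<star> fun_hom F i P Q f n) \<star> snd (fun_obj F Q) (n - 1) =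
        (?\<pi> P n \<star> snd (fun_obj F P) (n - 1)) \<star> fun_hom F 0 P Q f (n - 1)" .
      have "nul ((?\<pi> P (n + i) \<star> fun_hom F i P Q f n) \<star> snd (fun_obj F Q) (n - 1))"
        unfolding e by (rule comp_nul[OF na]) (use * o t[of "n - 1"] 4 in auto)
      then show ?thesis using o t 4 by (intro cofactors_tgp) auto
    qed
  qed
  have o1: "fst (fun_obj (fun_ge A a F) P) n = tgt (?\<pi> P n)"
    "snd (fun_obj (fun_ge A a F) P) n = desc_arr A (?\<pi> P n) (?\<pi> P (n + 1) \<star> snd (fun_obj F P) n)" if "P \<in> dg_obj C" for P n
    using Fobj[OF that] by (auto simp: fun_ge_def trunc_ge_def)
  have h1: "fun_hom (fun_ge A a F) i P Q f n = desc_arr A (?\<pi> Q n) (?\<pi> P (n + i) \<star> fun_hom F i P Q f n)" for i P Q f n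
    by (simp add: fun_ge_def)
  note S = quot_functor[of ?\<pi> "fun_ge A a F", OF m fd fh o1 h1]
  have "cpx_functor A C (fun_ge A a F)" by (rule S(1))
  then show ?thesis unfolding cpx_nat_def
    using cpx_functor_axioms S(2,3) m o1 by (auto simp: Hom_iff)
qed

lemma fun_le_nonpos: "nonpos_functor A C (fun_le A b F)"
  using fun_le_nat[of b] Cpos unfolding cpx_nat_def by (blast intro: nonpos_functor.intro nonpos_functor_axioms.intro)

lemma fun_ge_nonpos: "nonpos_functor A C (fun_ge A a F)"
  using fun_ge_nat[of a] Cpos unfolding cpx_nat_def by (blast intro: nonpos_functor.intro nonpos_functor_axioms.intro)

lemma fun_trunc_nonpos: "nonpos_functor A C (fun_trunc A a b F)"
  unfolding fun_trunc_def by (rule nonpos_functor.fun_ge_nonpos[OF fun_le_nonpos])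

lemma fun_trunc_nat: "cpx_nat C (fun_le A b F) (fun_trunc A a b F) (\<lambda>P. tgp a (fun_obj (fun_le A b F) P))"
  unfolding fun_trunc_def by (rule nonpos_functor.fun_ge_nat[OF fun_le_nonpos])

end

context abelian
begin

subsection \<open>Total complexes\<close>

lemma mat_comp_entry:
  assumes f: "mtyp K X L Y f" and g: "mtyp L Y I Z g" and "i \<in> I" "k \<in> K"
  shows "sprj I Z i \<star> ((mat L Y I Z g \<star> mat K X L Y f) \<star> sinj K X k) = hsum (X k) (Z i) (\<lambda>j. g i j \<star> f j k) L"
proof -
  note mf = mat_simps[OF f] and mg = mat_simps[OF g]
  have "sprj I Z i \<star> ((mat L Y I Z g \<star> mat K X L Y f) \<star> sinj K X k) =
    sprj I Z i \<star> (mat L Y I Z g \<star> (mat K X L Y f \<star> sinj K X k))"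
    using mf mg assms by simp
  also have "\<dots> = hsum (src (mat K X L Y f \<star> sinj K X k)) (Z i) (\<lambda>j. g i j \<star> (sprj L Y j \<star> (mat K X L Y f \<star> sinj K X k))) L"
    by (rule sprj_mat[OF g]) (use mf assms in auto)
  also have "\<dots> = hsum (X k) (Z i) (\<lambda>j. g i j \<star> (sprj L Y j \<star> (mat K X L Y f \<star> sinj K X k))) L"
    using mf assms by simp
  also have "\<dots> = hsum (X k) (Z i) (\<lambda>j. g i j \<star> f j k) L"
    by (rule hsum_cong) (use mat_entry[OF f] f g assms in \<open>auto simp: Hom_iff\<close>)
  finally show ?thesis .
qed

text \<open>In the total differential the differentials of the complexes themselves occur only on
  the diagonal, the twisting maps in all entries. This lemma and \<open>hsum_diag_right\<close>
  separate the two contributions in a product of matrices.\<close>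

lemma hsum_diag_left:
  assumes "finite I" "i \<in> I" "obj X" "obj Z" "a \<in> Hom (Y i) Z" "\<And>j. j \<in> I \<Longrightarrow> q j \<in> Hom (Y j) Z" "\<And>j. j \<in> I \<Longrightarrow> f j \<in> Hom X (Y j)"
  shows "hsum X Z (\<lambda>j. (if i = j then a \<boxplus> q j else q j) \<star> f j) I = a \<star> f i \<boxplus> hsum X Z (\<lambda>j. q j \<star> f j) I"
proof -
  have t: "arr a" "src a = Y i" "tgt a = Z" "\<And>j. j \<in> I \<Longrightarrow> arr (q j) \<and> src (q j) = Y j \<and> tgt (q j) = Z \<and> arr (f j) \<and> src (f j) = X \<and> tgt (f j) = Y j"
    using assms by (auto simp: Hom_iff)
  have "hsum X Z (\<lambda>j. (if i = j then a \<boxplus> q j else q j) \<star> f j) I = hsum X Z (\<lambda>j. (if i = j then a \<star> f j else zr X Z) \<boxplus> q j \<star> f j) I"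
    by (rule hsum_cong) (use assms t in \<open>auto simp: Hom_iff bilin\<close>)
  also have "\<dots> = hsum X Z (\<lambda>j. if i = j then a \<star> f j else zr X Z) I \<boxplus> hsum X Z (\<lambda>j. q j \<star> f j) I"
    by (rule hsum_add) (use assms t in \<open>auto simp: Hom_iff\<close>)
  also have "hsum X Z (\<lambda>j. if i = j then a \<star> f j else zr X Z) I = a \<star> f i"
    using hsum_single[of I i "\<lambda>j. if i = j then a \<star> f j else zr X Z" X Z] assms t by (auto simp: Hom_iff)
  finally show ?thesis .
qed

lemma hsum_diag_right:
  assumes "finite I" "k \<in> I" "obj X" "obj Z" "a \<in> Hom X (Y k)" "\<And>j. j \<in> I \<Longrightarrow> q j \<in> Hom X (Y j)" "\<And>j. j \<in> I \<Longrightarrow> f j \<in> Hom (Y j) Z"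
  shows "hsum X Z (\<lambda>j. f j \<star> (if j = k then a \<boxplus> q j else q j)) I = f k \<star> a \<boxplus> hsum X Z (\<lambda>j. f j \<star> q j) I"
proof -
  have t: "arr a" "tgt a = Y k" "src a = X" "\<And>j. j \<in> I \<Longrightarrow> arr (q j) \<and> src (q j) = X \<and> tgt (q j) = Y j \<and> arr (f j) \<and> src (f j) = Y j \<and> tgt (f j) = Z"
    using assms by (auto simp: Hom_iff)
  have "hsum X Z (\<lambda>j. f j \<star> (if j = k then a \<boxplus> q j else q j)) I = hsum X Z (\<lambda>j. (if j = k then f j \<star> a else zr X Z) \<boxplus> f j \<star> q j) I"
    by (rule hsum_cong) (use assms t in \<open>auto simp: Hom_iff bilin\<close>)
  also have "\<dots> = hsum X Z (\<lambda>j. if j = k then f j \<star> a else zr X Z) I \<boxplus> hsum X Z (\<lambda>j. f j \<star> q j) I"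
    by (rule hsum_add) (use assms t in \<open>auto simp: Hom_iff\<close>)
  also have "hsum X Z (\<lambda>j. if j = k then f j \<star> a else zr X Z) I = f k \<star> a"
    using hsum_single[of I k "\<lambda>j. if j = k then f j \<star> a else zr X Z" X Z] assms t by (auto simp: Hom_iff)
  finally show ?thesis .
qed

end

lemma twistedD:
  assumes "twisted_complex C X"
  shows "fst X i \<in> dg_obj C" "finite (tw_supp C X)" "snd X i j \<in> carrier (dg_hom C (i - j + 1) (fst X i) (fst X j))"
    "signed (dg_hom C (i - j + 2) (fst X i) (fst X j)) i (dg_diff C (i - j + 1) (fst X i) (fst X j) (snd X i j))
        \<otimes>\<^bsub>dg_hom C (i - j + 2) (fst X i) (fst X j)\<^esub>
        finprod (dg_hom C (i - j + 2) (fst X i) (fst X j))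
          (\<lambda>l. dg_comp C (l - j + 1) (i - l + 1) (fst X i) (fst X l) (fst X j) (snd X l j) (snd X i l)) (tw_supp C X)
        = \<one>\<^bsub>dg_hom C (i - j + 2) (fst X i) (fst X j)\<^esub>"
  using assms by (cases X; simp add: twisted_complex_def)+

lemma PreTr_simps:
  "dg_obj (PreTr C) = {X. twisted_complex C X}"
  "f \<in> carrier (dg_hom (PreTr C) l X Y) \<longleftrightarrow> (\<forall>i j. f i j \<in> carrier (dg_hom C (l + i - j) (fst X i) (fst Y j)))"
  "(f \<otimes>\<^bsub>dg_hom (PreTr C) l X Y\<^esub> g) = (\<lambda>i j. f i j \<otimes>\<^bsub>dg_hom C (l + i - j) (fst X i) (fst Y j)\<^esub> g i j)"
  "\<one>\<^bsub>dg_hom (PreTr C) l X Y\<^esub> = (\<lambda>i j. \<one>\<^bsub>dg_hom C (l + i - j) (fst X i) (fst Y j)\<^esub>)"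
  "dg_id (PreTr C) X = (\<lambda>i j. if i = j then dg_id C (fst X i) else \<one>\<^bsub>dg_hom C (i - j) (fst X i) (fst X j)\<^esub>)"
  "dg_comp (PreTr C) l l' X Y Z g h = (\<lambda>i j. finprod (dg_hom C (l + l' + i - j) (fst X i) (fst Z j))
          (\<lambda>m. dg_comp C (l + m - j) (l' + i - m) (fst X i) (fst Y m) (fst Z j) (g m j) (h i m))
          (tw_supp C Y))"
  "dg_diff (PreTr C) l X Y f = (\<lambda>i j. let H = dg_hom C (l + 1 + i - j) (fst X i) (fst Y j) in
        signed H i (dg_diff C (l + i - j) (fst X i) (fst Y j) (f i j)) \<otimes>\<^bsub>H\<^esub>
        (finprod H (\<lambda>m. dg_comp C (l + m - j) (i - m + 1) (fst X i) (fst X m) (fst Y j) (f m j) (snd X i m))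
           (tw_supp C X) \<otimes>\<^bsub>H\<^esub>
         signed H (l + 1)
           (finprod H (\<lambda>m. dg_comp C (m - j + 1) (l + i - m) (fst X i) (fst Y m) (fst Y j) (snd Y m j) (f i m))
              (tw_supp C Y))))"
  by (simp_all add: PreTr_def case_prod_beta fun_eq_iff Let_def)

lemma Tr_obj_iff: "X \<in> cat_obj (Tr C) \<longleftrightarrow> twisted_complex C X"
  by (simp add: Tr_def homotopy_cat_def PreTr_simps)

context cpx_functor
begin

lemma Ccomp':
  assumes "P \<in> dg_obj C" "Q \<in> dg_obj C" "R \<in> dg_obj C" "g \<in> carrier (dg_hom C i Q R)" "f \<in> carrier (dg_hom C j P Q)" "k = i + j"
  shows "dg_comp C i j P Q R g f \<in> carrier (dg_hom C k P R)"
  using Ccomp[OF assms(1-5)] assms(6) by simp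

lemma Cdiff':
  assumes "P \<in> dg_obj C" "Q \<in> dg_obj C" "f \<in> carrier (dg_hom C i P Q)" "k = i + 1"
  shows "dg_diff C i P Q f \<in> carrier (dg_hom C k P Q)"
  using Cdiff[OF assms(1-3)] assms(4) by simp

lemma Fcomp':
  assumes "P \<in> dg_obj C" "Q \<in> dg_obj C" "R \<in> dg_obj C" "g \<in> carrier (dg_hom C i Q R)" "f \<in> carrier (dg_hom C j P Q)" "k = i + j" "m = n + i"
  shows "fun_hom F k P R (dg_comp C i j P Q R g f) n = fun_hom F j P Q f m \<star> fun_hom F i Q R g n"
  using Fcomp[OF assms(1-5)] assms(6,7) by simp

lemma Fdiff':
  assumes "P \<in> dg_obj C" "Q \<in> dg_obj C" "f \<in> carrier (dg_hom C i P Q)" "k = i + 1" "m = n + i" "n' = n + 1"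
  shows "fun_hom F k P Q (dg_diff C i P Q f) n =
      snd (fun_obj F P) m \<star> fun_hom F i P Q f n \<boxplus> sg (i + 1) (fun_hom F i P Q f n' \<star> snd (fun_obj F Q) n)"
  using Fdiff[OF assms(1-3)] assms(4-6) by simp

lemma Hmul: "P \<in> dg_obj C \<Longrightarrow> Q \<in> dg_obj C \<Longrightarrow> f \<in> carrier (dg_hom C i P Q) \<Longrightarrow> g \<in> carrier (dg_hom C i P Q) \<Longrightarrow>
    f \<otimes>\<^bsub>dg_hom C i P Q\<^esub> g \<in> carrier (dg_hom C i P Q)"
  by (rule monoid.m_closed[OF comm_monoid.axioms(1)[OF Cmon]])

lemma Hfinprod: assumes "P \<in> dg_obj C" "Q \<in> dg_obj C" "\<And>k. k \<in> I \<Longrightarrow> f k \<in> carrier (dg_hom C i P Q)"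
  shows "finprod (dg_hom C i P Q) f I \<in> carrier (dg_hom C i P Q)"
  by (rule comm_monoid.finprod_closed[OF Cmon[OF assms(1,2)]]) (use assms(3) in auto)

abbreviation tw where "tw \<equiv> twisted_complex C"
abbreviation su where "su \<equiv> tw_supp C"
abbreviation ts where "ts \<equiv> tot_summand F"
abbreviation tt where "tt \<equiv> fun_obj (tot_fun A C F)"
abbreviation tm where "tm \<equiv> fun_hom (tot_fun A C F)"
abbreviation tc where "tc \<equiv> dg_hom (PreTr C)"

lemma ts_objs: "tw X \<Longrightarrow> objs (su X) (ts X n)"
  using Fobj twistedD[of C X] by (auto simp: tot_summand_def)

lemma ts_obj [simp]: "tw X \<Longrightarrow> obj (ts X n i)"
  using Fobj twistedD[of C X] by (auto simp: tot_summand_def)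

text \<open>The total differential has the entries \<open>tent\<close>: the twisting part
  \<open>qent\<close> comes from the morphisms of the twisted complex, and the diagonal part
  \<open>dent\<close> is the differential of a single complex, which enters with the sign of its
  shift. As the functor is contravariant, the entry \<open>i j\<close> goes from the summand
  \<open>j\<close> to the summand \<open>i\<close>.\<close>

definition qent :: "('c, 'm) twisted \<Rightarrow> int \<Rightarrow> int \<Rightarrow> int \<Rightarrow> 'a" where
  "qent X n i j = fun_hom F (i - j + 1) (fst X i) (fst X j) (snd X i j) (n + j)"

definition dent :: "('c, 'm) twisted \<Rightarrow> int \<Rightarrow> int \<Rightarrow> 'a" where
  "dent X n i = snd (fun_obj F (fst X i)) (n + i)"

definition tent :: "('c, 'm) twisted \<Rightarrow> int \<Rightarrow> int \<Rightarrow> int \<Rightarrow> 'a" where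
  "tent X n i j = (if i = j then sg i (dent X n i) \<boxplus> qent X n i j else qent X n i j)"

definition ment :: "int \<Rightarrow> ('c, 'm) twisted \<Rightarrow> ('c, 'm) twisted \<Rightarrow> (int \<Rightarrow> int \<Rightarrow> 'm) \<Rightarrow> int \<Rightarrow> int \<Rightarrow> int \<Rightarrow> 'a" where
  "ment l X Y f n i j = fun_hom F (l + i - j) (fst X i) (fst Y j) (f i j) (n + j)"

lemma qent_simps [simp]:
  assumes "tw X"
  shows "arr (qent X n i j)" "src (qent X n i j) = ts X n j" "tgt (qent X n i j) = ts X (n + 1) i"
  using Fhom_simps[OF twistedD(1)[OF assms] twistedD(1)[OF assms] twistedD(3)[OF assms], of i j "n + j"] unfolding qent_def tot_summand_def
  by (auto simp: algebra_simps)

lemma dent_simps [simp]: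
  assumes "tw X"
  shows "arr (dent X n i)" "src (dent X n i) = ts X n i" "tgt (dent X n i) = ts X (n + 1) i"
  using Fobj[OF twistedD(1)[OF assms, of i]] unfolding dent_def tot_summand_def by (auto simp: algebra_simps)

lemma tent_simps [simp]:
  assumes "tw X"
  shows "arr (tent X n i j)" "src (tent X n i j) = ts X n j" "tgt (tent X n i j) = ts X (n + 1) i"
  using assms unfolding tent_def by auto

lemma ment_simps [simp]:
  assumes "tw X" "tw Y" "f \<in> carrier (tc l X Y)" "m = n + l"
  shows "arr (ment l X Y f n i j)" "src (ment l X Y f n i j) = ts Y n j" "tgt (ment l X Y f n i j) = ts X m i"
proof -
  have "f i j \<in> carrier (dg_hom C (l + i - j) (fst X i) (fst Y j))" using assms(3) by (simp add: PreTr_simps)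
  note F = Fhom_simps[OF twistedD(1)[OF assms(1)] twistedD(1)[OF assms(2)] this, of "n + j"]
  have e: "n + j + (l + i - j) = m + i" using assms(4) by simp
  show "arr (ment l X Y f n i j)" "src (ment l X Y f n i j) = ts Y n j" "tgt (ment l X Y f n i j) = ts X m i"
    using F unfolding ment_def tot_summand_def e by auto
qed

lemma tt_simps: assumes "tw X"
  shows "fst (tt X) n = dsum (su X) (ts X n)" "snd (tt X) n = mat (su X) (ts X n) (su X) (ts X (n + 1)) (tent X n)"
proof -
  show "fst (tt X) n = dsum (su X) (ts X n)" by (simp add: tot_fun_def)
  have "signed (hom_group A (ts X n i) (ts X (n + 1) i)) i (snd (fun_obj F (fst X i)) (n + i)) = sg i (dent X n i)" for i
    unfolding dent_def[symmetric] by (rule signed_hom) (use assms in \<open>auto simp: Hom_iff\<close>)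
  then have "(\<lambda>i j. let P = fst X; q = fun_hom F (i - j + 1) (P i) (P j) (snd X i j) (n + j) in
             if i = j
             then cat_add A (signed (hom_group A (ts X n i) (ts X (n + 1) i)) i
                     (snd (fun_obj F (P i)) (n + i))) q
             else q) = tent X n"
    by (intro ext) (simp add: tent_def qent_def Let_def)
  then show "snd (tt X) n = mat (su X) (ts X n) (su X) (ts X (n + 1)) (tent X n)" by (simp add: tot_fun_def)
qed

lemma tm_eq: "tm l X Y f n = mat (su Y) (ts Y n) (su X) (ts X (n + l)) (ment l X Y f n)"
  by (simp add: tot_fun_def ment_def[abs_def])

lemma tent_mtyp: "tw X \<Longrightarrow> m = n + 1 \<Longrightarrow> mtyp (su X) (ts X n) (su X) (ts X m) (tent X n)"
  using ts_objs by (auto simp: Hom_iff)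

lemma ment_mtyp: "tw X \<Longrightarrow> tw Y \<Longrightarrow> f \<in> carrier (tc l X Y) \<Longrightarrow> m = n + l \<Longrightarrow>
    mtyp (su Y) (ts Y n) (su X) (ts X m) (ment l X Y f n)"
  using ts_objs by (auto simp: Hom_iff)

lemma tt_types:
  assumes "tw X"
  shows "obj (fst (tt X) n)" "arr (snd (tt X) n)" "src (snd (tt X) n) = fst (tt X) n" "tgt (snd (tt X) n) = fst (tt X) (n + 1)"
  using mat_simps[OF tent_mtyp[OF assms refl]] dsum_simps(1)[OF ts_objs[OF assms]] unfolding tt_simps[OF assms] by auto

lemma tm_types:
  assumes "tw X" "tw Y" "f \<in> carrier (tc l X Y)"
  shows "arr (tm l X Y f n)" "src (tm l X Y f n) = fst (tt Y) n" "tgt (tm l X Y f n) = fst (tt X) (n + l)"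
  using mat_simps[OF ment_mtyp[OF assms refl]] unfolding tt_simps[OF assms(1)] tt_simps[OF assms(2)] tm_eq by auto

lemma sprj_d:
  assumes "tw X" "i \<in> su X" "arr x" "tgt x = fst (tt X) n"
  shows "sprj (su X) (ts X (n + 1)) i \<star> (snd (tt X) n \<star> x) = hsum (src x) (ts X (n + 1) i) (\<lambda>j. tent X n i j \<star> (sprj (su X) (ts X n) j \<star> x)) (su X)"
  unfolding tt_simps[OF assms(1)] by (rule sprj_mat[OF tent_mtyp[OF assms(1)]]) (use assms tt_simps in auto)

text \<open>The image of the Maurer-Cartan equation under the functor: the differential of
  \<open>q\<close> becomes a graded commutator with the differentials of the complexes, and the
  order of composition is reversed.\<close>

lemma maurer_cartan:
  assumes "tw X" "m = n + 1"
  shows "nul (sg i (dent X m i \<star> qent X n i k) \<boxplus>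
    (sg k (qent X m i k \<star> dent X n k) \<boxplus> hsum (ts X n k) (ts X (m + 1) i) (\<lambda>l. qent X m i l \<star> qent X n l k) (su X)))"
proof -
  note t = twistedD[OF assms(1)]
  let ?H = "dg_hom C (i - k + 2) (fst X i) (fst X k)"
  let ?c = "\<lambda>l. dg_comp C (l - k + 1) (i - l + 1) (fst X i) (fst X l) (fst X k) (snd X l k) (snd X i l)"
  have dq: "dg_diff C (i - k + 1) (fst X i) (fst X k) (snd X i k) \<in> carrier ?H"
    by (rule Cdiff'[OF t(1,1,3)]) simp
  have c: "?c l \<in> carrier ?H" for l by (rule Ccomp'[OF t(1,1,1,3,3)]) simp
  note sdq = signed_closed[OF t(1,1) dq, of i]
  have fc: "finprod ?H ?c (su X) \<in> carrier ?H" by (rule Hfinprod[OF t(1,1)]) (rule c)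
  have e: "n + k + (i - k + 2) = m + 1 + i" using assms(2) by simp
  have "sg i (fun_hom F (i - k + 2) (fst X i) (fst X k) (dg_diff C (i - k + 1) (fst X i) (fst X k) (snd X i k)) (n + k)) \<boxplus>
    hsum (fst (fun_obj F (fst X k)) (n + k)) (fst (fun_obj F (fst X i)) (n + k + (i - k + 2)))
      (\<lambda>l. fun_hom F (i - k + 2) (fst X i) (fst X k) (?c l) (n + k)) (su X) =
    zr (fst (fun_obj F (fst X k)) (n + k)) (fst (fun_obj F (fst X i)) (n + k + (i - k + 2)))"
    using arg_cong[OF t(4)[of i k], of "\<lambda>x. fun_hom F (i - k + 2) (fst X i) (fst X k) x (n + k)"]
    unfolding Fadd[OF t(1,1) sdq fc] Fsigned[OF t(1,1) dq] Ffinprod[OF t(1,1,2), of ?c, OF c] Fone[OF t(1,1)] .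
  moreover have "fun_hom F (i - k + 2) (fst X i) (fst X k) (?c l) (n + k) = qent X m i l \<star> qent X n l k" for l
    unfolding qent_def by (rule Fcomp'[OF t(1,1,1,3,3)]) (use assms in auto)
  moreover have "fun_hom F (i - k + 2) (fst X i) (fst X k) (dg_diff C (i - k + 1) (fst X i) (fst X k) (snd X i k)) (n + k) =
    dent X m i \<star> qent X n i k \<boxplus> sg (i - k + 1 + 1) (qent X m i k \<star> dent X n k)"
    unfolding qent_def dent_def by (rule Fdiff'[OF t(1,1,3)]) (use assms in auto)
  ultimately have z: "sg i (dent X m i \<star> qent X n i k \<boxplus> sg (i - k + 1 + 1) (qent X m i k \<star> dent X n k)) \<boxplus>
     hsum (ts X n k) (ts X (m + 1) i) (\<lambda>l. qent X m i l \<star> qent X n l k) (su X) = zr (ts X n k) (ts X (m + 1) i)"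
    unfolding tot_summand_def e by simp
  \<comment> \<open>The exponents add up to \<open>2 * i - k + 2\<close>, which has the parity of
    \<open>k\<close>; so the sign of the shift on the source side appears.\<close>
  have s: "sg i (sg (i - k + 1 + 1) (qent X m i k \<star> dent X n k)) = sg k (qent X m i k \<star> dent X n k)"
    using assms by (simp add: sg_sg) (simp add: sg_def)
  have h: "arr (hsum (ts X n k) (ts X (m + 1) i) (\<lambda>l. qent X m i l \<star> qent X n l k) (su X))"
    "src (hsum (ts X n k) (ts X (m + 1) i) (\<lambda>l. qent X m i l \<star> qent X n l k) (su X)) = ts X n k"
    "tgt (hsum (ts X n k) (ts X (m + 1) i) (\<lambda>l. qent X m i l \<star> qent X n l k) (su X)) = ts X (m + 1) i"
    using assms by (subst hsum_simps; auto simp: Hom_iff)+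
  have "sg i (dent X m i \<star> qent X n i k) \<boxplus>
    (sg k (qent X m i k \<star> dent X n k) \<boxplus> hsum (ts X n k) (ts X (m + 1) i) (\<lambda>l. qent X m i l \<star> qent X n l k) (su X)) =
    zr (ts X n k) (ts X (m + 1) i)"
    using z assms s h by (simp add: sg_plus add_assoc)
  then show ?thesis using assms(1) by simp
qed

text \<open>An entry of the square of the total differential consists of the square of the
  differential of one complex, which is zero, and of the terms in
  \<open>maurer_cartan\<close>.\<close>

lemma tt_cpx: assumes "tw X" shows "cpx (tt X)"
proof (rule cpxI)
  fix n
  note T = tt_types[OF assms] and o = ts_objs[OF assms]
  have "snd (tt X) (n + 1) \<star> snd (tt X) n = zr (fst (tt X) n) (fst (tt X) (n + 1 + 1))"
  proof (rule mat_eqI[OF o[of n] o[of "n + 1 + 1"]])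
    fix i k assume i: "i \<in> su X" and k: "k \<in> su X"
    let ?q = "hsum (ts X n k) (ts X (n + 1 + 1) i) (\<lambda>l. qent X (n + 1) i l \<star> qent X n l k) (su X)"
    have h: "arr ?q" "src ?q = ts X n k" "tgt ?q = ts X (n + 1 + 1) i"
      using assms by (subst hsum_simps; auto simp: Hom_iff)+
    have "sprj (su X) (ts X (n + 1 + 1)) i \<star> ((snd (tt X) (n + 1) \<star> snd (tt X) n) \<star> sinj (su X) (ts X n) k) =
      hsum (ts X n k) (ts X (n + 1 + 1) i) (\<lambda>j. tent X (n + 1) i j \<star> tent X n j k) (su X)"
      unfolding tt_simps[OF assms] by (rule mat_comp_entry[OF tent_mtyp[OF assms refl] tent_mtyp[OF assms refl] i k])
    also have "\<dots> = hsum (ts X n k) (ts X (n + 1 + 1) i) (\<lambda>j. (if i = j then sg i (dent X (n + 1) i) \<boxplus> qent X (n + 1) i j else qent X (n + 1) i j) \<star> tent X n j k) (su X)"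
      unfolding tent_def[of X "n + 1" i] ..
    also have "\<dots> = sg i (dent X (n + 1) i) \<star> tent X n i k \<boxplus>
        hsum (ts X n k) (ts X (n + 1 + 1) i) (\<lambda>j. qent X (n + 1) i j \<star> tent X n j k) (su X)"
      by (rule hsum_diag_left) (use i assms twistedD(2)[OF assms] in \<open>auto simp: Hom_iff\<close>)
    also have "hsum (ts X n k) (ts X (n + 1 + 1) i) (\<lambda>j. qent X (n + 1) i j \<star> tent X n j k) (su X) =
       hsum (ts X n k) (ts X (n + 1 + 1) i) (\<lambda>j. qent X (n + 1) i j \<star> (if j = k then sg k (dent X n k) \<boxplus> qent X n j k else qent X n j k)) (su X)"
      by (rule hsum_cong) (use assms in \<open>auto simp: Hom_iff tent_def\<close>)
    also have "\<dots> = qent X (n + 1) i k \<star> sg k (dent X n k) \<boxplus> ?q"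
      by (rule hsum_diag_right) (use k assms twistedD(2)[OF assms] in \<open>auto simp: Hom_iff\<close>)
    also have "qent X (n + 1) i k \<star> sg k (dent X n k) = sg k (qent X (n + 1) i k \<star> dent X n k)"
      using assms by (simp add: comp_sg)
    also have "sg i (dent X (n + 1) i) \<star> tent X n i k = sg i (dent X (n + 1) i \<star> qent X n i k)"
    proof -
      have "nul (dent X (n + 1) i \<star> dent X n i)"
        unfolding dent_def by (rule cpx_dd) (use Fobj twistedD(1)[OF assms] in auto)
      then show ?thesis using assms by (cases "i = k") (auto simp add: tent_def sg_comp comp_sg bilin sg_plus)
    qed
    finally have e: "sprj (su X) (ts X (n + 1 + 1)) i \<star> ((snd (tt X) (n + 1) \<star> snd (tt X) n) \<star> sinj (su X) (ts X n) k) =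
      sg i (dent X (n + 1) i \<star> qent X n i k) \<boxplus> (sg k (qent X (n + 1) i k \<star> dent X n k) \<boxplus> ?q)" .
    have "sprj (su X) (ts X (n + 1 + 1)) i \<star> ((snd (tt X) (n + 1) \<star> snd (tt X) n) \<star> sinj (su X) (ts X n) k) =
      zr (ts X n k) (ts X (n + 1 + 1) i)"
      unfolding e by (rule nul_eq[OF maurer_cartan[OF assms refl]]) (use assms h in auto)
    also have "\<dots> = sprj (su X) (ts X (n + 1 + 1)) i \<star> (zr (fst (tt X) n) (fst (tt X) (n + 1 + 1)) \<star> sinj (su X) (ts X n) k)"
      using o i k T by (simp add: tt_simps[OF assms])
    finally show "sprj (su X) (ts X (n + 1 + 1)) i \<star> ((snd (tt X) (n + 1) \<star> snd (tt X) n) \<star> sinj (su X) (ts X n) k) =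
      sprj (su X) (ts X (n + 1 + 1)) i \<star> (zr (fst (tt X) n) (fst (tt X) (n + 1 + 1)) \<star> sinj (su X) (ts X n) k)" .
  qed (use T tt_simps(1)[OF assms] in auto)
  then show "nul (snd (tt X) (n + 1) \<star> snd (tt X) n)" using T by simp
qed (use tt_types[OF assms] in auto)

end

context abelian
begin

lemma mat_eq_entries:
  assumes "mtyp K X I Y f" "arr g" "src g = dsum K X" "tgt g = dsum I Y"
    and "\<And>i j. i \<in> I \<Longrightarrow> j \<in> K \<Longrightarrow> sprj I Y i \<star> (g \<star> sinj K X j) = f i j"
  shows "mat K X I Y f = g"
  by (rule mat_eqI) (use assms mat_simps[OF assms(1)] mat_entry[OF assms(1)] in auto)

text \<open>Cohomology on a homotopy category is evaluated on cosets; this makes the value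
  independent of the member chosen, both for complexes and for the totals of morphisms of twisted
  complexes.\<close>

lemma cmap_htpy:
  assumes g: "cmap U V g" and k: "\<And>n. arr (k n) \<and> src (k n) = fst U n \<and> tgt (k n) = fst V (n - 1)"
    and g': "\<And>n. g' n = (snd V (n - 1) \<star> k n \<boxplus> k (n + 1) \<star> snd U n) \<boxplus> g n"
  shows "cmap U V g'" "cohom_map A s U V g' = cohom_map A s U V g"
proof -
  note c = cmapD[OF g]
  have t: "arr (k n)" "src (k n) = fst U n" "tgt (k n) = fst V (n - 1)" for n using k by auto
  have t': "tgt (k (n + 1)) = fst V n" for n using t(3)[of "n + 1"] by simp
  show cm: "cmap U V g'"
  proof (rule cmapI)
    fix n
    have "nul (snd V n \<star> (snd V (n - 1) \<star> k n))" by (rule cpx_ddx) (use c t in auto)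
    moreover have "nul (k (n + 1 + 1) \<star> (snd U (n + 1) \<star> snd U n))"
      by (rule nul_comp[OF cpx_dd]) (use c t in auto)
    ultimately show "snd V n \<star> g' n = g' (n + 1) \<star> snd U n"
      using c(1-5) c(6)[of n] t(1,2) t(3)[of n] t'[of n] t'[of "n + 1"] unfolding g' by (simp add: bilin)
  qed (use c t t' in \<open>auto simp: g'\<close>)
  show "cohom_map A s U V g' = cohom_map A s U V g"
  proof (rule cohom_map_htpy[OF cm g])
    fix z assume z: "cyc U s z"
    note z = cycD[OF z]
    have "nul (k (s + 1) \<star> (snd U s \<star> z))" by (rule nul_comp[OF z(3)]) (use c t z in auto)
    then have "g' s \<star> z = snd V (s - 1) \<star> (k s \<star> z) \<boxplus> g s \<star> z"
      using c(1-5) t t' z(1,2) unfolding g' by (simp add: bilin)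
    then have "g' s \<star> z \<boxminus> g s \<star> z = snd V (s - 1) \<star> (k s \<star> z)" using c(1-5) t t' z(1,2) by simp
    then show "cov (snd V (s - 1)) (g' s \<star> z \<boxminus> g s \<star> z)"
      using c t z by (auto intro: cov_factor)
  qed
qed

lemma homotopy_class_complexes:
  assumes "cmap U V g"
  shows "g' \<in> homotopy_class (complexes A) U V g \<Longrightarrow> cmap U V g' \<and> cohom_map A s U V g' = cohom_map A s U V g"
    and "homotopy_class (complexes A) U V g \<noteq> {}"
proof -
  note c = cmapD[OF assms]
  show "homotopy_class (complexes A) U V g \<noteq> {}"
  proof -
    have "(\<lambda>n. zr (fst U n) (fst V (n + - 1))) \<in> carrier (dg_hom (complexes A) (-1) U V)"
      using c by (auto simp: complexes_def Hom_iff)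
    then show ?thesis unfolding homotopy_class_def r_coset_def dg_coboundaries_def by blast
  qed
  assume "g' \<in> homotopy_class (complexes A) U V g"
  then obtain k where k: "\<And>n. k n \<in> Hom (fst U n) (fst V (n - 1))"
    and g': "g' = (\<lambda>n. dg_diff (complexes A) (-1) U V k n \<boxplus> g n)"
    unfolding homotopy_class_def r_coset_def dg_coboundaries_def by (auto simp: complexes_def)
  have t: "arr (k n)" "src (k n) = fst U n" "tgt (k n) = fst V (n - 1)" for n using k by (auto simp: Hom_iff)
  have "g' n = (snd V (n - 1) \<star> k n \<boxplus> k (n + 1) \<star> snd U n) \<boxplus> g n" for n
    unfolding g' by (simp add: complexes_def signed_def)
  then show "cmap U V g' \<and> cohom_map A s U V g' = cohom_map A s U V g"
    using cmap_htpy[OF assms, of k g'] t by blast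
qed

end

context cpx_functor
begin

lemma tc_carrier: "f \<in> carrier (tc l X Y) \<Longrightarrow> f i j \<in> carrier (dg_hom C (l + i - j) (fst X i) (fst Y j))"
  by (simp add: PreTr_simps)

lemma tm_eqI:
  assumes "tw X" "tw Y" "f \<in> carrier (tc l X Y)" "arr g" "src g = fst (tt Y) n" "tgt g = fst (tt X) (n + l)"
    and "\<And>i j. i \<in> su X \<Longrightarrow> j \<in> su Y \<Longrightarrow> sprj (su X) (ts X (n + l)) i \<star> (g \<star> sinj (su Y) (ts Y n) j) = ment l X Y f n i j"
  shows "tm l X Y f n = g"
  unfolding tm_eq by (rule mat_eq_entries[OF ment_mtyp[OF assms(1-3) refl]]) (use assms(4-) tt_simps assms(1,2) in auto)

lemma tm_entry:
  assumes "tw X" "tw Y" "f \<in> carrier (tc l X Y)" "m = n + l" "i \<in> su X" "j \<in> su Y"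
  shows "sprj (su X) (ts X m) i \<star> (tm l X Y f n \<star> sinj (su Y) (ts Y n) j) = ment l X Y f n i j"
  unfolding tm_eq assms(4) by (rule mat_entry[OF ment_mtyp[OF assms(1-3) refl] assms(5,6)])

lemma tc_one: "tw X \<Longrightarrow> tw Y \<Longrightarrow> \<one>\<^bsub>tc l X Y\<^esub> \<in> carrier (tc l X Y)"
  unfolding PreTr_simps by (intro allI Cone; erule twistedD(1))

lemma tc_mult: "tw X \<Longrightarrow> tw Y \<Longrightarrow> f \<in> carrier (tc l X Y) \<Longrightarrow> g \<in> carrier (tc l X Y) \<Longrightarrow> f \<otimes>\<^bsub>tc l X Y\<^esub> g \<in> carrier (tc l X Y)"
  unfolding PreTr_simps by (intro allI Hmul; (erule twistedD(1))?; blast)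

lemma tm_one:
  assumes "tw X" "tw Y"
  shows "tm l X Y \<one>\<^bsub>tc l X Y\<^esub> n = zr (fst (tt Y) n) (fst (tt X) (n + l))"
proof (rule tm_eqI[OF assms tc_one[OF assms]])
  fix i j assume ij: "i \<in> su X" "j \<in> su Y"
  have e: "n + j + (l + i - j) = n + l + i" by simp
  have "ment l X Y \<one>\<^bsub>tc l X Y\<^esub> n i j = zr (ts Y n j) (ts X (n + l) i)"
    unfolding ment_def PreTr_simps Fone[OF twistedD(1)[OF assms(1)] twistedD(1)[OF assms(2)]] tot_summand_def e ..
  then show "sprj (su X) (ts X (n + l)) i \<star> (zr (fst (tt Y) n) (fst (tt X) (n + l)) \<star> sinj (su Y) (ts Y n) j) = ment l X Y \<one>\<^bsub>tc l X Y\<^esub> n i j"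
    using ts_objs[OF assms(1)] ts_objs[OF assms(2)] tt_types[OF assms(1)] tt_types[OF assms(2)] ij
    by (simp add: tt_simps(1)[OF assms(1)] tt_simps(1)[OF assms(2)])
qed (use tt_types[OF assms(1)] tt_types[OF assms(2)] in auto)

lemma tm_add:
  assumes "tw X" "tw Y" "f \<in> carrier (tc l X Y)" "g \<in> carrier (tc l X Y)"
  shows "tm l X Y (f \<otimes>\<^bsub>tc l X Y\<^esub> g) n = tm l X Y f n \<boxplus> tm l X Y g n"
proof (rule tm_eqI[OF assms(1,2) tc_mult[OF assms]])
  note tf = tm_types[OF assms(1-3)] and tg = tm_types[OF assms(1,2,4)]
  fix i j assume ij: "i \<in> su X" "j \<in> su Y"
  have "ment l X Y (f \<otimes>\<^bsub>tc l X Y\<^esub> g) n i j = ment l X Y f n i j \<boxplus> ment l X Y g n i j"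
    unfolding ment_def PreTr_simps
    by (rule Fadd[OF twistedD(1)[OF assms(1)] twistedD(1)[OF assms(2)] tc_carrier[OF assms(3)] tc_carrier[OF assms(4)]])
  also have "\<dots> = sprj (su X) (ts X (n + l)) i \<star> (tm l X Y f n \<star> sinj (su Y) (ts Y n) j)
    \<boxplus> sprj (su X) (ts X (n + l)) i \<star> (tm l X Y g n \<star> sinj (su Y) (ts Y n) j)"
    using tm_entry[OF assms(1-3) refl ij] tm_entry[OF assms(1,2,4) refl ij] by simp
  also have "\<dots> = sprj (su X) (ts X (n + l)) i \<star> ((tm l X Y f n \<boxplus> tm l X Y g n) \<star> sinj (su Y) (ts Y n) j)"
    using tf tg ij ts_objs[OF assms(1)] ts_objs[OF assms(2)] by (simp add: bilin tt_simps(1)[OF assms(1)] tt_simps(1)[OF assms(2)])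
  finally show "sprj (su X) (ts X (n + l)) i \<star> ((tm l X Y f n \<boxplus> tm l X Y g n) \<star> sinj (su Y) (ts Y n) j) =
    ment l X Y (f \<otimes>\<^bsub>tc l X Y\<^esub> g) n i j" by simp
qed (use tm_types[OF assms(1-3)] tm_types[OF assms(1,2,4)] in auto)

lemma tc_id: assumes "tw X" shows "dg_id (PreTr C) X \<in> carrier (tc 0 X X)"
  using Cone[OF twistedD(1)[OF assms] twistedD(1)[OF assms]] Cid[OF twistedD(1)[OF assms]] by (simp add: PreTr_simps)

lemma tm_id:
  assumes "tw X"
  shows "tm 0 X X (dg_id (PreTr C) X) n = idt (fst (tt X) n)"
proof (rule tm_eqI[OF assms assms tc_id[OF assms]])
  fix i j assume ij: "i \<in> su X" "j \<in> su X"
  note P = twistedD(1)[OF assms]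
  have "ment 0 X X (dg_id (PreTr C) X) n i j = (if i = j then idt (ts X n i) else zr (ts X n j) (ts X n i))"
    unfolding ment_def PreTr_simps using Fid[OF P] Fone[OF P P, of "i - j" i j "n + j"] by (auto simp: tot_summand_def)
  also have "\<dots> = sprj (su X) (ts X n) i \<star> sinj (su X) (ts X n) j"
    using ts_objs[OF assms] ij by auto
  finally show "sprj (su X) (ts X (n + 0)) i \<star> (idt (fst (tt X) n) \<star> sinj (su X) (ts X n) j) = ment 0 X X (dg_id (PreTr C) X) n i j"
    using ts_objs[OF assms] ij by (simp add: tt_simps(1)[OF assms])
qed (use tt_types[OF assms] in auto)

lemma tc_comp_entry:
  assumes "tw X" "tw Y" "tw Z" "g \<in> carrier (tc l Y Z)" "f \<in> carrier (tc l' X Y)"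
  shows "dg_comp C (l + m - j) (l' + i - m) (fst X i) (fst Y m) (fst Z j) (g m j) (f i m)
    \<in> carrier (dg_hom C (l + l' + i - j) (fst X i) (fst Z j))"
  by (rule Ccomp'[OF twistedD(1)[OF assms(1)] twistedD(1)[OF assms(2)] twistedD(1)[OF assms(3)]
      tc_carrier[OF assms(4)] tc_carrier[OF assms(5)]]) simp

lemma tc_comp:
  assumes "tw X" "tw Y" "tw Z" "g \<in> carrier (tc l Y Z)" "f \<in> carrier (tc l' X Y)"
  shows "dg_comp (PreTr C) l l' X Y Z g f \<in> carrier (tc (l + l') X Z)"
  unfolding PreTr_simps
  by (intro allI Hfinprod twistedD(1)[OF assms(1)] twistedD(1)[OF assms(3)] tc_comp_entry[OF assms])

lemma tm_comp:
  assumes "tw X" "tw Y" "tw Z" "g \<in> carrier (tc l Y Z)" "f \<in> carrier (tc l' X Y)"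
  shows "tm (l + l') X Z (dg_comp (PreTr C) l l' X Y Z g f) n = tm l' X Y f (n + l) \<star> tm l Y Z g n"
proof (rule tm_eqI[OF assms(1,3) tc_comp[OF assms]])
  note tf = tm_types[OF assms(1,2,5)] and tg = tm_types[OF assms(2,3,4)]
  have e: "n + (l + l') = n + l + l'" by simp
  fix i k assume ik: "i \<in> su X" "k \<in> su Z"
  have "sprj (su X) (ts X (n + (l + l'))) i \<star> ((tm l' X Y f (n + l) \<star> tm l Y Z g n) \<star> sinj (su Z) (ts Z n) k) =
    hsum (ts Z n k) (ts X (n + (l + l')) i) (\<lambda>j. ment l' X Y f (n + l) i j \<star> ment l Y Z g n j k) (su Y)"
    unfolding tm_eq e by (rule mat_comp_entry[OF ment_mtyp[OF assms(2,3,4) refl] ment_mtyp[OF assms(1,2,5) refl] ik])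
  also have "\<dots> = ment (l + l') X Z (dg_comp (PreTr C) l l' X Y Z g f) n i k"
  proof -
    let ?c = "\<lambda>m. dg_comp C (l + m - k) (l' + i - m) (fst X i) (fst Y m) (fst Z k) (g m k) (f i m)"
    have "ment (l + l') X Z (dg_comp (PreTr C) l l' X Y Z g f) n i k =
      hsum (fst (fun_obj F (fst Z k)) (n + k)) (fst (fun_obj F (fst X i)) (n + k + (l + l' + i - k)))
        (\<lambda>m. fun_hom F (l + l' + i - k) (fst X i) (fst Z k) (?c m) (n + k)) (su Y)"
      unfolding ment_def PreTr_simps
      by (rule Ffinprod[OF twistedD(1)[OF assms(1)] twistedD(1)[OF assms(3)] twistedD(2)[OF assms(2)] tc_comp_entry[OF assms]])
    moreover have "fst (fun_obj F (fst X i)) (n + k + (l + l' + i - k)) = ts X (n + (l + l')) i"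
      by (simp add: tot_summand_def algebra_simps)
    moreover have "fst (fun_obj F (fst Z k)) (n + k) = ts Z n k" by (simp add: tot_summand_def)
    moreover have "fun_hom F (l + l' + i - k) (fst X i) (fst Z k) (?c m) (n + k) = ment l' X Y f (n + l) i m \<star> ment l Y Z g n m k" for m
      unfolding ment_def by (rule Fcomp'[OF twistedD(1)[OF assms(1)] twistedD(1)[OF assms(2)] twistedD(1)[OF assms(3)]
         tc_carrier[OF assms(4)] tc_carrier[OF assms(5)]]) simp_all
    ultimately show ?thesis by simp
  qed
  finally show "sprj (su X) (ts X (n + (l + l'))) i \<star> ((tm l' X Y f (n + l) \<star> tm l Y Z g n) \<star> sinj (su Z) (ts Z n) k) =
    ment (l + l') X Z (dg_comp (PreTr C) l l' X Y Z g f) n i k" .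
qed (use tm_types[OF assms(1,2,5)] tm_types[OF assms(2,3,4)] in \<open>auto simp: add.assoc\<close>)

lemma tc_diff_parts:
  assumes "tw X" "tw Y" "f \<in> carrier (tc l X Y)"
  shows "dg_diff C (l + i - j) (fst X i) (fst Y j) (f i j) \<in> carrier (dg_hom C (l + 1 + i - j) (fst X i) (fst Y j))"
    "dg_comp C (l + m - j) (i - m + 1) (fst X i) (fst X m) (fst Y j) (f m j) (snd X i m)
      \<in> carrier (dg_hom C (l + 1 + i - j) (fst X i) (fst Y j))"
    "dg_comp C (m - j + 1) (l + i - m) (fst X i) (fst Y m) (fst Y j) (snd Y m j) (f i m)
      \<in> carrier (dg_hom C (l + 1 + i - j) (fst X i) (fst Y j))"
proof -
  note P = twistedD(1)[OF assms(1)] twistedD(1)[OF assms(2)] and f = tc_carrier[OF assms(3)]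
    and q = twistedD(3)[OF assms(1)] twistedD(3)[OF assms(2)]
  show "dg_diff C (l + i - j) (fst X i) (fst Y j) (f i j) \<in> carrier (dg_hom C (l + 1 + i - j) (fst X i) (fst Y j))"
    by (rule Cdiff'[OF P f]) simp
  show "dg_comp C (l + m - j) (i - m + 1) (fst X i) (fst X m) (fst Y j) (f m j) (snd X i m)
      \<in> carrier (dg_hom C (l + 1 + i - j) (fst X i) (fst Y j))"
    by (rule Ccomp'[OF P(1,1,2) f q(1)]) simp
  show "dg_comp C (m - j + 1) (l + i - m) (fst X i) (fst Y m) (fst Y j) (snd Y m j) (f i m)
      \<in> carrier (dg_hom C (l + 1 + i - j) (fst X i) (fst Y j))"
    by (rule Ccomp'[OF P(1,2,2) q(2) f]) simp
qed

lemma tc_diff: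
  assumes "tw X" "tw Y" "f \<in> carrier (tc l X Y)"
  shows "dg_diff (PreTr C) l X Y f \<in> carrier (tc (l + 1) X Y)"
  unfolding PreTr_simps Let_def
  by (intro allI Hmul signed_closed Hfinprod twistedD(1)[OF assms(1)] twistedD(1)[OF assms(2)] tc_diff_parts[OF assms])

text \<open>The three summands in the differential of \<open>PreTr\<close> correspond to the
  diagonal differentials and to the twisting maps of \<open>X\<close> and of \<open>Y\<close>. As
  the functor is contravariant, those of \<open>X\<close> act on the target.\<close>

lemma tm_diff:
  assumes "tw X" "tw Y" "f \<in> carrier (tc l X Y)"
  shows "tm (l + 1) X Y (dg_diff (PreTr C) l X Y f) n =
    snd (tt X) (n + l) \<star> tm l X Y f n \<boxplus> sg (l + 1) (tm l X Y f (n + 1) \<star> snd (tt Y) n)"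
proof (rule tm_eqI[OF assms(1,2) tc_diff[OF assms]])
  note t = tm_types[OF assms] and X = tt_types[OF assms(1)] and Y = tt_types[OF assms(2)]
  note P = twistedD(1)[OF assms(1)] twistedD(1)[OF assms(2)] and f = tc_carrier[OF assms(3)]
    and q = twistedD(3)[OF assms(1)] twistedD(3)[OF assms(2)] and fin = twistedD(2)[OF assms(1)] twistedD(2)[OF assms(2)]
  note oX = ts_objs[OF assms(1)] and oY = ts_objs[OF assms(2)]
  have e: "n + (l + 1) = n + l + 1" and e': "n + 1 + l = n + l + 1" by simp_all
  show "arr (snd (tt X) (n + l) \<star> tm l X Y f n \<boxplus> sg (l + 1) (tm l X Y f (n + 1) \<star> snd (tt Y) n))"
    "src (snd (tt X) (n + l) \<star> tm l X Y f n \<boxplus> sg (l + 1) (tm l X Y f (n + 1) \<star> snd (tt Y) n)) = fst (tt Y) n"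
    "tgt (snd (tt X) (n + l) \<star> tm l X Y f n \<boxplus> sg (l + 1) (tm l X Y f (n + 1) \<star> snd (tt Y) n)) = fst (tt X) (n + (l + 1))"
    using t X Y by (simp_all add: e e')
  fix i j assume ij: "i \<in> su X" "j \<in> su Y"
  let ?A = "ts Y n j" and ?B = "ts X (n + l + 1) i"
  let ?m = "ment l X Y f"
  let ?s1 = "hsum ?A ?B (\<lambda>m. qent X (n + l) i m \<star> ?m n m j) (su X)"
  let ?s2 = "hsum ?A ?B (\<lambda>m. ?m (n + 1) i m \<star> qent Y n m j) (su Y)"
  have mt: "arr (?m n i j)" "src (?m n i j) = ts Y n j" "tgt (?m n i j) = ts X (n + l) i" for n i j
    using assms by simp_all
  have mt': "tgt (?m (n + 1) i j) = ts X (n + l + 1) i" for i j using mt(3)[of "n + 1"] by (simp only: e')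
  note mt = mt(1,2) mt(3)[of n] mt'
  have s1: "arr ?s1" "src ?s1 = ?A" "tgt ?s1 = ?B" and s2: "arr ?s2" "src ?s2 = ?A" "tgt ?s2 = ?B"
    using assms mt by (subst hsum_simps; auto simp: Hom_iff)+
  have L: "sprj (su X) (ts X (n + l + 1)) i \<star> ((snd (tt X) (n + l) \<star> tm l X Y f n) \<star> sinj (su Y) (ts Y n) j) =
    sg i (dent X (n + l) i \<star> ?m n i j) \<boxplus> ?s1"
  proof -
    have "sprj (su X) (ts X (n + l + 1)) i \<star> ((snd (tt X) (n + l) \<star> tm l X Y f n) \<star> sinj (su Y) (ts Y n) j) =
      hsum ?A ?B (\<lambda>m. tent X (n + l) i m \<star> ?m n m j) (su X)"
      unfolding tt_simps[OF assms(1)] tm_eq by (rule mat_comp_entry[OF ment_mtyp[OF assms refl] tent_mtyp[OF assms(1) refl] ij])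
    also have "\<dots> = hsum ?A ?B (\<lambda>m. (if i = m then sg i (dent X (n + l) i) \<boxplus> qent X (n + l) i m else qent X (n + l) i m) \<star> ?m n m j) (su X)"
      unfolding tent_def[of X "n + l" i] ..
    also have "\<dots> = sg i (dent X (n + l) i) \<star> ?m n i j \<boxplus> ?s1"
      by (rule hsum_diag_left) (use ij assms fin mt in \<open>auto simp: Hom_iff\<close>)
    also have "sg i (dent X (n + l) i) \<star> ?m n i j = sg i (dent X (n + l) i \<star> ?m n i j)"
      using assms mt by (simp add: sg_comp)
    finally show ?thesis .
  qed
  have R: "sprj (su X) (ts X (n + l + 1)) i \<star> ((tm l X Y f (n + 1) \<star> snd (tt Y) n) \<star> sinj (su Y) (ts Y n) j) =
    sg j (?m (n + 1) i j \<star> dent Y n j) \<boxplus> ?s2"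
  proof -
    have "sprj (su X) (ts X (n + l + 1)) i \<star> ((tm l X Y f (n + 1) \<star> snd (tt Y) n) \<star> sinj (su Y) (ts Y n) j) =
      hsum ?A ?B (\<lambda>m. ?m (n + 1) i m \<star> tent Y n m j) (su Y)"
      unfolding tt_simps[OF assms(2)] tm_eq e'
      by (rule mat_comp_entry[OF tent_mtyp[OF assms(2) refl] ment_mtyp[OF assms] ij]) simp
    also have "\<dots> = hsum ?A ?B (\<lambda>m. ?m (n + 1) i m \<star> (if m = j then sg j (dent Y n j) \<boxplus> qent Y n m j else qent Y n m j)) (su Y)"
      by (rule hsum_cong) (use assms mt in \<open>auto simp: Hom_iff tent_def\<close>)
    also have "\<dots> = ?m (n + 1) i j \<star> sg j (dent Y n j) \<boxplus> ?s2"
      by (rule hsum_diag_right) (use ij assms fin mt in \<open>auto simp: Hom_iff\<close>)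
    also have "?m (n + 1) i j \<star> sg j (dent Y n j) = sg j (?m (n + 1) i j \<star> dent Y n j)"
      using assms mt by (simp add: comp_sg)
    finally show ?thesis .
  qed
  let ?H = "dg_hom C (l + 1 + i - j) (fst X i) (fst Y j)"
  let ?c1 = "\<lambda>m. dg_comp C (l + m - j) (i - m + 1) (fst X i) (fst X m) (fst Y j) (f m j) (snd X i m)"
  let ?c2 = "\<lambda>m. dg_comp C (m - j + 1) (l + i - m) (fst X i) (fst Y m) (fst Y j) (snd Y m j) (f i m)"
  note parts = tc_diff_parts[OF assms]
  let ?d = "dg_diff C (l + i - j) (fst X i) (fst Y j) (f i j)"
  have c1: "finprod ?H ?c1 (su X) \<in> carrier ?H" and c2: "finprod ?H ?c2 (su Y) \<in> carrier ?H"
    by (rule Hfinprod[OF P], rule parts)+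
  have ef: "n + j + (l + 1 + i - j) = n + l + 1 + i" by simp
  have F1: "fun_hom F (l + 1 + i - j) (fst X i) (fst Y j) (?c1 m) (n + j) = qent X (n + l) i m \<star> ?m n m j" for m
    unfolding qent_def ment_def by (rule Fcomp'[OF P(1,1,2) f q(1)]) simp_all
  have F2: "fun_hom F (l + 1 + i - j) (fst X i) (fst Y j) (?c2 m) (n + j) = ?m (n + 1) i m \<star> qent Y n m j" for m
    unfolding qent_def ment_def by (rule Fcomp'[OF P(1,2,2) q(2) f]) simp_all
  have F3: "fun_hom F (l + 1 + i - j) (fst X i) (fst Y j) ?d (n + j) =
    dent X (n + l) i \<star> ?m n i j \<boxplus> sg (l + i - j + 1) (?m (n + 1) i j \<star> dent Y n j)"
    unfolding dent_def ment_def by (rule Fdiff'[OF P f]) simp_all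
  have "ment (l + 1) X Y (dg_diff (PreTr C) l X Y f) n i j =
    sg i (dent X (n + l) i \<star> ?m n i j \<boxplus> sg (l + i - j + 1) (?m (n + 1) i j \<star> dent Y n j)) \<boxplus> (?s1 \<boxplus> sg (l + 1) ?s2)"
    unfolding ment_def[of "l + 1"] PreTr_simps Let_def
    by (subst Fadd[OF P signed_closed[OF P parts(1)] Hmul[OF P c1 signed_closed[OF P c2]]],
        subst Fadd[OF P c1 signed_closed[OF P c2]],
        subst Fsigned[OF P parts(1)], subst Fsigned[OF P c2],
        subst Ffinprod[OF P fin(1)], rule parts(2), subst Ffinprod[OF P fin(2)], rule parts(3))
      (simp only: F1 F2 F3 ef tot_summand_def)
  also have "\<dots> = (sg i (dent X (n + l) i \<star> ?m n i j) \<boxplus> ?s1) \<boxplus> sg (l + 1) (sg j (?m (n + 1) i j \<star> dent Y n j) \<boxplus> ?s2)"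
  proof -
    \<comment> \<open>Both sides have the parity of \<open>l + 1 + j\<close>; the two copies of
      \<open>i\<close> cancel.\<close>
    have s: "sg i (sg (l + i - j + 1) (?m (n + 1) i j \<star> dent Y n j)) = sg (l + 1) (sg j (?m (n + 1) i j \<star> dent Y n j))"
      using assms mt by (simp add: sg_sg) (simp add: sg_def)
    have tt: "arr (dent X (n + l) i \<star> ?m n i j)" "src (dent X (n + l) i \<star> ?m n i j) = ?A" "tgt (dent X (n + l) i \<star> ?m n i j) = ?B"
      "arr (?m (n + 1) i j \<star> dent Y n j)" "src (?m (n + 1) i j \<star> dent Y n j) = ?A" "tgt (?m (n + 1) i j \<star> dent Y n j) = ?B"
      using assms mt by (simp_all add: e')
    show ?thesis using s tt s1 s2
      by (simp add: sg_plus add_assoc) (simp add: add_lcomm[of ?s1])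
  qed
  also have "\<dots> = sprj (su X) (ts X (n + l + 1)) i \<star> ((snd (tt X) (n + l) \<star> tm l X Y f n) \<star> sinj (su Y) (ts Y n) j) \<boxplus>
     sg (l + 1) (sprj (su X) (ts X (n + l + 1)) i \<star> ((tm l X Y f (n + 1) \<star> snd (tt Y) n) \<star> sinj (su Y) (ts Y n) j))"
    by (simp only: L R)
  also have "\<dots> = sprj (su X) (ts X (n + l + 1)) i \<star>
      ((snd (tt X) (n + l) \<star> tm l X Y f n \<boxplus> sg (l + 1) (tm l X Y f (n + 1) \<star> snd (tt Y) n)) \<star> sinj (su Y) (ts Y n) j)"
    using t X Y ij oX oY
    by (simp add: bilin sg_comp comp_sg e' tt_simps(1)[OF assms(1)] tt_simps(1)[OF assms(2)])
  finally show "sprj (su X) (ts X (n + (l + 1))) i \<star>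
      ((snd (tt X) (n + l) \<star> tm l X Y f n \<boxplus> sg (l + 1) (tm l X Y f (n + 1) \<star> snd (tt Y) n)) \<star> sinj (su Y) (ts Y n) j) =
      ment (l + 1) X Y (dg_diff (PreTr C) l X Y f) n i j" by (simp only: e)
qed

subsection \<open>Cohomology of total complexes\<close>

text \<open>The condition is placed on the map of total complexes rather than on a cocycle in
  \<open>PreTr C\<close>: in this form composites inherit it from the composition of chain maps,
  whereas cocycles would call for a Leibniz rule in \<open>C\<close>.\<close>

definition good :: "('c, 'm) twisted \<Rightarrow> ('c, 'm) twisted \<Rightarrow> (int \<Rightarrow> int \<Rightarrow> 'm) \<Rightarrow> bool" where
  "good X Y f \<longleftrightarrow> f \<in> carrier (tc 0 X Y) \<and> cmap (tt Y) (tt X) (tm 0 X Y f)"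

definition hm :: "int \<Rightarrow> ('c, 'm) twisted \<Rightarrow> ('c, 'm) twisted \<Rightarrow> (int \<Rightarrow> int \<Rightarrow> 'm) \<Rightarrow> 'a" where
  "hm s X Y f = cohom_map A s (tt Y) (tt X) (tm 0 X Y f)"

lemma cocycle_good:
  assumes "tw X" "tw Y" "f \<in> dg_cocycles (PreTr C) X Y"
  shows "good X Y f"
proof -
  have f: "f \<in> carrier (tc 0 X Y)" "dg_diff (PreTr C) 0 X Y f = \<one>\<^bsub>tc 1 X Y\<^esub>"
    using assms(3) by (auto simp: dg_cocycles_def)
  note t = tm_types[OF assms(1,2) f(1)] and X = tt_cpx[OF assms(1)] and Y = tt_cpx[OF assms(2)]
  have "cmap (tt Y) (tt X) (tm 0 X Y f)"
  proof (rule cmapI[OF Y X])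
    fix n
    have "snd (tt X) n \<star> tm 0 X Y f n \<boxminus> tm 0 X Y f (n + 1) \<star> snd (tt Y) n = zr (fst (tt Y) n) (fst (tt X) (n + 1))"
      using tm_diff[OF assms(1,2) f(1), of n] tm_one[OF assms(1,2), of 1 n] by (simp add: f(2) sg_def)
    then have "nul (snd (tt X) n \<star> tm 0 X Y f n \<boxminus> tm 0 X Y f (n + 1) \<star> snd (tt Y) n)" using X Y by simp
    then show "snd (tt X) n \<star> tm 0 X Y f n = tm 0 X Y f (n + 1) \<star> snd (tt Y) n"
      by (subst (asm) nul_minus_iff) (use t X Y in auto)
  qed (use t in auto)
  then show ?thesis using f by (simp add: good_def)
qed

lemma good_homotopy_class:
  assumes "tw X" "tw Y" "good X Y f" "f' \<in> homotopy_class (PreTr C) X Y f"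
  shows "good X Y f'" "hm s X Y f' = hm s X Y f"
proof -
  have f: "f \<in> carrier (tc 0 X Y)" "cmap (tt Y) (tt X) (tm 0 X Y f)" using assms(3) by (auto simp: good_def)
  obtain k where k: "k \<in> carrier (tc (-1) X Y)" "f' = dg_diff (PreTr C) (-1) X Y k \<otimes>\<^bsub>tc 0 X Y\<^esub> f"
    using assms(4) unfolding homotopy_class_def r_coset_def dg_coboundaries_def by auto
  have dk: "dg_diff (PreTr C) (-1) X Y k \<in> carrier (tc 0 X Y)" using tc_diff[OF assms(1,2) k(1)] by simp
  note t = tm_types[OF assms(1,2) k(1)]
  have e: "tm 0 X Y f' n = (snd (tt X) (n - 1) \<star> tm (-1) X Y k n \<boxplus> tm (-1) X Y k (n + 1) \<star> snd (tt Y) n) \<boxplus> tm 0 X Y f n" for n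
    using tm_add[OF assms(1,2) dk f(1), of n] tm_diff[OF assms(1,2) k(1), of n] by (simp add: k(2) sg_def)
  have "f' \<in> carrier (tc 0 X Y)" unfolding k(2) by (rule tc_mult[OF assms(1,2) dk f(1)])
  then show "good X Y f'" "hm s X Y f' = hm s X Y f"
    unfolding good_def hm_def using cmap_htpy[OF f(2), of "tm (-1) X Y k" "tm 0 X Y f'"] e t by auto
qed

lemma homotopy_class_nonempty: "tw X \<Longrightarrow> tw Y \<Longrightarrow> homotopy_class (PreTr C) X Y f \<noteq> {}"
  using tc_one[of X Y "-1"] unfolding homotopy_class_def r_coset_def dg_coboundaries_def by blast

text \<open>The value is a definite description over two layers of representatives: a member of
  \<open>c\<close>, and a member of the homotopy class of its total. All of them induce the same
  arrow of cohomology, so the description has a value.\<close>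

lemma cohom_Tr_eval:
  assumes "c \<noteq> {}" "\<And>f. f \<in> c \<Longrightarrow> good X Y f \<and> hm s X Y f = h"
  shows "snd (cohom_Tr A C F s) (X, Y, c) = h"
proof -
  let ?U = "\<Union>f\<in>c. homotopy_class (complexes A) (tt Y) (tt X) (tm 0 X Y f)"
  obtain f where f: "f \<in> c" using assms(1) by auto
  have "cohom_map A s (tt Y) (tt X) ` ?U = {h}"
  proof -
    have "cohom_map A s (tt Y) (tt X) g = h" if "g \<in> ?U" for g
      using that homotopy_class_complexes(1) assms(2) unfolding good_def hm_def by blast
    moreover have "?U \<noteq> {}" using f homotopy_class_complexes(2) assms(2)[OF f] unfolding good_def by blast
    ultimately show ?thesis by auto
  qed
  then show ?thesis by (simp add: cohom_Tr_def homotopy_fun_def cohom_htpy_def Let_def)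
qed

lemma good_comp:
  assumes "tw X" "tw Y" "tw Z" "good Y Z g" "good X Y f"
  shows "good X Z (dg_comp (PreTr C) 0 0 X Y Z g f)"
    "hm s X Z (dg_comp (PreTr C) 0 0 X Y Z g f) = hm s X Y f \<star> hm s Y Z g"
proof -
  have g: "g \<in> carrier (tc 0 Y Z)" "cmap (tt Z) (tt Y) (tm 0 Y Z g)" using assms(4) by (auto simp: good_def)
  have f: "f \<in> carrier (tc 0 X Y)" "cmap (tt Y) (tt X) (tm 0 X Y f)" using assms(5) by (auto simp: good_def)
  have e: "tm 0 X Z (dg_comp (PreTr C) 0 0 X Y Z g f) = (\<lambda>n. tm 0 X Y f n \<star> tm 0 Y Z g n)"
    using tm_comp[OF assms(1-3) g(1) f(1)] by auto
  show "good X Z (dg_comp (PreTr C) 0 0 X Y Z g f)"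
    unfolding good_def e using tc_comp[OF assms(1-3) g(1) f(1)] cmap_comp[OF g(2) f(2)] by simp
  show "hm s X Z (dg_comp (PreTr C) 0 0 X Y Z g f) = hm s X Y f \<star> hm s Y Z g"
    unfolding hm_def e by (rule cohom_map_comp[OF g(2) f(2)])
qed

lemma good_id:
  assumes "tw X"
  shows "good X X (dg_id (PreTr C) X)" "hm s X X (dg_id (PreTr C) X) = idt (cohom A s (tt X))"
proof -
  note X = tt_cpx[OF assms]
  have e: "tm 0 X X (dg_id (PreTr C) X) = (\<lambda>n. idt (fst (tt X) n))" using tm_id[OF assms] by auto
  show "good X X (dg_id (PreTr C) X)" unfolding good_def e using tc_id[OF assms] X by (auto intro: cmapI)
  show "hm s X X (dg_id (PreTr C) X) = idt (cohom A s (tt X))"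
    unfolding hm_def e by (rule cohom_map_id[OF X refl])
qed

lemma hm_types:
  assumes "good X Y f"
  shows "arr (hm s X Y f)" "src (hm s X Y f) = cohom A s (tt Y)" "tgt (hm s X Y f) = cohom A s (tt X)"
  using cohom_map[of "tt Y" "tt X" "tm 0 X Y f"] assms unfolding good_def hm_def by auto

end

context abelian
begin

text \<open>
  The axioms of \<open>cpx_functor\<close> do not make \<open>Tr C\<close> a category. The following triples include its
  arrows and their composites, and cohomology is functorial on them.
\<close>

definition adm :: "('c, 'm) dgcat \<Rightarrow> ('c, 'm) twisted \<Rightarrow> ('c, 'm) twisted \<Rightarrow> (int \<Rightarrow> int \<Rightarrow> 'm) set \<Rightarrow> bool" where
  "adm C X Y c \<longleftrightarrow> twisted_complex C X \<and> twisted_complex C Y \<and> c \<noteq> {} \<and>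
     (\<forall>F :: ('c, 'm, 'o, 'a) cpx_fun. cpx_functor A C F \<longrightarrow> (\<forall>f\<in>c. cpx_functor.good A C F X Y f) \<and>
        (\<forall>s. \<forall>f\<in>c. \<forall>f'\<in>c. cpx_functor.hm A C F s X Y f = cpx_functor.hm A C F s X Y f'))"

end

context cpx_functor
begin

lemma admD:
  assumes "adm C X Y c" "f \<in> c"
  shows "tw X" "tw Y" "good X Y f" "snd (cohom_Tr A C F s) (X, Y, c) = hm s X Y f"
proof -
  show "tw X" "tw Y" "good X Y f" using assms cpx_functor_axioms unfolding adm_def by blast+
  show "snd (cohom_Tr A C F s) (X, Y, c) = hm s X Y f"
    by (rule cohom_Tr_eval) (use assms cpx_functor_axioms in \<open>unfold adm_def, blast\<close>)+
qed

lemma adm_homotopy_class: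
  assumes "tw X" "tw Y" "\<And>F' :: ('c, 'm, 'o, 'a) cpx_fun. cpx_functor A C F' \<Longrightarrow> cpx_functor.good A C F' X Y f"
  shows "adm C X Y (homotopy_class (PreTr C) X Y f)"
  unfolding adm_def
proof (intro conjI allI impI ballI)
  fix F' :: "('c, 'm, 'o, 'a) cpx_fun" and f1 s
  assume F': "cpx_functor A C F'" and f1: "f1 \<in> homotopy_class (PreTr C) X Y f"
  interpret F': cpx_functor A C F' by (rule F')
  note * = F'.good_homotopy_class[OF assms(1,2) assms(3)[OF F']]
  show "F'.good X Y f1" by (rule *[OF f1])
  fix f2 assume "f2 \<in> homotopy_class (PreTr C) X Y f"
  then show "F'.hm s X Y f1 = F'.hm s X Y f2" using *(2)[OF f1] *(2) by metis
qed (use assms homotopy_class_nonempty in auto)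

lemma adm_hom:
  assumes "\<alpha> \<in> cat_hom (Tr C) X Y"
  obtains c where "\<alpha> = (X, Y, c)" "adm C X Y c"
proof -
  obtain f where f: "f \<in> dg_cocycles (PreTr C) X Y" "\<alpha> = (X, Y, homotopy_class (PreTr C) X Y f)" "tw X" "tw Y"
    using assms unfolding cat_hom_def Tr_def homotopy_cat_def by (auto simp: PreTr_simps)
  have "adm C X Y (homotopy_class (PreTr C) X Y f)"
    by (rule adm_homotopy_class[OF f(3,4)]) (rule cpx_functor.cocycle_good[OF _ f(3,4,1)])
  then show thesis using that f(2) by blast
qed

lemma adm_id: assumes "tw X" shows "adm C X X (homotopy_class (PreTr C) X X (dg_id (PreTr C) X))"
  by (rule adm_homotopy_class[OF assms assms]) (rule cpx_functor.good_id(1)[OF _ assms])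

text \<open>Composition in \<open>Tr C\<close> is a union over representatives of both arrows. Each
  composite of representatives has the same effect on cohomology, for every functor at once, so the
  union is again of the required kind.\<close>

lemma adm_comp:
  assumes "adm C X Y c" "adm C Y Z c'"
  defines "c'' \<equiv> \<Union>g\<in>c'. \<Union>f\<in>c. homotopy_class (PreTr C) X Z (dg_comp (PreTr C) 0 0 X Y Z g f)"
  shows "adm C X Z c''"
    "snd (cohom_Tr A C F s) (X, Z, c'') = snd (cohom_Tr A C F s) (X, Y, c) \<star> snd (cohom_Tr A C F s) (Y, Z, c')"
proof -
  obtain f0 g0 where fg0: "f0 \<in> c" "g0 \<in> c'" using assms unfolding adm_def by blast
  have t: "tw X" "tw Y" "tw Z" using assms unfolding adm_def by blast+
  have *: "cpx_functor.good A C F' X Z h \<and> cpx_functor.hm A C F' s X Z h = cpx_functor.hm A C F' s X Y f0 \<star> cpx_functor.hm A C F' s Y Z g0"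
    if F': "cpx_functor A C F'" and h: "h \<in> c''" for F' :: "('c, 'm, 'o, 'a) cpx_fun" and h s
  proof -
    interpret F': cpx_functor A C F' by (rule F')
    obtain g f where gf: "g \<in> c'" "f \<in> c" and h: "h \<in> homotopy_class (PreTr C) X Z (dg_comp (PreTr C) 0 0 X Y Z g f)"
      using h unfolding c''_def by blast
    have G: "F'.good X Y f" "F'.good Y Z g" "F'.hm s X Y f = F'.hm s X Y f0" "F'.hm s Y Z g = F'.hm s Y Z g0"
      using assms(1,2) gf fg0 F' unfolding adm_def by blast+
    show ?thesis using F'.good_comp[OF t G(2,1)] F'.good_homotopy_class[OF t(1,3) _ h] G(3,4) by metis
  qed
  have ne: "c'' \<noteq> {}"
    unfolding c''_def using fg0 homotopy_class_nonempty[OF t(1,3), of "dg_comp (PreTr C) 0 0 X Y Z g0 f0"] by auto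
  show adm: "adm C X Z c''" unfolding adm_def using t ne * by simp
  obtain h where h: "h \<in> c''" using ne by blast
  show "snd (cohom_Tr A C F s) (X, Z, c'') = snd (cohom_Tr A C F s) (X, Y, c) \<star> snd (cohom_Tr A C F s) (Y, Z, c')"
    using admD(4)[OF adm h] admD(4)[OF assms(1) fg0(1)] admD(4)[OF assms(2) fg0(2)] *[OF cpx_functor_axioms h] by simp
qed

lemma cohom_Tr_types:
  assumes "adm C X Y c"
  shows "arr (snd (cohom_Tr A C F s) (X, Y, c))" "src (snd (cohom_Tr A C F s) (X, Y, c)) = cohom A s (tt Y)"
    "tgt (snd (cohom_Tr A C F s) (X, Y, c)) = cohom A s (tt X)"
proof -
  obtain f where "f \<in> c" using assms unfolding adm_def by blast
  note f = admD[OF assms this]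
  show "arr (snd (cohom_Tr A C F s) (X, Y, c))" "src (snd (cohom_Tr A C F s) (X, Y, c)) = cohom A s (tt Y)"
    "tgt (snd (cohom_Tr A C F s) (X, Y, c)) = cohom A s (tt X)" unfolding f(4) using hm_types[OF f(3)] by auto
qed

lemma cohom_Tr_id:
  assumes "tw X"
  shows "snd (cohom_Tr A C F s) (X, X, homotopy_class (PreTr C) X X (dg_id (PreTr C) X)) = idt (cohom A s (tt X))"
proof -
  obtain f where f: "f \<in> homotopy_class (PreTr C) X X (dg_id (PreTr C) X)"
    using homotopy_class_nonempty[OF assms assms] by blast
  show ?thesis unfolding admD(4)[OF adm_id[OF assms] f]
    using good_homotopy_class(2)[OF assms assms good_id(1)[OF assms] f] good_id(2)[OF assms] by simp
qed

text \<open>The functor laws for \<open>\<Psi>\<close> hold after precomposition with the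
  epimorphisms \<open>u\<close>, where they are those of cohomology; cancelling \<open>u\<close>
  transports them. This serves for quotients of cohomology as well as for isomorphic copies of
  it.\<close>

lemma contra_functor_epi:
  assumes u: "\<And>X. tw X \<Longrightarrow> epi (u X) \<and> src (u X) = cohom A s (tt X) \<and> tgt (u X) = fst \<Psi> X"
    and \<Psi>: "\<And>X Y c. adm C X Y c \<Longrightarrow> arr (snd \<Psi> (X, Y, c)) \<and> src (snd \<Psi> (X, Y, c)) = fst \<Psi> Y \<and>
      tgt (snd \<Psi> (X, Y, c)) = fst \<Psi> X \<and> snd \<Psi> (X, Y, c) \<star> u Y = u X \<star> snd (cohom_Tr A C F s) (X, Y, c)"
  shows "contra_functor (Tr C) A \<Psi>"
  unfolding contra_functor_def
proof (intro conjI ballI)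
  fix X assume "X \<in> cat_obj (Tr C)"
  then have X: "tw X" by (simp add: Tr_obj_iff)
  note uX = u[OF X] and HX = tt_cpx[OF X]
  show o: "obj (fst \<Psi> X)" using uX by (metis epi_arr obj_tgt)
  show "snd \<Psi> (cat_id (Tr C) X) = idt (fst \<Psi> X)"
  proof -
    have i: "cat_id (Tr C) X = (X, X, homotopy_class (PreTr C) X X (dg_id (PreTr C) X))"
      by (simp add: Tr_def homotopy_cat_def)
    note p = \<Psi>[OF adm_id[OF X]]
    show ?thesis unfolding i
      by (rule epi_cancel[OF conjunct1[OF uX]]) (use p uX HX o cohom_Tr_id[OF X] in auto)
  qed
  fix Y assume "Y \<in> cat_obj (Tr C)"
  { fix f assume "f \<in> cat_hom (Tr C) X Y"
    then obtain c where "f = (X, Y, c)" "adm C X Y c" by (rule adm_hom)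
    then show "snd \<Psi> f \<in> Hom (fst \<Psi> Y) (fst \<Psi> X)" using \<Psi> by (auto simp: Hom_iff) }
  fix Z f g assume "Z \<in> cat_obj (Tr C)" "f \<in> cat_hom (Tr C) X Y" "g \<in> cat_hom (Tr C) Y Z"
  then obtain c c' where c: "f = (X, Y, c)" "adm C X Y c" "g = (Y, Z, c')" "adm C Y Z c'"
    by (metis adm_hom)
  define c'' where "c'' = (\<Union>g\<in>c'. \<Union>f\<in>c. homotopy_class (PreTr C) X Z (dg_comp (PreTr C) 0 0 X Y Z g f))"
  have gf: "g \<star>\<^bsub>Tr C\<^esub> f = (X, Z, c'')" unfolding c c''_def by (simp add: Tr_def homotopy_cat_def)
  note A = adm_comp[OF c(2,4), folded c''_def]
  have Z: "tw Z" and Y: "tw Y" using c(4) unfolding adm_def by auto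
  note uY = u[OF Y] and uZ = u[OF Z]
  note p = \<Psi>[OF c(2)] and q = \<Psi>[OF c(4)] and r = \<Psi>[OF A(1)]
  note t = cohom_Tr_types[OF c(2), of s] and t' = cohom_Tr_types[OF c(4), of s]
  have "(snd \<Psi> (X, Y, c) \<star> snd \<Psi> (Y, Z, c')) \<star> u Z = snd \<Psi> (X, Y, c) \<star> (snd \<Psi> (Y, Z, c') \<star> u Z)"
    by (rule assoc) (use p q uX uY uZ in auto)
  also have "\<dots> = snd \<Psi> (X, Y, c) \<star> (u Y \<star> snd (cohom_Tr A C F s) (Y, Z, c'))" using q by simp
  also have "\<dots> = (u X \<star> snd (cohom_Tr A C F s) (X, Y, c)) \<star> snd (cohom_Tr A C F s) (Y, Z, c')"
    by (rule comp_reduce) (use p q uX uY uZ t t' in auto)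
  also have "\<dots> = u X \<star> snd (cohom_Tr A C F s) (X, Z, c'')"
    unfolding A(2) by (rule assoc) (use p q uX uY uZ t t' in auto)
  finally have e: "(snd \<Psi> (X, Y, c) \<star> snd \<Psi> (Y, Z, c')) \<star> u Z = u X \<star> snd (cohom_Tr A C F s) (X, Z, c'')" .
  show "snd \<Psi> (g \<star>\<^bsub>Tr C\<^esub> f) = snd \<Psi> f \<star> snd \<Psi> g"
    unfolding gf unfolding c(1,3)
    by (rule epi_cancel[OF conjunct1[OF uZ]]) (use p q r e uZ in auto)
qed

lemma contra_functor_cohom_Tr: "contra_functor (Tr C) A (cohom_Tr A C F s)"
proof (rule contra_functor_epi[of "\<lambda>X. idt (cohom A s (tt X))" s])
  fix X assume "tw X"
  then show "epi (idt (cohom A s (tt X))) \<and> src (idt (cohom A s (tt X))) = cohom A s (tt X) \<and>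
    tgt (idt (cohom A s (tt X))) = fst (cohom_Tr A C F s) X"
    using tt_cpx by (simp add: cohom_Tr_def homotopy_fun_def Let_def)
next
  fix X Y c assume a: "adm C X Y c"
  then have "tw X" "tw Y" unfolding adm_def by auto
  then show "arr (snd (cohom_Tr A C F s) (X, Y, c)) \<and> src (snd (cohom_Tr A C F s) (X, Y, c)) = fst (cohom_Tr A C F s) Y \<and>
      tgt (snd (cohom_Tr A C F s) (X, Y, c)) = fst (cohom_Tr A C F s) X \<and>
      snd (cohom_Tr A C F s) (X, Y, c) \<star> idt (cohom A s (tt Y)) = idt (cohom A s (tt X)) \<star> snd (cohom_Tr A C F s) (X, Y, c)"
    using cohom_Tr_types[OF a, of s] by (simp add: cohom_Tr_def homotopy_fun_def Let_def)
qed

end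

section \<open>Natural transformations induce maps of total complexes\<close>

context abelian
begin

definition diag :: "int set \<Rightarrow> (int \<Rightarrow> 'o) \<Rightarrow> (int \<Rightarrow> 'o) \<Rightarrow> (int \<Rightarrow> 'a) \<Rightarrow> 'a" where
  "diag I X Y \<theta> = mat I X I Y (\<lambda>i j. if i = j then \<theta> i else zr (X j) (Y i))"

lemma diag_simps:
  assumes "objs I X" "objs I Y" "\<And>i. i \<in> I \<Longrightarrow> \<theta> i \<in> Hom (X i) (Y i)"
  shows "arr (diag I X Y \<theta>)" "src (diag I X Y \<theta>) = dsum I X" "tgt (diag I X Y \<theta>) = dsum I Y"
    "i \<in> I \<Longrightarrow> arr x \<Longrightarrow> tgt x = dsum I X \<Longrightarrow> sprj I Y i \<star> (diag I X Y \<theta> \<star> x) = \<theta> i \<star> (sprj I X i \<star> x)"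
    "j \<in> I \<Longrightarrow> arr y \<Longrightarrow> tgt y = X j \<Longrightarrow> diag I X Y \<theta> \<star> (sinj I X j \<star> y) = sinj I Y j \<star> (\<theta> j \<star> y)"
proof -
  let ?f = "\<lambda>i j. if i = j then \<theta> i else zr (X j) (Y i)"
  have t: "i \<in> I \<Longrightarrow> arr (\<theta> i) \<and> src (\<theta> i) = X i \<and> tgt (\<theta> i) = Y i" for i using assms(3) by (auto simp: Hom_iff)
  have m: "mtyp I X I Y ?f" using assms by (auto simp: Hom_iff)
  show d: "arr (diag I X Y \<theta>)" "src (diag I X Y \<theta>) = dsum I X" "tgt (diag I X Y \<theta>) = dsum I Y"
    unfolding diag_def by (rule mat_simps[OF m])+
  show p: "sprj I Y i \<star> (diag I X Y \<theta> \<star> x) = \<theta> i \<star> (sprj I X i \<star> x)" if "i \<in> I" "arr x" "tgt x = dsum I X" for i x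
  proof -
    have "sprj I Y i \<star> (diag I X Y \<theta> \<star> x) = hsum (src x) (Y i) (\<lambda>j. ?f i j \<star> (sprj I X j \<star> x)) I"
      unfolding diag_def by (rule sprj_mat[OF m that])
    also have "\<dots> = ?f i i \<star> (sprj I X i \<star> x)"
      by (rule hsum_single) (use that assms(1,2) t in \<open>auto simp: Hom_iff\<close>)
    finally show ?thesis by simp
  qed
  assume y: "j \<in> I" "arr y" "tgt y = X j"
  show "diag I X Y \<theta> \<star> (sinj I X j \<star> y) = sinj I Y j \<star> (\<theta> j \<star> y)"
  proof (rule dsum_eqI[OF assms(2)])
    fix i assume i: "i \<in> I"
    have "sprj I Y i \<star> (diag I X Y \<theta> \<star> (sinj I X j \<star> y)) = \<theta> i \<star> (sprj I X i \<star> (sinj I X j \<star> y))"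
      by (rule p) (use i y assms in auto)
    also have "\<dots> = sprj I Y i \<star> (sinj I Y j \<star> (\<theta> j \<star> y))"
      using i y assms(1,2) t[OF i] t[OF y(1)] by (simp add: sprj_sinj)
    finally show "sprj I Y i \<star> (diag I X Y \<theta> \<star> (sinj I X j \<star> y)) = sprj I Y i \<star> (sinj I Y j \<star> (\<theta> j \<star> y))" .
  qed (use y d t assms(1,2) in auto)
qed

end

locale tot_nat = abelian A + F: cpx_functor A C F + F': cpx_functor A C F'
  for A :: "('o, 'a) addcat" (structure) and C :: "('c, 'm) dgcat" and F F' :: "('c, 'm, 'o, 'a) cpx_fun" +
  fixes \<theta> :: "'c \<Rightarrow> int \<Rightarrow> 'a"
  assumes nat: "cpx_nat C F F' \<theta>"
begin

abbreviation tr where "tr \<equiv> tot_trans A C F F' \<theta>"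

lemma \<theta>_types:
  assumes "P \<in> dg_obj C"
  shows "arr (\<theta> P n)" "src (\<theta> P n) = fst (fun_obj F P) n" "tgt (\<theta> P n) = fst (fun_obj F' P) n"
  using nat assms unfolding cpx_nat_def Hom_iff by auto

lemma \<theta>_d: "P \<in> dg_obj C \<Longrightarrow> snd (fun_obj F' P) n \<star> \<theta> P n = \<theta> P (n + 1) \<star> snd (fun_obj F P) n"
  using nat unfolding cpx_nat_def by auto

lemma \<theta>_hom: "P \<in> dg_obj C \<Longrightarrow> Q \<in> dg_obj C \<Longrightarrow> f \<in> carrier (dg_hom C i P Q) \<Longrightarrow> m = n + i \<Longrightarrow>
    \<theta> P m \<star> fun_hom F i P Q f n = fun_hom F' i P Q f n \<star> \<theta> Q n"
  using nat unfolding cpx_nat_def by auto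

lemma tr_diag: "tr X n = diag (tw_supp C X) (tot_summand F X n) (tot_summand F' X n) (\<lambda>i. \<theta> (fst X i) (n + i))"
  by (simp add: tot_trans_def diag_def)

lemma \<theta>_ts: assumes "F.tw X" shows "\<theta> (fst X i) (n + i) \<in> Hom (tot_summand F X n i) (tot_summand F' X n i)"
  using \<theta>_types[OF twistedD(1)[OF assms]] by (auto simp: tot_summand_def Hom_iff)

lemmas tr_simps' = diag_simps[OF F.ts_objs F'.ts_objs \<theta>_ts, folded tr_diag]

lemma tr_simps:
  assumes "F.tw X"
  shows "arr (tr X n)" "src (tr X n) = fst (F.tt X) n" "tgt (tr X n) = fst (F'.tt X) n"
    "i \<in> F.su X \<Longrightarrow> arr x \<Longrightarrow> tgt x = fst (F.tt X) n \<Longrightarrow>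
      sprj (F.su X) (F'.ts X n) i \<star> (tr X n \<star> x) = \<theta> (fst X i) (n + i) \<star> (sprj (F.su X) (F.ts X n) i \<star> x)"
    "j \<in> F.su X \<Longrightarrow> arr y \<Longrightarrow> tgt y = F.ts X n j \<Longrightarrow>
      tr X n \<star> (sinj (F.su X) (F.ts X n) j \<star> y) = sinj (F.su X) (F'.ts X n) j \<star> (\<theta> (fst X j) (n + j) \<star> y)"
  using tr_simps'[OF assms assms assms] F.tt_simps(1)[OF assms] F'.tt_simps(1)[OF assms] by auto

lemma tr_tm:
  assumes "F.tw X" "F.tw Y" "f \<in> carrier (F.tc l X Y)" "m = n + l"
  shows "tr X m \<star> F.tm l X Y f n = F'.tm l X Y f n \<star> tr Y n"
proof -
  note X = F.ts_objs[OF assms(1)] F'.ts_objs[OF assms(1)] and Y = F.ts_objs[OF assms(2)] F'.ts_objs[OF assms(2)]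
  note tX = tr_simps[OF assms(1), where n = m] and tY = tr_simps[OF assms(2), where n = n]
  note m = F.tm_types[OF assms(1-3), of n, folded assms(4)] F'.tm_types[OF assms(1-3), of n, folded assms(4)]
  note s = F.tt_simps(1)[OF assms(1)] F'.tt_simps(1)[OF assms(1)] F.tt_simps(1)[OF assms(2)] F'.tt_simps(1)[OF assms(2)]
  show ?thesis
  proof (rule mat_eqI[OF Y(1)[of n] X(2)[of m]])
    fix i j assume i: "i \<in> F.su X" and j: "j \<in> F.su Y"
    note \<theta>j = \<theta>_types[OF twistedD(1)[OF assms(2)], of j "n + j"]
    have "sprj (F.su X) (F'.ts X m) i \<star> ((tr X m \<star> F.tm l X Y f n) \<star> sinj (F.su Y) (F.ts Y n) j)
       = sprj (F.su X) (F'.ts X m) i \<star> (tr X m \<star> (F.tm l X Y f n \<star> sinj (F.su Y) (F.ts Y n) j))"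
      using tX(1-3) m X Y i j by (simp add: s)
    also have "\<dots> = \<theta> (fst X i) (m + i) \<star> F.ment l X Y f n i j"
      using tX(4)[OF i, of "F.tm l X Y f n \<star> sinj (F.su Y) (F.ts Y n) j"] F.tm_entry[OF assms i j] m Y j by (simp add: s)
    also have "\<dots> = F'.ment l X Y f n i j \<star> \<theta> (fst Y j) (n + j)"
      unfolding F.ment_def F'.ment_def
      by (rule \<theta>_hom[OF twistedD(1)[OF assms(1)] twistedD(1)[OF assms(2)] F.tc_carrier[OF assms(3)]]) (simp add: assms(4))
    also have "\<dots> = sprj (F.su X) (F'.ts X m) i \<star> ((F'.tm l X Y f n \<star> sinj (F.su Y) (F'.ts Y n) j) \<star> \<theta> (fst Y j) (n + j))"
    proof -
      have "F'.ment l X Y f n i j \<star> \<theta> (fst Y j) (n + j) =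
        (sprj (F.su X) (F'.ts X m) i \<star> (F'.tm l X Y f n \<star> sinj (F.su Y) (F'.ts Y n) j)) \<star> \<theta> (fst Y j) (n + j)"
        using F'.tm_entry[OF assms i j] by simp
      also have "\<dots> = sprj (F.su X) (F'.ts X m) i \<star> ((F'.tm l X Y f n \<star> sinj (F.su Y) (F'.ts Y n) j) \<star> \<theta> (fst Y j) (n + j))"
        by (rule assoc) (use m X Y i j \<theta>j in \<open>auto simp: s tot_summand_def\<close>)
      finally show ?thesis .
    qed
    also have "\<dots> = sprj (F.su X) (F'.ts X m) i \<star> ((F'.tm l X Y f n \<star> tr Y n) \<star> sinj (F.su Y) (F.ts Y n) j)"
    proof -
      have "tr Y n \<star> sinj (F.su Y) (F.ts Y n) j = sinj (F.su Y) (F'.ts Y n) j \<star> \<theta> (fst Y j) (n + j)"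
        using tY(5)[OF j, of "idt (F.ts Y n j)"] Y j \<theta>j by (simp add: tot_summand_def)
      then have "(F'.tm l X Y f n \<star> tr Y n) \<star> sinj (F.su Y) (F.ts Y n) j = (F'.tm l X Y f n \<star> sinj (F.su Y) (F'.ts Y n) j) \<star> \<theta> (fst Y j) (n + j)"
        using m tY(1-3) Y j \<theta>j by (simp add: s tot_summand_def)
      then show ?thesis by simp
    qed
    finally show "sprj (F.su X) (F'.ts X m) i \<star> ((tr X m \<star> F.tm l X Y f n) \<star> sinj (F.su Y) (F.ts Y n) j) =
      sprj (F.su X) (F'.ts X m) i \<star> ((F'.tm l X Y f n \<star> tr Y n) \<star> sinj (F.su Y) (F.ts Y n) j)" .
  qed (use m tX tY s in auto)
qed

lemma tr_tent:
  assumes "F.tw X"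
  shows "F'.tent X n i j \<star> \<theta> (fst X j) (n + j) = \<theta> (fst X i) (n + 1 + i) \<star> F.tent X n i j"
proof -
  note P = twistedD(1)[OF assms]
  have q: "F'.qent X n i j \<star> \<theta> (fst X j) (n + j) = \<theta> (fst X i) (n + 1 + i) \<star> F.qent X n i j"
    unfolding F.qent_def F'.qent_def by (rule \<theta>_hom[symmetric, OF P P twistedD(3)[OF assms]]) simp
  have e: "n + i + 1 = n + 1 + i" by simp
  have d: "F'.dent X n i \<star> \<theta> (fst X i) (n + i) = \<theta> (fst X i) (n + 1 + i) \<star> F.dent X n i"
    unfolding F.dent_def F'.dent_def using \<theta>_d[OF P, of i "n + i"] by (simp only: e)
  note t = \<theta>_ts[OF assms, where n = n, THEN HomD(1)] \<theta>_ts[OF assms, where n = n, THEN HomD(2)] \<theta>_ts[OF assms, where n = n, THEN HomD(3)]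
    \<theta>_ts[OF assms, where n = "n + 1", THEN HomD(1)] \<theta>_ts[OF assms, where n = "n + 1", THEN HomD(2)] \<theta>_ts[OF assms, where n = "n + 1", THEN HomD(3)]
  show ?thesis
  proof (cases "i = j")
    case True
    then show ?thesis using q d t assms unfolding F.tent_def F'.tent_def by (simp add: bilin sg_comp comp_sg)
  qed (use q in \<open>simp add: F.tent_def F'.tent_def\<close>)
qed

lemma tr_cmap:
  assumes "F.tw X"
  shows "cmap (F.tt X) (F'.tt X) (tr X)"
proof (rule cmapI[OF F.tt_cpx[OF assms] F'.tt_cpx[OF assms]])
  fix n
  note oX = F.ts_objs[OF assms] F'.ts_objs[OF assms] and s = F.tt_simps(1)[OF assms] F'.tt_simps(1)[OF assms]
  note t0 = tr_simps[OF assms, where n = n] and t1 = tr_simps[OF assms, where n = "n + 1"]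
  note d = F.tt_types[OF assms] and d' = F'.tt_types[OF assms]
  show "arr (tr X n)" "src (tr X n) = fst (F.tt X) n" "tgt (tr X n) = fst (F'.tt X) n" by (rule t0)+
  show "snd (F'.tt X) n \<star> tr X n = tr X (n + 1) \<star> snd (F.tt X) n"
  proof (rule mat_eqI[OF oX(1)[of n] oX(2)[of "n + 1"]])
    fix i j assume i: "i \<in> F.su X" and j: "j \<in> F.su X"
    note \<theta>j = \<theta>_ts[OF assms, of j n, THEN HomD(1)] \<theta>_ts[OF assms, of j n, THEN HomD(2)] \<theta>_ts[OF assms, of j n, THEN HomD(3)]
    have E': "sprj (F.su X) (F'.ts X (n + 1)) i \<star> (snd (F'.tt X) n \<star> sinj (F.su X) (F'.ts X n) j) = F'.tent X n i j"
      unfolding F'.tt_simps[OF assms] by (rule mat_entry[OF F'.tent_mtyp[OF assms refl] i j])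
    have E: "sprj (F.su X) (F.ts X (n + 1)) i \<star> (snd (F.tt X) n \<star> sinj (F.su X) (F.ts X n) j) = F.tent X n i j"
      unfolding F.tt_simps[OF assms] by (rule mat_entry[OF F.tent_mtyp[OF assms refl] i j])
    have "sprj (F.su X) (F'.ts X (n + 1)) i \<star> ((tr X (n + 1) \<star> snd (F.tt X) n) \<star> sinj (F.su X) (F.ts X n) j) =
      sprj (F.su X) (F'.ts X (n + 1)) i \<star> (tr X (n + 1) \<star> (snd (F.tt X) n \<star> sinj (F.su X) (F.ts X n) j))"
      using t1(1-3) d oX i j by (simp add: s)
    also have "\<dots> = \<theta> (fst X i) (n + 1 + i) \<star> F.tent X n i j"
      using t1(4)[OF i, of "snd (F.tt X) n \<star> sinj (F.su X) (F.ts X n) j"] E d oX j by (simp add: s)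
    also have "\<dots> = F'.tent X n i j \<star> \<theta> (fst X j) (n + j)" by (rule tr_tent[OF assms, symmetric])
    also have "\<dots> = sprj (F.su X) (F'.ts X (n + 1)) i \<star> ((snd (F'.tt X) n \<star> sinj (F.su X) (F'.ts X n) j) \<star> \<theta> (fst X j) (n + j))"
      unfolding E'[symmetric] by (rule assoc) (use d' oX i j \<theta>j in \<open>auto simp: s\<close>)
    also have "\<dots> = sprj (F.su X) (F'.ts X (n + 1)) i \<star> ((snd (F'.tt X) n \<star> tr X n) \<star> sinj (F.su X) (F.ts X n) j)"
    proof -
      have "tr X n \<star> sinj (F.su X) (F.ts X n) j = sinj (F.su X) (F'.ts X n) j \<star> \<theta> (fst X j) (n + j)"
        using t0(5)[OF j, of "idt (F.ts X n j)"] oX j \<theta>j assms by simp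
      then have "(snd (F'.tt X) n \<star> tr X n) \<star> sinj (F.su X) (F.ts X n) j = (snd (F'.tt X) n \<star> sinj (F.su X) (F'.ts X n) j) \<star> \<theta> (fst X j) (n + j)"
        using d' t0(1-3) oX j \<theta>j by (simp add: s)
      then show ?thesis by simp
    qed
    finally show "sprj (F.su X) (F'.ts X (n + 1)) i \<star> ((snd (F'.tt X) n \<star> tr X n) \<star> sinj (F.su X) (F.ts X n) j) =
      sprj (F.su X) (F'.ts X (n + 1)) i \<star> ((tr X (n + 1) \<star> snd (F.tt X) n) \<star> sinj (F.su X) (F.ts X n) j)" by simp
  qed (use t0 t1 d d' s in auto)
qed

lemma tr_cohom_natural:
  assumes "adm C X Y c"
  shows "cohom_map A s (F.tt X) (F'.tt X) (tr X) \<star> snd (cohom_Tr A C F s) (X, Y, c) =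
    snd (cohom_Tr A C F' s) (X, Y, c) \<star> cohom_map A s (F.tt Y) (F'.tt Y) (tr Y)"
proof -
  obtain f where f: "f \<in> c" using assms unfolding adm_def by blast
  note a = F.admD[OF assms f] and a' = F'.admD[OF assms f]
  have g: "f \<in> carrier (F.tc 0 X Y)" "cmap (F.tt Y) (F.tt X) (F.tm 0 X Y f)" "cmap (F'.tt Y) (F'.tt X) (F'.tm 0 X Y f)"
    using a(3) a'(3) by (auto simp: F.good_def F'.good_def)
  have "(\<lambda>n. tr X n \<star> F.tm 0 X Y f n) = (\<lambda>n. F'.tm 0 X Y f n \<star> tr Y n)"
    using tr_tm[OF a(1,2) g(1)] by auto
  then show ?thesis unfolding a(4) a'(4) F.hm_def F'.hm_def
    using cohom_map_comp[OF g(2) tr_cmap[OF a(1)], of s] cohom_map_comp[OF tr_cmap[OF a(2)] g(3), of s] by simp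
qed

end

subsection \<open>Strictness of filtrations without maps between weights\<close>

text \<open>
  A complex \<open>K\<close> with an increasing filtration, given by the generalised elements \<open>mem b n\<close> of
  degree \<open>n\<close> of its step \<open>b\<close>. The step \<open>b\<close> maps by \<open>pi a b\<close> onto a complex \<open>T a b\<close>, and the kernel
  of this map is the step \<open>a - 1\<close> up to an acyclic complex. In the application, \<open>karr w n\<close>
  and \<open>larr w n\<close> are a kernel and a cokernel of pullbacks in the cohomology of degree \<open>w\<close>.
\<close>

locale weight_filtration = abelian A for A :: "('o, 'a) addcat" (structure) +
  fixes K :: "('o, 'a) cpx" and mem :: "int \<Rightarrow> int \<Rightarrow> 'a \<Rightarrow> bool" and T :: "int \<Rightarrow> int \<Rightarrow> ('o, 'a) cpx"
    and pi :: "int \<Rightarrow> int \<Rightarrow> int \<Rightarrow> 'a \<Rightarrow> 'a" and karr larr :: "int \<Rightarrow> int \<Rightarrow> 'a"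
  assumes K: "cpx K" and T: "a \<le> b \<Longrightarrow> cpx (T a b)"
    and mem_type: "mem b n x \<Longrightarrow> arr x \<and> tgt x = fst K n"
    and mem_nul: "nul x \<Longrightarrow> tgt x = fst K n \<Longrightarrow> mem b n x"
    and mem_plus: "mem b n x \<Longrightarrow> mem b n y \<Longrightarrow> src x = src y \<Longrightarrow> mem b n (x \<boxplus> y)"
    and mem_neg: "mem b n x \<Longrightarrow> mem b n (neg x)"
    and mem_comp: "mem b n x \<Longrightarrow> arr e \<Longrightarrow> tgt e = src x \<Longrightarrow> mem b n (x \<star> e)"
    and mem_d: "mem b n x \<Longrightarrow> mem b (n + 1) (snd K n \<star> x)"
    and mem_mono: "mem a n x \<Longrightarrow> a \<le> b \<Longrightarrow> mem b n x"
    and mem_low: "\<exists>B. \<forall>b\<le>B. \<forall>x. mem b n x \<longrightarrow> nul x"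
    and mem_high: "\<exists>B. \<forall>b\<ge>B. \<forall>x. arr x \<and> tgt x = fst K n \<longrightarrow> mem b n x"
    and pi_type: "a \<le> b \<Longrightarrow> mem b n x \<Longrightarrow> arr (pi a b n x) \<and> src (pi a b n x) = src x \<and> tgt (pi a b n x) = fst (T a b) n"
    and pi_plus: "a \<le> b \<Longrightarrow> mem b n x \<Longrightarrow> mem b n y \<Longrightarrow> src x = src y \<Longrightarrow> pi a b n (x \<boxplus> y) = pi a b n x \<boxplus> pi a b n y"
    and pi_neg: "a \<le> b \<Longrightarrow> mem b n x \<Longrightarrow> pi a b n (neg x) = neg (pi a b n x)"
    and pi_comp: "a \<le> b \<Longrightarrow> mem b n x \<Longrightarrow> arr e \<Longrightarrow> tgt e = src x \<Longrightarrow> pi a b n (x \<star> e) = pi a b n x \<star> e"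
    and pi_d: "a \<le> b \<Longrightarrow> mem b n x \<Longrightarrow> pi a b (n + 1) (snd K n \<star> x) = snd (T a b) n \<star> pi a b n x"
    and pi_low: "a \<le> b \<Longrightarrow> mem (a - 1) n x \<Longrightarrow> nul (pi a b n x)"
    and pi_surj: "a \<le> b \<Longrightarrow> arr t \<Longrightarrow> tgt t = fst (T a b) n \<Longrightarrow>
      \<exists>e x. epi e \<and> tgt e = src t \<and> mem b n x \<and> src x = src e \<and> pi a b n x = t \<star> e"
    and pi_ker: "a \<le> b \<Longrightarrow> mem b n x \<Longrightarrow> nul (pi a b n x) \<Longrightarrow> mem (a - 1) (n + 1) (snd K n \<star> x) \<Longrightarrow>
      \<exists>e u. epi e \<and> tgt e = src x \<and> mem b (n - 1) u \<and> src u = src e \<and> nul (pi a b (n - 1) u) \<and>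
        mem (a - 1) n (x \<star> e \<boxminus> snd K (n - 1) \<star> u)"
    and karr: "arr (karr w n)" "tgt (karr w n) = fst (T w w) n" "nul (snd (T w w) n \<star> karr w n)"
      "arr t \<Longrightarrow> tgt t = fst (T w w) n \<Longrightarrow> nul (snd (T w w) n \<star> t) \<Longrightarrow> factors (karr w n) t"
    and larr: "arr (larr w n)" "src (larr w n) = fst (T w w) n" "nul (larr w n \<star> snd (T w w) (n - 1))"
      "arr t \<Longrightarrow> tgt t = fst (T w w) n \<Longrightarrow> nul (larr w n \<star> t) \<Longrightarrow> cov (snd (T w w) (n - 1)) t"
    and weights: "w \<noteq> w' \<Longrightarrow> arr \<phi> \<Longrightarrow> src \<phi> = src (karr w n) \<Longrightarrow> tgt \<phi> = tgt (larr w' n') \<Longrightarrow> nul \<phi>"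
begin

lemma mem_arr: "mem b n x \<Longrightarrow> arr x" and mem_tgt: "mem b n x \<Longrightarrow> tgt x = fst K n"
  using mem_type by auto

lemmas memD = mem_arr mem_tgt

lemma mem_minus: "mem b n x \<Longrightarrow> mem b n y \<Longrightarrow> src x = src y \<Longrightarrow> mem b n (x \<boxminus> y)"
  by (rule mem_plus) (auto intro: mem_neg dest: mem_arr)

lemma mem_d': "mem b (n - 1) x \<Longrightarrow> mem b n (snd K (n - 1) \<star> x)"
  using mem_d[of b "n - 1" x] by simp

lemma pi_d': "a \<le> b \<Longrightarrow> mem b (n - 1) x \<Longrightarrow> pi a b n (snd K (n - 1) \<star> x) = snd (T a b) (n - 1) \<star> pi a b (n - 1) x"
  using pi_d[of a b "n - 1" x] by simp

lemma pi_simps: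
  assumes "a \<le> b" "mem b n x"
  shows "arr (pi a b n x)" "src (pi a b n x) = src x" "tgt (pi a b n x) = fst (T a b) n"
  using pi_type[OF assms] by auto

lemma pi_minus:
  assumes "a \<le> b" "mem b n x" "mem b n y" "src x = src y"
  shows "pi a b n (x \<boxminus> y) = pi a b n x \<boxminus> pi a b n y"
  using pi_plus[OF assms(1,2) mem_neg[OF assms(3)]] pi_neg[OF assms(1,3)] assms mem_arr[OF assms(3)] by simp

text \<open>The primitive \<open>y\<close> has to lie in the step \<open>b\<close> itself, so this
  expresses that the class of \<open>z\<close> vanishes in the cohomology of the step. Being locally
  a boundary in \<open>K\<close> is weaker; strictness is the comparison of the two.\<close>

definition loc_bdry :: "int \<Rightarrow> int \<Rightarrow> 'a \<Rightarrow> bool" where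
  "loc_bdry b n z \<longleftrightarrow> (\<exists>e y. epi e \<and> tgt e = src z \<and> mem b (n - 1) y \<and> src y = src e \<and> snd K (n - 1) \<star> y = z \<star> e)"

lemma loc_bdryE:
  assumes "loc_bdry b n z"
  obtains e y where "epi e" "arr e" "tgt e = src z" "mem b (n - 1) y" "arr y" "tgt y = fst K (n - 1)" "src y = src e"
    "snd K (n - 1) \<star> y = z \<star> e"
  using assms memD epi_arr unfolding loc_bdry_def by blast

lemma loc_bdryI: "snd K (n - 1) \<star> y = z \<star> e \<Longrightarrow> epi e \<Longrightarrow> tgt e = src z \<Longrightarrow> mem b (n - 1) y \<Longrightarrow> src y = src e \<Longrightarrow> loc_bdry b n z"
  unfolding loc_bdry_def by blast

lemma loc_bdry_bdry: "mem b (n - 1) y \<Longrightarrow> loc_bdry b n (snd K (n - 1) \<star> y)"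
  by (rule loc_bdryI[of n y _ "idt (src y)"]) (use K memD[of b "n - 1" y] in auto)

lemma loc_bdry_mono: "loc_bdry a n z \<Longrightarrow> a \<le> b \<Longrightarrow> loc_bdry b n z"
  unfolding loc_bdry_def using mem_mono by blast

lemma loc_bdry_local:
  assumes "loc_bdry b n (z \<star> e)" "epi e" "arr z" "tgt e = src z"
  shows "loc_bdry b n z"
proof -
  obtain e' y where e': "epi e'" "arr e'" "tgt e' = src (z \<star> e)" "mem b (n - 1) y" "arr y" "tgt y = fst K (n - 1)" "src y = src e'"
    "snd K (n - 1) \<star> y = (z \<star> e) \<star> e'" using assms(1) by (rule loc_bdryE)
  show ?thesis by (rule loc_bdryI[of n y z "e \<star> e'"]) (use e' assms epi_comp[of e' e] in auto)
qed

lemma loc_bdry_comp: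
  assumes "loc_bdry b n z" "arr z" "arr s" "tgt s = src z"
  shows "loc_bdry b n (z \<star> s)"
proof -
  obtain e y where e: "epi e" "arr e" "tgt e = src z" "mem b (n - 1) y" "arr y" "tgt y = fst K (n - 1)" "src y = src e"
    "snd K (n - 1) \<star> y = z \<star> e" using assms(1) by (rule loc_bdryE)
  have "cov e s" by (rule cov_epi[OF e(1)]) (use assms e in auto)
  then obtain f v where f: "epi f" "arr f" "tgt f = src s" "arr v" "src v = src f" "tgt v = src e" "e \<star> v = s \<star> f" by (rule covE)
  have "snd K (n - 1) \<star> (y \<star> v) = (z \<star> e) \<star> v" by (rule comp_reduce[OF e(8)]) (use e f K in auto)
  also have "\<dots> = z \<star> (e \<star> v)" by (rule assoc) (use e f assms in auto)
  also have "\<dots> = (z \<star> s) \<star> f" unfolding f(7) using f assms by simp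
  finally show ?thesis by (rule loc_bdryI) (use e f assms mem_comp in auto)
qed

lemma loc_bdry_plus:
  assumes "loc_bdry b n z" "loc_bdry b n w" "arr z" "arr w" "src z = src w" "tgt z = tgt w"
  shows "loc_bdry b n (z \<boxplus> w)"
proof -
  obtain e y where e: "epi e" "arr e" "tgt e = src z" "mem b (n - 1) y" "arr y" "tgt y = fst K (n - 1)" "src y = src e"
    "snd K (n - 1) \<star> y = z \<star> e" using assms(1) by (rule loc_bdryE)
  have "loc_bdry b n (w \<star> e)" by (rule loc_bdry_comp[OF assms(2)]) (use assms e in auto)
  then obtain f x where f: "epi f" "arr f" "tgt f = src (w \<star> e)" "mem b (n - 1) x" "arr x" "tgt x = fst K (n - 1)" "src x = src f"
    "snd K (n - 1) \<star> x = (w \<star> e) \<star> f" by (rule loc_bdryE)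
  have f3: "tgt f = src e" using f(3) e assms by simp
  have "snd K (n - 1) \<star> (y \<star> f) = (z \<star> e) \<star> f" by (rule comp_reduce[OF e(8)]) (use e f f3 K in auto)
  then have "snd K (n - 1) \<star> (y \<star> f \<boxplus> x) = (z \<star> e) \<star> f \<boxplus> (w \<star> e) \<star> f"
    using f e f3 K by (simp add: comp_plus del: assoc)
  also have "\<dots> = (z \<boxplus> w) \<star> (e \<star> f)" using e f f3 assms by (simp add: bilin)
  finally show ?thesis
    by (rule loc_bdryI) (use e f f3 assms mem_comp[OF e(4)] mem_plus epi_comp[of f e] in auto)
qed

lemma loc_bdry_neg: assumes "loc_bdry b n z" "arr z" shows "loc_bdry b n (neg z)"
proof -
  obtain e y where e: "epi e" "arr e" "tgt e = src z" "mem b (n - 1) y" "arr y" "tgt y = fst K (n - 1)" "src y = src e"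
    "snd K (n - 1) \<star> y = z \<star> e" using assms(1) by (rule loc_bdryE)
  have "snd K (n - 1) \<star> neg y = neg z \<star> e" using e assms K by (simp add: bilin)
  then show ?thesis by (rule loc_bdryI) (use e assms mem_neg in auto)
qed

lemma nul_dd: "arr x \<Longrightarrow> tgt x = fst K (n - 1) \<Longrightarrow> nul (snd K n \<star> (snd K (n - 1) \<star> x))"
  by (rule cpx_ddx[OF K]) auto

text \<open>An element of the kernel of \<open>pi\<close> can be corrected locally by a boundary so
  as to lie in the step \<open>a - 1\<close>, and this leaves its own boundary unchanged.\<close>

lemma loc_bdry_ker:
  assumes ab: "a \<le> b" and x: "mem b (n - 1) x" "nul (pi a b (n - 1) x)" "mem (a - 1) n (snd K (n - 1) \<star> x)"
  shows "loc_bdry (a - 1) n (snd K (n - 1) \<star> x)"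
proof -
  have "\<exists>e u. epi e \<and> tgt e = src x \<and> mem b (n - 1 - 1) u \<and> src u = src e \<and> nul (pi a b (n - 1 - 1) u) \<and>
        mem (a - 1) (n - 1) (x \<star> e \<boxminus> snd K (n - 1 - 1) \<star> u)"
    by (rule pi_ker) (use assms in auto)
  then obtain e u where e: "epi e" "tgt e = src x" "mem b (n - 1 - 1) u" "src u = src e"
    "mem (a - 1) (n - 1) (x \<star> e \<boxminus> snd K (n - 1 - 1) \<star> u)" by blast
  note u = memD[OF e(3)] and x' = memD[OF x(1)]
  have "nul (snd K (n - 1) \<star> (snd K (n - 1 - 1) \<star> u))" by (rule nul_dd) (use u in auto)
  then have "snd K (n - 1) \<star> (x \<star> e \<boxminus> snd K (n - 1 - 1) \<star> u) = (snd K (n - 1) \<star> x) \<star> e"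
    using u x' e K by (simp add: bilin)
  then show ?thesis by (rule loc_bdryI) (use e u x' K in auto)
qed

text \<open>A local primitive of the image of \<open>z\<close> lifts to the step \<open>b\<close>,
  and the boundary of the lift is subtracted. The difference lies in the kernel of
  \<open>pi\<close>, and a second boundary correction moves it to the step
  \<open>a - 1\<close>.\<close>

lemma cocycle_reduce:
  assumes ab: "a \<le> b" and z: "mem b n z" "nul (snd K n \<star> z)" "cov (snd (T a b) (n - 1)) (pi a b n z)"
  obtains e y where "epi e" "tgt e = src z" "mem b (n - 1) y" "src y = src e" "mem (a - 1) n (z \<star> e \<boxminus> snd K (n - 1) \<star> y)"
proof -
  note T = T[OF ab] and z' = memD[OF z(1)] and pz = pi_simps[OF ab z(1)]
  obtain e t where e: "epi e" "arr e" "tgt e = src (pi a b n z)" "arr t" "src t = src e" "tgt t = src (snd (T a b) (n - 1))"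
    "snd (T a b) (n - 1) \<star> t = pi a b n z \<star> e" using z(3) by (rule covE)
  have t: "tgt t = fst (T a b) (n - 1)" and e3: "tgt e = src z" using e T pz by auto
  obtain f y where f: "epi f" "tgt f = src t" "mem b (n - 1) y" "src y = src f" "pi a b (n - 1) y = t \<star> f"
    using pi_surj[OF ab e(4) t] by blast
  note y = memD[OF f(3)]
  have f2: "tgt f = src e" using f e by simp
  let ?w = "z \<star> (e \<star> f) \<boxminus> snd K (n - 1) \<star> y"
  have zm: "mem b n (z \<star> (e \<star> f))" by (rule mem_comp[OF z(1)]) (use e f f2 e3 in auto)
  have dy: "mem b n (snd K (n - 1) \<star> y)" by (rule mem_d'[OF f(3)])
  have s: "src (z \<star> (e \<star> f)) = src (snd K (n - 1) \<star> y)" using z' e f f2 e3 y K by simp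
  have w: "mem b n ?w" by (rule mem_minus[OF zm dy s])
  have "pi a b n ?w = pi a b n z \<star> (e \<star> f) \<boxminus> snd (T a b) (n - 1) \<star> (t \<star> f)"
    using pi_minus[OF ab zm dy s] pi_comp[OF ab z(1), of "e \<star> f"] pi_d'[OF ab f(3)] f e f2 e3 by simp
  also have "snd (T a b) (n - 1) \<star> (t \<star> f) = (pi a b n z \<star> e) \<star> f"
    by (rule comp_reduce[OF e(7)]) (use e f f2 T t in auto)
  also have "pi a b n z \<star> (e \<star> f) \<boxminus> \<dots> = zr (src f) (fst (T a b) n)"
    using e f f2 e3 pz by simp
  finally have pw: "nul (pi a b n ?w)" using f T by simp
  have "nul (snd K n \<star> (z \<star> (e \<star> f)))"
  proof -
    have "nul ((snd K n \<star> z) \<star> (e \<star> f))" by (rule comp_nul[OF z(2)]) (use z' e f f2 e3 K in auto)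
    then show ?thesis using z' e f f2 e3 K by simp
  qed
  moreover have "nul (snd K n \<star> (snd K (n - 1) \<star> y))" by (rule nul_dd) (use y in auto)
  ultimately have "nul (snd K n \<star> ?w)" using z' e f f2 e3 y K by (simp add: bilin)
  then have "mem (a - 1) (n + 1) (snd K n \<star> ?w)" by (rule mem_nul) (use memD[OF w] K in auto)
  then obtain g u where g: "epi g" "tgt g = src ?w" "mem b (n - 1) u" "src u = src g"
    "mem (a - 1) n (?w \<star> g \<boxminus> snd K (n - 1) \<star> u)" using pi_ker[OF ab w pw] by blast
  note u = memD[OF g(3)]
  have g2: "tgt g = src f" using g z' e f f2 e3 y K by simp
  have "?w \<star> g \<boxminus> snd K (n - 1) \<star> u = z \<star> (e \<star> f \<star> g) \<boxminus> snd K (n - 1) \<star> (y \<star> g \<boxplus> u)"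
    using z' e f f2 e3 y K g(1,4) g2 u by (simp add: bilin add_assoc)
  moreover have "mem b (n - 1) (y \<star> g \<boxplus> u)"
    by (rule mem_plus[OF mem_comp[OF f(3)] g(3)]) (use g g2 f y in auto)
  ultimately show thesis using that[of "e \<star> f \<star> g" "y \<star> g \<boxplus> u"] g(1,4,5) g2 f(1,4) e(1) e3 f2 y u
    epi_comp[of f e] epi_comp[of g "e \<star> f"] by simp
qed

text \<open>
  The cocycle \<open>z\<close> represents a map from the kernel \<open>karr w m\<close>, presented as a quotient by \<open>e\<close>, to
  the cohomology of the step \<open>b\<close>. \<open>Q b n\<close> says that all such maps vanish for \<open>w > b\<close>.
\<close>

definition Q :: "int \<Rightarrow> int \<Rightarrow> bool" where
  "Q b n \<longleftrightarrow> (\<forall>w>b. \<forall>m e z. epi e \<and> tgt e = src (karr w m) \<and> mem b n z \<and> src z = src e \<and> nul (snd K n \<star> z) \<and>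
     (\<forall>s. arr s \<and> tgt s = src e \<and> nul (e \<star> s) \<longrightarrow> loc_bdry b n (z \<star> s)) \<longrightarrow> loc_bdry b n z)"

text \<open>
  The boundary of \<open>x0\<close> in the cohomology of the step \<open>b - 1\<close> depends only on \<open>pi b b (n - 1) x0\<close>, so
  the universal case is that of the kernel of weight \<open>b\<close>.
\<close>

lemma mono_step:
  assumes Q: "Q (b - 1) n" and x0: "mem b (n - 1) x0" "mem (b - 1) n (snd K (n - 1) \<star> x0)"
  shows "loc_bdry (b - 1) n (snd K (n - 1) \<star> x0)"
proof -
  have bb: "b \<le> b" by simp
  note T = T[OF bb] and x0' = memD[OF x0(1)] and px0 = pi_simps[OF bb x0(1)]
  let ?k = "karr b (n - 1)"
  note k = karr(1-3)[of b "n - 1"]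
  have "nul (snd (T b b) (n - 1) \<star> pi b b (n - 1) x0)"
    using pi_low[OF bb x0(2)] pi_d'[OF bb x0(1)] by simp
  then have "factors ?k (pi b b (n - 1) x0)" using px0 by (intro karr(4)) auto
  then obtain s0 where s0: "arr s0" "src s0 = src (pi b b (n - 1) x0)" "tgt s0 = src ?k" "?k \<star> s0 = pi b b (n - 1) x0" by (rule factorsE)
  obtain e x where e: "epi e" "tgt e = src ?k" "mem b (n - 1) x" "src x = src e" "pi b b (n - 1) x = ?k \<star> e"
    using pi_surj[OF bb k(1,2)] by blast
  note x = memD[OF e(3)]
  have "nul ((snd (T b b) (n - 1) \<star> ?k) \<star> e)" by (rule comp_nul[OF k(3)]) (use k e T in auto)
  then have "nul (pi b b n (snd K (n - 1) \<star> x))" using pi_d'[OF bb e(3)] e k T by simp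
  moreover have "mem (b - 1) (n + 1) (snd K n \<star> (snd K (n - 1) \<star> x))"
    by (rule mem_nul[OF nul_dd]) (use x K in auto)
  ultimately obtain e1 u where e1: "epi e1" "tgt e1 = src (snd K (n - 1) \<star> x)" "mem b (n - 1) u" "src u = src e1"
    "nul (pi b b (n - 1) u)" "mem (b - 1) n ((snd K (n - 1) \<star> x) \<star> e1 \<boxminus> snd K (n - 1) \<star> u)"
    using pi_ker[OF bb mem_d'[OF e(3)]] by blast
  note u = memD[OF e1(3)]
  have e12: "tgt e1 = src e" using e1(2) x e K by simp
  have xe1: "mem b (n - 1) (x \<star> e1)" by (rule mem_comp[OF e(3)]) (use e1 e12 e in auto)
  \<comment> \<open>As \<open>u\<close> is killed by \<open>pi\<close>, the correction keeps the
    image under \<open>pi\<close> and makes the boundary fall into the step \<open>b - 1\<close>.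
    The boundary of \<open>x'\<close> is the universal cocycle, on the cover \<open>e'\<close> of
    the kernel.\<close>
  define x' where "x' = x \<star> e1 \<boxminus> u"
  define e' where "e' = e \<star> e1"
  have su: "src (x \<star> e1) = src u" using x e1 e12 e by simp
  have e': "epi e'" "arr e'" "tgt e' = src ?k" "src e' = src e1" using e(1,2) e1(1) e12 epi_comp[of e1 e] by (auto simp: e'_def)
  have x'm: "mem b (n - 1) x'" unfolding x'_def by (rule mem_minus[OF xe1 e1(3) su])
  have x't: "arr x'" "tgt x' = fst K (n - 1)" "src x' = src e1" using memD[OF x'm] su u e1(1,3,4) e12 x e(1,2,4) by (auto simp: x'_def)
  have px': "pi b b (n - 1) x' = ?k \<star> e'"
    unfolding x'_def e'_def using pi_minus[OF bb xe1 e1(3) su] pi_comp[OF bb e(3), of e1] pi_simps[OF bb e1(3)] e1 e12 e k by simp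
  have dx': "mem (b - 1) n (snd K (n - 1) \<star> x')"
    using e1(6) x u e1 e12 e K unfolding x'_def by (simp add: bilin)
  have z: "loc_bdry (b - 1) n (snd K (n - 1) \<star> x')"
  proof -
    \<comment> \<open>On the kernel of the cover the element \<open>x'\<close> is killed by
      \<open>pi\<close>, so its boundary has a primitive in the step \<open>b - 1\<close>. Hence the
      boundary of \<open>x'\<close> defines a map on the kernel of weight \<open>b\<close>.\<close>
    have "loc_bdry (b - 1) n ((snd K (n - 1) \<star> x') \<star> s)" if s: "arr s" "tgt s = src e'" "nul (e' \<star> s)" for s
    proof -
      have "loc_bdry (b - 1) n (snd K (n - 1) \<star> (x' \<star> s))"
      proof (rule loc_bdry_ker[OF bb])
        show "mem b (n - 1) (x' \<star> s)" by (rule mem_comp[OF x'm]) (use s x't e' in auto)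
        have "pi b b (n - 1) (x' \<star> s) = ?k \<star> (e' \<star> s)" using pi_comp[OF bb x'm, of s] s x't e' k px' by simp
        then show "nul (pi b b (n - 1) (x' \<star> s))" using s e' k by simp
        have "mem (b - 1) n ((snd K (n - 1) \<star> x') \<star> s)" by (rule mem_comp[OF dx']) (use s x't e' K in auto)
        then show "mem (b - 1) n (snd K (n - 1) \<star> (x' \<star> s))" using s x't e' K by simp
      qed
      then show ?thesis using s x't e' K by simp
    qed
    moreover have "nul (snd K n \<star> (snd K (n - 1) \<star> x'))" by (rule nul_dd) (use x't in auto)
    moreover have "src (snd K (n - 1) \<star> x') = src e'" using x't e' K by simp
    \<comment> \<open>The weight \<open>b\<close> is the first one to which
      \<open>Q (b - 1) n\<close> applies.\<close>
    moreover have "b > b - 1" by simp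
    ultimately show ?thesis using Q e'(1,3) dx' unfolding Q_def by blast
  qed
  have "cov e' s0" by (rule cov_epi[OF e'(1)]) (use s0 e' in auto)
  then obtain f v where f: "epi f" "arr f" "tgt f = src s0" "arr v" "src v = src f" "tgt v = src e'" "e' \<star> v = s0 \<star> f" by (rule covE)
  have f3: "tgt f = src x0" using f s0 px0 by simp
  have a1: "mem b (n - 1) (x0 \<star> f)" by (rule mem_comp[OF x0(1)]) (use f f3 in auto)
  have a2: "mem b (n - 1) (x' \<star> v)" by (rule mem_comp[OF x'm]) (use f x't e' in auto)
  have a3: "src (x0 \<star> f) = src (x' \<star> v)" using f f3 x0' x't e' by simp
  \<comment> \<open>Locally \<open>x0\<close> and the pullback of \<open>x'\<close> along
    \<open>v\<close> have the same image under \<open>pi\<close>, so their boundaries differ by a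
    boundary from the step \<open>b - 1\<close>.\<close>
  let ?y = "x0 \<star> f \<boxminus> x' \<star> v"
  have dyeq: "snd K (n - 1) \<star> ?y = (snd K (n - 1) \<star> x0) \<star> f \<boxminus> (snd K (n - 1) \<star> x') \<star> v"
    using f f3 x0' x't e' K by (simp add: bilin)
  have "loc_bdry (b - 1) n (snd K (n - 1) \<star> ?y)"
  proof (rule loc_bdry_ker[OF bb])
    show "mem b (n - 1) ?y" by (rule mem_minus[OF a1 a2 a3])
    have "pi b b (n - 1) ?y = pi b b (n - 1) x0 \<star> f \<boxminus> (?k \<star> e') \<star> v"
      using pi_minus[OF bb a1 a2 a3] pi_comp[OF bb x0(1), of f] pi_comp[OF bb x'm, of v] px' f f3 x't e' by simp
    also have "(?k \<star> e') \<star> v = ?k \<star> (e' \<star> v)" by (rule assoc) (use k e' f in auto)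
    also have "\<dots> = (?k \<star> s0) \<star> f" unfolding f(7) using k s0(1-3) f(2,3) by simp
    also have "\<dots> = pi b b (n - 1) x0 \<star> f" by (simp only: s0(4))
    finally show "nul (pi b b (n - 1) ?y)" using px0 f f3 T by simp
    show "mem (b - 1) n (snd K (n - 1) \<star> ?y)" unfolding dyeq
      by (rule mem_minus[OF mem_comp[OF x0(2)] mem_comp[OF dx']]) (use f f3 x0' x't e' K in auto)
  qed
  moreover have "loc_bdry (b - 1) n ((snd K (n - 1) \<star> x') \<star> v)" by (rule loc_bdry_comp[OF z]) (use f x't e' K in auto)
  ultimately have "loc_bdry (b - 1) n (snd K (n - 1) \<star> ?y \<boxplus> (snd K (n - 1) \<star> x') \<star> v)"
    by (rule loc_bdry_plus) (use f f3 x0' x't e' K in auto)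
  moreover have "snd K (n - 1) \<star> ?y \<boxplus> (snd K (n - 1) \<star> x') \<star> v = (snd K (n - 1) \<star> x0) \<star> f"
    unfolding dyeq by (rule minus_add_cancel) (use f f3 x0' x't e' K in auto)
  ultimately have "loc_bdry (b - 1) n ((snd K (n - 1) \<star> x0) \<star> f)" by simp
  then show ?thesis by (rule loc_bdry_local) (use f f3 x0' K in auto)
qed

text \<open>
  The image of \<open>z\<close> in the cohomology of weight \<open>b\<close> induces a map from a kernel of weight \<open>w\<close> to a
  cokernel of weight \<open>b\<close>, which is zero. So \<open>z\<close> can be moved to the step \<open>b - 1\<close> locally.
\<close>

lemma Q_step:
  assumes Q: "Q (b - 1) n"
  shows "Q b n"
  unfolding Q_def
proof (intro allI impI, elim conjE)
  have bb: "b \<le> b" by simp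
  note T = T[OF bb]
  fix w m e z
  assume w: "b < w" and e: "epi e" "tgt e = src (karr w m)" and z: "mem b n z" "src z = src e" "nul (snd K n \<star> z)"
    and h: "\<forall>s. arr s \<and> tgt s = src e \<and> nul (e \<star> s) \<longrightarrow> loc_bdry b n (z \<star> s)"
  note z' = memD[OF z(1)] and pz = pi_simps[OF bb z(1)] and c = larr(1-3)[of b n]
  let ?c = "larr b n"
  \<comment> \<open>On the kernel of \<open>e\<close> the cocycle is locally a boundary from the
    step \<open>b\<close>, and \<open>?c\<close> kills boundaries; so the composite descends along
    \<open>e\<close> to an arrow on the kernel of weight \<open>w\<close>.\<close>
  have "cofactors e (?c \<star> pi b b n z)"
  proof (rule epi_cofactor[OF e(1)])
    fix s assume s: "arr s" "tgt s = src e" "nul (e \<star> s)"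
    then have "loc_bdry b n (z \<star> s)" using h by blast
    then obtain e1 y where e1: "epi e1" "arr e1" "tgt e1 = src (z \<star> s)" "mem b (n - 1) y" "arr y" "tgt y = fst K (n - 1)" "src y = src e1"
      "snd K (n - 1) \<star> y = (z \<star> s) \<star> e1" by (rule loc_bdryE)
    have e13: "tgt e1 = src s" using e1 s z z' by simp
    have zs: "mem b n (z \<star> s)" by (rule mem_comp[OF z(1)]) (use s z in auto)
    have "pi b b n ((z \<star> s) \<star> e1) = (pi b b n z \<star> s) \<star> e1"
      using pi_comp[OF bb zs e1(2,3)] pi_comp[OF bb z(1) s(1)] s z by simp
    then have "snd (T b b) (n - 1) \<star> pi b b (n - 1) y = (pi b b n z \<star> s) \<star> e1"
      using pi_d'[OF bb e1(4)] e1(8) by simp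
    moreover have "nul ((?c \<star> snd (T b b) (n - 1)) \<star> pi b b (n - 1) y)"
      by (rule comp_nul[OF c(3)]) (use c T pi_simps[OF bb e1(4)] in auto)
    moreover have "(?c \<star> snd (T b b) (n - 1)) \<star> pi b b (n - 1) y = ?c \<star> (snd (T b b) (n - 1) \<star> pi b b (n - 1) y)"
      by (rule assoc) (use c T pi_simps[OF bb e1(4)] in auto)
    ultimately have "nul (?c \<star> ((pi b b n z \<star> s) \<star> e1))" by simp
    then have "nul (((?c \<star> pi b b n z) \<star> s) \<star> e1)" using c pz s z e1 e13 by simp
    then show "nul ((?c \<star> pi b b n z) \<star> s)" by (rule epi_nul[OF e1(1)]) (use c pz s z e13 in auto)
  qed (use c pz z in auto)
  then obtain \<phi> where \<phi>: "arr \<phi>" "src \<phi> = tgt e" "tgt \<phi> = tgt (?c \<star> pi b b n z)" "\<phi> \<star> e = ?c \<star> pi b b n z" by (rule cofactorsE)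
  have "nul \<phi>" by (rule weights[of w b]) (use \<phi> e w c pz in auto)
  then have "nul (\<phi> \<star> e)" by (rule comp_nul) (use \<phi>(1,2) e in auto)
  then have "nul (?c \<star> pi b b n z)" by (simp only: \<phi>(4))
  then have "cov (snd (T b b) (n - 1)) (pi b b n z)" using pz by (intro larr(4)) auto
  then obtain f y where f: "epi f" "tgt f = src z" "mem b (n - 1) y" "src y = src f" "mem (b - 1) n (z \<star> f \<boxminus> snd K (n - 1) \<star> y)"
    using cocycle_reduce[OF bb z(1,3)] by blast
  note y = memD[OF f(3)]
  define z2 where "z2 = z \<star> f \<boxminus> snd K (n - 1) \<star> y"
  have z2: "mem (b - 1) n z2" "arr z2" "src z2 = src f" "tgt z2 = fst K n"
    using f(5) f z' y K by (auto simp: z2_def)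
  have "nul ((snd K n \<star> z) \<star> f)" by (rule comp_nul[OF z(3)]) (use z' f K in auto)
  then have "nul (snd K n \<star> (z \<star> f))" using z' f K by simp
  moreover have "nul (snd K n \<star> (snd K (n - 1) \<star> y))" by (rule nul_dd) (use y in auto)
  ultimately have dz2: "nul (snd K n \<star> z2)" unfolding z2_def using z' f y K by (simp add: bilin)
  have "loc_bdry (b - 1) n (z2 \<star> s)" if s: "arr s" "tgt s = src (e \<star> f)" "nul ((e \<star> f) \<star> s)" for s
  proof -
    have ts: "tgt s = src f" "tgt f = src e" using s f e z by auto
    have "loc_bdry b n (z \<star> (f \<star> s))" using h s ts f e by simp
    moreover have "loc_bdry b n (snd K (n - 1) \<star> (y \<star> s))" by (rule loc_bdry_bdry[OF mem_comp[OF f(3)]]) (use s ts f in auto)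
    then have "loc_bdry b n (neg (snd K (n - 1) \<star> (y \<star> s)))" by (rule loc_bdry_neg) (use s ts f y K in auto)
    ultimately have "loc_bdry b n (z \<star> (f \<star> s) \<boxminus> snd K (n - 1) \<star> (y \<star> s))"
      by (rule loc_bdry_plus) (use s ts f y z' K in auto)
    then have "loc_bdry b n (z2 \<star> s)" unfolding z2_def using s ts f y z' K by (simp add: bilin)
    then obtain e4 v where e4: "epi e4" "arr e4" "tgt e4 = src (z2 \<star> s)" "mem b (n - 1) v" "arr v" "tgt v = fst K (n - 1)" "src v = src e4"
      "snd K (n - 1) \<star> v = (z2 \<star> s) \<star> e4" by (rule loc_bdryE)
    \<comment> \<open>On the kernel of the cover the reduced cocycle is so far a boundary from the
      step \<open>b\<close>. As it lies in the step \<open>b - 1\<close>, \<open>mono_step\<close>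
      provides a primitive there.\<close>
    have "mem (b - 1) n (snd K (n - 1) \<star> v)" unfolding e4(8)
      by (rule mem_comp[OF mem_comp[OF z2(1)]]) (use s ts z2 e4 in auto)
    from mono_step[OF Q e4(4) this] have "loc_bdry (b - 1) n ((z2 \<star> s) \<star> e4)" by (simp only: e4(8))
    then show ?thesis by (rule loc_bdry_local) (use e4 s ts z2 in auto)
  qed
  moreover have "epi (e \<star> f)" "tgt (e \<star> f) = src (karr w m)" "src z2 = src (e \<star> f)" "w > b - 1"
    using epi_comp[of f e] e f z z2 w by auto
  ultimately have "loc_bdry (b - 1) n z2" using Q z2(1) dz2 unfolding Q_def by blast
  then have "loc_bdry b n z2" by (rule loc_bdry_mono) simp
  then have "loc_bdry b n (z2 \<boxplus> snd K (n - 1) \<star> y)"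
    using loc_bdry_bdry[OF f(3)] by (rule loc_bdry_plus) (use z2 y f K in auto)
  moreover have "z2 \<boxplus> snd K (n - 1) \<star> y = z \<star> f" unfolding z2_def by (rule minus_add_cancel) (use z' y f K in auto)
  ultimately have "loc_bdry b n (z \<star> f)" by simp
  then show "loc_bdry b n z" by (rule loc_bdry_local) (use f z' in auto)
qed

lemma loc_bdry_nul: assumes "nul z" "arr z" "tgt z = fst K n" shows "loc_bdry b n z"
proof (rule loc_bdryI)
  show "mem b (n - 1) (zr (src z) (fst K (n - 1)))" by (rule mem_nul) (use assms K in auto)
  show "snd K (n - 1) \<star> zr (src z) (fst K (n - 1)) = z \<star> idt (src z)"
    using assms K nul_eq[OF assms(1) refl assms(3)] by simp
qed (use assms K in auto)

text \<open>For small \<open>b\<close> the step is zero in degree \<open>n\<close>, so the statement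
  is trivial there, and \<open>Q_step\<close> climbs from that point.\<close>

lemma Q_all: "Q b n"
proof -
  obtain B where B: "\<And>b x. b \<le> B \<Longrightarrow> mem b n x \<Longrightarrow> nul x" using mem_low by blast
  have low: "Q b n" if "b \<le> B" for b
    unfolding Q_def using B[OF that] loc_bdry_nul memD by blast
  show ?thesis
  proof (cases "b \<le> B")
    case False
    then have "B \<le> b" by simp
    then show ?thesis
    proof (induction rule: int_ge_induct)
      case (step i)
      then show ?case using Q_step[of "i + 1" n] by simp
    qed (use low in simp)
  qed (use low in simp)
qed

text \<open>In a fixed degree the filtration is exhaustive, so \<open>x\<close> lies in some step
  \<open>b + k\<close>. By \<open>mono_step\<close>, one step at a time, its boundary acquires a
  primitive in a smaller step, until the step \<open>b\<close> is reached.\<close>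

lemma strict:
  assumes "arr x" "tgt x = fst K (n - 1)" "mem b n (snd K (n - 1) \<star> x)"
  shows "loc_bdry b n (snd K (n - 1) \<star> x)"
proof -
  have *: "loc_bdry b n (snd K (n - 1) \<star> x)" if "mem (b + int k) (n - 1) x" "mem b n (snd K (n - 1) \<star> x)" for k x
    using that
  proof (induction k arbitrary: x)
    case 0
    then show ?case using loc_bdry_bdry by simp
  next
    case (Suc k)
    note x = memD[OF Suc.prems(1)]
    have "loc_bdry (b + int (Suc k) - 1) n (snd K (n - 1) \<star> x)"
      by (rule mono_step[OF Q_all Suc.prems(1)]) (rule mem_mono[OF Suc.prems(2)], simp)
    then obtain e y where e: "epi e" "arr e" "tgt e = src (snd K (n - 1) \<star> x)" "mem (b + int (Suc k) - 1) (n - 1) y" "arr y"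
      "tgt y = fst K (n - 1)" "src y = src e" "snd K (n - 1) \<star> y = (snd K (n - 1) \<star> x) \<star> e" by (rule loc_bdryE)
    have "loc_bdry b n (snd K (n - 1) \<star> y)"
    proof (rule Suc.IH)
      show "mem (b + int k) (n - 1) y" using e(4) by simp
      show "mem b n (snd K (n - 1) \<star> y)" unfolding e(8) by (rule mem_comp[OF Suc.prems(2)]) (use e in auto)
    qed
    then show ?case unfolding e(8) by (rule loc_bdry_local) (use e x K in auto)
  qed
  obtain B where B: "\<And>b x. b \<ge> B \<Longrightarrow> arr x \<Longrightarrow> tgt x = fst K (n - 1) \<Longrightarrow> mem b (n - 1) x" using mem_high by blast
  have "mem (b + int (nat (B - b))) (n - 1) x" by (rule B) (use assms in auto)
  then show ?thesis using * assms(3) by blast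
qed

text \<open>A lift \<open>x\<close> of \<open>t\<close> has its boundary in the kernel of
  \<open>pi\<close>. Subtracting \<open>u\<close> pushes that boundary into the step
  \<open>a - 1\<close>, and by strictness it is then locally the boundary of some \<open>v\<close>
  in this step; the difference is a cocycle with the same image. Strictness is what makes the
  connecting map vanish here.\<close>

lemma pi_cocycle_surj:
  assumes ab: "a \<le> b" and t: "arr t" "tgt t = fst (T a b) n" "nul (snd (T a b) n \<star> t)"
  obtains e z where "epi e" "tgt e = src t" "mem b n z" "src z = src e" "nul (snd K n \<star> z)" "pi a b n z = t \<star> e"
proof -
  note T = T[OF ab]
  obtain e x where e: "epi e" "tgt e = src t" "mem b n x" "src x = src e" "pi a b n x = t \<star> e"
    using pi_surj[OF ab t(1,2)] by blast
  note x = memD[OF e(3)]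
  have n1: "n + 1 - 1 = n" by simp
  have dx: "mem b (n + 1) (snd K n \<star> x)" by (rule mem_d[OF e(3)])
  have "nul ((snd (T a b) n \<star> t) \<star> e)" by (rule comp_nul[OF t(3)]) (use t e T in auto)
  then have "nul (pi a b (n + 1) (snd K n \<star> x))" using pi_d[OF ab e(3)] e t T by simp
  moreover have "mem (a - 1) (n + 1 + 1) (snd K (n + 1) \<star> (snd K n \<star> x))"
    by (rule mem_nul[OF cpx_ddx[OF K]]) (use x K in auto)
  ultimately obtain f u where f: "epi f" "tgt f = src (snd K n \<star> x)" "mem b n u" "src u = src f" "nul (pi a b n u)"
    "mem (a - 1) (n + 1) ((snd K n \<star> x) \<star> f \<boxminus> snd K n \<star> u)"
    using pi_ker[OF ab dx] unfolding n1 by blast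
  note u = memD[OF f(3)]
  have f2: "tgt f = src e" using f x e K by simp
  define y where "y = x \<star> f \<boxminus> u"
  have xf: "mem b n (x \<star> f)" by (rule mem_comp[OF e(3)]) (use f f2 e in auto)
  have su: "src (x \<star> f) = src u" using x f f2 e by simp
  have y: "mem b n y" "arr y" "tgt y = fst K n" "src y = src f"
    using mem_minus[OF xf f(3) su] su memD[OF xf] u f by (auto simp: y_def)
  have py: "pi a b n y = t \<star> (e \<star> f)"
    unfolding y_def using pi_minus[OF ab xf f(3) su] pi_comp[OF ab e(3), of f] pi_simps[OF ab f(3)] f e f2 t by simp
  have "mem (a - 1) (n + 1) (snd K n \<star> y)" using f(6) x u f e f2 K unfolding y_def by (simp add: bilin)
  then have "loc_bdry (a - 1) (n + 1) (snd K n \<star> y)" using strict[of y "n + 1" "a - 1"] y by simp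
  then obtain g v where g: "epi g" "arr g" "tgt g = src (snd K n \<star> y)" "mem (a - 1) n v" "arr v"
      "tgt v = fst K n" "src v = src g" "snd K n \<star> v = (snd K n \<star> y) \<star> g" unfolding loc_bdry_def n1 using memD epi_arr by blast
  have g3: "tgt g = src f" using g y K by simp
  have yg: "mem b n (y \<star> g)" by (rule mem_comp[OF y(1)]) (use g g3 y in auto)
  have vb: "mem b n v" by (rule mem_mono[OF g(4)]) (use ab in simp)
  have sv: "src (y \<star> g) = src v" using y g g3 by simp
  show thesis
  proof (rule that[of "e \<star> f \<star> g" "y \<star> g \<boxminus> v"])
    show "epi (e \<star> f \<star> g)" using epi_comp[of f e] epi_comp[of g "e \<star> f"] e f f2 g g3 by simp
    show "mem b n (y \<star> g \<boxminus> v)" by (rule mem_minus[OF yg vb sv])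
    have "pi a b n (y \<star> g \<boxminus> v) = pi a b n y \<star> g"
      using pi_minus[OF ab yg vb sv] pi_comp[OF ab y(1), of g] pi_low[OF ab g(4)] pi_simps[OF ab vb] pi_simps[OF ab y(1)] g g3 y by simp
    then show "pi a b n (y \<star> g \<boxminus> v) = t \<star> (e \<star> f \<star> g)" using py e f f2 g g3 t by simp
    have "snd K n \<star> (y \<star> g \<boxminus> v) = (snd K n \<star> y) \<star> g \<boxminus> snd K n \<star> v" using y g g3 K by (simp add: bilin)
    then show "nul (snd K n \<star> (y \<star> g \<boxminus> v))" unfolding g(8) using y g g3 K by simp
  qed (use e f f2 g g3 y in auto)
qed

end

context cpx_functor
begin

lemma zero_obj_nul:
  assumes "P \<in> dg_obj C" "dg_zero_obj C P"
  shows "nul (idt (fst (fun_obj F P) n))"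
proof -
  have "idt (fst (fun_obj F P) n) = zr (fst (fun_obj F P) n) (fst (fun_obj F P) (n + 0))"
    using Fid[OF assms(1), of n] Fone[OF assms(1,1), of 0 n] assms(2) unfolding dg_zero_obj_def by simp
  then show ?thesis using Fobj[OF assms(1)] by simp
qed

end

subsection \<open>The filtration of the total complex\<close>

text \<open>Morphisms of degree 0 take the place of finite correspondences, so that the chase runs
  over a general \<open>C\<close> without morphisms of positive degree.\<close>

locale weight_functor = nonpos_functor +
  assumes no_maps: "\<lbrakk>P \<in> dg_obj C; P' \<in> dg_obj C; Q \<in> dg_obj C; Q' \<in> dg_obj C;
    f \<in> carrier (dg_hom C 0 P P'); g \<in> carrier (dg_hom C 0 Q Q'); w \<noteq> w'; arr \<phi>;
    src \<phi> = src (ker (cohom_map A w (fun_obj F P') (fun_obj F P) (fun_hom F 0 P P' f)));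
    tgt \<phi> = tgt (cok (cohom_map A w' (fun_obj F Q') (fun_obj F Q) (fun_hom F 0 Q Q' g)))\<rbrakk> \<Longrightarrow> nul \<phi>"

locale tw_nonpos = nonpos_functor A C F for A :: "('o, 'a) addcat" (structure) and C :: "('c, 'm) dgcat" and F +
  fixes X :: "('c, 'm) twisted"
  assumes X: "twisted_complex C X"
begin

abbreviation obX where "obX i \<equiv> fun_obj F (fst X i)"

lemma obX_cpx [simp]: "cpx (obX i)"
  by (rule Fobj[OF twistedD(1)[OF X]])

end

text \<open>The prefixes \<open>L\<close> and \<open>R\<close> stand for the truncated functors
  whose totals are G_b X and the models of its quotients, \<open>I\<close> for the inclusion of G_b
  X in G X, and \<open>P\<close> for the projection to those models, for all values of the
  bounds.\<close>

sublocale tw_nonpos \<subseteq> L: nonpos_functor A C "fun_le A b F" for b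
  by (rule fun_le_nonpos)

sublocale tw_nonpos \<subseteq> R: nonpos_functor A C "fun_trunc A a b F" for a b
  by (rule fun_trunc_nonpos)

sublocale tw_nonpos \<subseteq> I: tot_nat A C "fun_le A b F" F "\<lambda>P. trunc_le_incl A b (fun_obj F P)" for b
  by (intro tot_nat.intro tot_nat_axioms.intro abelian_axioms L.cpx_functor_axioms cpx_functor_axioms fun_le_nat)

sublocale tw_nonpos \<subseteq> P: tot_nat A C "fun_le A b F" "fun_trunc A a b F" "\<lambda>P. trunc_ge_proj A a (fun_obj (fun_le A b F) P)" for a b
  by (intro tot_nat.intro tot_nat_axioms.intro abelian_axioms L.cpx_functor_axioms R.cpx_functor_axioms fun_trunc_nat)

context tw_nonpos
begin

abbreviation Kc where "Kc \<equiv> tt X"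
abbreviation Gc where "Gc b \<equiv> L.tt b X"
abbreviation Tc where "Tc a b \<equiv> R.tt a b X"
abbreviation inc where "inc b n \<equiv> I.tr b X n"
abbreviation prj where "prj a b n \<equiv> P.tr b a X n"
abbreviation cmp where "cmp n i x \<equiv> sprj (su X) (ts X n) i \<star> x"
abbreviation sI where "sI \<equiv> su X"

lemma fin: "finite sI"
  by (rule twistedD(2)[OF X])

lemmas Kcpx [simp] = tt_cpx[OF X] and Gcpx [simp] = L.tt_cpx[OF X] and Tcpx [simp] = R.tt_cpx[OF X]

lemma Kfst: "fst Kc n = dsum sI (ts X n)"
  by (rule tt_simps[OF X])

lemmas objs_ts = ts_objs[OF X] and objs_L = L.ts_objs[OF X] and objs_R = R.ts_objs[OF X]

lemma cmp_simps [simp]: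
  assumes "i \<in> sI" "arr x" "tgt x = fst Kc n"
  shows "arr (cmp n i x)" "src (cmp n i x) = src x" "tgt (cmp n i x) = ts X n i"
  using assms objs_ts[of n] by (simp_all add: Kfst)

lemma ts_eq: "ts X n i = fst (obX i) (n + i)"
  by (simp add: tot_summand_def)

lemma incI [simp]: "arr (inc b n)" "src (inc b n) = fst (Gc b) n" "tgt (inc b n) = fst Kc n"
  using I.tr_simps(1-3)[OF X] by auto

lemma prjI [simp]: "arr (prj a b n)" "src (prj a b n) = fst (Gc b) n" "tgt (prj a b n) = fst (Tc a b) n"
  using P.tr_simps(1-3)[OF X] by auto

lemma inc_cmap: "cmap (Gc b) Kc (inc b)"
  by (rule I.tr_cmap[OF X])

lemma prj_cmap: "cmap (Gc b) (Tc a b) (prj a b)"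
  by (rule P.tr_cmap[OF X])

lemma cmp_inc:
  assumes "i \<in> sI" "arr y" "tgt y = fst (Gc b) n"
  shows "cmp n i (inc b n \<star> y) = tli b (obX i) (n + i) \<star> (sprj sI (L.ts b X n) i \<star> y)"
  by (rule I.tr_simps(4)[OF X assms])

lemma Lcmp_simps [simp]:
  assumes "i \<in> sI" "arr y" "tgt y = fst (Gc b) n"
  shows "arr (sprj sI (L.ts b X n) i \<star> y)" "src (sprj sI (L.ts b X n) i \<star> y) = src y"
    "tgt (sprj sI (L.ts b X n) i \<star> y) = src (tli b (obX i) (n + i))"
  using assms objs_L[of b n] by (simp_all add: L.tt_simps[OF X]) (simp add: tot_summand_def fun_le_def trunc_le_def)

lemma mono_inc [simp]: "mono (inc b n)"
proof (rule monoI)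
  fix y assume y: "arr y" "tgt y = src (inc b n)" "nul (inc b n \<star> y)"
  show "nul y"
  proof (rule dsum_nulI[OF objs_L[of b n]])
    fix i assume i: "i \<in> sI"
    have "nul (cmp n i (inc b n \<star> y))" by (rule nul_comp[OF y(3)]) (use y i objs_ts Kfst in auto)
    then have "nul (tli b (obX i) (n + i) \<star> (sprj sI (L.ts b X n) i \<star> y))" using cmp_inc[OF i] y by simp
    then show "nul (sprj sI (L.ts b X n) i \<star> y)" by (rule mono_nul[rotated]) (use y i in auto)
  qed (use y L.tt_simps[OF X] in auto)
qed simp

section \<open>Generalised elements of the steps and their images in the truncations\<close>

definition mem :: "int \<Rightarrow> int \<Rightarrow> 'a \<Rightarrow> bool" where
  "mem b n x \<longleftrightarrow> arr x \<and> tgt x = fst Kc n \<and> factors (inc b n) x"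

definition pi :: "int \<Rightarrow> int \<Rightarrow> int \<Rightarrow> 'a \<Rightarrow> 'a" where
  "pi a b n x = prj a b n \<star> lift_arr A (inc b n) x"

text \<open>The inclusion is a diagonal matrix, so a lift is the tuple of lifts of the components,
  and each component is governed by \<open>factors_tli\<close> in its internal degree
  \<open>n + i\<close>.\<close>

lemma mem_iff:
  assumes "arr x" "tgt x = fst Kc n"
  shows "mem b n x \<longleftrightarrow> (\<forall>i\<in>sI. n + i < b \<or> (n + i = b \<and> nul (snd (obX i) (n + i) \<star> cmp n i x)) \<or> nul (cmp n i x))"
proof -
  have "factors (inc b n) x \<longleftrightarrow> (\<forall>i\<in>sI. factors (tli b (obX i) (n + i)) (cmp n i x))"
  proof
    assume "factors (inc b n) x"
    then obtain y where y: "arr y" "tgt y = src (inc b n)" "inc b n \<star> y = x" by (rule factorsE)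
    show "\<forall>i\<in>sI. factors (tli b (obX i) (n + i)) (cmp n i x)"
    proof
      fix i assume i: "i \<in> sI"
      have "tli b (obX i) (n + i) \<star> (sprj sI (L.ts b X n) i \<star> y) = cmp n i x"
        using cmp_inc[OF i, of y b n] y by simp
      then show "factors (tli b (obX i) (n + i)) (cmp n i x)" by (rule factorsI) (use y i in auto)
    qed
  next
    assume f: "\<forall>i\<in>sI. factors (tli b (obX i) (n + i)) (cmp n i x)"
    let ?l = "\<lambda>i. lift_arr A (tli b (obX i) (n + i)) (cmp n i x)"
    have l: "i \<in> sI \<Longrightarrow> ?l i \<in> Hom (src x) (L.ts b X n i)" for i
      using f assms by (auto simp: Hom_iff) (simp add: tot_summand_def fun_le_def trunc_le_def)
    let ?y = "tuple sI (L.ts b X n) (src x) ?l"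
    have y: "arr ?y" "src ?y = src x" "tgt ?y = fst (Gc b) n" "\<And>i. i \<in> sI \<Longrightarrow> sprj sI (L.ts b X n) i \<star> ?y = ?l i"
      using tuple_simps[OF objs_L[of b n] _ l] assms L.tt_simps[OF X] by auto
    have "inc b n \<star> ?y = x"
    proof (rule dsum_eqI[OF objs_ts[of n]])
      fix i assume i: "i \<in> sI"
      show "cmp n i (inc b n \<star> ?y) = cmp n i x" using cmp_inc[OF i y(1,3)] y(4)[OF i] f i by simp
    qed (use y assms Kfst in auto)
    then show "factors (inc b n) x" by (rule factorsI) (use y in auto)
  qed
  also have "\<dots> \<longleftrightarrow> (\<forall>i\<in>sI. n + i < b \<or> (n + i = b \<and> nul (snd (obX i) (n + i) \<star> cmp n i x)) \<or> nul (cmp n i x))"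
    using assms by (intro ball_cong refl factors_tli) (auto simp: ts_eq)
  finally show ?thesis using assms by (simp add: mem_def)
qed

lemma memE:
  assumes "mem b n x"
  obtains y where "arr y" "src y = src x" "tgt y = fst (Gc b) n" "inc b n \<star> y = x" "lift_arr A (inc b n) x = y" "arr x" "tgt x = fst Kc n"
proof -
  have x: "arr x" "tgt x = fst Kc n" "factors (inc b n) x" using assms by (auto simp: mem_def)
  from x(3) obtain y where y: "arr y" "src y = src x" "tgt y = src (inc b n)" "inc b n \<star> y = x" by (rule factorsE)
  then have "lift_arr A (inc b n) x = y" by (intro lift_eqI) auto
  with that y x show thesis by simp
qed

lemma memI: "inc b n \<star> y = x \<Longrightarrow> arr y \<Longrightarrow> tgt y = fst (Gc b) n \<Longrightarrow> mem b n x"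
  unfolding mem_def using factorsI[of "inc b n" y x] by auto

lemma pi_nul_iff:
  assumes "a \<le> b" "mem b n x"
  shows "nul (pi a b n x) \<longleftrightarrow> (\<forall>i\<in>sI. (n + i > a \<longrightarrow> nul (cmp n i x)) \<and> (n + i = a \<longrightarrow> cov (snd (obX i) (a - 1)) (cmp n i x)))"
proof -
  obtain y where y: "arr y" "src y = src x" "tgt y = fst (Gc b) n" "inc b n \<star> y = x" "lift_arr A (inc b n) x = y" "arr x" "tgt x = fst Kc n"
    using assms(2) by (rule memE)
  let ?y = "\<lambda>i. sprj sI (L.ts b X n) i \<star> y"
  have c: "sprj sI (R.ts a b X n) i \<star> (prj a b n \<star> y) = tgp a (fun_obj (fun_le A b F) (fst X i)) (n + i) \<star> ?y i" if "i \<in> sI" for i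
    by (rule P.tr_simps(4)[OF X that y(1,3)])
  have xy: "cmp n i x = tli b (obX i) (n + i) \<star> ?y i" if "i \<in> sI" for i
    using cmp_inc[OF that y(1,3)] y(4) by simp
  have "nul (prj a b n \<star> y) \<longleftrightarrow> (\<forall>i\<in>sI. nul (sprj sI (R.ts a b X n) i \<star> (prj a b n \<star> y)))"
    using dsum_nulI[OF objs_R[of a b n], of "prj a b n \<star> y"] objs_R[of a b n] y R.tt_simps[OF X] by auto
  also have "\<dots> \<longleftrightarrow> (\<forall>i\<in>sI. (n + i > a \<longrightarrow> nul (cmp n i x)) \<and> (n + i = a \<longrightarrow> cov (snd (obX i) (a - 1)) (cmp n i x)))"
  proof (rule ball_cong[OF refl])
    fix i assume i: "i \<in> sI"
    let ?m = "tli b (obX i) (n + i)" and ?L = "fun_obj (fun_le A b F) (fst X i)"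
    have t: "arr (?y i)" "tgt (?y i) = src ?m" "src (?y i) = src y" "mono ?m" "arr ?m" using y i by auto
    have Lc: "cpx ?L" "fst ?L (n + i) = src ?m" by (simp_all add: L.Fobj[OF twistedD(1)[OF X]]) (simp add: fun_le_def trunc_le_def)
    have "nul (sprj sI (R.ts a b X n) i \<star> (prj a b n \<star> y)) \<longleftrightarrow> (n + i > a \<longrightarrow> nul (?y i)) \<and> (n + i = a \<longrightarrow> cov (snd ?L (a - 1)) (?y i))"
      unfolding c[OF i] by (rule nul_tgp) (use Lc t in auto)
    moreover have "nul (?y i) \<longleftrightarrow> nul (cmp n i x)" unfolding xy[OF i] by (rule mono_nul_iff[symmetric]) (use t in auto)
    moreover have "cov (snd ?L (a - 1)) (?y i) \<longleftrightarrow> cov (snd (obX i) (a - 1)) (cmp n i x)" if na: "n + i = a"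
    proof -
      \<comment> \<open>Since \<open>a - 1 < b\<close>, the truncation leaves the complex unchanged
        in degree \<open>a - 1\<close>; the boundaries in degree \<open>a\<close> are the same
        before and after it.\<close>
      have id: "tli b (obX i) (a - 1) = idt (fst (obX i) (a - 1))" using assms(1) by (simp add: trunc_le_incl_def)
      have f: "tli b (obX i) (a - 1 + 1) \<star> snd ?L (a - 1) = snd (obX i) (a - 1) \<star> tli b (obX i) (a - 1)"
        by (rule I.\<theta>_d[OF twistedD(1)[OF X], symmetric])
      then have "?m \<star> snd ?L (a - 1) = snd (obX i) (a - 1)" using na by (simp add: id)
      moreover have "cov (?m \<star> snd ?L (a - 1)) (?m \<star> ?y i) \<longleftrightarrow> cov (snd ?L (a - 1)) (?y i)"
        by (rule cov_mono_comp) (use t Lc na in auto)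
      ultimately show ?thesis unfolding xy[OF i] by simp
    qed
    ultimately show "nul (sprj sI (R.ts a b X n) i \<star> (prj a b n \<star> y)) \<longleftrightarrow>
      (n + i > a \<longrightarrow> nul (cmp n i x)) \<and> (n + i = a \<longrightarrow> cov (snd (obX i) (a - 1)) (cmp n i x))" by blast
  qed
  finally show ?thesis unfolding pi_def y(5) .
qed

lemma epi_prj [simp]: "epi (prj a b n)"
proof (rule epiI)
  fix g assume g: "arr g" "src g = tgt (prj a b n)" "nul (g \<star> prj a b n)"
  have "g = zr (dsum sI (R.ts a b X n)) (tgt g)"
  proof (rule dsum_coeqI[OF objs_R[of a b n]])
    fix i assume i: "i \<in> sI"
    let ?L = "fun_obj (fun_le A b F) (fst X i)"
    let ?e = "tgp a ?L (n + i)"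
    have Lc: "cpx ?L" "fst ?L (n + i) = L.ts b X n i" by (simp_all add: L.Fobj[OF twistedD(1)[OF X]]) (simp add: tot_summand_def)
    have e: "epi ?e" "arr ?e" "src ?e = L.ts b X n i" "tgt ?e = R.ts a b X n i"
      using Lc by (auto simp: tot_summand_def) (simp add: fun_trunc_def fun_ge_def trunc_ge_def)
    have j: "prj a b n \<star> sinj sI (L.ts b X n) i = sinj sI (R.ts a b X n) i \<star> ?e"
      using P.tr_simps(5)[OF X i, of "idt (L.ts b X n i)" b n a] objs_L[of b n] i e by simp
    have "nul ((g \<star> prj a b n) \<star> sinj sI (L.ts b X n) i)" by (rule comp_nul[OF g(3)]) (use g i objs_L[of b n] L.tt_simps[OF X] in auto)
    moreover have "(g \<star> prj a b n) \<star> sinj sI (L.ts b X n) i = g \<star> (prj a b n \<star> sinj sI (L.ts b X n) i)"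
      by (rule assoc) (use g i objs_L[of b n] L.tt_simps[OF X] in auto)
    moreover have "g \<star> (sinj sI (R.ts a b X n) i \<star> ?e) = (g \<star> sinj sI (R.ts a b X n) i) \<star> ?e"
      by (rule assoc[symmetric]) (use g i objs_R[of a b n] R.tt_simps[OF X] e in auto)
    ultimately have "nul ((g \<star> sinj sI (R.ts a b X n) i) \<star> ?e)" unfolding j by simp
    then have "nul (g \<star> sinj sI (R.ts a b X n) i)"
      by (rule epi_nul[OF e(1)]) (use g i objs_R[of a b n] R.tt_simps[OF X] e in auto)
    then show "g \<star> sinj sI (R.ts a b X n) i = zr (dsum sI (R.ts a b X n)) (tgt g) \<star> sinj sI (R.ts a b X n) i"
      by (intro nul_eq2) (use g i objs_R[of a b n] R.tt_simps[OF X] in auto)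
  qed (use g objs_R[of a b n] R.tt_simps[OF X] in auto)
  then show "nul g" using g objs_R[of a b n] by (metis dsum_simps(1) nul_zr obj_tgt)
qed simp

text \<open>The morphism from index \<open>i\<close> to index \<open>j\<close> of a twisted complex
  has degree \<open>i - j + 1\<close>, which is positive for \<open>j \<le> i\<close>. So the total
  differential is triangular: a summand receives twisting maps only from summands of larger
  index.\<close>

lemma qent_nul: "j \<le> i \<Longrightarrow> nul (qent X n i j)"
  unfolding qent_def by (rule Fpos_nul[OF twistedD(1)[OF X] twistedD(1)[OF X] twistedD(3)[OF X]]) simp

text \<open>By triangularity the component \<open>i\<close> of a boundary depends only on the
  components of index at least \<open>i\<close>. If those above \<open>i\<close> vanish, only the
  differential of the complex at \<open>i\<close> is left, with the sign of its shift.\<close>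

lemma d_cmp_top:
  assumes i: "i \<in> sI" and x: "arr x" "tgt x = fst Kc n" and top: "\<And>j. j \<in> sI \<Longrightarrow> j > i \<Longrightarrow> nul (cmp n j x)"
  shows "cmp (n + 1) i (snd Kc n \<star> x) = sg i (snd (obX i) (n + i) \<star> cmp n i x)"
proof -
  have t: "tent X n i j \<star> cmp n j x = (if j = i then sg i (dent X n i \<star> cmp n i x) else zr (src x) (ts X (n + 1) i))" if j: "j \<in> sI" for j
  proof -
    consider "j < i" | "j = i" | "j > i" by linarith
    then show ?thesis
    proof cases
      case 1
      then have "nul (tent X n i j)" using qent_nul[of j i n] by (simp add: tent_def)
      then have "nul (tent X n i j \<star> cmp n j x)" by (rule comp_nul) (use j x X in auto)
      then show ?thesis using 1 j x X by (simp add: nul_eq)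
    next
      case 2
      then have "tent X n i j = sg i (dent X n i)" using qent_nul[of i i n] X by (simp add: tent_def)
      then show ?thesis using 2 j x X by (simp add: sg_comp)
    next
      case 3
      have "nul (tent X n i j \<star> cmp n j x)" by (rule nul_comp[OF top[OF j 3]]) (use j x X in auto)
      then show ?thesis using 3 j x X by (simp add: nul_eq)
    qed
  qed
  have "cmp (n + 1) i (snd Kc n \<star> x) = hsum (src x) (ts X (n + 1) i) (\<lambda>j. tent X n i j \<star> cmp n j x) sI"
    by (rule sprj_d[OF X i x])
  also have "\<dots> = tent X n i i \<star> cmp n i x"
    by (rule hsum_single) (use fin i x X t in \<open>auto simp: Hom_iff\<close>)
  finally show ?thesis using t[OF i] by (simp add: dent_def)
qed

lemma mem_nul: assumes "nul x" "tgt x = fst Kc n" shows "mem b n x"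
proof -
  have x: "arr x" by (rule nul_arr[OF assms(1)])
  show ?thesis unfolding mem_iff[OF x assms(2)] using assms x objs_ts[of n] by (auto simp: Kfst)
qed

lemma pi_surj:
  assumes "arr t" "tgt t = fst (Tc a b) n"
  shows "\<exists>e x. epi e \<and> tgt e = src t \<and> mem b n x \<and> src x = src e \<and> pi a b n x = t \<star> e"
proof -
  have "cov (prj a b n) t" by (rule cov_epi) (use assms in auto)
  then obtain e y where e: "epi e" "arr e" "tgt e = src t" "arr y" "src y = src e" "tgt y = src (prj a b n)" "prj a b n \<star> y = t \<star> e"
    by (rule covE)
  have y: "tgt y = fst (Gc b) n" using e by simp
  have l: "lift_arr A (inc b n) (inc b n \<star> y) = y" by (rule lift_eqI) (use e y in auto)
  have "mem b n (inc b n \<star> y)" by (rule memI) (use e y in auto)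
  moreover have "pi a b n (inc b n \<star> y) = t \<star> e" unfolding pi_def l by (rule e(7))
  ultimately show ?thesis using e y by (metis comp_simps(2) incI(1,2))
qed

text \<open>An element killed by \<open>pi\<close> has zero components in internal degrees above
  \<open>a\<close> and locally a boundary in internal degree \<open>a\<close>. Removing the latter
  by the boundary of an element concentrated in one summand disturbs otherwise only summands of
  smaller index, by triangularity; so all components in internal degree at least \<open>a\<close>
  become zero.\<close>

lemma pi_ker:
  assumes ab: "a \<le> b" and x: "mem b n x" "nul (pi a b n x)" "mem (a - 1) (n + 1) (snd Kc n \<star> x)"
  shows "\<exists>e u. epi e \<and> tgt e = src x \<and> mem b (n - 1) u \<and> src u = src e \<and> nul (pi a b (n - 1) u) \<and>
        mem (a - 1) n (x \<star> e \<boxminus> snd Kc (n - 1) \<star> u)"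
proof -
  \<comment> \<open>The index of the only summand that has internal degree \<open>a\<close> in total
    degree \<open>n\<close>.\<close>
  define i0 where "i0 = a - n"
  have xt: "arr x" "tgt x = fst Kc n" using x(1) by (auto simp: mem_def)
  note px = x(2)[unfolded pi_nul_iff[OF ab x(1)], rule_format]
  obtain e u where e: "epi e" "tgt e = src x" "arr u" "tgt u = fst Kc (n - 1)" "src u = src e"
    and u0: "\<And>i. i \<in> sI \<Longrightarrow> i \<noteq> i0 \<Longrightarrow> nul (cmp (n - 1) i u)"
    and u1: "i0 \<in> sI \<Longrightarrow> cmp n i0 x \<star> e = sg i0 (snd (obX i0) (a - 1) \<star> cmp (n - 1) i0 u)"
  proof (cases "i0 \<in> sI")
    case False
    show ?thesis
    proof (rule that[of "idt (src x)" "zr (src x) (fst Kc (n - 1))"])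
      fix i assume "i \<in> sI"
      then show "nul (cmp (n - 1) i (zr (src x) (fst Kc (n - 1))))" using xt objs_ts[of "n - 1"] by (simp add: Kfst)
    qed (use xt False in auto)
  next
    case True
    have "cov (snd (obX i0) (a - 1)) (cmp n i0 x)" using px[OF True] by (simp add: i0_def)
    then obtain e c where e: "epi e" "arr e" "tgt e = src (cmp n i0 x)" "arr c" "src c = src e" "tgt c = src (snd (obX i0) (a - 1))"
      "snd (obX i0) (a - 1) \<star> c = cmp n i0 x \<star> e" by (rule covE)
    have c: "tgt c = ts X (n - 1) i0" using e by (simp add: ts_eq i0_def)
    \<comment> \<open>The sign cancels the one that the total differential puts on the summand
      \<open>i0\<close>.\<close>
    let ?u = "sinj sI (ts X (n - 1)) i0 \<star> sg i0 c"
    have cu: "cmp (n - 1) i ?u = (if i = i0 then sg i0 c else zr (src c) (ts X (n - 1) i))" if "i \<in> sI" for i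
      using sprj_sinj[OF objs_ts[of "n - 1"] that True, of "sg i0 c"] e(4) c by simp
    show ?thesis
    proof (rule that[of e ?u])
      show "epi e" "tgt e = src x" "arr ?u" "tgt ?u = fst Kc (n - 1)" "src ?u = src e"
        using e(1-5) c xt True objs_ts[of "n - 1"] by (auto simp: Kfst)
      show "nul (cmp (n - 1) i ?u)" if "i \<in> sI" "i \<noteq> i0" for i unfolding cu[OF that(1)] using that e(4) X by simp
      show "cmp n i0 x \<star> e = sg i0 (snd (obX i0) (a - 1) \<star> cmp (n - 1) i0 ?u)"
        unfolding cu[OF True] e(7)[symmetric] using e(4-6) by (simp add: comp_sg sg_sg) (simp add: sg_def)
    qed
  qed
  have uc: "arr (cmp (n - 1) i u)" "src (cmp (n - 1) i u) = src e" "tgt (cmp (n - 1) i u) = ts X (n - 1) i" if "i \<in> sI" for i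
    using that e by auto
  have mu: "mem b (n - 1) u" unfolding mem_iff[OF e(3,4)]
  proof
    fix i assume "i \<in> sI"
    then show "n - 1 + i < b \<or> n - 1 + i = b \<and> nul (snd (obX i) (n - 1 + i) \<star> cmp (n - 1) i u) \<or> nul (cmp (n - 1) i u)"
      using u0[of i] ab by (cases "i = i0") (auto simp: i0_def)
  qed
  have pu: "nul (pi a b (n - 1) u)" unfolding pi_nul_iff[OF ab mu]
  proof
    fix i assume i: "i \<in> sI"
    show "(n - 1 + i > a \<longrightarrow> nul (cmp (n - 1) i u)) \<and> (n - 1 + i = a \<longrightarrow> cov (snd (obX i) (a - 1)) (cmp (n - 1) i u))"
    proof (cases "i = i0")
      case False
      have "nul (cmp (n - 1) i u)" by (rule u0[OF i False])
      then show ?thesis using uc[OF i] by (auto simp: cov_iff ts_eq)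
    qed (use i0_def in auto)
  qed
  define y where "y = x \<star> e \<boxminus> snd Kc (n - 1) \<star> u"
  have y: "arr y" "tgt y = fst Kc n" "src y = src e" unfolding y_def using xt e by auto
  have cy: "cmp n i y = cmp n i x \<star> e \<boxminus> cmp n i (snd Kc (n - 1) \<star> u)" if "i \<in> sI" for i
    unfolding y_def using that xt e objs_ts[of n] by (simp add: bilin Kfst)
  have du: "cmp n i (snd Kc (n - 1) \<star> u) = sg i (snd (obX i) (n - 1 + i) \<star> cmp (n - 1) i u)" if "i \<in> sI" "i \<ge> i0" for i
    using d_cmp_top[OF that(1) e(3,4)] u0 that by simp
  have y0: "nul (cmp n i y)" if i: "i \<in> sI" "i \<ge> i0" for i
  proof (cases "i = i0")
    case True
    have "cmp n i x \<star> e = cmp n i (snd Kc (n - 1) \<star> u)"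
      using u1 du[OF i] i True by (simp add: i0_def)
    then show ?thesis unfolding cy[OF i(1)] using i(1) e xt X by simp
  next
    case False
    then have "nul (cmp n i x)" using px[OF i(1)] i by (simp add: i0_def)
    then have "nul (cmp n i x \<star> e)" by (rule comp_nul) (use i e xt in auto)
    moreover have "nul (cmp n i (snd Kc (n - 1) \<star> u))"
      unfolding du[OF i] using u0[OF i(1) False] uc[OF i(1)] by (simp add: ts_eq)
    ultimately show ?thesis unfolding cy[OF i(1)] using i(1) e xt X by simp
  qed
  have "mem (a - 1) n y" unfolding mem_iff[OF y(1,2)]
  proof
    fix i assume i: "i \<in> sI"
    \<comment> \<open>In internal degree \<open>a - 1\<close> the truncation asks for a cocycle. The
      components of \<open>y\<close> of larger index vanish, so by \<open>d_cmp_top\<close> the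
      differential of this one is, up to sign, a component of the boundary of \<open>y\<close>, of
      internal degree \<open>a\<close>. That boundary is the boundary of \<open>x\<close> composed
      with \<open>e\<close>, and it lies in the step \<open>a - 1\<close>.\<close>
    have "nul (snd (obX i) (n + i) \<star> cmp n i y)" if "i = i0 - 1"
    proof -
      have "nul (snd Kc n \<star> (snd Kc (n - 1) \<star> u))" by (rule cpx_ddx) (use e in auto)
      then have dy: "snd Kc n \<star> y = (snd Kc n \<star> x) \<star> e" unfolding y_def using xt e by (simp add: bilin)
      have "nul (cmp (n + 1) i (snd Kc n \<star> x))"
        using x(3) mem_iff[of "snd Kc n \<star> x" "n + 1" "a - 1"] xt i that by (auto simp: i0_def)
      then have "nul (cmp (n + 1) i (snd Kc n \<star> x) \<star> e)" by (rule comp_nul) (use i xt e in auto)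
      then have "nul (cmp (n + 1) i (snd Kc n \<star> y))" unfolding dy using i xt e objs_ts[of "n + 1"] by (simp add: Kfst)
      moreover have "cmp (n + 1) i (snd Kc n \<star> y) = sg i (snd (obX i) (n + i) \<star> cmp n i y)"
        by (rule d_cmp_top[OF i y(1,2)]) (use y0 that in auto)
      ultimately show ?thesis using i y by (simp add: ts_eq)
    qed
    then show "n + i < a - 1 \<or> n + i = a - 1 \<and> nul (snd (obX i) (n + i) \<star> cmp n i y) \<or> nul (cmp n i y)"
      using y0[OF i] by (cases "i \<ge> i0"; cases "i = i0 - 1") (auto simp: i0_def)
  qed
  then show ?thesis using e mu pu unfolding y_def by blast
qed

lemma mem_plus: assumes "mem b n x" "mem b n y" "src x = src y" shows "mem b n (x \<boxplus> y)"
proof -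
  obtain u where u: "arr u" "src u = src x" "tgt u = fst (Gc b) n" "inc b n \<star> u = x" "lift_arr A (inc b n) x = u" "arr x" "tgt x = fst Kc n"
    using assms(1) by (rule memE)
  obtain v where v: "arr v" "src v = src y" "tgt v = fst (Gc b) n" "inc b n \<star> v = y" "lift_arr A (inc b n) y = v" "arr y" "tgt y = fst Kc n"
    using assms(2) by (rule memE)
  have "inc b n \<star> (u \<boxplus> v) = x \<boxplus> y" using u(1-4) v(1-4) assms(3) by (simp add: bilin)
  then show ?thesis by (rule memI) (use u v assms in auto)
qed

lemma mem_neg: assumes "mem b n x" shows "mem b n (neg x)"
proof -
  obtain u where u: "arr u" "src u = src x" "tgt u = fst (Gc b) n" "inc b n \<star> u = x" "lift_arr A (inc b n) x = u" "arr x" "tgt x = fst Kc n"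
    using assms(1) by (rule memE)
  have "inc b n \<star> neg u = neg x" using u(1-4) by (simp add: bilin)
  then show ?thesis by (rule memI) (use u in auto)
qed

lemma mem_comp: assumes "mem b n x" "arr e" "tgt e = src x" shows "mem b n (x \<star> e)"
proof -
  obtain u where u: "arr u" "src u = src x" "tgt u = fst (Gc b) n" "inc b n \<star> u = x" "lift_arr A (inc b n) x = u" "arr x" "tgt x = fst Kc n"
    using assms(1) by (rule memE)
  have "inc b n \<star> (u \<star> e) = x \<star> e" by (rule comp_reduce[OF u(4)]) (use u assms in auto)
  then show ?thesis by (rule memI) (use u assms in auto)
qed

lemma mem_d: assumes "mem b n x" shows "mem b (n + 1) (snd Kc n \<star> x)"
proof -
  obtain u where u: "arr u" "src u = src x" "tgt u = fst (Gc b) n" "inc b n \<star> u = x" "lift_arr A (inc b n) x = u" "arr x" "tgt x = fst Kc n"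
    using assms(1) by (rule memE)
  have "inc b (n + 1) \<star> (snd (Gc b) n \<star> u) = snd Kc n \<star> x"
    using cmap_dx[OF inc_cmap u(1,3)] by (simp only: u(4))
  then show ?thesis by (rule memI) (use u in auto)
qed

lemma mem_mono: assumes "mem a n x" "a \<le> b" shows "mem b n x"
proof -
  have x: "arr x" "tgt x = fst Kc n" using assms(1) by (auto simp: mem_def)
  show ?thesis using assms unfolding mem_iff[OF x] by force
qed

lemma index_bounds: "\<exists>B. \<forall>i\<in>sI. \<bar>n + i\<bar> < B"
proof -
  have "\<bar>n + i\<bar> < Max (insert 0 ((\<lambda>i. \<bar>n + i\<bar>) ` sI)) + 1" if "i \<in> sI" for i
    using fin that Max_ge[of "insert 0 ((\<lambda>i. \<bar>n + i\<bar>) ` sI)" "\<bar>n + i\<bar>"] by simp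
  then show ?thesis by blast
qed

lemma mem_low: "\<exists>B. \<forall>b\<le>B. \<forall>x. mem b n x \<longrightarrow> nul x"
proof -
  obtain B where B: "\<forall>i\<in>sI. \<bar>n + i\<bar> < B" using index_bounds by blast
  have "nul x" if "b \<le> - B" "mem b n x" for b x
  proof -
    have x: "arr x" "tgt x = fst Kc n" using that(2) by (auto simp: mem_def)
    show ?thesis
    proof (rule dsum_nulI[OF objs_ts[of n]])
      fix i assume "i \<in> sI"
      then show "nul (cmp n i x)" using that(2)[unfolded mem_iff[OF x]] B that(1) by force
    qed (use x Kfst in auto)
  qed
  then show ?thesis by blast
qed

lemma mem_high: "\<exists>B. \<forall>b\<ge>B. \<forall>x. arr x \<and> tgt x = fst Kc n \<longrightarrow> mem b n x"
proof -
  obtain B where B: "\<forall>i\<in>sI. \<bar>n + i\<bar> < B" using index_bounds by blast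
  have "mem b n x" if "B \<le> b" "arr x" "tgt x = fst Kc n" for b x
    unfolding mem_iff[OF that(2,3)] using B that(1) by force
  then show ?thesis by blast
qed

lemma pi_simps:
  assumes "mem b n x"
  shows "arr (pi a b n x)" "src (pi a b n x) = src x" "tgt (pi a b n x) = fst (Tc a b) n"
proof -
  obtain u where u: "arr u" "src u = src x" "tgt u = fst (Gc b) n" "inc b n \<star> u = x" "lift_arr A (inc b n) x = u" "arr x" "tgt x = fst Kc n"
    using assms(1) by (rule memE)
  then show "arr (pi a b n x)" "src (pi a b n x) = src x" "tgt (pi a b n x) = fst (Tc a b) n" unfolding pi_def by auto
qed

lemma mem_factors: "mem b n x \<Longrightarrow> factors (inc b n) x"
  by (simp add: mem_def)

lemma pi_plus: "mem b n x \<Longrightarrow> mem b n y \<Longrightarrow> src x = src y \<Longrightarrow> pi a b n (x \<boxplus> y) = pi a b n x \<boxplus> pi a b n y"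
  unfolding pi_def by (subst lift_plus) (auto simp: bilin mem_factors)

lemma pi_neg: "mem b n x \<Longrightarrow> pi a b n (neg x) = neg (pi a b n x)"
  unfolding pi_def by (subst lift_neg) (auto simp: bilin mem_factors)

lemma pi_comp: "mem b n x \<Longrightarrow> arr e \<Longrightarrow> tgt e = src x \<Longrightarrow> pi a b n (x \<star> e) = pi a b n x \<star> e"
  unfolding pi_def by (subst lift_comp) (auto simp: mem_factors, simp add: mem_def)

lemma pi_d: assumes "mem b n x" shows "pi a b (n + 1) (snd Kc n \<star> x) = snd (Tc a b) n \<star> pi a b n x"
proof -
  obtain u where u: "arr u" "src u = src x" "tgt u = fst (Gc b) n" "inc b n \<star> u = x" "lift_arr A (inc b n) x = u" "arr x" "tgt x = fst Kc n"
    using assms(1) by (rule memE)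
  have "inc b (n + 1) \<star> (snd (Gc b) n \<star> u) = snd Kc n \<star> x"
    using cmap_dx[OF inc_cmap u(1,3)] by (simp only: u(4))
  then have l: "lift_arr A (inc b (n + 1)) (snd Kc n \<star> x) = snd (Gc b) n \<star> u" by (intro lift_eqI) (use u in auto)
  show ?thesis unfolding pi_def l u(5) using cmap_dx[OF prj_cmap u(1,3)] by simp
qed

lemma pi_low: assumes "a \<le> b" "mem (a - 1) n x" shows "nul (pi a b n x)"
proof -
  have x: "arr x" "tgt x = fst Kc n" using assms(2) by (auto simp: mem_def)
  have "mem b n x" by (rule mem_mono[OF assms(2)]) (use assms(1) in simp)
  then show ?thesis unfolding pi_nul_iff[OF assms(1) \<open>mem b n x\<close>]
    using assms(2)[unfolded mem_iff[OF x]] x by (auto simp: cov_iff ts_eq)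
qed

subsection \<open>The graded pieces\<close>

definition pb :: "int \<Rightarrow> int \<Rightarrow> 'a" where
  "pb w k = cohom_map A w (obX (k + 1)) (obX k) (fun_hom F 0 (fst X k) (fst X (k + 1)) (snd X k (k + 1)))"

lemma q0: "snd X k (k + 1) \<in> carrier (dg_hom C 0 (fst X k) (fst X (k + 1)))"
  using twistedD(3)[OF X, of k "k + 1"] by simp

lemma pb_simps [simp]: "arr (pb w k)" "src (pb w k) = cohom A w (obX (k + 1))" "tgt (pb w k) = cohom A w (obX k)"
  using cohom_map[OF cmap_F0[OF twistedD(1)[OF X] twistedD(1)[OF X] q0], of w] unfolding pb_def by auto

text \<open>Both sides are given by the same chosen cokernel of the same arrow, so these are
  equalities, and the graded pieces contain the cohomology objects themselves.\<close>

lemma trunc_top: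
  assumes "cpx Y"
  shows "tgp w (trunc_le A w Y) w = to_cohom A Y w" "trunc_ge_obj A w (trunc_le A w Y) w = cohom A w Y"
proof -
  have "snd (trunc_le A w Y) (w - 1) = lift_arr A (cocyc A Y w) (snd Y (w - 1))"
    using assms by (simp add: trunc_le_def trunc_le_incl_def)
  then show "tgp w (trunc_le A w Y) w = to_cohom A Y w" "trunc_ge_obj A w (trunc_le A w Y) w = cohom A w Y"
    by (simp_all add: trunc_ge_proj_def trunc_ge_obj_def to_cohom_def cohom_def)
qed

lemma R_ts: "R.ts w w X n i = (if n + i = w then cohom A w (obX i) else zero_obj A)"
  using trunc_top(2)[OF obX_cpx, of w i]
  by (auto simp: tot_summand_def fun_trunc_def fun_ge_def fun_le_def trunc_ge_def)
    (auto simp: trunc_ge_obj_def trunc_le_def trunc_le_obj_def)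

text \<open>Entries between neighbouring indices come from morphisms of degree 0. In the one degree
  where the truncation is nonzero, the arrow that such a morphism induces unfolds to the definition
  of \<open>cohom_map\<close>.\<close>

lemma R_tent: assumes "n + (i + 1) = w" shows "R.tent w w X n i (i + 1) = pb w i"
proof -
  have "R.tent w w X n i (i + 1) = fun_hom (fun_trunc A w w F) 0 (fst X i) (fst X (i + 1)) (snd X i (i + 1)) w"
    unfolding R.tent_def R.qent_def using assms by simp
  also have "\<dots> = pb w i"
    unfolding pb_def cohom_map_def fun_trunc_def fun_ge_def fun_le_def
    by (simp add: trunc_top trunc_le_incl_def)
  finally show ?thesis .
qed

lemma Tfst: "fst (Tc a b) n = dsum sI (R.ts a b X n)"
  by (rule R.tt_simps[OF X])

lemma T_other: "i \<in> sI \<Longrightarrow> n + i \<noteq> w \<Longrightarrow> arr t \<Longrightarrow> tgt t = fst (Tc w w) n \<Longrightarrow> nul (sprj sI (R.ts w w X n) i \<star> t)"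
  by (rule nul_to_zero_obj) (use objs_R[of w w n] in \<open>auto simp: Tfst R_ts\<close>)

lemma T_single:
  assumes "i \<in> sI" "n + i = w" "arr t" "tgt t = fst (Tc w w) n"
  shows "sinj sI (R.ts w w X n) i \<star> (sprj sI (R.ts w w X n) i \<star> t) = t"
proof (rule dsum_eqI[OF objs_R[of w w n]])
  note o = objs_R[of w w n]
  fix j assume j: "j \<in> sI"
  show "sprj sI (R.ts w w X n) j \<star> (sinj sI (R.ts w w X n) i \<star> (sprj sI (R.ts w w X n) i \<star> t)) = sprj sI (R.ts w w X n) j \<star> t"
  proof (cases "j = i")
    case False
    then have nj: "n + j \<noteq> w" using assms(2) by simp
    show ?thesis by (rule nul_eq2[OF T_other[OF j nj] T_other[OF j nj]]) (use j assms o in \<open>auto simp: Tfst\<close>)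
  qed (use assms o in \<open>simp add: sprj_sinj Tfst\<close>)
qed (use assms objs_R[of w w n] in \<open>auto simp: Tfst\<close>)

lemma T_none:
  assumes "w - n \<notin> sI" "arr t" "tgt t = fst (Tc w w) n"
  shows "nul t"
proof (rule dsum_nulI[OF objs_R[of w w n]])
  fix i assume i: "i \<in> sI"
  then have "n + i \<noteq> w" using assms(1) by auto
  then show "nul (sprj sI (R.ts w w X n) i \<star> t)" by (rule T_other[OF i]) (use assms in auto)
qed (use assms in \<open>auto simp: Tfst\<close>)

lemma T_d:
  assumes "i \<in> sI" "i + 1 \<in> sI" "n + (i + 1) = w" "arr t" "tgt t = fst (Tc w w) n"
  shows "sprj sI (R.ts w w X (n + 1)) i \<star> (snd (Tc w w) n \<star> t) = pb w i \<star> (sprj sI (R.ts w w X n) (i + 1) \<star> t)"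
proof -
  note o = objs_R[of w w n]
  have "sprj sI (R.ts w w X (n + 1)) i \<star> (snd (Tc w w) n \<star> t) =
    hsum (src t) (R.ts w w X (n + 1) i) (\<lambda>j. R.tent w w X n i j \<star> (sprj sI (R.ts w w X n) j \<star> t)) sI"
    by (rule R.sprj_d[OF X assms(1,4,5)])
  also have "\<dots> = R.tent w w X n i (i + 1) \<star> (sprj sI (R.ts w w X n) (i + 1) \<star> t)"
  proof (rule hsum_single[OF fin assms(2)])
    show "R.tent w w X n i (i + 1) \<star> (sprj sI (R.ts w w X n) (i + 1) \<star> t) \<in> Hom (src t) (R.ts w w X (n + 1) i)"
      using assms o X by (auto simp: Hom_iff Tfst)
    fix j assume j: "j \<in> sI" "j \<noteq> i + 1"
    have "nul (sprj sI (R.ts w w X n) j \<star> t)" by (rule T_other) (use j assms in auto)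
    then have "nul (R.tent w w X n i j \<star> (sprj sI (R.ts w w X n) j \<star> t))"
      by (rule nul_comp) (use j assms o X in \<open>auto simp: Tfst\<close>)
    then show "R.tent w w X n i j \<star> (sprj sI (R.ts w w X n) j \<star> t) = zr (src t) (R.ts w w X (n + 1) i)"
      by (rule nul_eq) (use j assms o X in \<open>auto simp: Tfst\<close>)
  qed
  finally show ?thesis by (simp only: R_tent[OF assms(3)])
qed

text \<open>A pullback \<open>pb\<close> may start or end at an index outside the support, where the
  total complex has no summand at all. It is then zero, because the complex there has vanishing
  cohomology.\<close>

lemma cohom_zero: assumes "i \<notin> sI" shows "nul (idt (cohom A w (obX i)))"
proof -
  have "dg_zero_obj C (fst X i)" using assms by (simp add: tw_supp_def)
  then have z: "nul (idt (fst (obX i) w))" by (rule zero_obj_nul[OF twistedD(1)[OF X]])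
  have "nul (cocyc A (obX i) w)" by (rule nul_to[OF z]) auto
  then have "nul (idt (src (cocyc A (obX i) w)))"
    by (intro mono_nul[of "cocyc A (obX i) w" "idt (src (cocyc A (obX i) w))"]) auto
  then have "nul (to_cohom A (obX i) w)" by (rule nul_from) auto
  then have "nul (idt (cohom A w (obX i)) \<star> to_cohom A (obX i) w)" by simp
  then show ?thesis by (rule epi_nul[rotated]) auto
qed

text \<open>
  In degree \<open>n\<close>, the graded piece of weight \<open>w\<close> is the cohomology in degree \<open>w\<close> of the complex
  \<open>F (P i)\<close> with \<open>i = w - n\<close>, and its differential is the pullback \<open>pb\<close> along a morphism of degree
  \<open>0\<close> since there are no morphisms of positive degree.
\<close>

definition karr :: "int \<Rightarrow> int \<Rightarrow> 'a" where
  "karr w n = (if w - n \<in> sI then sinj sI (R.ts w w X n) (w - n) \<star> ker (pb w (w - n - 1)) else zr (zero_obj A) (fst (Tc w w) n))"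

definition larr :: "int \<Rightarrow> int \<Rightarrow> 'a" where
  "larr w n = (if w - n \<in> sI then cok (pb w (w - n)) \<star> sprj sI (R.ts w w X n) (w - n) else zr (fst (Tc w w) n) (zero_obj A))"

lemma karr_type: "arr (karr w n)" "tgt (karr w n) = fst (Tc w w) n"
  and larr_type: "arr (larr w n)" "src (larr w n) = fst (Tc w w) n"
  using objs_R[of w w n] unfolding karr_def larr_def by (auto simp: Tfst R_ts)

lemma karr_d: "nul (snd (Tc w w) n \<star> karr w n)"
proof (cases "w - n \<in> sI")
  case True
  note o = objs_R[of w w n] and o1 = objs_R[of w w "n + 1"]
  let ?i = "w - n - 1" and ?k = "karr w n"
  have k: "sprj sI (R.ts w w X n) (w - n) \<star> ?k = ker (pb w ?i)"
    unfolding karr_def using True o by (simp add: sprj_sinj R_ts)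
  show ?thesis
  proof (rule dsum_nulI[OF o1])
    fix i assume i: "i \<in> sI"
    show "nul (sprj sI (R.ts w w X (n + 1)) i \<star> (snd (Tc w w) n \<star> ?k))"
    proof (cases "i = ?i")
      case i': True
      have e: "i + 1 = w - n" using i' by simp
      have "sprj sI (R.ts w w X (n + 1)) i \<star> (snd (Tc w w) n \<star> ?k) = pb w i \<star> (sprj sI (R.ts w w X n) (i + 1) \<star> ?k)"
        by (rule T_d) (use i i' True karr_type in auto)
      also have "\<dots> = pb w ?i \<star> ker (pb w ?i)" by (simp only: e k) (simp only: i')
      finally show ?thesis by simp
    next
      case False
      then have "n + 1 + i \<noteq> w" by auto
      then show ?thesis by (rule T_other[OF i]) (use karr_type in auto)
    qed
  qed (use karr_type Tfst in auto)
next
  case False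
  then show ?thesis using karr_type T_none[OF False, of "karr w n"] by simp
qed

text \<open>A cocycle of the graded piece is given by its component of index \<open>w - n\<close>,
  and that component is killed by the pullback to the index below; where that index is outside the
  support, the pullback has zero target.\<close>

lemma karr_factors:
  assumes "arr t" "tgt t = fst (Tc w w) n" "nul (snd (Tc w w) n \<star> t)"
  shows "factors (karr w n) t"
proof (cases "w - n \<in> sI")
  case True
  note o = objs_R[of w w n] and o1 = objs_R[of w w "n + 1"]
  let ?i = "w - n - 1" and ?t = "sprj sI (R.ts w w X n) (w - n) \<star> t"
  have t: "arr ?t" "src ?t = src t" "tgt ?t = cohom A w (obX (w - n))" using True o assms by (auto simp: Tfst R_ts)
  have "nul (pb w ?i \<star> ?t)"
  proof (cases "?i \<in> sI")
    case i: True
    have "nul (sprj sI (R.ts w w X (n + 1)) ?i \<star> (snd (Tc w w) n \<star> t))"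
      by (rule nul_comp[OF assms(3)]) (use assms o1 i in \<open>auto simp: Tfst\<close>)
    then show ?thesis using T_d[OF i, of n w t] True assms by simp
  next
    case False
    show ?thesis by (rule nul_to[OF cohom_zero[OF False]]) (use t in auto)
  qed
  then have "factors (ker (pb w ?i)) ?t" using t by (subst factors_ker) auto
  then obtain s where s: "arr s" "src s = src ?t" "tgt s = src (ker (pb w ?i))" "ker (pb w ?i) \<star> s = ?t" by (rule factorsE)
  have "karr w n \<star> s = sinj sI (R.ts w w X n) (w - n) \<star> (ker (pb w ?i) \<star> s)"
    unfolding karr_def using True o s(1,3) by (simp add: R_ts)
  also have "\<dots> = t" unfolding s(4) by (rule T_single) (use True assms in auto)
  finally show ?thesis by (rule factorsI) (use karr_type s True o in \<open>auto simp: karr_def R_ts\<close>)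
next
  case False
  show ?thesis by (rule nul_factors[OF T_none[OF False]]) (use assms karr_type in auto)
qed

lemma larr_d: "nul (larr w n \<star> snd (Tc w w) (n - 1))"
proof (cases "w - n \<in> sI")
  case True
  note o = objs_R[of w w n] and o1 = objs_R[of w w "n - 1"]
  let ?i = "w - n" and ?d = "snd (Tc w w) (n - 1)"
  have "nul (sprj sI (R.ts w w X n) ?i \<star> ?d) \<or> (?i + 1 \<in> sI)"
  proof (cases "?i + 1 \<in> sI")
    case False
    have "nul (snd (Tc w w) (n - 1))"
    proof -
      have "nul (idt (fst (Tc w w) (n - 1)))"
        by (rule T_none) (use False in \<open>auto simp: algebra_simps\<close>)
      then show ?thesis by (rule nul_from) auto
    qed
    then show ?thesis using True o by (simp add: Tfst)
  qed simp
  moreover have "sprj sI (R.ts w w X n) ?i \<star> ?d = pb w ?i \<star> sprj sI (R.ts w w X (n - 1)) (?i + 1)" if "?i + 1 \<in> sI"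
    using T_d[OF True that, of "n - 1" w "idt (fst (Tc w w) (n - 1))"] o1 that by (simp add: Tfst)
  moreover have "nul (cok (pb w ?i) \<star> (pb w ?i \<star> sprj sI (R.ts w w X (n - 1)) (?i + 1)))" if "?i + 1 \<in> sI"
  proof -
    have "nul ((cok (pb w ?i) \<star> pb w ?i) \<star> sprj sI (R.ts w w X (n - 1)) (?i + 1))"
      by (rule comp_nul) (use that o1 in \<open>auto simp: R_ts\<close>)
    moreover have "(cok (pb w ?i) \<star> pb w ?i) \<star> sprj sI (R.ts w w X (n - 1)) (?i + 1) =
      cok (pb w ?i) \<star> (pb w ?i \<star> sprj sI (R.ts w w X (n - 1)) (?i + 1))"
      by (rule assoc) (use that o1 in \<open>auto simp: R_ts\<close>)
    ultimately show ?thesis by simp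
  qed
  moreover have "larr w n \<star> ?d = cok (pb w ?i) \<star> (sprj sI (R.ts w w X n) ?i \<star> ?d)"
    unfolding larr_def using True o by (simp add: Tfst R_ts)
  ultimately show ?thesis using True o by (auto simp: Tfst R_ts)
next
  case False
  then show ?thesis by (simp add: larr_def)
qed

text \<open>A component killed by the cokernel of the pullback is locally of the form
  \<open>pb w ?i \<star> y\<close>; placed in the summand of index \<open>?i + 1\<close> in degree
  \<open>n - 1\<close>, \<open>y\<close> becomes a primitive. If this index is outside the support,
  \<open>y\<close> vanishes and with it \<open>t\<close>.\<close>

lemma larr_cov:
  assumes "arr t" "tgt t = fst (Tc w w) n" "nul (larr w n \<star> t)"
  shows "cov (snd (Tc w w) (n - 1)) t"
proof (cases "w - n \<in> sI")
  case True
  note o = objs_R[of w w n] and o1 = objs_R[of w w "n - 1"]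
  let ?i = "w - n" and ?d = "snd (Tc w w) (n - 1)"
  let ?t = "sprj sI (R.ts w w X n) ?i \<star> t"
  have t: "arr ?t" "src ?t = src t" "tgt ?t = cohom A w (obX ?i)" using True o assms by (auto simp: Tfst R_ts)
  have "larr w n \<star> t = cok (pb w ?i) \<star> ?t" unfolding larr_def using True o assms by (simp add: Tfst R_ts)
  then have "cov (pb w ?i) ?t" using assms(3) t by (simp add: cov_iff)
  then obtain e y where e: "epi e" "arr e" "tgt e = src ?t" "arr y" "src y = src e" "tgt y = src (pb w ?i)" "pb w ?i \<star> y = ?t \<star> e"
    by (rule covE)
  have te: "sprj sI (R.ts w w X n) ?i \<star> (t \<star> e) = pb w ?i \<star> y" using e(1-3) t(2) True o assms unfolding e(7) by (simp add: Tfst)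
  show ?thesis
  proof (cases "?i + 1 \<in> sI")
    case i1: True
    let ?u = "sinj sI (R.ts w w X (n - 1)) (?i + 1) \<star> y"
    have tsu: "R.ts w w X (n - 1) (?i + 1) = cohom A w (obX (?i + 1))" by (simp add: R_ts)
    have u: "arr ?u" "src ?u = src e" "tgt ?u = fst (Tc w w) (n - 1)" using i1 o1 e tsu by (auto simp: Tfst)
    have "?d \<star> ?u = t \<star> e"
    proof (rule dsum_eqI[OF o])
      fix j assume j: "j \<in> sI"
      show "sprj sI (R.ts w w X n) j \<star> (?d \<star> ?u) = sprj sI (R.ts w w X n) j \<star> (t \<star> e)"
      proof (cases "j = ?i")
        case True
        have "sprj sI (R.ts w w X n) ?i \<star> (?d \<star> ?u) = pb w ?i \<star> (sprj sI (R.ts w w X (n - 1)) (?i + 1) \<star> ?u)"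
          using T_d[OF \<open>?i \<in> sI\<close> i1, of "n - 1" w ?u] u by simp
        also have "sprj sI (R.ts w w X (n - 1)) (?i + 1) \<star> ?u = y"
          using sprj_sinj[OF o1 i1 i1, of y] e tsu by simp
        finally show ?thesis unfolding True te .
      next
        case False
        then have nj: "n + j \<noteq> w" by auto
        show ?thesis by (rule nul_eq2[OF T_other[OF j nj] T_other[OF j nj]]) (use u e assms t j o in \<open>auto simp: Tfst\<close>)
      qed
    qed (use u e assms t Tfst in auto)
    then show ?thesis by (rule covI) (use u e t in auto)
  next
    case False
    have "nul (idt (src (pb w ?i)))" using cohom_zero[OF False] by simp
    then have "nul y" by (rule nul_to) (use e in auto)
    then have "nul (pb w ?i \<star> y)" by (rule nul_comp) (use e in auto)
    then have "nul (?t \<star> e)" by (simp only: e(7))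
    then have "nul ?t" by (rule epi_nul[OF e(1)]) (use t e in auto)
    then have "nul (sinj sI (R.ts w w X n) ?i \<star> ?t)" by (rule nul_comp) (use t True o in \<open>auto simp: R_ts\<close>)
    then have "nul t" using T_single[OF True _ assms(1,2)] by simp
    then show ?thesis using assms by (simp add: cov_iff)
  qed
next
  case False
  have "nul t" by (rule T_none[OF False assms(1,2)])
  then show ?thesis using assms by (simp add: cov_iff)
qed

end

locale weight_cpx = tw_nonpos + weight_functor
begin

lemma weights_vanish:
  assumes "w \<noteq> w'" "arr \<phi>" "src \<phi> = src (karr w n)" "tgt \<phi> = tgt (larr w' n')"
  shows "nul \<phi>"
proof (cases "w - n \<in> sI \<and> w' - n' \<in> sI")
  case True
  have k: "src (karr w n) = src (ker (pb w (w - n - 1)))"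
    and l: "tgt (larr w' n') = tgt (cok (pb w' (w' - n')))"
    unfolding karr_def larr_def using True objs_R[of w w n] objs_R[of w' w' n'] by (simp_all add: R_ts)
  show ?thesis
    by (rule no_maps[OF twistedD(1)[OF X] twistedD(1)[OF X] twistedD(1)[OF X] twistedD(1)[OF X]
        q0[of "w - n - 1"] q0[of "w' - n'"] assms(1,2)])
      (use assms(3,4) k l in \<open>auto simp: pb_def\<close>)
next
  case False
  then have "src \<phi> = zero_obj A \<or> tgt \<phi> = zero_obj A" using assms(3,4) by (auto simp: karr_def larr_def)
  then show ?thesis using nul_to_zero_obj nul_from_zero_obj assms(2) by blast
qed

end

sublocale weight_cpx \<subseteq> W: weight_filtration A "tt X" mem "\<lambda>a b. R.tt a b X" pi karr larr
proof (intro weight_filtration.intro weight_filtration_axioms.intro abelian_axioms)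
  show "mem b n x \<Longrightarrow> arr x \<and> tgt x = fst Kc n" for b n x by (simp add: mem_def)
  show "mem b n x \<Longrightarrow> arr (pi a b n x) \<and> src (pi a b n x) = src x \<and> tgt (pi a b n x) = fst (Tc a b) n" for a b n x
    by (simp add: pi_simps)
qed (blast intro: Kcpx Tcpx mem_nul mem_plus mem_neg mem_comp mem_d mem_mono mem_low mem_high pi_plus pi_neg pi_comp pi_d
  pi_low pi_surj pi_ker karr_type karr_d karr_factors larr_type larr_d larr_cov weights_vanish)+

section \<open>Membership in subobjects, tested locally\<close>

context abelian
begin

lemma mono_factors_iff:
  assumes "mono m" "arr g" "tgt g = tgt m"
  shows "factors m g \<longleftrightarrow> nul (cok m \<star> g)"
proof
  assume "factors m g"
  then obtain h where h: "arr h" "src h = src g" "tgt h = src m" "m \<star> h = g" by (rule factorsE)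
  have "nul ((cok m \<star> m) \<star> h)" by (rule comp_nul) (use assms h in auto)
  moreover have "(cok m \<star> m) \<star> h = cok m \<star> (m \<star> h)" by (rule assoc) (use assms h in auto)
  ultimately show "nul (cok m \<star> g)" by (simp only: h(4))
qed (rule mono_factor[OF assms])

lemma factors_local:
  assumes "mono m" "factors m (g \<star> e)" "epi e" "arr g" "tgt g = tgt m" "src g = tgt e"
  shows "factors m g"
proof -
  have "nul ((cok m \<star> g) \<star> e)" using assms mono_factors_iff[of m "g \<star> e"] by simp
  then have "nul (cok m \<star> g)" by (rule epi_nul[OF assms(3)]) (use assms in auto)
  then show ?thesis using assms by (simp add: mono_factors_iff)
qed

lemma factors_comp:
  assumes "factors m g" "arr m" "arr e" "tgt e = src g"
  shows "factors m (g \<star> e)"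
proof -
  obtain h where h: "arr h" "src h = src g" "tgt h = src m" "m \<star> h = g" using assms(1) by (rule factorsE)
  have "m \<star> (h \<star> e) = g \<star> e" by (rule comp_reduce[OF h(4)]) (use h assms in auto)
  then show ?thesis by (rule factorsI) (use h assms in auto)
qed

lemma factors_trans:
  assumes "factors m k" "factors k g" "arr m" "arr k"
  shows "factors m g"
proof -
  obtain h where h: "arr h" "src h = src k" "tgt h = src m" "m \<star> h = k" using assms(1) by (rule factorsE)
  obtain l where l: "arr l" "src l = src g" "tgt l = src k" "k \<star> l = g" using assms(2) by (rule factorsE)
  have "m \<star> (h \<star> l) = k \<star> l" by (rule comp_reduce[OF h(4)]) (use h l assms in auto)
  then have "m \<star> (h \<star> l) = g" by (simp only: l(4))
  then show ?thesis by (rule factorsI) (use h l assms in auto)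
qed

subsection \<open>Degeneration\<close>

text \<open>A class in E_r at p is represented by an element of step p whose differential lies in
  step p - r. By strictness this differential is locally that of an element of step p - r, hence of
  step p - 1, and such differentials are divided out in the target of d_r.\<close>

lemma strict_degenerates:
  assumes K: "cpx K"
    and \<iota>: "\<And>p n. mono (\<iota> p n)" "\<And>p n. tgt (\<iota> p n) = fst K n"
    and incl: "\<And>p q n. p \<le> q \<Longrightarrow> factors (\<iota> q n) (\<iota> p n)"
    and strict: "\<And>p n x. arr x \<Longrightarrow> tgt x = fst K n \<Longrightarrow> factors (\<iota> p (n + 1)) (snd K n \<star> x) \<Longrightarrow>
      \<exists>e y. epi e \<and> tgt e = src x \<and> arr y \<and> factors (\<iota> p n) y \<and> src y = src e \<and> tgt y = fst K n \<and>
        snd K n \<star> y = (snd K n \<star> x) \<star> e"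
  shows "degenerates_at_E1 A K \<iota>"
proof -
  let ?Z = "ss_Z A K \<iota>"
  have \<iota>' [simp]: "arr (\<iota> p n)" for p n using \<iota>(1) by simp
  have Z: "mono (?Z r p n)" "tgt (?Z r p n) = fst K n" for r p n
    unfolding ss_Z_def using \<iota> K by (auto intro!: mono_comp)
  have Z' [simp]: "arr (?Z r p n)" for r p n using Z(1) by simp
  have fZ: "factors (?Z r p n) x \<longleftrightarrow> factors (\<iota> p n) x \<and> factors (\<iota> (p - r) (n + 1)) (snd K n \<star> x)"
    if x: "arr x" "tgt x = fst K n" for r p n x
  proof -
    let ?g = "cok (\<iota> (p - r) (n + 1)) \<star> (snd K n \<star> \<iota> p n)"
    have g: "arr ?g" "src ?g = src (\<iota> p n)" using \<iota> K by auto
    have c: "factors (\<iota> (p - r) (n + 1)) (snd K n \<star> x) \<longleftrightarrow> nul (?g \<star> y)"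
      if y: "arr y" "tgt y = src (\<iota> p n)" "\<iota> p n \<star> y = x" for y
    proof -
      have "?g \<star> y = cok (\<iota> (p - r) (n + 1)) \<star> (snd K n \<star> (\<iota> p n \<star> y))" using y(1,2) \<iota> K by simp
      then show ?thesis unfolding y(3) by (subst mono_factors_iff) (use \<iota> K x in auto)
    qed
    show ?thesis
    proof
      assume "factors (?Z r p n) x"
      then obtain h where h: "arr h" "src h = src x" "tgt h = src (?Z r p n)" "?Z r p n \<star> h = x" by (rule factorsE)
      have h3: "tgt h = src (ker ?g)" using h(3) g \<iota> by (simp add: ss_Z_def)
      have e: "\<iota> p n \<star> (ker ?g \<star> h) = x" using h(4) h(1) h3 g \<iota> by (simp add: ss_Z_def)
      have "nul ((?g \<star> ker ?g) \<star> h)" by (rule comp_nul) (use g h h3 in auto)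
      moreover have "(?g \<star> ker ?g) \<star> h = ?g \<star> (ker ?g \<star> h)" by (rule assoc) (use g h h3 in auto)
      ultimately have "nul (?g \<star> (ker ?g \<star> h))" by simp
      then show "factors (\<iota> p n) x \<and> factors (\<iota> (p - r) (n + 1)) (snd K n \<star> x)"
        using c[of "ker ?g \<star> h"] e g h(1) h3 factorsI[OF e] by simp
    next
      assume a: "factors (\<iota> p n) x \<and> factors (\<iota> (p - r) (n + 1)) (snd K n \<star> x)"
      then obtain y where y: "arr y" "src y = src x" "tgt y = src (\<iota> p n)" "\<iota> p n \<star> y = x" by (blast elim: factorsE)
      have "nul (?g \<star> y)" using c[OF y(1,3,4)] a by blast
      then have "factors (ker ?g) y" using g y by (subst factors_ker) auto
      then obtain s where s: "arr s" "src s = src y" "tgt s = src (ker ?g)" "ker ?g \<star> s = y" by (rule factorsE)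
      have "?Z r p n \<star> s = \<iota> p n \<star> (ker ?g \<star> s)" unfolding ss_Z_def by (rule assoc) (use s g in auto)
      then have "?Z r p n \<star> s = x" by (simp only: s(4) y(4))
      then show "factors (?Z r p n) x" by (rule factorsI) (use s g in \<open>auto simp: ss_Z_def\<close>)
    qed
  qed
  have ZZ: "factors (\<iota> p n) (?Z r p n)" "factors (\<iota> (p - r) (n + 1)) (snd K n \<star> ?Z r p n)" for r p n
    using fZ[of "?Z r p n" n r p] Z by simp_all
  have ddn: "nul (snd K (n + 1) \<star> (snd K n \<star> x))" if "arr x" "tgt x = fst K n" for n x
    by (rule cpx_ddx[OF K]) (use that in auto)
  let ?u = "\<lambda>r p n. lift_arr A (?Z r p n) (?Z (r - 1) (p - 1) n)"
  let ?v = "\<lambda>r p n. lift_arr A (?Z r p n) (snd K (n - 1) \<star> ?Z (r - 1) (p + r - 1) (n - 1))"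
  have fu: "factors (?Z r p n) (?Z (r - 1) (p - 1) n)" for r p n
  proof -
    have "factors (\<iota> p n) (?Z (r - 1) (p - 1) n)"
      by (rule factors_trans[OF incl[of "p - 1" p] ZZ(1)]) auto
    moreover have "p - 1 - (r - 1) = p - r" by simp
    ultimately show ?thesis using ZZ(2)[of "p - 1" "r - 1" n] by (subst fZ) (use Z in auto)
  qed
  have fv: "factors (?Z r p n) (snd K (n - 1) \<star> ?Z (r - 1) (p + r - 1) (n - 1))" for r p n
  proof -
    have e: "p + r - 1 - (r - 1) = p" "n - 1 + 1 = n" by simp_all
    have t: "arr (?Z (r - 1) (p + r - 1) (n - 1))" "tgt (?Z (r - 1) (p + r - 1) (n - 1)) = fst K (n - 1)" using Z by auto
    have "factors (\<iota> p n) (snd K (n - 1) \<star> ?Z (r - 1) (p + r - 1) (n - 1))"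
      using ZZ(2)[of "p + r - 1" "r - 1" "n - 1"] unfolding e .
    moreover have "nul (snd K n \<star> (snd K (n - 1) \<star> ?Z (r - 1) (p + r - 1) (n - 1)))"
      using ddn[OF t] unfolding e .
    then have "factors (\<iota> (p - r) (n + 1)) (snd K n \<star> (snd K (n - 1) \<star> ?Z (r - 1) (p + r - 1) (n - 1)))"
      by (rule nul_factors) (use t K \<iota> in auto)
    ultimately show ?thesis by (subst fZ) (use t K in auto)
  qed
  have quot: "epi (ss_quot A K \<iota> r p n) \<and> src (ss_quot A K \<iota> r p n) = src (?Z r p n) \<and>
     nul (ss_quot A K \<iota> r p n \<star> ?v r p n)" for r p n
  proof -
    define u v where "u = ?u r p n" and "v = ?v r p n"
    have uv: "arr u" "tgt u = src (?Z r p n)" "arr v" "tgt v = src (?Z r p n)"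
      unfolding u_def v_def using fu fv Z by auto
    define Y where "Y = (\<lambda>b. src (if b then u else v))"
    have Y: "objs UNIV Y" "Y True = src u" "Y False = src v" using uv by (auto simp: Y_def)
    note s = dsum_simps[OF Y(1)]
    define t where "t = u \<star> sprj UNIV Y True \<boxplus> v \<star> sprj UNIV Y False"
    have t: "arr t" "src t = dsum UNIV Y" "tgt t = src (?Z r p n)" unfolding t_def using uv s Y by auto
    have tv: "t \<star> sinj UNIV Y False = v" unfolding t_def using uv s Y by (simp add: bilin)
    have q: "ss_quot A K \<iota> r p n = cok t"
      unfolding ss_quot_def Let_def t_def u_def v_def Y_def by simp
    have "nul ((cok t \<star> t) \<star> sinj UNIV Y False)" by (rule comp_nul) (use t s Y in auto)
    moreover have "(cok t \<star> t) \<star> sinj UNIV Y False = cok t \<star> (t \<star> sinj UNIV Y False)" by (rule assoc) (use t s Y in auto)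
    ultimately show ?thesis unfolding q using t tv v_def by simp
  qed
  show ?thesis
    unfolding degenerates_at_E1_def
  proof (intro allI impI)
    fix r p n :: int assume r: "r \<ge> 1"
    let ?q = "ss_quot A K \<iota> r p n" and ?q' = "ss_quot A K \<iota> r (p - r) (n + 1)"
    let ?l = "lift_arr A (?Z r (p - r) (n + 1)) (snd K n \<star> ?Z r p n)"
    note q = quot[of r p n] and q' = quot[of r "p - r" "n + 1"]
    have z: "arr (?Z r p n)" "tgt (?Z r p n) = fst K n" using Z by auto
    have "factors (\<iota> (p - r - r) (n + 1 + 1)) (snd K (n + 1) \<star> (snd K n \<star> ?Z r p n))"
      by (rule nul_factors[OF ddn[OF z]]) (use z K \<iota> in auto)
    then have fl: "factors (?Z r (p - r) (n + 1)) (snd K n \<star> ?Z r p n)"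
      using ZZ(2) by (subst fZ) (use z K in auto)
    then have l: "arr ?l" "src ?l = src (?Z r p n)" "tgt ?l = src (?Z r (p - r) (n + 1))"
      "?Z r (p - r) (n + 1) \<star> ?l = snd K n \<star> ?Z r p n" using Z z K by auto
    obtain e y where e: "epi e" "tgt e = src (?Z r p n)" "arr y" "factors (\<iota> (p - r) n) y" "src y = src e" "tgt y = fst K n"
      "snd K n \<star> y = (snd K n \<star> ?Z r p n) \<star> e" using strict[OF z ZZ(2)] by blast
    \<comment> \<open>With \<open>p - r\<close> in place of \<open>p\<close>, the boundaries divided
      out come from the step \<open>p - r + r - 1 = p - 1\<close>; this step contains
      \<open>y\<close> because \<open>r \<ge> 1\<close>.\<close>
    have ee: "p - 1 - (r - 1) = p - r" "p - r + r - 1 = p - 1" "n + 1 - 1 = n" by simp_all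
    have "factors (\<iota> (p - 1) n) y" by (rule factors_trans[OF incl[of "p - r" "p - 1"] e(4)]) (use r in auto)
    moreover have "factors (\<iota> (p - r) (n + 1)) (snd K n \<star> y)"
      unfolding e(7) by (rule factors_comp[OF ZZ(2)]) (use z K e in auto)
    ultimately have "factors (?Z (r - 1) (p - 1) n) y" by (subst fZ) (use e in \<open>auto simp: ee\<close>)
    then obtain y' where y': "arr y'" "src y' = src y" "tgt y' = src (?Z (r - 1) (p - 1) n)" "?Z (r - 1) (p - 1) n \<star> y' = y" by (rule factorsE)
    let ?w = "?v r (p - r) (n + 1)"
    have w: "arr ?w" "src ?w = src (?Z (r - 1) (p - 1) n)" "tgt ?w = src (?Z r (p - r) (n + 1))"
      "?Z r (p - r) (n + 1) \<star> ?w = snd K n \<star> ?Z (r - 1) (p - 1) n"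
      using fv[of r "p - r" "n + 1"] Z K by (simp_all add: ee)
    have "?w \<star> y' = ?l \<star> e"
    proof (rule mono_cancel[OF Z(1)[of r "p - r" "n + 1"]])
      have "?Z r (p - r) (n + 1) \<star> (?w \<star> y') = (snd K n \<star> ?Z (r - 1) (p - 1) n) \<star> y'"
        by (rule comp_reduce[OF w(4)]) (use w(1-3) y' in auto)
      also have "\<dots> = snd K n \<star> (?Z (r - 1) (p - 1) n \<star> y')" by (rule assoc) (use y' Z K in auto)
      also have "\<dots> = (snd K n \<star> ?Z r p n) \<star> e" by (simp only: y'(4) e(7))
      also have "\<dots> = ?Z r (p - r) (n + 1) \<star> (?l \<star> e)"
        by (rule comp_reduce[OF l(4), symmetric]) (use l e in auto)
      finally show "?Z r (p - r) (n + 1) \<star> (?w \<star> y') = ?Z r (p - r) (n + 1) \<star> (?l \<star> e)" .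
    qed (use w(1-3) y' l(1-3) e in auto)
    moreover have "nul ((?q' \<star> ?w) \<star> y')" by (rule comp_nul) (use q' w(1-3) y' in auto)
    moreover have "(?q' \<star> ?w) \<star> y' = ?q' \<star> (?w \<star> y')" by (rule assoc) (use q' w(1-3) y' in auto)
    moreover have "(?q' \<star> ?l) \<star> e = ?q' \<star> (?l \<star> e)" by (rule assoc) (use q' l(1-3) e in auto)
    ultimately have "nul ((?q' \<star> ?l) \<star> e)" by simp
    then have nl: "nul (?q' \<star> ?l)" by (rule epi_nul[OF e(1)]) (use q' l(1-3) e in auto)
    have "desc_arr A ?q (?q' \<star> ?l) = zr (tgt ?q) (tgt ?q')"
    proof (rule desc_eqI)
      have q1: "epi ?q" "arr ?q" "src ?q = src (?Z r p n)" "epi ?q'" "arr ?q'" "src ?q' = src (?Z r (p - r) (n + 1))"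
        using q q' by auto
      then show "epi ?q" "arr (zr (tgt ?q) (tgt ?q'))" "src (zr (tgt ?q) (tgt ?q')) = tgt ?q" by auto
      have "?q' \<star> ?l = zr (src (?Z r p n)) (tgt ?q')" by (rule nul_eq[OF nl]) (use q1 l(1-3) in auto)
      then show "zr (tgt ?q) (tgt ?q') \<star> ?q = ?q' \<star> ?l" using q1 by simp
    qed
    then show "ss_diff A K \<iota> r p n = zr (ss_E A K \<iota> r p n) (ss_E A K \<iota> r (p - r) (n + 1))"
      by (simp add: ss_diff_def ss_E_def)
  qed
qed

end

context tw_nonpos
begin

lemma G_incl_eq: "G_incl A C F X b = inc b"
  by (auto simp: G_incl_def)

lemma inc_factors: "p \<le> q \<Longrightarrow> factors (inc q n) (inc p n)"
  using mem_mono[of p n "inc p n" q] by (simp add: mem_def)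

end

context weight_cpx
begin

lemma strict:
  assumes "arr x" "tgt x = fst Kc n" "factors (inc p (n + 1)) (snd Kc n \<star> x)"
  shows "\<exists>e y. epi e \<and> tgt e = src x \<and> arr y \<and> factors (inc p n) y \<and> src y = src e \<and> tgt y = fst Kc n \<and>
        snd Kc n \<star> y = (snd Kc n \<star> x) \<star> e"
proof -
  have "W.loc_bdry p (n + 1) (snd Kc n \<star> x)"
    using W.strict[of x "n + 1" p] assms by (simp add: mem_def)
  then show ?thesis unfolding W.loc_bdry_def mem_def using assms by auto
qed

lemma S_deg: "S_degenerates A C F X"
  unfolding S_degenerates_def G_incl_eq[abs_def]
  by (rule strict_degenerates) (use inc_factors strict in auto)

end

section \<open>Degeneration for the quotient complexes\<close>

locale weight_quot = weight_cpx +
  fixes a b :: int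
  assumes ab: "a \<le> b"
begin

abbreviation jj where "jj p n \<equiv> lift_arr A (inc b n) (inc p n)"
abbreviation qq where "qq n \<equiv> cok (jj a n)"
abbreviation GQ where "GQ \<equiv> G_quot A C F X b a"
abbreviation fil where "fil \<equiv> G_quot_filt A C F X b a"

lemma jj [simp]:
  assumes "p \<le> b"
  shows "arr (jj p n)" "src (jj p n) = fst (Gc p) n" "tgt (jj p n) = fst (Gc b) n" "inc b n \<star> jj p n = inc p n"
  using inc_factors[OF assms, of n] by auto

lemma mono_jj: assumes "p \<le> b" shows "mono (jj p n)"
proof (rule monoI)
  fix g assume g: "arr g" "tgt g = src (jj p n)" "nul (jj p n \<star> g)"
  then have "nul (inc b n \<star> (jj p n \<star> g))" using assms by simp
  moreover have "inc b n \<star> (jj p n \<star> g) = inc p n \<star> g"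
    by (rule comp_reduce[OF jj(4)]) (use assms g in auto)
  ultimately have "nul (inc p n \<star> g)" by simp
  then show "nul g" by (rule mono_nul[OF mono_inc]) (use g assms in auto)
qed (use assms in simp)

lemma jj_d: assumes "p \<le> b" shows "snd (Gc b) n \<star> jj p n = jj p (n + 1) \<star> snd (Gc p) n"
proof (rule mono_cancel[OF mono_inc])
  have "inc b (n + 1) \<star> (snd (Gc b) n \<star> jj p n) = snd Kc n \<star> (inc b n \<star> jj p n)"
    using cmap_dx[OF inc_cmap, of "jj p n" b n] assms by simp
  also have "\<dots> = inc p (n + 1) \<star> snd (Gc p) n" using cmapD(6)[OF inc_cmap, of n p] assms by simp
  also have "\<dots> = inc b (n + 1) \<star> (jj p (n + 1) \<star> snd (Gc p) n)"
    by (rule comp_reduce[OF jj(4), symmetric]) (use assms in auto)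
  finally show "inc b (n + 1) \<star> (snd (Gc b) n \<star> jj p n) = inc b (n + 1) \<star> (jj p (n + 1) \<star> snd (Gc p) n)" .
qed (use assms in auto)

lemma qq [simp]: "epi (qq n)" "src (qq n) = fst (Gc b) n" "nul (qq n \<star> jj a n)"
  using jj[OF ab, of n] by auto

lemma GQ_simps: "fst GQ n = tgt (qq n)" "arr (snd GQ n)" "src (snd GQ n) = tgt (qq n)" "tgt (snd GQ n) = tgt (qq (n + 1))"
  "snd GQ n \<star> qq n = qq (n + 1) \<star> snd (Gc b) n"
proof -
  have p: "G_proj A C F X b a n = qq n" for n by (simp add: G_proj_def G_incl_eq)
  show "fst GQ n = tgt (qq n)" by (simp add: G_quot_def p)
  have s: "snd GQ n = desc_arr A (qq n) (qq (n + 1) \<star> snd (Gc b) n)" by (simp add: G_quot_def p)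
  have n: "nul ((qq (n + 1) \<star> jj a (n + 1)) \<star> snd (Gc a) n)" by (rule comp_nul[OF qq(3)]) (use jj[OF ab] in auto)
  have e: "(qq (n + 1) \<star> jj a (n + 1)) \<star> snd (Gc a) n = (qq (n + 1) \<star> snd (Gc b) n) \<star> jj a n"
    using jj[OF ab] epi_arr[OF qq(1)] by (simp add: jj_d[OF ab] del: cok_simps)
  have "nul ((qq (n + 1) \<star> snd (Gc b) n) \<star> jj a n)" using n unfolding e .
  then have "cofactors (qq n) (qq (n + 1) \<star> snd (Gc b) n)" using jj[OF ab] by (simp add: cofactors_cok)
  then show "arr (snd GQ n)" "src (snd GQ n) = tgt (qq n)" "tgt (snd GQ n) = tgt (qq (n + 1))"
    "snd GQ n \<star> qq n = qq (n + 1) \<star> snd (Gc b) n" unfolding s by auto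
qed

lemma GQ_cpx: "cpx GQ"
proof (rule cpxI)
  fix n
  have "(snd GQ (n + 1) \<star> snd GQ n) \<star> qq n = snd GQ (n + 1) \<star> (snd GQ n \<star> qq n)"
    by (rule assoc) (use GQ_simps in auto)
  also have "\<dots> = snd GQ (n + 1) \<star> (qq (n + 1) \<star> snd (Gc b) n)" by (simp only: GQ_simps(5))
  also have "\<dots> = (qq (n + 1 + 1) \<star> snd (Gc b) (n + 1)) \<star> snd (Gc b) n"
    by (rule comp_reduce[OF GQ_simps(5)]) (use GQ_simps in auto)
  also have "\<dots> = qq (n + 1 + 1) \<star> (snd (Gc b) (n + 1) \<star> snd (Gc b) n)" by (rule assoc) auto
  finally have e: "(snd GQ (n + 1) \<star> snd GQ n) \<star> qq n = qq (n + 1 + 1) \<star> (snd (Gc b) (n + 1) \<star> snd (Gc b) n)" .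
  have "nul ((snd GQ (n + 1) \<star> snd GQ n) \<star> qq n)"
    unfolding e by (rule nul_comp[OF cpx_dd]) auto
  then show "nul (snd GQ (n + 1) \<star> snd GQ n)" by (rule epi_nul[OF qq(1)]) (use GQ_simps in auto)
qed (use GQ_simps epi_arr[OF qq(1)] in auto)

lemma qq_nul_iff:
  assumes "arr y" "tgt y = fst (Gc b) n"
  shows "nul (qq n \<star> y) \<longleftrightarrow> mem a n (inc b n \<star> y)"
proof -
  have "nul (qq n \<star> y) \<longleftrightarrow> factors (jj a n) y"
    by (rule mono_factors_iff[OF mono_jj[OF ab], symmetric]) (use assms jj[OF ab] in auto)
  also have "\<dots> \<longleftrightarrow> factors (inc a n) (inc b n \<star> y)"
  proof
    assume "factors (jj a n) y"
    then obtain h where h: "arr h" "src h = src y" "tgt h = src (jj a n)" "jj a n \<star> h = y" by (rule factorsE)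
    have "inc a n \<star> h = inc b n \<star> (jj a n \<star> h)"
      by (rule comp_reduce[OF jj(4)[OF ab], symmetric]) (use h ab in auto)
    then have "inc a n \<star> h = inc b n \<star> y" by (simp only: h(4))
    then show "factors (inc a n) (inc b n \<star> y)" by (rule factorsI) (use h ab in auto)
  next
    assume "factors (inc a n) (inc b n \<star> y)"
    then obtain h where h: "arr h" "src h = src (inc b n \<star> y)" "tgt h = src (inc a n)" "inc a n \<star> h = inc b n \<star> y" by (rule factorsE)
    have "jj a n \<star> h = y"
    proof (rule mono_cancel[OF mono_inc])
      show "inc b n \<star> (jj a n \<star> h) = inc b n \<star> y"
        unfolding h(4)[symmetric] by (rule comp_reduce[OF jj(4)[OF ab]]) (use h ab in auto)
    qed (use h assms ab in auto)
    then show "factors (jj a n) y" by (rule factorsI) (use h ab in auto)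
  qed
  finally show ?thesis using assms by (simp add: mem_def)
qed

text \<open>Step \<open>p\<close> of the induced filtration is the image of this arrow; keeping the
  arrow itself reduces membership to local lifts from a step of G X.\<close>

definition ff where "ff p n = qq n \<star> jj (min p b) n"

lemma ff [simp]: "arr (ff p n)" "src (ff p n) = fst (Gc (min p b)) n" "tgt (ff p n) = tgt (qq n)"
  unfolding ff_def using jj[of "min p b" n] by auto

lemma fil_eq: "fil p n = im (ff p n)"
  by (simp add: G_quot_filt_def G_proj_def G_incl_eq ff_def)

text \<open>The preimage in G_b X of a step of the induced filtration is the sum of the
  corresponding step of G_b X and the subcomplex divided out. The filtration is linearly ordered, so
  this sum is the larger of the two.\<close>

lemma cov_ff_iff:
  assumes y: "arr y" "tgt y = fst (Gc b) n"
  shows "cov (ff p n) (qq n \<star> y) \<longleftrightarrow> mem (max (min p b) a) n (inc b n \<star> y)"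
proof
  let ?p = "min p b"
  have pb: "?p \<le> b" by simp
  assume "cov (ff p n) (qq n \<star> y)"
  then obtain e x where e: "epi e" "arr e" "tgt e = src (qq n \<star> y)" "arr x" "src x = src e" "tgt x = src (ff p n)"
    "ff p n \<star> x = (qq n \<star> y) \<star> e" by (rule covE)
  have x: "tgt x = fst (Gc ?p) n" "tgt e = src y" using e y by auto
  let ?z = "y \<star> e \<boxminus> jj ?p n \<star> x"
  have z: "arr ?z" "tgt ?z = fst (Gc b) n" using e x y jj[OF pb] by auto
  have "qq n \<star> (jj ?p n \<star> x) = qq n \<star> (y \<star> e)"
    using e(7) e(1-5) x y jj(1-3)[OF pb] unfolding ff_def by simp
  then have "nul (qq n \<star> ?z)" using e(1-5) x y jj(1-3)[OF pb] epi_arr[OF qq(1)] by (simp add: bilin)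
  then have m: "mem a n (inc b n \<star> ?z)" using qq_nul_iff[OF z] by simp
  have c: "inc b n \<star> (jj ?p n \<star> x) = inc ?p n \<star> x" by (rule comp_reduce[OF jj(4)[OF pb]]) (use e x jj[OF pb] in auto)
  have "mem ?p n (inc ?p n \<star> x)" by (rule memI) (use e x in auto)
  then have m2: "mem (max ?p a) n (inc ?p n \<star> x)" by (rule mem_mono) simp
  have m1: "mem (max ?p a) n (inc b n \<star> ?z)" by (rule mem_mono[OF m]) simp
  have "mem (max ?p a) n (inc b n \<star> ?z \<boxplus> inc ?p n \<star> x)"
    by (rule mem_plus[OF m1 m2]) (use e x y jj(1-3)[OF pb] in auto)
  moreover have "inc b n \<star> ?z \<boxplus> inc ?p n \<star> x = (inc b n \<star> y) \<star> e"
    using e x y jj(1-3)[OF pb] c by (simp add: bilin add_assoc)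
  ultimately have "factors (inc (max ?p a) n) ((inc b n \<star> y) \<star> e)" by (simp add: mem_def)
  then have "factors (inc (max ?p a) n) (inc b n \<star> y)" by (rule factors_local[rotated]) (use e x y in auto)
  then show "mem (max ?p a) n (inc b n \<star> y)" using y by (simp add: mem_def)
next
  let ?p = "min p b"
  have pb: "?p \<le> b" by simp
  assume m: "mem (max ?p a) n (inc b n \<star> y)"
  show "cov (ff p n) (qq n \<star> y)"
  proof (cases "?p \<le> a")
    case True
    then have "nul (qq n \<star> y)" using m qq_nul_iff[OF y] by (simp add: max_def)
    then show ?thesis using y epi_arr[OF qq(1)] by (simp add: cov_iff)
  next
    case False
    then have "mem ?p n (inc b n \<star> y)" using m by (simp add: max_def split: if_splits)
    then obtain h where h: "arr h" "src h = src (inc b n \<star> y)" "tgt h = fst (Gc ?p) n" "inc ?p n \<star> h = inc b n \<star> y" by (rule memE)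
    have "jj ?p n \<star> h = y"
    proof (rule mono_cancel[OF mono_inc])
      show "inc b n \<star> (jj ?p n \<star> h) = inc b n \<star> y"
        unfolding h(4)[symmetric] by (rule comp_reduce[OF jj(4)[OF pb]]) (use h jj[OF pb] in auto)
    qed (use h y jj[OF pb] in auto)
    then have "ff p n \<star> h = qq n \<star> y" unfolding ff_def using h jj(1-3)[OF pb] by simp
    then show ?thesis by (rule cov_factor) (use h in auto)
  qed
qed

text \<open>Strictness of G X passes to the quotient: an element is lifted locally to G_b X, a
  primitive for the boundary of the lift is found in the right step of G X, and this step is
  contained in G_b X.\<close>

lemma SN_deg: "degenerates_at_E1 A GQ fil"
proof (rule strict_degenerates[OF GQ_cpx])
  fix p n
  show "mono (fil p n)" "tgt (fil p n) = fst GQ n" unfolding fil_eq by (auto simp: GQ_simps)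
next
  fix p q n :: int assume pq: "p \<le> q"
  let ?e = "lift_arr A (im (ff p n)) (ff p n)"
  have e: "epi ?e" "arr ?e" "tgt ?e = src (im (ff p n))" "im (ff p n) \<star> ?e = ff p n"
    using lift_im_epi[of "ff p n"] by auto
  have "cov (ff q n) (ff p n)"
    unfolding ff_def[of p] by (subst cov_ff_iff) (use pq jj[of "min p b" n] mem_mono[of "min p b" n "inc (min p b) n"] in \<open>auto simp: mem_def\<close>)
  then have "cov (ff q n) (im (ff p n) \<star> ?e)" by (simp only: e(4))
  then have "cov (ff q n) (im (ff p n))" by (subst (asm) cov_epi_iff[OF e(1)]) (use e in auto)
  then show "factors (fil q n) (fil p n)" unfolding fil_eq by (subst factors_im_cov) auto
next
  fix p n x assume x: "arr x" "tgt x = fst GQ n" and f: "factors (fil p (n + 1)) (snd GQ n \<star> x)"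
  \<comment> \<open>The step of G X that is the preimage of step \<open>p\<close> of the quotient;
    as \<open>a \<le> b\<close>, it does not exceed \<open>b\<close>.\<close>
  let ?q = "max (min p b) a"
  have "cov (qq n) x" by (rule cov_epi) (use x GQ_simps in auto)
  then obtain e y where e: "epi e" "arr e" "tgt e = src x" "arr y" "src y = src e" "tgt y = src (qq n)" "qq n \<star> y = x \<star> e" by (rule covE)
  have y: "tgt y = fst (Gc b) n" using e by simp
  have dK: "snd GQ n \<star> (qq n \<star> w) = qq (n + 1) \<star> (snd (Gc b) n \<star> w)" if "arr w" "tgt w = fst (Gc b) n" for w
    using comp_reduce[OF GQ_simps(5), of n w] that GQ_simps by simp
  have "cov (ff p (n + 1)) (snd GQ n \<star> x)" using f x GQ_simps unfolding fil_eq by (subst (asm) factors_im_cov) auto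
  then have "cov (ff p (n + 1)) ((snd GQ n \<star> x) \<star> e)" by (rule cov_comp) (use x e GQ_simps in auto)
  then have "cov (ff p (n + 1)) (snd GQ n \<star> (qq n \<star> y))" unfolding e(7) using x e(1-5) GQ_simps by simp
  then have "mem ?q (n + 1) (inc b (n + 1) \<star> (snd (Gc b) n \<star> y))"
    unfolding dK[OF e(4) y] by (subst (asm) cov_ff_iff) (use e y in auto)
  moreover have dy: "inc b (n + 1) \<star> (snd (Gc b) n \<star> y) = snd Kc n \<star> (inc b n \<star> y)"
    using cmap_dx[OF inc_cmap e(4) y] by simp
  ultimately have "factors (inc ?q (n + 1)) (snd Kc n \<star> (inc b n \<star> y))" by (simp add: mem_def)
  then obtain f z where f: "epi f" "tgt f = src (inc b n \<star> y)" "arr z" "factors (inc ?q n) z" "src z = src f" "tgt z = fst Kc n"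
    "snd Kc n \<star> z = (snd Kc n \<star> (inc b n \<star> y)) \<star> f" using strict[of "inc b n \<star> y" n ?q] e y by auto
  have f2: "tgt f = src y" using f e y by simp
  have zq: "mem ?q n z" using f by (simp add: mem_def)
  then have "mem b n z" by (rule mem_mono) (use ab in auto)
  then obtain z' where z': "arr z'" "src z' = src z" "tgt z' = fst (Gc b) n" "inc b n \<star> z' = z" by (rule memE)
  have "cov (ff p n) (qq n \<star> z')" using zq z' by (simp add: cov_ff_iff)
  then have fz: "factors (fil p n) (qq n \<star> z')" unfolding fil_eq by (subst factors_im_cov) (use z' in auto)
  have "snd (Gc b) n \<star> z' = (snd (Gc b) n \<star> y) \<star> f"
  proof (rule mono_cancel[OF mono_inc])
    have "inc b (n + 1) \<star> (snd (Gc b) n \<star> z') = snd Kc n \<star> z"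
      using cmap_dx[OF inc_cmap z'(1,3)] by (simp only: z'(4))
    also have "\<dots> = (inc b (n + 1) \<star> (snd (Gc b) n \<star> y)) \<star> f" by (simp only: f(7) dy)
    also have "\<dots> = inc b (n + 1) \<star> ((snd (Gc b) n \<star> y) \<star> f)" using e y f f2 by simp
    finally show "inc b (n + 1) \<star> (snd (Gc b) n \<star> z') = inc b (n + 1) \<star> ((snd (Gc b) n \<star> y) \<star> f)" .
  qed (use z' e y f f2 in auto)
  then have "snd GQ n \<star> (qq n \<star> z') = (snd GQ n \<star> (qq n \<star> y)) \<star> f"
    unfolding dK[OF z'(1,3)] dK[OF e(4) y] using e y f f2 by simp
  also have "\<dots> = (snd GQ n \<star> x) \<star> (e \<star> f)" unfolding e(7) using e(1-5) x f f2 GQ_simps by simp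
  finally show "\<exists>e y. epi e \<and> tgt e = src x \<and> arr y \<and> factors (fil p n) y \<and> src y = src e \<and> tgt y = fst GQ n \<and>
        snd GQ n \<star> y = (snd GQ n \<star> x) \<star> e"
    using fz e(1-5) f f2 z' epi_comp[of f e] GQ_simps
    by (intro exI[of _ "e \<star> f"] exI[of _ "qq n \<star> z'"]) auto
qed

end

context weight_cpx
begin

lemma SN_deg: "SN_degenerates A C F b N X"
proof -
  interpret weight_quot A C F X "b - int N - 1" b
    by unfold_locales simp
  show ?thesis unfolding SN_degenerates_def by (rule SN_deg)
qed

end

context abelian
begin

lemma cov_im: assumes "cov g (h \<star> f)" "arr g" "arr h" "arr f" "src h = tgt f" "tgt h = tgt g"
  shows "cov g (h \<star> im f)"
proof -
  let ?e = "lift_arr A (im f) f"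
  have e: "epi ?e" "arr ?e" "tgt ?e = src (im f)" "im f \<star> ?e = f" using lift_im_epi[of f] assms(4) by auto
  have "(h \<star> im f) \<star> ?e = h \<star> (im f \<star> ?e)" by (rule assoc) (use e assms in auto)
  then have "cov g ((h \<star> im f) \<star> ?e)" using assms(1) by (simp only: e(4))
  then show ?thesis by (subst (asm) cov_epi_iff[OF e(1)]) (use e assms in auto)
qed

text \<open>Having the same kernel, tested on all arrows, each of the two epimorphisms descends
  along the other, and the resulting arrows are mutually inverse because epimorphisms
  cancel.\<close>

lemma epi_iso:
  assumes u: "epi u" and v: "epi v" and s: "src u = src v"
    and k: "\<And>x. arr x \<Longrightarrow> tgt x = src u \<Longrightarrow> nul (u \<star> x) \<longleftrightarrow> nul (v \<star> x)"
  shows "arr (desc_arr A u v)" "src (desc_arr A u v) = tgt u" "tgt (desc_arr A u v) = tgt v"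
    "desc_arr A u v \<star> u = v" "cat_iso A (desc_arr A u v)"
proof -
  have c: "cofactors u v" by (rule epi_cofactor[OF u]) (use assms in auto)
  have c': "cofactors v u" by (rule epi_cofactor[OF v]) (use assms in auto)
  let ?d = "desc_arr A u v" and ?d' = "desc_arr A v u"
  show d: "arr ?d" "src ?d = tgt u" "tgt ?d = tgt v" "?d \<star> u = v" using u c by auto
  have d': "arr ?d'" "src ?d' = tgt v" "tgt ?d' = tgt u" "?d' \<star> v = u" using v c' by auto
  have "?d' \<star> ?d = idt (tgt u)"
  proof (rule epi_cancel[OF u])
    have "(?d' \<star> ?d) \<star> u = ?d' \<star> (?d \<star> u)" by (rule assoc) (use d d' u in auto)
    also have "\<dots> = u" by (simp only: d(4) d'(4))
    finally show "(?d' \<star> ?d) \<star> u = idt (tgt u) \<star> u" using u by simp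
  qed (use d d' u in auto)
  moreover have "?d \<star> ?d' = idt (tgt v)"
  proof (rule epi_cancel[OF v])
    have "(?d \<star> ?d') \<star> v = ?d \<star> (?d' \<star> v)" by (rule assoc) (use d d' v in auto)
    also have "\<dots> = v" by (simp only: d(4) d'(4))
    finally show "(?d \<star> ?d') \<star> v = idt (tgt v) \<star> v" using v by simp
  qed (use d d' v in auto)
  ultimately show "cat_iso A ?d" unfolding cat_iso_def using d d' by (intro conjI bexI[of _ ?d']) auto
qed

end

subsection \<open>The quotients of the weight filtration\<close>

context tw_nonpos
begin

abbreviation gci where "gci s l \<equiv> G_cohom_incl A C F s l X"
abbreviation win where "win s l \<equiv> W_incl A C F s l X"

lemma gci_eq: "gci s l = cohom_map A s (Gc l) Kc (inc l)"
  by (simp add: G_cohom_incl_def G_incl_eq)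

lemma gci [simp]: "arr (gci s l)" "src (gci s l) = cohom A s (Gc l)" "tgt (gci s l) = cohom A s Kc"
  unfolding gci_eq using cohom_map[OF inc_cmap] by auto

lemma gci_cls: "cyc (Gc l) s z \<Longrightarrow> gci s l \<star> cls (Gc l) s z = cls Kc s (inc l s \<star> z)"
  unfolding gci_eq by (rule cohom_map(4)[OF inc_cmap])

lemma win [simp]: "mono (win s l)" "tgt (win s l) = cohom A s Kc"
  unfolding W_incl_def by auto

lemma win_factors: "arr x \<Longrightarrow> tgt x = cohom A s Kc \<Longrightarrow> factors (win s l) x \<longleftrightarrow> cov (gci s l) x"
  unfolding W_incl_def by (rule factors_im_cov) auto

lemma gci_cov: assumes "a \<le> b" shows "cov (gci s b) (gci s a)"
proof -
  let ?j = "\<lambda>n. lift_arr A (inc b n) (inc a n)"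
  have j: "arr (?j n)" "src (?j n) = fst (Gc a) n" "tgt (?j n) = fst (Gc b) n" "inc b n \<star> ?j n = inc a n" for n
    using inc_factors[OF assms, of n] by auto
  have "cmap (Gc a) (Gc b) ?j"
  proof (rule cmapI)
    fix n
    show "snd (Gc b) n \<star> ?j n = ?j (n + 1) \<star> snd (Gc a) n"
    proof (rule mono_cancel[OF mono_inc])
      have "inc b (n + 1) \<star> (snd (Gc b) n \<star> ?j n) = snd Kc n \<star> (inc b n \<star> ?j n)"
        using cmap_dx[OF inc_cmap, of "?j n" b n] j(1-3) by simp
      also have "\<dots> = inc a (n + 1) \<star> snd (Gc a) n" using cmapD(6)[OF inc_cmap, of n a] j by simp
      also have "\<dots> = inc b (n + 1) \<star> (?j (n + 1) \<star> snd (Gc a) n)"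
        by (rule comp_reduce[OF j(4), symmetric]) (use j in auto)
      finally show "inc b (n + 1) \<star> (snd (Gc b) n \<star> ?j n) = inc b (n + 1) \<star> (?j (n + 1) \<star> snd (Gc a) n)" .
    qed (use j in auto)
  qed (use j in auto)
  from cohom_map_comp[OF this inc_cmap, of s] cohom_map[OF this, of s]
  have "gci s b \<star> cohom_map A s (Gc a) (Gc b) ?j = gci s a" unfolding gci_eq by (simp add: j(4))
  then show ?thesis by (rule cov_factor) (use cohom_map[OF \<open>cmap (Gc a) (Gc b) ?j\<close>, of s] in auto)
qed

lemma win_mono: assumes "a \<le> b" shows "factors (win s b) (win s a)"
proof -
  have "cov (gci s b) (idt (cohom A s Kc) \<star> im (gci s a))" by (rule cov_im) (use gci_cov[OF assms] in auto)
  then have "cov (gci s b) (win s a)" by (simp add: W_incl_def)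
  then show ?thesis by (subst win_factors) auto
qed

abbreviation wpr where "wpr s b a \<equiv> W_proj A C F s b a X"
abbreviation wk where "wk s b a \<equiv> lift_arr A (win s b) (win s a)"
abbreviation we where "we s b \<equiv> lift_arr A (win s b) (gci s b)"
abbreviation gw where "gw s b a \<equiv> G_to_W_quot A C F s b a X"
abbreviation gt where "gt s b a \<equiv> G_to_trunc A C F s b a X"

lemma wk [simp]:
  assumes "a \<le> b"
  shows "arr (wk s b a)" "src (wk s b a) = src (win s a)" "tgt (wk s b a) = src (win s b)" "win s b \<star> wk s b a = win s a"
  using win_mono[OF assms, of s] by auto

lemma we [simp]: "arr (we s b)" "src (we s b) = cohom A s (Gc b)" "tgt (we s b) = src (win s b)" "win s b \<star> we s b = gci s b"
proof -
  have "factors (win s b) (gci s b)" unfolding W_incl_def by simp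
  then show "arr (we s b)" "src (we s b) = cohom A s (Gc b)" "tgt (we s b) = src (win s b)" "win s b \<star> we s b = gci s b" by auto
qed

lemma wpr_eq: "wpr s b a = cok (wk s b a)"
  by (simp add: W_proj_def)

lemma wpr [simp]:
  assumes "a \<le> b"
  shows "epi (wpr s b a)" "src (wpr s b a) = src (win s b)" "nul (wpr s b a \<star> wk s b a)"
  unfolding wpr_eq using wk[OF assms, of s] by auto

lemma gw_eq: "gw s b a = wpr s b a \<star> we s b"
  by (simp add: G_to_W_quot_def)

lemma gw:
  assumes "a \<le> b"
  shows "epi (gw s b a)" "src (gw s b a) = cohom A s (Gc b)" "tgt (gw s b a) = tgt (wpr s b a)"
proof -
  have "epi (we s b)" using lift_im_epi[of "gci s b"] by (simp add: W_incl_def)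
  then show "epi (gw s b a)" "src (gw s b a) = cohom A s (Gc b)" "tgt (gw s b a) = tgt (wpr s b a)"
    unfolding gw_eq using wpr[OF assms, of s] epi_arr[OF wpr(1)[OF assms, of s]] by (auto intro: epi_comp)
qed

text \<open>The inclusions of W_a and W_b are monomorphisms, so vanishing in the quotient means that
  the image in the cohomology of G X lies in W_a, which is an image and is tested by local
  lifting.\<close>

lemma gw_nul:
  assumes "a \<le> b" "arr x" "tgt x = cohom A s (Gc b)"
  shows "nul (gw s b a \<star> x) \<longleftrightarrow> cov (gci s a) (gci s b \<star> x)"
proof -
  note k = wk[OF assms(1), of s]
  have mk: "mono (wk s b a)"
  proof (rule monoI)
    fix g assume g: "arr g" "tgt g = src (wk s b a)" "nul (wk s b a \<star> g)"
    then have "nul (win s b \<star> (wk s b a \<star> g))" using k by simp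
    moreover have "win s b \<star> (wk s b a \<star> g) = win s a \<star> g" by (rule comp_reduce[OF k(4)]) (use g k in auto)
    ultimately have "nul (win s a \<star> g)" by simp
    then show "nul g" by (rule mono_nul[rotated]) (use g k in auto)
  qed (use k in simp)
  have "gw s b a \<star> x = cok (wk s b a) \<star> (we s b \<star> x)" unfolding gw_eq wpr_eq using assms k by simp
  then have "nul (gw s b a \<star> x) \<longleftrightarrow> factors (wk s b a) (we s b \<star> x)"
    using mono_factors_iff[OF mk, of "we s b \<star> x"] assms k by simp
  also have "\<dots> \<longleftrightarrow> factors (win s a) (gci s b \<star> x)"
  proof -
    have e: "win s b \<star> (we s b \<star> x) = gci s b \<star> x" by (rule comp_reduce[OF we(4)]) (use assms in auto)
    show ?thesis
    proof
      assume "factors (wk s b a) (we s b \<star> x)"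
      then obtain h where h: "arr h" "src h = src (we s b \<star> x)" "tgt h = src (wk s b a)" "wk s b a \<star> h = we s b \<star> x" by (rule factorsE)
      have "win s b \<star> (wk s b a \<star> h) = win s a \<star> h" by (rule comp_reduce[OF k(4)]) (use h k in auto)
      then have "win s a \<star> h = gci s b \<star> x" by (simp only: h(4) e)
      then show "factors (win s a) (gci s b \<star> x)" by (rule factorsI) (use h k in auto)
    next
      assume "factors (win s a) (gci s b \<star> x)"
      then obtain h where h: "arr h" "src h = src (gci s b \<star> x)" "tgt h = src (win s a)" "win s a \<star> h = gci s b \<star> x" by (rule factorsE)
      have "wk s b a \<star> h = we s b \<star> x"
      proof (rule mono_cancel[OF win(1)[of s b]])
        have "win s b \<star> (wk s b a \<star> h) = win s a \<star> h" by (rule comp_reduce[OF k(4)]) (use h k in auto)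
        then show "win s b \<star> (wk s b a \<star> h) = win s b \<star> (we s b \<star> x)" by (simp only: h(4) e)
      qed (use h k assms in auto)
      then show "factors (wk s b a) (we s b \<star> x)" by (rule factorsI) (use h k in auto)
    qed
  qed
  also have "\<dots> \<longleftrightarrow> cov (gci s a) (gci s b \<star> x)" by (rule win_factors) (use assms in auto)
  finally show ?thesis .
qed

lemma gt_eq: "gt s b a = cohom_map A s (Gc b) (Tc (a + 1) b) (prj (a + 1) b)"
proof -
  have "tot_trans A C (fun_le A b F) (fun_trunc A (a + 1) b F) (\<lambda>P. trunc_ge_proj A (a + 1) (fun_obj (fun_le A b F) P)) X = prj (a + 1) b"
    by auto
  then show ?thesis by (simp add: G_to_trunc_def)
qed

lemma gt [simp]: "arr (gt s b a)" "src (gt s b a) = cohom A s (Gc b)" "tgt (gt s b a) = cohom A s (Tc (a + 1) b)"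
  unfolding gt_eq using cohom_map[OF prj_cmap] by auto

lemma gt_cls: "cyc (Gc b) s z \<Longrightarrow> gt s b a \<star> cls (Gc b) s z = cls (Tc (a + 1) b) s (prj (a + 1) b s \<star> z)"
  unfolding gt_eq by (rule cohom_map(4)[OF prj_cmap])

lemma cyc_inc: assumes "arr z" "tgt z = fst (Gc l) s" "nul (snd Kc s \<star> (inc l s \<star> z))" shows "cyc (Gc l) s z"
proof -
  have "nul (inc l (s + 1) \<star> (snd (Gc l) s \<star> z))" using cmap_dx[OF inc_cmap assms(1,2)] assms(3) by simp
  then have "nul (snd (Gc l) s \<star> z)" by (rule mono_nul[rotated]) (use assms in auto)
  then show ?thesis using assms by (simp add: cyc_def)
qed

end

context weight_cpx
begin

text \<open>For cocycles of \<open>G\<^sub>b X\<close> this describes the kernels of both maps from \<open>H\<^sup>s(G\<^sub>b X)\<close>.\<close>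

definition dec where
  "dec a s \<zeta> \<longleftrightarrow> (\<exists>e y w. epi e \<and> tgt e = src \<zeta> \<and> mem a s y \<and> src y = src e \<and> nul (snd Kc s \<star> y) \<and>
     arr w \<and> src w = src e \<and> tgt w = fst Kc (s - 1) \<and> \<zeta> \<star> e = y \<boxplus> snd Kc (s - 1) \<star> w)"

text \<open>Two classes agree in the cohomology of G X when the cocycles differ locally by the
  boundary of an arbitrary element \<open>w\<close> of G X; this is why \<open>dec\<close> puts no
  weight condition on \<open>w\<close>.\<close>

lemma dec_gci:
  assumes ab: "a \<le> b" and z: "cyc (Gc b) s z"
  shows "cov (gci s a) (cls Kc s (inc b s \<star> z)) \<longleftrightarrow> dec a s (inc b s \<star> z)"
proof -
  let ?\<zeta> = "inc b s \<star> z"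
  have c: "cyc Kc s ?\<zeta>" by (rule cyc_cmap[OF inc_cmap z])
  note \<zeta> = cycD[OF c]
  show ?thesis
  proof
    assume "cov (gci s a) (cls Kc s ?\<zeta>)"
    then obtain e h where e: "epi e" "arr e" "tgt e = src (cls Kc s ?\<zeta>)" "arr h" "src h = src e" "tgt h = src (gci s a)"
      "gci s a \<star> h = cls Kc s ?\<zeta> \<star> e" by (rule covE)
    have e3: "tgt e = src ?\<zeta>" using e c by simp
    have th: "tgt h = cohom A s (Gc a)" using e by simp
    obtain f z' where f: "epi f" "arr f" "tgt f = src h" "cyc (Gc a) s z'" "src z' = src f" "cls (Gc a) s z' = h \<star> f"
      using cls_ex[OF Gcpx e(4) th] by blast
    note z' = cycD[OF f(4)]
    have f3: "tgt f = src e" using f e by simp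
    have c': "cyc Kc s (inc a s \<star> z')" by (rule cyc_cmap[OF inc_cmap f(4)])
    have c2: "cyc Kc s (?\<zeta> \<star> (e \<star> f))" by (rule cyc_comp[OF Kcpx c]) (use e e3 f f3 in auto)
    have "cls Kc s (?\<zeta> \<star> (e \<star> f)) = cls Kc s ?\<zeta> \<star> (e \<star> f)" by (rule cls_comp[OF Kcpx c]) (use e e3 f f3 in auto)
    also have "\<dots> = (cls Kc s ?\<zeta> \<star> e) \<star> f" by (rule assoc[symmetric]) (use e e3 f f3 c in auto)
    also have "\<dots> = gci s a \<star> (h \<star> f)" unfolding e(7)[symmetric] by (rule assoc) (use e f f3 in auto)
    also have "\<dots> = cls Kc s (inc a s \<star> z')" unfolding f(6)[symmetric] by (rule gci_cls[OF f(4)])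
    finally have "cov (snd Kc (s - 1)) (?\<zeta> \<star> (e \<star> f) \<boxminus> inc a s \<star> z')"
      by (subst (asm) cls_eq_iff[OF Kcpx c2 c']) (use \<zeta> e e3 f f3 z' in auto)
    then obtain g w where g: "epi g" "arr g" "tgt g = src (?\<zeta> \<star> (e \<star> f) \<boxminus> inc a s \<star> z')" "arr w" "src w = src g" "tgt w = src (snd Kc (s - 1))"
      "snd Kc (s - 1) \<star> w = (?\<zeta> \<star> (e \<star> f) \<boxminus> inc a s \<star> z') \<star> g" by (rule covE)
    note cc = cycD(1,2)[OF c2] cycD(1,2)[OF c']
    have sr: "src (?\<zeta> \<star> (e \<star> f)) = src f" using cycD[OF z] e(2) e3 f(2) f3 by simp
    have g3: "tgt g = src f" using g(3) cc sr z' f by simp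
    have "inc a s \<star> (z' \<star> g) \<boxplus> snd Kc (s - 1) \<star> w = (?\<zeta> \<star> (e \<star> f)) \<star> g"
      unfolding g(7) using cc sr g(2) g3 z' f(5) cycD[OF z] e(2) e3 f(2) f3
      by (simp add: bilin add_lcomm[of "inc a s \<star> (z' \<star> g)"])
    then have eq: "?\<zeta> \<star> (e \<star> f \<star> g) = inc a s \<star> (z' \<star> g) \<boxplus> snd Kc (s - 1) \<star> w"
      using cycD[OF z] e(2) e3 f(2) f3 g(2) g3 by simp
    have "nul (snd Kc s \<star> (inc a s \<star> (z' \<star> g)))"
    proof -
      have "nul ((snd Kc s \<star> (inc a s \<star> z')) \<star> g)" by (rule comp_nul[OF cycD(3)[OF c']]) (use z' g g3 f in auto)
      then show ?thesis using z' g(2) g3 f by simp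
    qed
    moreover have "mem a s (inc a s \<star> (z' \<star> g))" by (rule memI[OF refl]) (use z'(1-3) g(2) g3 f(5) in auto)
    moreover have "epi (e \<star> f \<star> g)" using epi_comp[of g f] epi_comp[of "f \<star> g" e] e(1,2) f(1,2) f3 g(1,2) g3 by simp
    moreover have "tgt (e \<star> f \<star> g) = src ?\<zeta>" "src (inc a s \<star> (z' \<star> g)) = src (e \<star> f \<star> g)" "src w = src (e \<star> f \<star> g)" "tgt w = fst Kc (s - 1)"
      using e(2) e3 f(2) f3 g(2,5,6) g3 z'(1-3) f(5) by simp_all
    ultimately show "dec a s ?\<zeta>" unfolding dec_def using eq g(4)
      by (intro exI[of _ "e \<star> f \<star> g"] exI[of _ "inc a s \<star> (z' \<star> g)"] exI[of _ w]) (simp only: simp_thms)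
  next
    assume "dec a s ?\<zeta>"
    then obtain e y w where e: "epi e" "tgt e = src ?\<zeta>" "mem a s y" "src y = src e" "nul (snd Kc s \<star> y)"
     "arr w" "src w = src e" "tgt w = fst Kc (s - 1)" "?\<zeta> \<star> e = y \<boxplus> snd Kc (s - 1) \<star> w" unfolding dec_def by blast
    obtain z' where z': "arr z'" "src z' = src y" "tgt z' = fst (Gc a) s" "inc a s \<star> z' = y" using e(3) by (rule memE)
    have cz': "cyc (Gc a) s z'" by (rule cyc_inc) (use z' e in auto)
    have y: "arr y" "tgt y = fst Kc s" using e(3) by (auto simp: mem_def)
    have cy: "cyc Kc s y" using y e(5) by (simp add: cyc_def)
    have cw: "cyc Kc s (snd Kc (s - 1) \<star> w)" by (rule cyc_bdry) (use e in auto)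
    have "cov (snd Kc (s - 1)) (snd Kc (s - 1) \<star> w)" by (rule cov_factor) (use e in auto)
    then have n: "nul (cls Kc s (snd Kc (s - 1) \<star> w))" using cls_nul[OF Kcpx cw] by simp
    have "cls Kc s ?\<zeta> \<star> e = cls Kc s (?\<zeta> \<star> e)" by (rule cls_comp[OF Kcpx c, symmetric]) (use e in auto)
    also have "\<dots> = cls Kc s y \<boxplus> cls Kc s (snd Kc (s - 1) \<star> w)"
      unfolding e(9) by (rule cls_plus[OF Kcpx cy cw]) (use e y in auto)
    also have "\<dots> = cls Kc s y" by (rule add_nul[OF n]) (use cy cw e in auto)
    also have "\<dots> = gci s a \<star> cls (Gc a) s z'" unfolding gci_cls[OF cz'] z'(4) ..
    finally have "gci s a \<star> cls (Gc a) s z' = cls Kc s ?\<zeta> \<star> e" by simp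
    then show "cov (gci s a) (cls Kc s ?\<zeta>)" by (rule covI) (use e c cz' z' in auto)
  qed
qed

text \<open>Forwards, \<open>cocycle_reduce\<close> gives the decomposition. Backwards, the boundary
  of \<open>w\<close> lies in G_b X, being a difference of elements of it, but \<open>w\<close>
  itself may not; strictness provides a local primitive \<open>v\<close> in G_b X, and the image of
  \<open>v\<close> under \<open>pi\<close> is the one required.\<close>

lemma dec_trunc:
  assumes ab: "a + 1 \<le> b" and z: "cyc (Gc b) s z"
  shows "cov (snd (Tc (a + 1) b) (s - 1)) (prj (a + 1) b s \<star> z) \<longleftrightarrow> dec a s (inc b s \<star> z)"
proof -
  let ?\<zeta> = "inc b s \<star> z"
  have c: "cyc Kc s ?\<zeta>" by (rule cyc_cmap[OF inc_cmap z])
  note \<zeta> = cycD[OF c] and z' = cycD[OF z]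
  have m: "mem b s ?\<zeta>" by (rule memI[OF refl]) (use z' in auto)
  have p: "pi (a + 1) b s ?\<zeta> = prj (a + 1) b s \<star> z"
    unfolding pi_def by (subst lift_eqI[of "inc b s" z]) (use z' in auto)
  show ?thesis
  proof
    assume "cov (snd (Tc (a + 1) b) (s - 1)) (prj (a + 1) b s \<star> z)"
    then have "cov (snd (Tc (a + 1) b) (s - 1)) (pi (a + 1) b s ?\<zeta>)" by (simp only: p)
    then obtain e y where e: "epi e" "tgt e = src ?\<zeta>" "mem b (s - 1) y" "src y = src e"
      "mem (a + 1 - 1) s (?\<zeta> \<star> e \<boxminus> snd Kc (s - 1) \<star> y)" by (rule W.cocycle_reduce[OF ab m \<zeta>(3)])
    have y: "arr y" "tgt y = fst Kc (s - 1)" using e(3) by (auto simp: mem_def)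
    have "nul ((snd Kc s \<star> ?\<zeta>) \<star> e)" by (rule comp_nul[OF \<zeta>(3)]) (use \<zeta>(1,2) e in auto)
    then have n1: "nul (snd Kc s \<star> (?\<zeta> \<star> e))" using z' e(1,2) by simp
    have n2: "nul (snd Kc s \<star> (snd Kc (s - 1) \<star> y))" by (rule cpx_ddx) (use y in auto)
    have "nul (snd Kc s \<star> (?\<zeta> \<star> e \<boxminus> snd Kc (s - 1) \<star> y))" using n1 n2 z' e(1,2,4) y by (simp add: bilin)
    moreover have "?\<zeta> \<star> e = (?\<zeta> \<star> e \<boxminus> snd Kc (s - 1) \<star> y) \<boxplus> snd Kc (s - 1) \<star> y"
      by (rule minus_add_cancel[symmetric]) (use z' e y in auto)
    ultimately show "dec a s ?\<zeta>" unfolding dec_def using e y z'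
      by (intro exI[of _ e] exI[of _ "?\<zeta> \<star> e \<boxminus> snd Kc (s - 1) \<star> y"] exI[of _ y]) auto
  next
    assume "dec a s ?\<zeta>"
    then obtain e y w where e: "epi e" "tgt e = src ?\<zeta>" "mem a s y" "src y = src e" "nul (snd Kc s \<star> y)"
     "arr w" "src w = src e" "tgt w = fst Kc (s - 1)" "?\<zeta> \<star> e = y \<boxplus> snd Kc (s - 1) \<star> w" unfolding dec_def by blast
    have y: "arr y" "tgt y = fst Kc s" "mem b s y" using e(3) mem_mono[OF e(3), of b] ab by (auto simp: mem_def)
    have me: "mem b s (?\<zeta> \<star> e)" by (rule mem_comp[OF m]) (use e in auto)
    have w_eq: "snd Kc (s - 1) \<star> w = ?\<zeta> \<star> e \<boxminus> y"
      unfolding e(9) using y e by (simp add: add_comm[of y] add_assoc)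
    have "mem b s (snd Kc (s - 1) \<star> w)"
      unfolding w_eq by (rule W.mem_minus[OF me y(3)]) (use e(1,2,4) z' in auto)
    then have "W.loc_bdry b s (snd Kc (s - 1) \<star> w)" by (rule W.strict[OF e(6,8)])
    then obtain f v where f: "epi f" "arr f" "tgt f = src (snd Kc (s - 1) \<star> w)" "mem b (s - 1) v" "arr v" "tgt v = fst Kc (s - 1)"
      "src v = src f" "snd Kc (s - 1) \<star> v = (snd Kc (s - 1) \<star> w) \<star> f" by (rule W.loc_bdryE)
    have f3: "tgt f = src e" using f e by simp
    have yf: "mem b s (y \<star> f)" "mem a s (y \<star> f)" using mem_comp[OF y(3) f(2)] mem_comp[OF e(3) f(2)] e f3 by auto
    have dv: "mem b s (snd Kc (s - 1) \<star> v)" by (rule W.mem_d'[OF f(4)])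
    have sv: "src (y \<star> f) = src (snd Kc (s - 1) \<star> v)" using y e f f3 by simp
    have "?\<zeta> \<star> (e \<star> f) = (?\<zeta> \<star> e) \<star> f" using z' e(1,2) f f3 by simp
    also have "\<dots> = y \<star> f \<boxplus> snd Kc (s - 1) \<star> v" unfolding e(9) f(8) using y e f f3 by (simp add: bilin)
    finally have eq: "?\<zeta> \<star> (e \<star> f) = y \<star> f \<boxplus> snd Kc (s - 1) \<star> v" .
    have "pi (a + 1) b s ?\<zeta> \<star> (e \<star> f) = pi (a + 1) b s (?\<zeta> \<star> (e \<star> f))"
      by (rule pi_comp[OF m, symmetric]) (use e f f3 in auto)
    also have "\<dots> = pi (a + 1) b s (y \<star> f) \<boxplus> snd (Tc (a + 1) b) (s - 1) \<star> pi (a + 1) b (s - 1) v"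
      unfolding eq pi_plus[OF yf(1) dv sv] W.pi_d'[OF ab f(4)] ..
    also have "\<dots> = snd (Tc (a + 1) b) (s - 1) \<star> pi (a + 1) b (s - 1) v"
    proof (rule nul_add_eq)
      show "nul (pi (a + 1) b s (y \<star> f))" by (rule pi_low[OF ab]) (use yf in simp)
    qed (use pi_simps[OF yf(1)] pi_simps[OF f(4)] sv f(5,6) in auto)
    finally have "snd (Tc (a + 1) b) (s - 1) \<star> pi (a + 1) b (s - 1) v = pi (a + 1) b s ?\<zeta> \<star> (e \<star> f)" by simp
    then have "cov (snd (Tc (a + 1) b) (s - 1)) (pi (a + 1) b s ?\<zeta>)"
      by (rule covI) (use e f f3 pi_simps[OF f(4)] pi_simps[OF m] epi_comp[of f e] in auto)
    then show "cov (snd (Tc (a + 1) b) (s - 1)) (prj (a + 1) b s \<star> z)" by (simp only: p)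
  qed
qed

lemma gw_gt_nul:
  assumes ab: "a + 1 \<le> b" and x: "arr x" "tgt x = cohom A s (Gc b)"
  shows "nul (gw s b a \<star> x) \<longleftrightarrow> nul (gt s b a \<star> x)"
proof -
  have ab': "a \<le> b" using ab by simp
  obtain e z where e: "epi e" "arr e" "tgt e = src x" "cyc (Gc b) s z" "src z = src e" "cls (Gc b) s z = x \<star> e"
    using cls_ex[OF Gcpx x] by blast
  have t: "arr (cls (Gc b) s z)" "tgt (cls (Gc b) s z) = cohom A s (Gc b)" using e(4) by auto
  have "nul (gw s b a \<star> x) \<longleftrightarrow> nul ((gw s b a \<star> x) \<star> e)"
    by (rule epi_nul_iff[symmetric]) (use e gw[OF ab', of s] x in auto)
  also have "(gw s b a \<star> x) \<star> e = gw s b a \<star> cls (Gc b) s z" unfolding e(6) by (rule assoc) (use e gw[OF ab', of s] x in auto)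
  also have "nul \<dots> \<longleftrightarrow> cov (gci s a) (cls Kc s (inc b s \<star> z))" unfolding gw_nul[OF ab' t] gci_cls[OF e(4)] ..
  also have "\<dots> \<longleftrightarrow> dec a s (inc b s \<star> z)" by (rule dec_gci[OF ab' e(4)])
  also have "\<dots> \<longleftrightarrow> cov (snd (Tc (a + 1) b) (s - 1)) (prj (a + 1) b s \<star> z)" by (rule dec_trunc[OF ab e(4), symmetric])
  also have "\<dots> \<longleftrightarrow> nul (cls (Tc (a + 1) b) s (prj (a + 1) b s \<star> z))"
    by (rule cls_nul[symmetric, OF Tcpx cyc_cmap[OF prj_cmap e(4)]])
  also have "\<dots> \<longleftrightarrow> nul (gt s b a \<star> cls (Gc b) s z)" unfolding gt_cls[OF e(4)] ..
  also have "gt s b a \<star> cls (Gc b) s z = (gt s b a \<star> x) \<star> e" unfolding e(6) by (rule assoc[symmetric]) (use e x in auto)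
  also have "nul \<dots> \<longleftrightarrow> nul (gt s b a \<star> x)" by (rule epi_nul_iff) (use e x in auto)
  finally show ?thesis .
qed

text \<open>Arrows into the cohomology of the truncation are locally classes of cocycles, and these
  lift to cocycles of G_b X by \<open>pi_cocycle_surj\<close>; strictness enters through that
  lemma.\<close>

lemma gt_epi: assumes ab: "a + 1 \<le> b" shows "epi (gt s b a)"
proof (rule epi_covI)
  fix t assume t: "arr t" "tgt t = tgt (gt s b a)"
  then have t2: "tgt t = cohom A s (Tc (a + 1) b)" by simp
  obtain e t' where e: "epi e" "arr e" "tgt e = src t" "cyc (Tc (a + 1) b) s t'" "src t' = src e" "cls (Tc (a + 1) b) s t' = t \<star> e"
    using cls_ex[OF Tcpx t(1) t2] by blast
  note t' = cycD[OF e(4)]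
  obtain f \<zeta> where f: "epi f" "tgt f = src t'" "mem b s \<zeta>" "src \<zeta> = src f" "nul (snd Kc s \<star> \<zeta>)" "pi (a + 1) b s \<zeta> = t' \<star> f"
    using W.pi_cocycle_surj[OF ab t'] by blast
  have f2: "tgt f = src e" using f e by simp
  obtain z where z: "arr z" "src z = src \<zeta>" "tgt z = fst (Gc b) s" "inc b s \<star> z = \<zeta>" "lift_arr A (inc b s) \<zeta> = z"
    using f(3) by (rule memE)
  have cz: "cyc (Gc b) s z" by (rule cyc_inc) (use z f in auto)
  have p: "prj (a + 1) b s \<star> z = t' \<star> f" using f(6) unfolding pi_def z(5) .
  have "gt s b a \<star> cls (Gc b) s z = cls (Tc (a + 1) b) s (t' \<star> f)" unfolding gt_cls[OF cz] p ..
  also have "\<dots> = (t \<star> e) \<star> f" unfolding e(6)[symmetric] by (rule cls_comp[OF Tcpx e(4)]) (use f in auto)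
  also have "\<dots> = t \<star> (e \<star> f)" by (rule assoc) (use t e f f2 in auto)
  finally show "cov (gt s b a) t" by (rule covI) (use t e f f2 cz z epi_comp[of f e] in auto)
qed simp

end

section \<open>Functoriality of the weight quotients and naturality of their comparison with
  truncations\<close>

context nonpos_functor
begin

lemma tw_nonpos: "tw X \<Longrightarrow> tw_nonpos A C F X"
  by (intro tw_nonpos.intro tw_nonpos_axioms.intro nonpos_functor_axioms)

text \<open>The inclusions of the steps G_l are natural in the twisted complex, so the map
  \<open>h\<close> of cohomology carries W_l of \<open>Y\<close> into W_l of \<open>X\<close>. The
  restrictions for \<open>a\<close> and \<open>b\<close> are compatible, and the arrow in
  \<open>W_quot\<close> is the one they induce on the quotient.\<close>

lemma W_quot_natural:
  assumes ab: "a \<le> b" and \<alpha>: "adm C X Y c"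
  shows "arr (snd (W_quot A C F s b a) (X, Y, c))"
    "src (snd (W_quot A C F s b a) (X, Y, c)) = fst (W_quot A C F s b a) Y"
    "tgt (snd (W_quot A C F s b a) (X, Y, c)) = fst (W_quot A C F s b a) X"
    "snd (W_quot A C F s b a) (X, Y, c) \<star> G_to_W_quot A C F s b a Y =
      G_to_W_quot A C F s b a X \<star> snd (cohom_Tr A C (fun_le A b F) s) (X, Y, c)"
proof -
  have tw: "tw X" "tw Y" using \<alpha> by (auto simp: adm_def)
  interpret X: tw_nonpos A C F X by (rule tw_nonpos[OF tw(1)])
  interpret Y: tw_nonpos A C F Y by (rule tw_nonpos[OF tw(2)])
  define h where "h = snd (cohom_Tr A C F s) (X, Y, c)"
  have h: "arr h" "src h = cohom A s Y.Kc" "tgt h = cohom A s X.Kc" unfolding h_def using cohom_Tr_types[OF \<alpha>] by auto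
  have nat: "X.gci s l \<star> snd (cohom_Tr A C (fun_le A l F) s) (X, Y, c) = h \<star> Y.gci s l" for l
    unfolding X.gci_eq Y.gci_eq h_def using X.I.tr_cohom_natural[OF \<alpha>] by simp
  have hl: "arr (snd (cohom_Tr A C (fun_le A l F) s) (X, Y, c))" "src (snd (cohom_Tr A C (fun_le A l F) s) (X, Y, c)) = cohom A s (Y.Gc l)"
    "tgt (snd (cohom_Tr A C (fun_le A l F) s) (X, Y, c)) = cohom A s (X.Gc l)" for l
    using X.L.cohom_Tr_types[OF \<alpha>, of l s] by auto
  have fw: "factors (X.win s l) (h \<star> Y.win s l)" for l
  proof -
    have "cov (X.gci s l) (h \<star> Y.gci s l)" unfolding nat[symmetric] by (rule cov_factor) (use hl in auto)
    then have "cov (X.gci s l) (h \<star> im (Y.gci s l))" by (rule cov_im) (use h in auto)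
    then have "cov (X.gci s l) (h \<star> Y.win s l)" by (simp add: W_incl_def)
    then show ?thesis by (subst X.win_factors) (use h in auto)
  qed
  define k where "k l = lift_arr A (X.win s l) (h \<star> Y.win s l)" for l
  have k: "arr (k l)" "src (k l) = src (Y.win s l)" "tgt (k l) = src (X.win s l)" "X.win s l \<star> k l = h \<star> Y.win s l" for l
    unfolding k_def using fw[of l] h by auto
  have kk: "k b \<star> Y.wk s b a = X.wk s b a \<star> k a"
  proof (rule mono_cancel[OF X.win(1)[of s b]])
    have "X.win s b \<star> (k b \<star> Y.wk s b a) = (h \<star> Y.win s b) \<star> Y.wk s b a"
      by (rule comp_reduce[OF k(4)]) (use k Y.wk[OF ab, of s] in auto)
    also have "\<dots> = h \<star> (Y.win s b \<star> Y.wk s b a)" by (rule assoc) (use h Y.wk(1-3)[OF ab, of s] in auto)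
    also have "\<dots> = X.win s a \<star> k a" unfolding Y.wk(4)[OF ab] k(4) ..
    also have "\<dots> = X.win s b \<star> (X.wk s b a \<star> k a)"
      by (rule comp_reduce[OF X.wk(4)[OF ab], symmetric]) (use k X.wk[OF ab, of s] in auto)
    finally show "X.win s b \<star> (k b \<star> Y.wk s b a) = X.win s b \<star> (X.wk s b a \<star> k a)" .
  qed (use k X.wk[OF ab, of s] Y.wk[OF ab, of s] in auto)
  have xw: "arr (X.wpr s b a)" "arr (Y.wpr s b a)" using X.wpr[OF ab, of s] Y.wpr[OF ab, of s] by auto
  have e: "(X.wpr s b a \<star> k b) \<star> Y.wk s b a = (X.wpr s b a \<star> X.wk s b a) \<star> k a"
  proof -
    have "(X.wpr s b a \<star> k b) \<star> Y.wk s b a = X.wpr s b a \<star> (k b \<star> Y.wk s b a)"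
      by (rule assoc) (use xw k X.wpr[OF ab, of s] Y.wk[OF ab, of s] in auto)
    also have "\<dots> = (X.wpr s b a \<star> X.wk s b a) \<star> k a"
      unfolding kk by (rule assoc[symmetric]) (use xw k X.wpr[OF ab, of s] X.wk[OF ab, of s] in auto)
    finally show ?thesis .
  qed
  have "nul ((X.wpr s b a \<star> k b) \<star> Y.wk s b a)"
    unfolding e by (rule comp_nul[OF X.wpr(3)[OF ab]]) (use xw k X.wpr[OF ab, of s] X.wk[OF ab, of s] in auto)
  then have cf: "cofactors (Y.wpr s b a) (X.wpr s b a \<star> k b)"
    unfolding Y.wpr_eq using xw k X.wpr[OF ab, of s] Y.wk[OF ab, of s] by (subst cofactors_cok) auto
  have d: "snd (W_quot A C F s b a) (X, Y, c) = desc_arr A (Y.wpr s b a) (X.wpr s b a \<star> k b)"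
    by (simp add: W_quot_def Let_def Tr_def homotopy_cat_def k_def h_def)
  have D: "arr (snd (W_quot A C F s b a) (X, Y, c))" "src (snd (W_quot A C F s b a) (X, Y, c)) = tgt (Y.wpr s b a)"
    "tgt (snd (W_quot A C F s b a) (X, Y, c)) = tgt (X.wpr s b a)"
    "snd (W_quot A C F s b a) (X, Y, c) \<star> Y.wpr s b a = X.wpr s b a \<star> k b"
    unfolding d using cf Y.wpr[OF ab, of s] xw k X.wpr[OF ab, of s] by auto
  then show "arr (snd (W_quot A C F s b a) (X, Y, c))" "src (snd (W_quot A C F s b a) (X, Y, c)) = fst (W_quot A C F s b a) Y"
    "tgt (snd (W_quot A C F s b a) (X, Y, c)) = fst (W_quot A C F s b a) X" by (simp_all add: W_quot_def)
  let ?hb = "snd (cohom_Tr A C (fun_le A b F) s) (X, Y, c)"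
  have ke: "k b \<star> Y.we s b = X.we s b \<star> ?hb"
  proof (rule mono_cancel[OF X.win(1)[of s b]])
    have "X.win s b \<star> (k b \<star> Y.we s b) = (h \<star> Y.win s b) \<star> Y.we s b"
      by (rule comp_reduce[OF k(4)]) (use k in auto)
    also have "\<dots> = h \<star> (Y.win s b \<star> Y.we s b)" by (rule assoc) (use h in auto)
    also have "\<dots> = X.gci s b \<star> ?hb" unfolding Y.we(4) nat ..
    also have "\<dots> = X.win s b \<star> (X.we s b \<star> ?hb)"
      by (rule comp_reduce[OF X.we(4), symmetric]) (use hl in auto)
    finally show "X.win s b \<star> (k b \<star> Y.we s b) = X.win s b \<star> (X.we s b \<star> ?hb)" .
  qed (use k hl in auto)
  have "snd (W_quot A C F s b a) (X, Y, c) \<star> Y.gw s b a = (X.wpr s b a \<star> k b) \<star> Y.we s b"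
    unfolding Y.gw_eq by (rule comp_reduce[OF D(4)]) (use D xw Y.wpr[OF ab, of s] in auto)
  also have "\<dots> = X.wpr s b a \<star> (k b \<star> Y.we s b)" by (rule assoc) (use xw X.wpr[OF ab, of s] k in auto)
  also have "\<dots> = X.gw s b a \<star> ?hb"
    unfolding ke X.gw_eq by (rule assoc[symmetric]) (use xw X.wpr[OF ab, of s] hl in auto)
  finally show "snd (W_quot A C F s b a) (X, Y, c) \<star> Y.gw s b a = X.gw s b a \<star> ?hb" .
qed

lemma contra_functor_W_quot:
  assumes ab: "a \<le> b"
  shows "contra_functor (Tr C) A (W_quot A C F s b a)"
proof (rule cpx_functor.contra_functor_epi[OF nonpos_functor.axioms(1)[OF fun_le_nonpos[of b]], where u = "G_to_W_quot A C F s b a" and s = s])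
  fix X assume "tw X"
  then interpret tw_nonpos A C F X by (rule tw_nonpos)
  show "epi (gw s b a) \<and> src (gw s b a) = cohom A s (Gc b) \<and> tgt (gw s b a) = fst (W_quot A C F s b a) X"
    using gw[OF ab, of s] by (simp add: W_quot_def)
qed (use W_quot_natural[OF ab] in blast)

end

context weight_functor
begin

lemma weight_cpx: "tw X \<Longrightarrow> weight_cpx A C F X"
  by (intro weight_cpx.intro tw_nonpos weight_functor_axioms)

text \<open>Both functors are quotients of the cohomology of G_b X by the same kernel. Naturality is
  checked after precomposition with the epimorphism \<open>G_to_W_quot\<close>, where it becomes the
  naturality of the two maps out of that cohomology.\<close>

lemma W_quot_iso:
  fixes b s :: int and N :: nat
  defines "a \<equiv> b - int N - 1"
  defines "\<eta> \<equiv> \<lambda>X. desc_arr A (G_to_W_quot A C F s b a X) (G_to_trunc A C F s b a X)"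
  shows "natural_iso (Tr C) A (W_quot A C F s b a) (cohom_Tr A C (fun_trunc A (b - int N) b F) s) \<eta>"
    and "tw X \<Longrightarrow> \<eta> X \<star> G_to_W_quot A C F s b a X = G_to_trunc A C F s b a X"
proof -
  \<comment> \<open>The lowest degree kept by the truncation is \<open>a + 1\<close>, so that
    exactly \<open>N + 1\<close> degrees remain.\<close>
  have ab: "a \<le> b" "a + 1 \<le> b" "b - int N = a + 1" by (simp_all add: a_def)
  have H: "arr (\<eta> X)" "src (\<eta> X) = fst (W_quot A C F s b a) X" "tgt (\<eta> X) = fst (cohom_Tr A C (fun_trunc A (a + 1) b F) s) X"
    "cat_iso A (\<eta> X)" "\<eta> X \<star> G_to_W_quot A C F s b a X = G_to_trunc A C F s b a X" if "tw X" for X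
  proof -
    interpret weight_cpx A C F X by (rule weight_cpx[OF that])
    note u = gw[OF ab(1), of s] and v = gt_epi[OF ab(2), of s]
    have k: "\<And>x. arr x \<Longrightarrow> tgt x = src (gw s b a) \<Longrightarrow> nul (gw s b a \<star> x) \<longleftrightarrow> nul (gt s b a \<star> x)"
      using gw_gt_nul[OF ab(2), of _ s] u by simp
    note I = epi_iso[OF u(1) v _ k]
    show "arr (\<eta> X)" "src (\<eta> X) = fst (W_quot A C F s b a) X" "tgt (\<eta> X) = fst (cohom_Tr A C (fun_trunc A (a + 1) b F) s) X"
      "cat_iso A (\<eta> X)" "\<eta> X \<star> G_to_W_quot A C F s b a X = G_to_trunc A C F s b a X"
      unfolding \<eta>_def using I u by (simp_all add: W_quot_def cohom_Tr_def homotopy_fun_def Let_def)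
  qed
  show "tw X \<Longrightarrow> \<eta> X \<star> G_to_W_quot A C F s b a X = G_to_trunc A C F s b a X" by (rule H(5))
  show "natural_iso (Tr C) A (W_quot A C F s b a) (cohom_Tr A C (fun_trunc A (b - int N) b F) s) \<eta>"
    unfolding natural_iso_def ab(3)
  proof (intro conjI ballI)
    show "contra_functor (Tr C) A (W_quot A C F s b a)" by (rule contra_functor_W_quot[OF ab(1)])
    show "contra_functor (Tr C) A (cohom_Tr A C (fun_trunc A (a + 1) b F) s)"
      by (rule cpx_functor.contra_functor_cohom_Tr[OF nonpos_functor.axioms(1)[OF fun_trunc_nonpos]])
    fix X assume "X \<in> cat_obj (Tr C)"
    then have X: "tw X" by (simp add: Tr_obj_iff)
    show "\<eta> X \<in> Hom (fst (W_quot A C F s b a) X) (fst (cohom_Tr A C (fun_trunc A (a + 1) b F) s) X)" "cat_iso A (\<eta> X)"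
      using H[OF X] by auto
    fix Y f assume "Y \<in> cat_obj (Tr C)" and f: "f \<in> cat_hom (Tr C) X Y"
    then have Y: "tw Y" by (simp add: Tr_obj_iff)
    obtain c where c: "f = (X, Y, c)" "adm C X Y c" using f by (rule adm_hom)
    interpret X: tw_nonpos A C F X by (rule tw_nonpos[OF X])
    interpret Y: tw_nonpos A C F Y by (rule tw_nonpos[OF Y])
    note hX = H[OF X] and hY = H[OF Y] and w = W_quot_natural[OF ab(1) c(2), of s]
    let ?w = "snd (W_quot A C F s b a) (X, Y, c)" and ?t = "snd (cohom_Tr A C (fun_trunc A (a + 1) b F) s) (X, Y, c)"
    let ?hb = "snd (cohom_Tr A C (fun_le A b F) s) (X, Y, c)"
    note uX = X.gw[OF ab(1), of s] and uY = Y.gw[OF ab(1), of s]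
    note t = X.R.cohom_Tr_types[OF c(2), of "a + 1" b s] and hb = X.L.cohom_Tr_types[OF c(2), of b s]
    have nat: "X.gt s b a \<star> ?hb = ?t \<star> Y.gt s b a"
      unfolding X.gt_eq Y.gt_eq by (rule X.P.tr_cohom_natural[OF c(2)])
    have "(\<eta> X \<star> ?w) \<star> Y.gw s b a = \<eta> X \<star> (?w \<star> Y.gw s b a)"
      by (rule assoc) (use hX w uY in \<open>auto simp: W_quot_def\<close>)
    also have "\<dots> = (\<eta> X \<star> X.gw s b a) \<star> ?hb"
      unfolding w(4) by (rule assoc[symmetric]) (use hX uX hb in \<open>auto simp: W_quot_def\<close>)
    also have "\<dots> = ?t \<star> (\<eta> Y \<star> Y.gw s b a)" unfolding hX(5) hY(5) nat ..
    also have "\<dots> = (?t \<star> \<eta> Y) \<star> Y.gw s b a"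
      by (rule assoc[symmetric]) (use hY uY t in \<open>auto simp: W_quot_def cohom_Tr_def homotopy_fun_def Let_def\<close>)
    finally have e: "(\<eta> X \<star> ?w) \<star> Y.gw s b a = (?t \<star> \<eta> Y) \<star> Y.gw s b a" .
    have "\<eta> X \<star> ?w = ?t \<star> \<eta> Y"
      by (rule epi_cancel[OF uY(1) e]) (use hX hY w t uY in \<open>auto simp: W_quot_def cohom_Tr_def homotopy_fun_def Let_def\<close>)
    then show "\<eta> X \<star> snd (W_quot A C F s b a) f = snd (cohom_Tr A C (fun_trunc A (a + 1) b F) s) f \<star> \<eta> Y" by (simp only: c(1))
  qed
qed

end

subsection \<open>Quotients of differential graded categories\<close>

locale dg_ideal = dg_category C for C :: "('c, 'm) dgcat" +
  fixes D :: "int \<Rightarrow> 'c \<Rightarrow> 'c \<Rightarrow> 'm set"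
  assumes D_sub: "P \<in> dg_obj C \<Longrightarrow> Q \<in> dg_obj C \<Longrightarrow> subgroup (D i P Q) (dg_hom C i P Q)"
    and D_left: "P \<in> dg_obj C \<Longrightarrow> Q \<in> dg_obj C \<Longrightarrow> R \<in> dg_obj C \<Longrightarrow>
      g \<in> carrier (dg_hom C i Q R) \<Longrightarrow> f \<in> D j P Q \<Longrightarrow> dg_comp C i j P Q R g f \<in> D (i + j) P R"
    and D_right: "P \<in> dg_obj C \<Longrightarrow> Q \<in> dg_obj C \<Longrightarrow> R \<in> dg_obj C \<Longrightarrow>
      g \<in> D i Q R \<Longrightarrow> f \<in> carrier (dg_hom C j P Q) \<Longrightarrow> dg_comp C i j P Q R g f \<in> D (i + j) P R"
    and D_diff: "P \<in> dg_obj C \<Longrightarrow> Q \<in> dg_obj C \<Longrightarrow> f \<in> D i P Q \<Longrightarrow> dg_diff C i P Q f \<in> D (i + 1) P Q"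
begin

abbreviation cl where "cl i P Q f \<equiv> D i P Q #>\<^bsub>dg_hom C i P Q\<^esub> f"
abbreviation CD where "CD \<equiv> dg_quotient C D"

lemma grp: "P \<in> dg_obj C \<Longrightarrow> Q \<in> dg_obj C \<Longrightarrow> group (dg_hom C i P Q)"
  using hom_group by (simp add: comm_group_def)

lemma D_normal: "P \<in> dg_obj C \<Longrightarrow> Q \<in> dg_obj C \<Longrightarrow> D i P Q \<lhd> dg_hom C i P Q"
  by (intro comm_group.subgroup_imp_normal hom_group D_sub)

lemma D_carrier: "P \<in> dg_obj C \<Longrightarrow> Q \<in> dg_obj C \<Longrightarrow> f \<in> D i P Q \<Longrightarrow> f \<in> carrier (dg_hom C i P Q)"
  using D_sub subgroup.mem_carrier by metis

lemma D_one: "P \<in> dg_obj C \<Longrightarrow> Q \<in> dg_obj C \<Longrightarrow> \<one>\<^bsub>dg_hom C i P Q\<^esub> \<in> D i P Q"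
  using D_sub subgroup.one_closed by metis

lemma cl_self: "P \<in> dg_obj C \<Longrightarrow> Q \<in> dg_obj C \<Longrightarrow> f \<in> carrier (dg_hom C i P Q) \<Longrightarrow> f \<in> cl i P Q f"
  by (rule group.rcos_self[OF grp _ D_sub])

lemma cl_mem:
  assumes "P \<in> dg_obj C" "Q \<in> dg_obj C" "f \<in> carrier (dg_hom C i P Q)" "f' \<in> cl i P Q f"
  obtains d where "d \<in> D i P Q" "f' = d \<otimes>\<^bsub>dg_hom C i P Q\<^esub> f" "f' \<in> carrier (dg_hom C i P Q)"
    "cl i P Q f' = cl i P Q f"
proof -
  obtain d where d: "d \<in> D i P Q" "f' = d \<otimes>\<^bsub>dg_hom C i P Q\<^esub> f" using assms(4) by (auto simp: r_coset_def)
  have "f' \<in> carrier (dg_hom C i P Q)"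
    unfolding d(2) by (rule monoid.m_closed[OF group.is_monoid[OF grp] D_carrier]) (use assms d in auto)
  then show thesis
    by (rule that[OF d]) (rule group.repr_independence[OF grp assms(4,3) D_sub, symmetric]; rule assms)
qed

lemma cl_D: "P \<in> dg_obj C \<Longrightarrow> Q \<in> dg_obj C \<Longrightarrow> f \<in> D i P Q \<Longrightarrow> cl i P Q f = D i P Q"
  by (rule group.coset_join2[OF grp D_carrier D_sub])

lemma cl_mult_D:
  assumes "P \<in> dg_obj C" "Q \<in> dg_obj C" "f \<in> carrier (dg_hom C i P Q)" "d \<in> D i P Q"
  shows "cl i P Q (d \<otimes>\<^bsub>dg_hom C i P Q\<^esub> f) = cl i P Q f"
proof -
  have "d \<otimes>\<^bsub>dg_hom C i P Q\<^esub> f \<in> cl i P Q f" using assms(4) by (auto simp: r_coset_def)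
  from cl_mem[OF assms(1-3) this] show ?thesis by metis
qed

lemma CD_simps [simp]:
  "dg_obj CD = dg_obj C" "carrier (dg_hom CD i P Q) = cl i P Q ` carrier (dg_hom C i P Q)"
  "\<one>\<^bsub>dg_hom CD i P Q\<^esub> = D i P Q" "dg_id CD P = cl 0 P P (dg_id C P)"
  by (simp_all add: dg_quotient_def carrier_FactGroup)

lemma hom_CD: "dg_hom CD i P Q = dg_hom C i P Q Mod D i P Q"
  by (simp add: dg_quotient_def)

lemma CD_grp: "P \<in> dg_obj C \<Longrightarrow> Q \<in> dg_obj C \<Longrightarrow> comm_group (dg_hom CD i P Q)"
  by (simp add: hom_CD comm_group.abelian_FactGroup hom_group D_sub)

lemma cl_hom: "P \<in> dg_obj C \<Longrightarrow> Q \<in> dg_obj C \<Longrightarrow> cl i P Q \<in> hom (dg_hom C i P Q) (dg_hom CD i P Q)"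
  using normal.r_coset_hom_Mod[OF D_normal] by (simp add: hom_CD)

lemma cl_group_hom: "P \<in> dg_obj C \<Longrightarrow> Q \<in> dg_obj C \<Longrightarrow> group_hom (dg_hom C i P Q) (dg_hom CD i P Q) (cl i P Q)"
  by (intro group_hom.intro group_hom_axioms.intro cl_hom grp comm_group.axioms(2) CD_grp)

lemma CD_mult:
  assumes "P \<in> dg_obj C" "Q \<in> dg_obj C" "f \<in> carrier (dg_hom C i P Q)" "g \<in> carrier (dg_hom C i P Q)"
  shows "cl i P Q f \<otimes>\<^bsub>dg_hom CD i P Q\<^esub> cl i P Q g = cl i P Q (f \<otimes>\<^bsub>dg_hom C i P Q\<^esub> g)"
  by (rule hom_mult[OF cl_hom[OF assms(1,2)] assms(3,4), symmetric])

lemma CD_signed: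
  assumes "P \<in> dg_obj C" "Q \<in> dg_obj C" "f \<in> carrier (dg_hom C i P Q)"
  shows "signed (dg_hom CD i P Q) n (cl i P Q f) = cl i P Q (signed (dg_hom C i P Q) n f)"
  using group_hom.hom_inv[OF cl_group_hom[OF assms(1,2)] assms(3)] by (simp add: signed_def)

lemma CD_finprod:
  assumes "P \<in> dg_obj C" "Q \<in> dg_obj C" "finite I" "\<And>k. k \<in> I \<Longrightarrow> f k \<in> carrier (dg_hom C i P Q)"
  shows "finprod (dg_hom CD i P Q) (\<lambda>k. cl i P Q (f k)) I = cl i P Q (finprod (dg_hom C i P Q) f I)"
  using assms(3,4)
proof (induction I)
  case empty
  show ?case using cl_D[OF assms(1,2) D_one[OF assms(1,2)]]
    by (simp add: comm_monoid.finprod_empty[OF comm_group.axioms(1)[OF hom_group[OF assms(1,2)]]]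
      comm_monoid.finprod_empty[OF comm_group.axioms(1)[OF CD_grp[OF assms(1,2)]]])
next
  case (insert k I)
  interpret H: comm_group "dg_hom C i P Q" by (rule hom_group[OF assms(1,2)])
  interpret H': comm_group "dg_hom CD i P Q" by (rule CD_grp[OF assms(1,2)])
  have f: "f \<in> I \<rightarrow> carrier (dg_hom C i P Q)" "f k \<in> carrier (dg_hom C i P Q)" using insert by auto
  have f': "(\<lambda>k. cl i P Q (f k)) \<in> I \<rightarrow> carrier (dg_hom CD i P Q)" "cl i P Q (f k) \<in> carrier (dg_hom CD i P Q)" using insert by auto
  have "finprod (dg_hom CD i P Q) (\<lambda>k. cl i P Q (f k)) (insert k I) =
    cl i P Q (f k) \<otimes>\<^bsub>dg_hom CD i P Q\<^esub> finprod (dg_hom CD i P Q) (\<lambda>k. cl i P Q (f k)) I"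
    by (rule H'.finprod_insert) (use insert f' in auto)
  also have "\<dots> = cl i P Q (f k) \<otimes>\<^bsub>dg_hom CD i P Q\<^esub> cl i P Q (finprod (dg_hom C i P Q) f I)"
    using insert by simp
  also have "\<dots> = cl i P Q (f k \<otimes>\<^bsub>dg_hom C i P Q\<^esub> finprod (dg_hom C i P Q) f I)"
    by (rule CD_mult[OF assms(1,2) f(2) H.finprod_closed[OF f(1)]])
  also have "f k \<otimes>\<^bsub>dg_hom C i P Q\<^esub> finprod (dg_hom C i P Q) f I = finprod (dg_hom C i P Q) f (insert k I)"
    by (rule H.finprod_insert[symmetric]) (use insert f in auto)
  finally show ?case .
qed

lemma comp_cl:
  assumes o: "P \<in> dg_obj C" "Q \<in> dg_obj C" "R \<in> dg_obj C"
    and g: "g \<in> carrier (dg_hom C i Q R)" and f: "f \<in> carrier (dg_hom C j P Q)"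
    and "g' \<in> cl i Q R g" "f' \<in> cl j P Q f"
  shows "cl (i + j) P R (dg_comp C i j P Q R g' f') = cl (i + j) P R (dg_comp C i j P Q R g f)"
proof -
  obtain d where d: "d \<in> D i Q R" "g' = d \<otimes>\<^bsub>dg_hom C i Q R\<^esub> g" "g' \<in> carrier (dg_hom C i Q R)" "cl i Q R g' = cl i Q R g"
    by (rule cl_mem[OF o(2,3) g assms(6)])
  obtain e where e: "e \<in> D j P Q" "f' = e \<otimes>\<^bsub>dg_hom C j P Q\<^esub> f" "f' \<in> carrier (dg_hom C j P Q)" "cl j P Q f' = cl j P Q f"
    by (rule cl_mem[OF o(1,2) f assms(7)])
  note dc = D_carrier[OF o(2,3) d(1)] and ec = D_carrier[OF o(1,2) e(1)]
  have "dg_comp C i j P Q R g' f' = dg_comp C i j P Q R g' e \<otimes>\<^bsub>dg_hom C (i + j) P R\<^esub> dg_comp C i j P Q R g' f"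
    unfolding e(2) by (rule hom_mult[OF comp_add_right[OF o d(3)] ec f])
  then have "cl (i + j) P R (dg_comp C i j P Q R g' f') = cl (i + j) P R (dg_comp C i j P Q R g' f)"
    using cl_mult_D[OF o(1,3) comp_closed[OF o d(3) f] D_left[OF o d(3) e(1)]] by simp
  also have "dg_comp C i j P Q R g' f = dg_comp C i j P Q R d f \<otimes>\<^bsub>dg_hom C (i + j) P R\<^esub> dg_comp C i j P Q R g f"
    unfolding d(2) using hom_mult[OF comp_add_left[OF o f] dc g] by simp
  also have "cl (i + j) P R \<dots> = cl (i + j) P R (dg_comp C i j P Q R g f)"
    by (rule cl_mult_D[OF o(1,3) comp_closed[OF o g f] D_right[OF o d(1) f]])
  finally show ?thesis .
qed

text \<open>\<open>dg_quotient\<close> composes cosets by a union over representatives; all members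
  of the union are the same coset by \<open>comp_cl\<close>, as the ideal is two-sided.\<close>

lemma CD_comp:
  assumes o: "P \<in> dg_obj C" "Q \<in> dg_obj C" "R \<in> dg_obj C"
    and g: "g \<in> carrier (dg_hom C i Q R)" and f: "f \<in> carrier (dg_hom C j P Q)"
  shows "dg_comp CD i j P Q R (cl i Q R g) (cl j P Q f) = cl (i + j) P R (dg_comp C i j P Q R g f)"
proof -
  have "dg_comp CD i j P Q R (cl i Q R g) (cl j P Q f) =
    (\<Union>g'\<in>cl i Q R g. \<Union>f'\<in>cl j P Q f. cl (i + j) P R (dg_comp C i j P Q R g' f'))"
    by (simp add: dg_quotient_def)
  also have "\<dots> = (\<Union>g'\<in>cl i Q R g. \<Union>f'\<in>cl j P Q f. cl (i + j) P R (dg_comp C i j P Q R g f))"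
    using comp_cl[OF assms] by simp
  also have "\<dots> = cl (i + j) P R (dg_comp C i j P Q R g f)"
    using cl_self[OF o(2,3) g] cl_self[OF o(1,2) f] by blast
  finally show ?thesis .
qed

lemma CD_diff:
  assumes o: "P \<in> dg_obj C" "Q \<in> dg_obj C" and f: "f \<in> carrier (dg_hom C i P Q)"
  shows "dg_diff CD i P Q (cl i P Q f) = cl (i + 1) P Q (dg_diff C i P Q f)"
proof -
  have df: "dg_diff C i P Q f \<in> carrier (dg_hom C (i + 1) P Q)" by (rule hom_in_carrier[OF diff_hom[OF o] f])
  have "cl (i + 1) P Q (dg_diff C i P Q f') = cl (i + 1) P Q (dg_diff C i P Q f)" if f': "f' \<in> cl i P Q f" for f'
  proof -
    obtain d where d: "d \<in> D i P Q" "f' = d \<otimes>\<^bsub>dg_hom C i P Q\<^esub> f" "f' \<in> carrier (dg_hom C i P Q)" "cl i P Q f' = cl i P Q f"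
      by (rule cl_mem[OF o f f'])
    have "dg_diff C i P Q f' = dg_diff C i P Q d \<otimes>\<^bsub>dg_hom C (i + 1) P Q\<^esub> dg_diff C i P Q f"
      unfolding d(2) by (rule hom_mult[OF diff_hom[OF o] D_carrier[OF o d(1)] f])
    then show ?thesis using cl_mult_D[OF o df D_diff[OF o d(1)]] by simp
  qed
  then have "dg_diff CD i P Q (cl i P Q f) = (\<Union>f'\<in>cl i P Q f. cl (i + 1) P Q (dg_diff C i P Q f))"
    by (simp add: dg_quotient_def)
  then show ?thesis using cl_self[OF o f] by blast
qed

definition qtw :: "('c, 'm) twisted \<Rightarrow> ('c, 'm set) twisted" where
  "qtw X = (fst X, \<lambda>i j. cl (i - j + 1) (fst X i) (fst X j) (snd X i j))"

definition qmat :: "int \<Rightarrow> ('c, 'm) twisted \<Rightarrow> ('c, 'm) twisted \<Rightarrow> (int \<Rightarrow> int \<Rightarrow> 'm) \<Rightarrow> int \<Rightarrow> int \<Rightarrow> 'm set" where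
  "qmat l X Y f i j = cl (l + i - j) (fst X i) (fst Y j) (f i j)"

lemma zero_obj_CD: "P \<in> dg_obj C \<Longrightarrow> dg_zero_obj CD P \<longleftrightarrow> dg_id C P \<in> D 0 P P"
  unfolding dg_zero_obj_def using id_closed[of P] cl_self[of P P "dg_id C P" 0] cl_D[of P P "dg_id C P" 0] by auto

lemma fst_qtw [simp]: "fst (qtw X) = fst X"
  by (simp add: qtw_def)

lemma supp_qtw:
  assumes "\<And>i. fst X i \<in> dg_obj C"
  shows "tw_supp CD (qtw X) \<subseteq> tw_supp C X" "i \<notin> tw_supp CD (qtw X) \<Longrightarrow> dg_id C (fst X i) \<in> D 0 (fst X i) (fst X i)"
proof -
  show "i \<notin> tw_supp CD (qtw X) \<Longrightarrow> dg_id C (fst X i) \<in> D 0 (fst X i) (fst X i)" for i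
    unfolding tw_supp_def using zero_obj_CD[OF assms, of i] by simp
  have "i \<in> tw_supp C X" if "i \<in> tw_supp CD (qtw X)" for i
    using that zero_obj_CD[OF assms, of i] D_one[OF assms assms, of 0 i i] unfolding tw_supp_def dg_zero_obj_def by auto
  then show "tw_supp CD (qtw X) \<subseteq> tw_supp C X" by blast
qed

text \<open>If the identity of the middle object lies in the ideal, every composite through it does.
  These are the terms that disappear from sums over the support when objects become zero in the
  quotient.\<close>

lemma comp_zero_D:
  assumes o: "P \<in> dg_obj C" "Q \<in> dg_obj C" "R \<in> dg_obj C" and g: "g \<in> carrier (dg_hom C i Q R)" and f: "f \<in> carrier (dg_hom C j P Q)"
    and "dg_id C Q \<in> D 0 Q Q" "k = i + j"
  shows "dg_comp C i j P Q R g f \<in> D k P R"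
proof -
  have "dg_comp C 0 j P Q Q (dg_id C Q) f \<in> D (0 + j) P Q" by (rule D_right[OF o(1,2,2) assms(6) f])
  then have "f \<in> D j P Q" using comp_id_left[OF o(1,2) f] by simp
  then show ?thesis unfolding assms(7) by (rule D_left[OF o g])
qed

lemma qtw_twisted:
  assumes "twisted_complex C X"
  shows "twisted_complex CD (qtw X)"
proof -
  note t = twistedD[OF assms]
  have "signed (dg_hom CD (i - j + 2) (fst X i) (fst X j)) i (dg_diff CD (i - j + 1) (fst X i) (fst X j) (snd (qtw X) i j))
        \<otimes>\<^bsub>dg_hom CD (i - j + 2) (fst X i) (fst X j)\<^esub>
        finprod (dg_hom CD (i - j + 2) (fst X i) (fst X j))
          (\<lambda>l. dg_comp CD (l - j + 1) (i - l + 1) (fst X i) (fst X l) (fst X j) (snd (qtw X) l j) (snd (qtw X) i l)) (tw_supp CD (qtw X))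
        = \<one>\<^bsub>dg_hom CD (i - j + 2) (fst X i) (fst X j)\<^esub>" for i j
  proof -
    let ?H = "dg_hom C (i - j + 2) (fst X i) (fst X j)" and ?H' = "dg_hom CD (i - j + 2) (fst X i) (fst X j)"
    let ?cl = "cl (i - j + 2) (fst X i) (fst X j)"
    let ?c = "\<lambda>l. dg_comp C (l - j + 1) (i - l + 1) (fst X i) (fst X l) (fst X j) (snd X l j) (snd X i l)"
    let ?d = "dg_diff C (i - j + 1) (fst X i) (fst X j) (snd X i j)"
    have e0: "(l - j + 1) + (i - l + 1) = i - j + 2" "i - j + 1 + 1 = i - j + 2" for l by simp_all
    have c: "?c l \<in> carrier ?H" for l
      unfolding e0(1)[of l, symmetric] by (rule comp_closed[OF t(1,1,1,3,3)])
    have d: "?d \<in> carrier ?H" unfolding e0(2)[symmetric] by (rule hom_in_carrier[OF diff_hom[OF t(1,1)] t(3)])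
    interpret H: comm_group ?H by (rule hom_group[OF t(1,1)])
    interpret H': comm_group ?H' by (rule CD_grp[OF t(1,1)])
    have e: "dg_comp CD (l - j + 1) (i - l + 1) (fst X i) (fst X l) (fst X j) (snd (qtw X) l j) (snd (qtw X) i l) = ?cl (?c l)" for l
      unfolding qtw_def snd_conv fst_conv e0(1)[of l, symmetric] by (rule CD_comp[OF t(1,1,1,3,3)])
    \<comment> \<open>The quotient may have a smaller support. The terms lost are composites through
      objects that became zero, so their cosets are neutral.\<close>
    have f: "finprod ?H' (\<lambda>l. ?cl (?c l)) (tw_supp CD (qtw X)) = finprod ?H' (\<lambda>l. ?cl (?c l)) (tw_supp C X)"
    proof (rule H'.finprod_mono_neutral_cong_left[OF t(2) supp_qtw(1)[OF t(1)]])
      fix l assume "l \<in> tw_supp C X - tw_supp CD (qtw X)"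
      then have "dg_id C (fst X l) \<in> D 0 (fst X l) (fst X l)" using supp_qtw(2)[of X l] t(1) by simp
      then have "?c l \<in> D (i - j + 2) (fst X i) (fst X j)" by (rule comp_zero_D[OF t(1,1,1,3,3)]) simp
      then show "?cl (?c l) = \<one>\<^bsub>?H'\<^esub>" using cl_D[OF t(1,1)] by simp
    qed (use c in auto)
    have d2: "dg_diff CD (i - j + 1) (fst X i) (fst X j) (snd (qtw X) i j) = ?cl ?d"
      unfolding qtw_def snd_conv e0(2)[symmetric] by (rule CD_diff[OF t(1,1,3)])
    have sd: "signed ?H i ?d \<in> carrier ?H" using d by (simp add: signed_def)
    have fc: "finprod ?H ?c (tw_supp C X) \<in> carrier ?H" using c by (intro H.finprod_closed) auto
    show ?thesis unfolding e f d2 CD_signed[OF t(1,1) d] CD_finprod[OF t(1,1,2) c] CD_mult[OF t(1,1) sd fc] t(4)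
      using cl_D[OF t(1,1) D_one[OF t(1,1)]] by simp
  qed
  moreover have "finite (tw_supp CD (qtw X))" using supp_qtw(1)[OF t(1)] t(2) by (rule finite_subset)
  ultimately show ?thesis unfolding twisted_complex_def case_prod_beta using t(1,3) by (auto simp: qtw_def)
qed

end

context abelian
begin

subsection \<open>Total complexes over a quotient\<close>

text \<open>
  A twisted complex may have a smaller support over the quotient. The total complexes are then
  isomorphic, but not equal.
\<close>

definition dl :: "int set \<Rightarrow> int set \<Rightarrow> (int \<Rightarrow> 'o) \<Rightarrow> 'a" where
  "dl K I Y = mat K Y I Y (\<lambda>i j. if i = j then idt (Y i) else zr (Y j) (Y i))"

lemma dl_mtyp: "objs K Y \<Longrightarrow> objs I Y \<Longrightarrow> mtyp K Y I Y (\<lambda>i j. if i = j then idt (Y i) else zr (Y j) (Y i))"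
  by (auto simp: Hom_iff)

lemma dl_simps [simp]:
  assumes "objs K Y" "objs I Y"
  shows "arr (dl K I Y)" "src (dl K I Y) = dsum K Y" "tgt (dl K I Y) = dsum I Y"
  unfolding dl_def using mat_simps[OF dl_mtyp[OF assms]] by auto

text \<open>Compared entry by entry, both sides are \<open>f i k\<close>. An index missing from
  \<open>I\<close> or from \<open>K'\<close> turns one of the sums into zero, and then the entry
  itself is zero because its target or its source is a zero object.\<close>

lemma dl_nat:
  assumes f: "mtyp (K \<union> K') X (I \<union> I') Y f"
    and K: "\<And>k. k \<in> K - K' \<Longrightarrow> nul (idt (X k))" and I: "\<And>i. i \<in> I' - I \<Longrightarrow> nul (idt (Y i))"
  shows "dl I I' Y \<star> mat K X I Y f = mat K' X I' Y f \<star> dl K K' X"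
proof -
  have o: "objs I Y" "objs I' Y" "objs K X" "objs K' X" using f by auto
  have f1: "mtyp K X I Y f" and f2: "mtyp K' X I' Y f" using f by auto
  note m1 = mat_simps[OF f1] and m2 = mat_simps[OF f2]
  show ?thesis
  proof (rule mat_eqI[OF o(3,2)])
    fix i k assume ik: "i \<in> I'" "k \<in> K"
    have X: "obj (X k)" and Y: "obj (Y i)" and fik: "arr (f i k)" "src (f i k) = X k" "tgt (f i k) = Y i" using ik f by (auto simp: Hom_iff)
    have fin: "finite I" "finite K'" using o by auto
    have "sprj I' Y i \<star> ((dl I I' Y \<star> mat K X I Y f) \<star> sinj K X k) =
      hsum (X k) (Y i) (\<lambda>j. (if i = j then idt (Y i) else zr (Y j) (Y i)) \<star> f j k) I"
      unfolding dl_def by (rule mat_comp_entry[OF f1 dl_mtyp[OF o(1,2)] ik])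
    also have "\<dots> = f i k"
    proof (cases "i \<in> I")
      case True
      have "hsum (X k) (Y i) (\<lambda>j. (if i = j then idt (Y i) else zr (Y j) (Y i)) \<star> f j k) I = (if i = i then idt (Y i) else zr (Y i) (Y i)) \<star> f i k"
        by (rule hsum_single[OF fin(1) True]) (use f ik fik Y in \<open>auto simp: Hom_iff\<close>)
      then show ?thesis using fik by simp
    next
      case False
      have "nul (f i k)" by (rule nul_to[OF I fik(1,3)]) (use ik False in auto)
      moreover have "hsum (X k) (Y i) (\<lambda>j. (if i = j then idt (Y i) else zr (Y j) (Y i)) \<star> f j k) I = zr (X k) (Y i)"
        by (rule hsum_zr[OF X Y]) (use f ik False Y in \<open>auto simp: Hom_iff\<close>)
      ultimately show ?thesis using fik nul_eq[of "f i k"] X Y by simp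
    qed
    also have "\<dots> = hsum (X k) (Y i) (\<lambda>j. f i j \<star> (if j = k then idt (X j) else zr (X k) (X j))) K'"
    proof (cases "k \<in> K'")
      case True
      have "hsum (X k) (Y i) (\<lambda>j. f i j \<star> (if j = k then idt (X j) else zr (X k) (X j))) K' = f i k \<star> (if k = k then idt (X k) else zr (X k) (X k))"
        by (rule hsum_single[OF fin(2) True]) (use f ik fik X in \<open>auto simp: Hom_iff\<close>)
      then show ?thesis using fik by simp
    next
      case False
      have "nul (f i k)" by (rule nul_from[OF K fik(1,2)]) (use ik False in auto)
      moreover have "hsum (X k) (Y i) (\<lambda>j. f i j \<star> (if j = k then idt (X j) else zr (X k) (X j))) K' = zr (X k) (Y i)"
        by (rule hsum_zr[OF X Y]) (use f ik False X in \<open>auto simp: Hom_iff\<close>)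
      ultimately show ?thesis using fik nul_eq[of "f i k"] X Y by simp
    qed
    also have "\<dots> = sprj I' Y i \<star> ((mat K' X I' Y f \<star> dl K K' X) \<star> sinj K X k)"
      unfolding dl_def by (rule mat_comp_entry[OF dl_mtyp[OF o(3,4)] f2 ik, symmetric])
    finally show "sprj I' Y i \<star> ((dl I I' Y \<star> mat K X I Y f) \<star> sinj K X k) =
      sprj I' Y i \<star> ((mat K' X I' Y f \<star> dl K K' X) \<star> sinj K X k)" .
  qed (use o m1 m2 in auto)
qed

lemma dl_refl: assumes "objs I Y" shows "dl I I Y = idt (dsum I Y)"
  unfolding dl_def by (rule mat_eq_entries[OF dl_mtyp[OF assms assms]]) (use assms sprj_sinj[OF assms, of _ _ "idt (Y _)"] in auto)

text \<open>This is \<open>dl_nat\<close> applied to the matrix that defines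
  \<open>dl\<close>.\<close>

lemma dl_inverse:
  assumes "objs I Y" "objs I' Y" "\<And>i. i \<in> I - I' \<Longrightarrow> nul (idt (Y i))"
  shows "dl I' I Y \<star> dl I I' Y = idt (dsum I Y)"
proof -
  have "mtyp (I \<union> I) Y (I' \<union> I) Y (\<lambda>i j. if i = j then idt (Y i) else zr (Y j) (Y i))"
    by (rule dl_mtyp) (use assms in auto)
  from dl_nat[OF this, folded dl_def] have "dl I' I Y \<star> dl I I' Y = dl I I Y \<star> dl I I Y"
    using assms(3) by simp
  then show ?thesis using assms by (simp add: dl_refl)
qed

end

section \<open>Functors that kill the ideal, on the quotient category\<close>

locale quot_fun = cpx_functor A C F + Q: dg_ideal C D
  for A :: "('o, 'a) addcat" (structure) and C :: "('c, 'm) dgcat" and F D +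
  assumes F_kill: "P \<in> dg_obj C \<Longrightarrow> Q \<in> dg_obj C \<Longrightarrow> f \<in> D i P Q \<Longrightarrow> nul (fun_hom F i P Q f n)"
begin

abbreviation CD where "CD \<equiv> dg_quotient C D"

text \<open>A coset is evaluated at a chosen representative; since \<open>F\<close> kills the ideal,
  the value does not depend on the choice (\<open>QF_cl\<close>).\<close>

definition QF :: "('c, 'm set, 'o, 'a) cpx_fun" where
  "QF = \<lparr>fun_obj = fun_obj F, fun_hom = \<lambda>i P Q c. fun_hom F i P Q (SOME f. f \<in> c)\<rparr>"

lemma QF_obj [simp]: "fun_obj QF = fun_obj F"
  by (simp add: QF_def)

lemma QF_cl:
  assumes "P \<in> dg_obj C" "Q \<in> dg_obj C" "f \<in> carrier (dg_hom C i P Q)"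
  shows "fun_hom QF i P Q (Q.cl i P Q f) n = fun_hom F i P Q f n"
proof -
  have "(SOME f'. f' \<in> Q.cl i P Q f) \<in> Q.cl i P Q f" by (rule someI[of "\<lambda>f'. f' \<in> Q.cl i P Q f" f, OF Q.cl_self[OF assms]])
  from Q.cl_mem[OF assms this] obtain d where d: "d \<in> D i P Q" "(SOME f'. f' \<in> Q.cl i P Q f) = d \<otimes>\<^bsub>dg_hom C i P Q\<^esub> f" by metis
  have dc: "d \<in> carrier (dg_hom C i P Q)" by (rule Q.D_carrier[OF assms(1,2) d(1)])
  have "fun_hom QF i P Q (Q.cl i P Q f) n = fun_hom F i P Q d n \<boxplus> fun_hom F i P Q f n"
    using Fadd[OF assms(1,2) dc assms(3), of n] by (simp add: QF_def d(2))
  also have "\<dots> = fun_hom F i P Q f n"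
    by (rule nul_add_eq[OF F_kill[OF assms(1,2) d(1)]]) (use Fhom_simps[OF assms] Fhom_simps[OF assms(1,2) dc] in auto)
  finally show ?thesis .
qed

lemma QF_functor: "cpx_functor A CD QF"
proof (intro cpx_functor.intro cpx_functor_axioms.intro)
  show "abelian A" by (rule abelian_axioms)
  show "comm_group (dg_hom CD i P Q)" if "P \<in> dg_obj CD" "Q \<in> dg_obj CD" for P Q i
    by (rule Q.CD_grp) (use that in simp_all)
  show "dg_id CD P \<in> carrier (dg_hom CD 0 P P)" if "P \<in> dg_obj CD" for P using Cid that by simp
  show "cpx (fun_obj QF P)" if "P \<in> dg_obj CD" for P using that Fobj by simp
  show "fun_hom QF 0 P P (dg_id CD P) n = idt (fst (fun_obj QF P) n)" if "P \<in> dg_obj CD" for P n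
    using that Fid Cid by (simp add: QF_cl)
  fix P Q c i n assume "P \<in> dg_obj CD" "Q \<in> dg_obj CD" and c: "c \<in> carrier (dg_hom CD i P Q)"
  then have o: "P \<in> dg_obj C" "Q \<in> dg_obj C" by simp_all
  obtain f where f: "f \<in> carrier (dg_hom C i P Q)" "c = Q.cl i P Q f" using c by auto
  show "dg_diff CD i P Q c \<in> carrier (dg_hom CD (i + 1) P Q)" unfolding f(2) Q.CD_diff[OF o f(1)] using Cdiff[OF o f(1)] by simp
  show "fun_hom QF i P Q c n \<in> Hom (fst (fun_obj QF Q) n) (fst (fun_obj QF P) (n + i))"
    unfolding f(2) QF_cl[OF o f(1)] using Fhom[OF o f(1)] by simp
  show "fun_hom QF (i + 1) P Q (dg_diff CD i P Q c) n = snd (fun_obj QF P) (n + i) \<star> fun_hom QF i P Q c n \<boxplus>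
      sg (i + 1) (fun_hom QF i P Q c (n + 1) \<star> snd (fun_obj QF Q) n)"
    unfolding f(2) Q.CD_diff[OF o f(1)] QF_cl[OF o f(1)] QF_cl[OF o Cdiff[OF o f(1)]] QF_obj by (rule Fdiff[OF o f(1)])
  { fix c' assume "c' \<in> carrier (dg_hom CD i P Q)"
    then obtain g where g: "g \<in> carrier (dg_hom C i P Q)" "c' = Q.cl i P Q g" by auto
    show "fun_hom QF i P Q (c \<otimes>\<^bsub>dg_hom CD i P Q\<^esub> c') n = fun_hom QF i P Q c n \<boxplus> fun_hom QF i P Q c' n"
      unfolding f(2) g(2) Q.CD_mult[OF o f(1) g(1)] QF_cl[OF o f(1)] QF_cl[OF o g(1)] QF_cl[OF o Hmul[OF o f(1) g(1)]]
      by (rule Fadd[OF o f(1) g(1)]) }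
  fix R c' j assume "R \<in> dg_obj CD" and c': "c' \<in> carrier (dg_hom CD j Q R)"
  then have R: "R \<in> dg_obj C" by simp
  obtain g where g: "g \<in> carrier (dg_hom C j Q R)" "c' = Q.cl j Q R g" using c' by auto
  note O = o R
  show "dg_comp CD j i P Q R c' c \<in> carrier (dg_hom CD (j + i) P R)"
    unfolding f(2) g(2) Q.CD_comp[OF O g(1) f(1)] using Ccomp[OF O g(1) f(1)] by simp
  show "fun_hom QF (j + i) P R (dg_comp CD j i P Q R c' c) n = fun_hom QF i P Q c (n + j) \<star> fun_hom QF j Q R c' n"
    unfolding f(2) g(2) Q.CD_comp[OF O g(1) f(1)] QF_cl[OF o(1) R Ccomp[OF O g(1) f(1)]] QF_cl[OF o f(1)] QF_cl[OF o(2) R g(1)]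
    by (rule Fcomp[OF O g(1) f(1)])
qed

end

sublocale quot_fun \<subseteq> QF: cpx_functor A CD QF
  by (rule QF_functor)

context quot_fun
begin

abbreviation qX where "qX \<equiv> Q.qtw"

definition tQ :: "('c, 'm) twisted \<Rightarrow> int \<Rightarrow> 'a" where
  "tQ X n = dl (su X) (QF.su (qX X)) (ts X n)"

definition tQ' :: "('c, 'm) twisted \<Rightarrow> int \<Rightarrow> 'a" where
  "tQ' X n = dl (QF.su (qX X)) (su X) (ts X n)"

lemma qX_tw: "tw X \<Longrightarrow> QF.tw (qX X)"
  by (rule Q.qtw_twisted)

text \<open>An index leaves the support when the identity of its object lies in the ideal. The
  functor kills this identity, so the summand lost was already a zero object; this is what makes the
  two total complexes isomorphic.\<close>

lemma qX_supp:
  assumes "tw X"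
  shows "QF.su (qX X) \<union> su X = su X" "su X \<union> QF.su (qX X) = su X" "i \<notin> QF.su (qX X) \<Longrightarrow> nul (idt (ts X n i))" "QF.su (qX X) - su X = {}"
proof -
  note t = twistedD(1)[OF assms]
  show "QF.su (qX X) \<union> su X = su X" "su X \<union> QF.su (qX X) = su X" "QF.su (qX X) - su X = {}"
    using Q.supp_qtw(1)[of X] t by auto
  assume "i \<notin> QF.su (qX X)"
  then have "dg_id C (fst X i) \<in> D 0 (fst X i) (fst X i)" using Q.supp_qtw(2)[of X i] t by simp
  from F_kill[OF t t this, of "n + i"] show "nul (idt (ts X n i))" unfolding Fid[OF t] tot_summand_def .
qed

lemma ts_qX: "QF.ts (qX X) n = ts X n"
  by (simp add: tot_summand_def fun_eq_iff)

lemma qX_objs: "tw X \<Longrightarrow> objs (QF.su (qX X)) (ts X n)"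
  using QF.ts_objs[OF qX_tw, of X n] by (simp add: ts_qX)

lemma tent_qX: assumes "tw X" shows "QF.tent (qX X) n = tent X n"
proof (intro ext)
  note t = twistedD[OF assms]
  have q: "QF.qent (qX X) n i j = qent X n i j" for i j
    unfolding QF.qent_def qent_def using QF_cl[OF t(1,1,3), of i j "n + j"] by (simp add: Q.qtw_def)
  have d: "QF.dent (qX X) n i = dent X n i" for i by (simp add: QF.dent_def dent_def)
  show "QF.tent (qX X) n i j = tent X n i j" for i j by (simp add: QF.tent_def tent_def q d)
qed

lemma ment_qX: assumes "tw X" "tw Y" "f \<in> carrier (tc l X Y)"
  shows "QF.ment l (qX X) (qX Y) (Q.qmat l X Y f) n = ment l X Y f n"
proof (intro ext)
  fix i j
  show "QF.ment l (qX X) (qX Y) (Q.qmat l X Y f) n i j = ment l X Y f n i j"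
    using QF_cl[OF twistedD(1)[OF assms(1)] twistedD(1)[OF assms(2)] tc_carrier[OF assms(3)], of i j "n + j"]
    by (simp add: QF.ment_def ment_def Q.qmat_def)
qed

lemma qmat_tc: "tw X \<Longrightarrow> tw Y \<Longrightarrow> f \<in> carrier (tc l X Y) \<Longrightarrow> Q.qmat l X Y f \<in> carrier (QF.tc l (qX X) (qX Y))"
  using tc_carrier[of f l X Y] by (auto simp: PreTr_simps Q.qmat_def)

lemma tQ_tm:
  assumes "tw X" "tw Y" "f \<in> carrier (tc l X Y)" "m = n + l"
  shows "tQ X m \<star> tm l X Y f n = QF.tm l (qX X) (qX Y) (Q.qmat l X Y f) n \<star> tQ Y n"
  unfolding tm_eq QF.tm_eq tQ_def ts_qX ment_qX[OF assms(1-3)] assms(4)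
  by (rule dl_nat) (use ment_mtyp[OF assms(1-3) refl] qX_supp[OF assms(1)] qX_supp[OF assms(2)] in simp_all)

lemma tQ_cmap: assumes "tw X" shows "cmap (tt X) (QF.tt (qX X)) (tQ X)"
proof (rule cmapI[OF tt_cpx[OF assms] QF.tt_cpx[OF qX_tw[OF assms]]])
  fix n
  note s = tt_simps[OF assms] QF.tt_simps[OF qX_tw[OF assms]]
  show "arr (tQ X n)" "src (tQ X n) = fst (tt X) n" "tgt (tQ X n) = fst (QF.tt (qX X)) n"
    unfolding tQ_def s ts_qX using qX_objs[OF assms] ts_objs[OF assms] by simp_all
  show "snd (QF.tt (qX X)) n \<star> tQ X n = tQ X (n + 1) \<star> snd (tt X) n"
    unfolding tQ_def s ts_qX tent_qX[OF assms]
    by (rule dl_nat[symmetric]) (use tent_mtyp[OF assms refl] qX_supp[OF assms] in simp_all)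
qed

lemma tQ'_cmap: assumes "tw X" shows "cmap (QF.tt (qX X)) (tt X) (tQ' X)"
proof (rule cmapI[OF QF.tt_cpx[OF qX_tw[OF assms]] tt_cpx[OF assms]])
  fix n
  note s = tt_simps[OF assms] QF.tt_simps[OF qX_tw[OF assms]]
  show "arr (tQ' X n)" "tgt (tQ' X n) = fst (tt X) n" "src (tQ' X n) = fst (QF.tt (qX X)) n"
    unfolding tQ'_def s ts_qX using qX_objs[OF assms] ts_objs[OF assms] by simp_all
  show "snd (tt X) n \<star> tQ' X n = tQ' X (n + 1) \<star> snd (QF.tt (qX X)) n"
    unfolding tQ'_def s ts_qX tent_qX[OF assms]
    by (rule dl_nat[symmetric]) (use tent_mtyp[OF assms refl] qX_supp[OF assms] in simp_all)
qed

lemma tQ_inverse: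
  assumes "tw X"
  shows "tQ' X n \<star> tQ X n = idt (fst (tt X) n)" "tQ X n \<star> tQ' X n = idt (fst (QF.tt (qX X)) n)"
  unfolding tQ_def tQ'_def tt_simps[OF assms] QF.tt_simps[OF qX_tw[OF assms]] ts_qX
  by (rule dl_inverse; use qX_objs[OF assms] ts_objs[OF assms] qX_supp[OF assms] in simp)+

text \<open>The map of totals over the quotient is the original one conjugated by the isomorphisms
  \<open>tQ\<close> and \<open>tQ'\<close>, hence a composite of chain maps.\<close>

lemma qmat_good:
  assumes "tw X" "tw Y" "good X Y f"
  shows "QF.good (qX X) (qX Y) (Q.qmat 0 X Y f)"
proof -
  have f: "f \<in> carrier (tc 0 X Y)" "cmap (tt Y) (tt X) (tm 0 X Y f)" using assms(3) by (auto simp: good_def)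
  note f' = qmat_tc[OF assms(1,2) f(1)] and t' = QF.tm_types[OF qX_tw[OF assms(1)] qX_tw[OF assms(2)] qmat_tc[OF assms(1,2) f(1)]]
  note q = cmapD[OF tQ_cmap[OF assms(1)]] cmapD[OF tQ'_cmap[OF assms(2)]] and fd = cmapD[OF f(2)] and qY = cmapD[OF tQ_cmap[OF assms(2)]]
  have "QF.tm 0 (qX X) (qX Y) (Q.qmat 0 X Y f) n = (tQ X n \<star> tm 0 X Y f n) \<star> tQ' Y n" for n
  proof -
    have e: "tQ X n \<star> tm 0 X Y f n = QF.tm 0 (qX X) (qX Y) (Q.qmat 0 X Y f) n \<star> tQ Y n"
      by (rule tQ_tm[OF assms(1,2) f(1)]) simp
    have "(tQ X n \<star> tm 0 X Y f n) \<star> tQ' Y n = QF.tm 0 (qX X) (qX Y) (Q.qmat 0 X Y f) n \<star> (tQ Y n \<star> tQ' Y n)"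
      unfolding e by (rule assoc) (use q(9-11) qY(3-5) t' in auto)
    then show ?thesis using t' by (simp add: tQ_inverse[OF assms(2)])
  qed
  then have "QF.tm 0 (qX X) (qX Y) (Q.qmat 0 X Y f) = (\<lambda>n. (tQ X n \<star> tm 0 X Y f n) \<star> tQ' Y n)" by auto
  then show ?thesis unfolding QF.good_def
    using f' cmap_comp[OF tQ'_cmap[OF assms(2)] cmap_comp[OF f(2) tQ_cmap[OF assms(1)]]] by simp
qed

definition \<zeta> :: "int \<Rightarrow> ('c, 'm) twisted \<Rightarrow> 'a" where
  "\<zeta> s X = cohom_map A s (tt X) (QF.tt (qX X)) (tQ X)"

lemma \<zeta>:
  assumes "tw X"
  shows "arr (\<zeta> s X)" "src (\<zeta> s X) = cohom A s (tt X)" "tgt (\<zeta> s X) = cohom A s (QF.tt (qX X))"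
    "cat_iso A (\<zeta> s X)" "epi (\<zeta> s X)"
proof -
  note c = tQ_cmap[OF assms] and c' = tQ'_cmap[OF assms]
  note h = cohom_map[OF c, of s, folded \<zeta>_def] and h' = cohom_map[OF c', of s]
  let ?\<zeta>' = "cohom_map A s (QF.tt (qX X)) (tt X) (tQ' X)"
  show z: "arr (\<zeta> s X)" "src (\<zeta> s X) = cohom A s (tt X)" "tgt (\<zeta> s X) = cohom A s (QF.tt (qX X))" using h by auto
  have "?\<zeta>' \<star> \<zeta> s X = cohom_map A s (tt X) (tt X) (\<lambda>n. tQ' X n \<star> tQ X n)"
    unfolding \<zeta>_def by (rule cohom_map_comp[OF c c', symmetric])
  also have "\<dots> = idt (cohom A s (tt X))" by (rule cohom_map_id[OF tt_cpx[OF assms] tQ_inverse(1)[OF assms]])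
  finally have i1: "?\<zeta>' \<star> \<zeta> s X = idt (cohom A s (tt X))" .
  have "\<zeta> s X \<star> ?\<zeta>' = cohom_map A s (QF.tt (qX X)) (QF.tt (qX X)) (\<lambda>n. tQ X n \<star> tQ' X n)"
    unfolding \<zeta>_def by (rule cohom_map_comp[OF c' c, symmetric])
  also have "\<dots> = idt (cohom A s (QF.tt (qX X)))" by (rule cohom_map_id[OF QF.tt_cpx[OF qX_tw[OF assms]] tQ_inverse(2)[OF assms]])
  finally have i2: "\<zeta> s X \<star> ?\<zeta>' = idt (cohom A s (QF.tt (qX X)))" .
  show "cat_iso A (\<zeta> s X)" unfolding cat_iso_def using z h' i1 i2 by (intro conjI bexI[of _ ?\<zeta>']) auto
  show "epi (\<zeta> s X)"
  proof (rule epiI)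
    fix g assume g: "arr g" "src g = tgt (\<zeta> s X)" "nul (g \<star> \<zeta> s X)"
    have "nul ((g \<star> \<zeta> s X) \<star> ?\<zeta>')" by (rule comp_nul[OF g(3)]) (use g z h' in auto)
    moreover have "(g \<star> \<zeta> s X) \<star> ?\<zeta>' = g \<star> (\<zeta> s X \<star> ?\<zeta>')" by (rule assoc) (use g z h' in auto)
    ultimately show "nul g" using g z by (simp add: i2)
  qed (rule z)
qed

lemma hm_qmat:
  assumes "tw X" "tw Y" "good X Y f"
  shows "QF.hm s (qX X) (qX Y) (Q.qmat 0 X Y f) \<star> \<zeta> s Y = \<zeta> s X \<star> hm s X Y f"
proof -
  have f: "f \<in> carrier (tc 0 X Y)" "cmap (tt Y) (tt X) (tm 0 X Y f)" using assms(3) by (auto simp: good_def)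
  have g: "cmap (QF.tt (qX Y)) (QF.tt (qX X)) (QF.tm 0 (qX X) (qX Y) (Q.qmat 0 X Y f))"
    using qmat_good[OF assms] by (simp add: QF.good_def)
  have "QF.tm 0 (qX X) (qX Y) (Q.qmat 0 X Y f) n \<star> tQ Y n = tQ X n \<star> tm 0 X Y f n" for n
    by (rule tQ_tm[OF assms(1,2) f(1), symmetric]) simp
  then show ?thesis
    unfolding QF.hm_def hm_def \<zeta>_def cohom_map_comp[OF tQ_cmap[OF assms(2)] g, symmetric]
      cohom_map_comp[OF f(2) tQ_cmap[OF assms(1)], symmetric] by simp
qed

definition tD :: "(('c, 'm) twisted, ('c, 'm) twisted \<times> ('c, 'm) twisted \<times> (int \<Rightarrow> int \<Rightarrow> 'm) set,
    ('c, 'm set) twisted, ('c, 'm set) twisted \<times> ('c, 'm set) twisted \<times> (int \<Rightarrow> int \<Rightarrow> 'm set) set) funct" where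
  "tD = (qX, \<lambda>(X, Y, c). (qX X, qX Y, \<Union>f\<in>c. homotopy_class (PreTr CD) (qX X) (qX Y) (Q.qmat 0 X Y f)))"

text \<open>The arrow given by \<open>tD\<close> is a union over all representatives in
  \<open>c\<close>. They have the same effect on cohomology, because \<open>hm_qmat\<close>
  determines it after precomposition with the epimorphism \<open>\<zeta> s Y\<close>, which
  cancels.\<close>

lemma tD_cohom:
  assumes "adm C X Y c"
  shows "arr (snd (cohom_Tr A CD QF s) (snd tD (X, Y, c)))"
    "src (snd (cohom_Tr A CD QF s) (snd tD (X, Y, c))) = cohom A s (QF.tt (qX Y))"
    "tgt (snd (cohom_Tr A CD QF s) (snd tD (X, Y, c))) = cohom A s (QF.tt (qX X))"
    "snd (cohom_Tr A CD QF s) (snd tD (X, Y, c)) \<star> \<zeta> s Y = \<zeta> s X \<star> snd (cohom_Tr A C F s) (X, Y, c)"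
proof -
  obtain f0 where f0: "f0 \<in> c" using assms unfolding adm_def by blast
  note a0 = admD[OF assms f0]
  let ?h = "QF.hm s (qX X) (qX Y) (Q.qmat 0 X Y f0)"
  let ?c = "\<Union>f\<in>c. homotopy_class (PreTr CD) (qX X) (qX Y) (Q.qmat 0 X Y f)"
  note qt = qX_tw[OF a0(1)] qX_tw[OF a0(2)]
  have eq: "QF.hm s (qX X) (qX Y) (Q.qmat 0 X Y f) = ?h" if f: "f \<in> c" for f
  proof -
    note a = admD[OF assms f]
    have hf: "hm s X Y f = hm s X Y f0" using a(4)[of s] a0(4)[of s] by simp
    note t = QF.hm_types[OF qmat_good[OF a(1-3)], of s] and t0 = QF.hm_types[OF qmat_good[OF a0(1-3)], of s]
    show ?thesis
      by (rule epi_cancel[OF \<zeta>(5)[OF a0(2), of s]])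
        (use hm_qmat[OF a(1-3), of s] hm_qmat[OF a0(1-3), of s] hf t t0 \<zeta>[OF a0(2), of s] in auto)
  qed
  have "snd (cohom_Tr A CD QF s) (qX X, qX Y, ?c) = ?h"
  proof (rule QF.cohom_Tr_eval)
    show "?c \<noteq> {}" using f0 QF.homotopy_class_nonempty[OF qt] by auto
    fix g assume "g \<in> ?c"
    then obtain f where f: "f \<in> c" and g: "g \<in> homotopy_class (PreTr CD) (qX X) (qX Y) (Q.qmat 0 X Y f)" by blast
    show "QF.good (qX X) (qX Y) g \<and> QF.hm s (qX X) (qX Y) g = ?h"
      using QF.good_homotopy_class[OF qt qmat_good[OF admD(1-3)[OF assms f]] g] eq[OF f] by simp
  qed
  then have h: "snd (cohom_Tr A CD QF s) (snd tD (X, Y, c)) = ?h" by (simp add: tD_def)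
  show "arr (snd (cohom_Tr A CD QF s) (snd tD (X, Y, c)))"
    "src (snd (cohom_Tr A CD QF s) (snd tD (X, Y, c))) = cohom A s (QF.tt (qX Y))"
    "tgt (snd (cohom_Tr A CD QF s) (snd tD (X, Y, c))) = cohom A s (QF.tt (qX X))"
    unfolding h using QF.hm_types[OF qmat_good[OF a0(1-3)], of s] by auto
  show "snd (cohom_Tr A CD QF s) (snd tD (X, Y, c)) \<star> \<zeta> s Y = \<zeta> s X \<star> snd (cohom_Tr A C F s) (X, Y, c)"
    unfolding h a0(4) by (rule hm_qmat[OF a0(1-3)])
qed

lemma tD_natural_iso: "natural_iso (Tr C) A (cohom_Tr A C F s) (funct_comp (cohom_Tr A CD QF s) tD) (\<zeta> s)"
  unfolding natural_iso_def
proof (intro conjI ballI)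
  have f1: "fst (funct_comp (cohom_Tr A CD QF s) tD) X = cohom A s (QF.tt (qX X))" for X
    by (simp add: funct_comp_def tD_def cohom_Tr_def homotopy_fun_def Let_def)
  have f2: "snd (funct_comp (cohom_Tr A CD QF s) tD) \<alpha> = snd (cohom_Tr A CD QF s) (snd tD \<alpha>)" for \<alpha>
    by (simp add: funct_comp_def)
  show "contra_functor (Tr C) A (cohom_Tr A C F s)" by (rule contra_functor_cohom_Tr)
  show "contra_functor (Tr C) A (funct_comp (cohom_Tr A CD QF s) tD)"
    by (rule contra_functor_epi[where u = "\<zeta> s" and s = s]) (simp_all add: f1 f2 \<zeta> tD_cohom)
  fix X assume "X \<in> cat_obj (Tr C)"
  then have X: "tw X" by (simp add: Tr_obj_iff)
  show "\<zeta> s X \<in> Hom (fst (cohom_Tr A C F s) X) (fst (funct_comp (cohom_Tr A CD QF s) tD) X)" "cat_iso A (\<zeta> s X)"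
    using \<zeta>[OF X, of s] unfolding f1 by (auto simp: cohom_Tr_def homotopy_fun_def Let_def)
  fix Y \<alpha> assume "\<alpha> \<in> cat_hom (Tr C) X Y"
  then obtain c where c: "\<alpha> = (X, Y, c)" "adm C X Y c" by (rule adm_hom)
  show "\<zeta> s X \<star> snd (cohom_Tr A C F s) \<alpha> = snd (funct_comp (cohom_Tr A CD QF s) tD) \<alpha> \<star> \<zeta> s Y"
    unfolding f2 c(1) by (rule tD_cohom(4)[OF c(2), symmetric])
qed

end

lemma (in abelian) natural_iso_trans:
  assumes "natural_iso T A \<Phi> \<Psi> \<eta>" "natural_iso T A \<Psi> \<Omega> \<theta>"
  shows "natural_iso T A \<Phi> \<Omega> (\<lambda>X. \<theta> X \<star> \<eta> X)"
proof -
  note a = assms(1)[unfolded natural_iso_def] and b = assms(2)[unfolded natural_iso_def]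
  have \<eta>: "arr (\<eta> X)" "src (\<eta> X) = fst \<Phi> X" "tgt (\<eta> X) = fst \<Psi> X" "cat_iso A (\<eta> X)" if "X \<in> cat_obj T" for X
    using a that by (auto simp: Hom_iff)
  have \<theta>: "arr (\<theta> X)" "src (\<theta> X) = fst \<Psi> X" "tgt (\<theta> X) = fst \<Omega> X" "cat_iso A (\<theta> X)" if "X \<in> cat_obj T" for X
    using b that by (auto simp: Hom_iff)
  show ?thesis unfolding natural_iso_def
  proof (intro conjI ballI)
    show "contra_functor T A \<Phi>" "contra_functor T A \<Omega>" using a b by auto
    fix X assume X: "X \<in> cat_obj T"
    note x = \<eta>[OF X] \<theta>[OF X]
    show "\<theta> X \<star> \<eta> X \<in> Hom (fst \<Phi> X) (fst \<Omega> X)" using x by auto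
    obtain u where u: "arr u" "src u = tgt (\<eta> X)" "tgt u = src (\<eta> X)" "u \<star> \<eta> X = idt (src (\<eta> X))" "\<eta> X \<star> u = idt (tgt (\<eta> X))"
      using x(4) unfolding cat_iso_def by (auto simp: Hom_iff)
    obtain v where v: "arr v" "src v = tgt (\<theta> X)" "tgt v = src (\<theta> X)" "v \<star> \<theta> X = idt (src (\<theta> X))" "\<theta> X \<star> v = idt (tgt (\<theta> X))"
      using x(8) unfolding cat_iso_def by (auto simp: Hom_iff)
    have "v \<star> (\<theta> X \<star> \<eta> X) = idt (src (\<theta> X)) \<star> \<eta> X" by (rule comp_reduce[OF v(4)]) (use x v in auto)
    then have 1: "(u \<star> v) \<star> (\<theta> X \<star> \<eta> X) = idt (src (\<theta> X \<star> \<eta> X))" using x(1-3,5-7) u(1-3) v(1-3) by (simp add: u(4))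
    have "\<eta> X \<star> (u \<star> v) = idt (tgt (\<eta> X)) \<star> v" by (rule comp_reduce[OF u(5)]) (use x u v in auto)
    then have 2: "(\<theta> X \<star> \<eta> X) \<star> (u \<star> v) = idt (tgt (\<theta> X \<star> \<eta> X))" using x(1-3,5-7) u(1-3) v(1-3) by (simp add: v(5))
    show "cat_iso A (\<theta> X \<star> \<eta> X)" unfolding cat_iso_def
      using 1 2 x(1-3,5-7) u(1-3) v(1-3) by (intro conjI bexI[of _ "u \<star> v"]) auto
    fix Y f assume Y: "Y \<in> cat_obj T" and f: "f \<in> cat_hom T X Y"
    note y = \<eta>[OF Y] \<theta>[OF Y]
    have p: "arr (snd \<Phi> f)" "src (snd \<Phi> f) = fst \<Phi> Y" "tgt (snd \<Phi> f) = fst \<Phi> X"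
      "arr (snd \<Psi> f)" "src (snd \<Psi> f) = fst \<Psi> Y" "tgt (snd \<Psi> f) = fst \<Psi> X"
      "arr (snd \<Omega> f)" "src (snd \<Omega> f) = fst \<Omega> Y" "tgt (snd \<Omega> f) = fst \<Omega> X"
      using a b X Y f unfolding contra_functor_def by (auto simp: Hom_iff)
    have n1: "\<eta> X \<star> snd \<Phi> f = snd \<Psi> f \<star> \<eta> Y" and n2: "\<theta> X \<star> snd \<Psi> f = snd \<Omega> f \<star> \<theta> Y" using a b X Y f by auto
    have "(\<theta> X \<star> \<eta> X) \<star> snd \<Phi> f = \<theta> X \<star> (\<eta> X \<star> snd \<Phi> f)" by (rule assoc) (use x p in auto)
    also have "\<dots> = (\<theta> X \<star> snd \<Psi> f) \<star> \<eta> Y" unfolding n1 by (rule assoc[symmetric]) (use x y p in auto)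
    also have "\<dots> = snd \<Omega> f \<star> (\<theta> Y \<star> \<eta> Y)" unfolding n2 by (rule assoc) (use x y p in auto)
    finally show "(\<theta> X \<star> \<eta> X) \<star> snd \<Phi> f = snd \<Omega> f \<star> (\<theta> Y \<star> \<eta> Y)" .
  qed
qed

subsection \<open>The ideal defining \<open>J\<^sub>N\<close>\<close>

text \<open>For \<open>J\<close> this is \<open>J_ideal\<close>. The boundaries in degree
  \<open>-N\<close> make the lowest group of the quotient a cokernel, and they are what closes the
  ideal under the differential.\<close>

definition trunc_ideal :: "('c, 'm) dgcat \<Rightarrow> nat \<Rightarrow> int \<Rightarrow> 'c \<Rightarrow> 'c \<Rightarrow> 'm set" where
  "trunc_ideal C N i P Q = (if i > - int N then {\<one>\<^bsub>dg_hom C i P Q\<^esub>}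
     else if i = - int N then dg_diff C (i - 1) P Q ` carrier (dg_hom C (i - 1) P Q)
     else carrier (dg_hom C i P Q))"

lemma trunc_ideal_top: "i = - int N \<Longrightarrow> k = i - 1 \<Longrightarrow> trunc_ideal C N i P Q = dg_diff C k P Q ` carrier (dg_hom C k P Q)"
  by (simp add: trunc_ideal_def)

locale nonpos_dg_category = dg_category +
  assumes pos: "P \<in> dg_obj C \<Longrightarrow> Q \<in> dg_obj C \<Longrightarrow> i > 0 \<Longrightarrow> f \<in> carrier (dg_hom C i P Q) \<Longrightarrow>
    f = \<one>\<^bsub>dg_hom C i P Q\<^esub>"
begin

lemma dg_group: "P \<in> dg_obj C \<Longrightarrow> Q \<in> dg_obj C \<Longrightarrow> group (dg_hom C i P Q)"
  using hom_group by (simp add: comm_group_def)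

lemma diff_closed: "P \<in> dg_obj C \<Longrightarrow> Q \<in> dg_obj C \<Longrightarrow> f \<in> carrier (dg_hom C i P Q) \<Longrightarrow> dg_diff C i P Q f \<in> carrier (dg_hom C (i + 1) P Q)"
  by (rule hom_in_carrier[OF diff_hom])

lemma diff_one: "P \<in> dg_obj C \<Longrightarrow> Q \<in> dg_obj C \<Longrightarrow> dg_diff C i P Q \<one>\<^bsub>dg_hom C i P Q\<^esub> = \<one>\<^bsub>dg_hom C (i + 1) P Q\<^esub>"
  by (rule hom_one[OF diff_hom dg_group dg_group])

lemma comp_one:
  assumes "P \<in> dg_obj C" "Q \<in> dg_obj C" "R \<in> dg_obj C"
  shows "g \<in> carrier (dg_hom C i Q R) \<Longrightarrow> dg_comp C i j P Q R g \<one>\<^bsub>dg_hom C j P Q\<^esub> = \<one>\<^bsub>dg_hom C (i + j) P R\<^esub>"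
    and "f \<in> carrier (dg_hom C j P Q) \<Longrightarrow> dg_comp C i j P Q R \<one>\<^bsub>dg_hom C i Q R\<^esub> f = \<one>\<^bsub>dg_hom C (i + j) P R\<^esub>"
  using hom_one[OF comp_add_right dg_group dg_group] hom_one[OF comp_add_left dg_group dg_group] assms by auto

lemma trunc_ideal_subgroup:
  assumes o: "P \<in> dg_obj C" "Q \<in> dg_obj C"
  shows "subgroup (trunc_ideal C N i P Q) (dg_hom C i P Q)"
proof -
  interpret H: group "dg_hom C i P Q" by (rule dg_group[OF o])
  have h: "dg_diff C (i - 1) P Q \<in> hom (dg_hom C (i - 1) P Q) (dg_hom C i P Q)" using diff_hom[OF o, of "i - 1"] by simp
  have "group_hom (dg_hom C (i - 1) P Q) (dg_hom C i P Q) (dg_diff C (i - 1) P Q)"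
    by (intro group_hom.intro group_hom_axioms.intro h dg_group o)
  then have "subgroup (dg_diff C (i - 1) P Q ` carrier (dg_hom C (i - 1) P Q)) (dg_hom C i P Q)"
    by (rule group_hom.img_is_subgroup)
  then show ?thesis using H.triv_subgroup H.subgroup_self unfolding trunc_ideal_def by presburger
qed

lemma trunc_ideal_one: "P \<in> dg_obj C \<Longrightarrow> Q \<in> dg_obj C \<Longrightarrow> \<one>\<^bsub>dg_hom C i P Q\<^esub> \<in> trunc_ideal C N i P Q"
  by (rule subgroup.one_closed[OF trunc_ideal_subgroup])

lemma trunc_ideal_carrier: "P \<in> dg_obj C \<Longrightarrow> Q \<in> dg_obj C \<Longrightarrow> f \<in> trunc_ideal C N i P Q \<Longrightarrow> f \<in> carrier (dg_hom C i P Q)"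
  by (rule subgroup.mem_carrier[OF trunc_ideal_subgroup])

text \<open>For composites, degrees decide every case but one: a morphism of degree 0 composed, on
  either side, with a boundary of degree \<open>-N\<close>. There the Leibniz rule applies; the
  differential of the morphism of degree 0 has degree 1 and vanishes, so the composite is again a
  boundary.\<close>

lemma trunc_ideal: "dg_ideal C (trunc_ideal C N)"
proof (intro dg_ideal.intro dg_ideal_axioms.intro)
  show "dg_category C" by (rule dg_category_axioms)
  fix i P Q assume o: "P \<in> dg_obj C" "Q \<in> dg_obj C"
  show "subgroup (trunc_ideal C N i P Q) (dg_hom C i P Q)" by (rule trunc_ideal_subgroup[OF o])
  { fix f assume f: "f \<in> trunc_ideal C N i P Q"
    note fc = trunc_ideal_carrier[OF o f]
    consider "i > - int N" | "i = - int N" | "i + 1 < - int N" | "i + 1 = - int N" by linarith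
    then show "dg_diff C i P Q f \<in> trunc_ideal C N (i + 1) P Q"
    proof cases
      case 1
      then have "f = \<one>\<^bsub>dg_hom C i P Q\<^esub>" using f by (simp add: trunc_ideal_def)
      then show ?thesis using diff_one[OF o] trunc_ideal_one[OF o] by simp
    next
      case 2
      then obtain h where h: "h \<in> carrier (dg_hom C (i - 1) P Q)" "f = dg_diff C (i - 1) P Q h"
        using f by (auto simp: trunc_ideal_def)
      have "dg_diff C i P Q f = \<one>\<^bsub>dg_hom C (i + 1) P Q\<^esub>" using diff_diff[OF o h(1)] h(2) by (simp add: add.commute)
      then show ?thesis using trunc_ideal_one[OF o] by simp
    next
      case 3 then show ?thesis using diff_closed[OF o fc] by (simp add: trunc_ideal_def)
    next
      case 4
      then have "trunc_ideal C N (i + 1) P Q = dg_diff C i P Q ` carrier (dg_hom C i P Q)" by (intro trunc_ideal_top) auto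
      then show ?thesis using fc by blast
    qed }
  fix R j f g assume R: "R \<in> dg_obj C"
  note O = o R
  { assume g: "g \<in> carrier (dg_hom C i Q R)" and f: "f \<in> trunc_ideal C N j P Q"
    note fc = trunc_ideal_carrier[OF o f]
    consider "i > 0" | "j > - int N" | "i \<le> 0" "i + j < - int N" | "i = 0" "j = - int N" by linarith
    then show "dg_comp C i j P Q R g f \<in> trunc_ideal C N (i + j) P R"
    proof cases
      case 1
      then have "g = \<one>\<^bsub>dg_hom C i Q R\<^esub>" using pos[OF o(2) R _ g] by simp
      then show ?thesis using comp_one(2)[OF O fc] trunc_ideal_one[OF o(1) R] by simp
    next
      case 2
      then have "f = \<one>\<^bsub>dg_hom C j P Q\<^esub>" using f by (simp add: trunc_ideal_def)
      then show ?thesis using comp_one(1)[OF O g] trunc_ideal_one[OF o(1) R] by simp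
    next
      case 3 then show ?thesis using comp_closed[OF O g fc] by (simp add: trunc_ideal_def)
    next
      case 4
      then obtain h where h: "h \<in> carrier (dg_hom C (j - 1) P Q)" "f = dg_diff C (j - 1) P Q h"
        using f by (auto simp: trunc_ideal_def)
      have "dg_diff C i Q R g = \<one>\<^bsub>dg_hom C (i + 1) Q R\<^esub>" using pos[OF o(2) R _ diff_closed[OF o(2) R g]] 4 by simp
      then have "dg_comp C (i + 1) (j - 1) P Q R (dg_diff C i Q R g) h = \<one>\<^bsub>dg_hom C (i + j) P R\<^esub>"
        using comp_one(2)[OF O h(1), of "i + 1"] by simp
      moreover interpret H: group "dg_hom C (i + j) P R" by (rule dg_group[OF o(1) R])
      have gf: "dg_comp C i j P Q R g f \<in> carrier (dg_hom C (i + j) P R)" by (rule comp_closed[OF O g fc])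
      ultimately have "dg_diff C (i + (j - 1)) P R (dg_comp C i (j - 1) P Q R g h) = dg_comp C i j P Q R g f"
        using leibniz[OF O g h(1)] h(2) by (simp add: signed_def)
      moreover have "dg_comp C i (j - 1) P Q R g h \<in> carrier (dg_hom C (i + (j - 1)) P R)" by (rule comp_closed[OF O g h(1)])
      moreover have "trunc_ideal C N (i + j) P R = dg_diff C (i + (j - 1)) P R ` carrier (dg_hom C (i + (j - 1)) P R)"
        using 4 by (intro trunc_ideal_top) auto
      ultimately show ?thesis by (metis image_eqI)
    qed }
  { assume g: "g \<in> trunc_ideal C N i Q R" and f: "f \<in> carrier (dg_hom C j P Q)"
    note gc = trunc_ideal_carrier[OF o(2) R g]
    consider "j > 0" | "i > - int N" | "j \<le> 0" "i + j < - int N" | "j = 0" "i = - int N" by linarith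
    then show "dg_comp C i j P Q R g f \<in> trunc_ideal C N (i + j) P R"
    proof cases
      case 1
      then have "f = \<one>\<^bsub>dg_hom C j P Q\<^esub>" using pos[OF o _ f] by simp
      then show ?thesis using comp_one(1)[OF O gc] trunc_ideal_one[OF o(1) R] by simp
    next
      case 2
      then have "g = \<one>\<^bsub>dg_hom C i Q R\<^esub>" using g by (simp add: trunc_ideal_def)
      then show ?thesis using comp_one(2)[OF O f] trunc_ideal_one[OF o(1) R] by simp
    next
      case 3 then show ?thesis using comp_closed[OF O gc f] by (simp add: trunc_ideal_def)
    next
      case 4
      then obtain h where h: "h \<in> carrier (dg_hom C (i - 1) Q R)" "g = dg_diff C (i - 1) Q R h"
        using g by (auto simp: trunc_ideal_def)
      have "dg_diff C j P Q f = \<one>\<^bsub>dg_hom C (j + 1) P Q\<^esub>" using pos[OF o _ diff_closed[OF o f]] 4 by simp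
      then have "dg_comp C (i - 1) (j + 1) P Q R h (dg_diff C j P Q f) = \<one>\<^bsub>dg_hom C (i + j) P R\<^esub>"
        using comp_one(1)[OF O h(1), of "j + 1"] by simp
      moreover interpret H: group "dg_hom C (i + j) P R" by (rule dg_group[OF o(1) R])
      have gf: "dg_comp C i j P Q R g f \<in> carrier (dg_hom C (i + j) P R)" by (rule comp_closed[OF O gc f])
      ultimately have "dg_diff C (i - 1 + j) P R (dg_comp C (i - 1) j P Q R h f) = dg_comp C i j P Q R g f"
        using leibniz[OF O h(1) f] h(2) 4(1) H.l_one[OF gf] by (simp add: signed_def)
      moreover have "dg_comp C (i - 1) j P Q R h f \<in> carrier (dg_hom C (i - 1 + j) P R)" by (rule comp_closed[OF O h(1) f])
      moreover have "trunc_ideal C N (i + j) P R = dg_diff C (i - 1 + j) P R ` carrier (dg_hom C (i - 1 + j) P R)"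
        using 4 by (intro trunc_ideal_top) auto
      ultimately show ?thesis by (metis image_eqI)
    qed }
qed

end

context nonpos_functor
begin

text \<open>The truncated complexes live in degrees \<open>a\<close> to \<open>b\<close>, so an
  arrow lowering degrees by more than \<open>b - a\<close> starts or ends at a zero object.\<close>

lemma fun_trunc_low:
  assumes o: "P \<in> dg_obj C" "Q \<in> dg_obj C" and f: "f \<in> carrier (dg_hom C i P Q)" and i: "i < a - b" and ab: "a \<le> b"
  shows "nul (fun_hom (fun_trunc A a b F) i P Q f n)"
proof -
  interpret T: nonpos_functor A C "fun_trunc A a b F" by (rule fun_trunc_nonpos)
  note t = T.Fhom_simps[OF o f, of n]
  show ?thesis
  proof (cases "n > b")
    case True
    then have "fst (fun_obj (fun_trunc A a b F) Q) n = zero_obj A"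
      using ab by (simp add: fun_trunc_def fun_ge_def fun_le_def trunc_ge_def trunc_ge_obj_def trunc_le_def trunc_le_obj_def)
    then show ?thesis using t by (intro nul_from_zero_obj) auto
  next
    case False
    then have "fst (fun_obj (fun_trunc A a b F) P) (n + i) = zero_obj A"
      using i by (simp add: fun_trunc_def fun_ge_def trunc_ge_def trunc_ge_obj_def)
    then show ?thesis using t by (intro nul_to_zero_obj) auto
  qed
qed

text \<open>The truncated complexes occupy \<open>N + 1\<close> consecutive degrees, so morphisms of
  degree below \<open>-N\<close> act as zero. A boundary of degree \<open>-N\<close> acts through
  the differentials and the action of a morphism of degree \<open>-N - 1\<close>, which is
  zero.\<close>

lemma fun_trunc_kill:
  assumes o: "P \<in> dg_obj C" "Q \<in> dg_obj C" and f: "f \<in> trunc_ideal C N i P Q"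
  shows "nul (fun_hom (fun_trunc A (b - int N) b F) i P Q f n)"
proof -
  interpret T: nonpos_functor A C "fun_trunc A (b - int N) b F" by (rule fun_trunc_nonpos)
  note low = fun_trunc_low[OF o, of _ _ "b - int N" b]
  consider "i > - int N" | "i = - int N" | "i < - int N" by linarith
  then show ?thesis
  proof cases
    case 1
    then have "f = \<one>\<^bsub>dg_hom C i P Q\<^esub>" using f by (simp add: trunc_ideal_def)
    then show ?thesis using T.Fone[OF o, of i n] T.Fobj o by simp
  next
    case 2
    then obtain h where h: "h \<in> carrier (dg_hom C (i - 1) P Q)" "f = dg_diff C (i - 1) P Q h"
      using f by (auto simp: trunc_ideal_def)
    have n: "nul (fun_hom (fun_trunc A (b - int N) b F) (i - 1) P Q h m)" for m by (rule low[OF h(1)]) (use 2 in auto)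
    note t = T.Fhom_simps[OF o h(1)] and T.Fobj[OF o(1)] T.Fobj[OF o(2)]
    have "nul (snd (fun_obj (fun_trunc A (b - int N) b F) P) (n + (i - 1)) \<star> fun_hom (fun_trunc A (b - int N) b F) (i - 1) P Q h n)"
      by (rule nul_comp[OF n]) (use t T.Fobj[OF o(1)] in auto)
    moreover have "nul (fun_hom (fun_trunc A (b - int N) b F) (i - 1) P Q h (n + 1) \<star> snd (fun_obj (fun_trunc A (b - int N) b F) Q) n)"
      by (rule comp_nul[OF n]) (use t T.Fobj[OF o(2)] in auto)
    ultimately show ?thesis using T.Fdiff[OF o h(1), of n] t T.Fobj[OF o(1)] T.Fobj[OF o(2)]
      unfolding h(2) by (simp add: add_nul algebra_simps)
  next
    case 3
    then have "f \<in> carrier (dg_hom C i P Q)" using f by (simp add: trunc_ideal_def)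
    then show ?thesis using low 3 by simp
  qed
qed

end

subsection \<open>The category \<open>J\<close>\<close>

lemma J_simps:
  "dg_obj J = SmPrVar" "carrier (dg_hom J i P Q) = Suslin i Q P" "\<one>\<^bsub>dg_hom J i P Q\<^esub> = 0"
  by (simp_all add: J_def)

lemma J_ideal_eq: "J_ideal N = trunc_ideal J N"
  by (intro ext) (simp add: J_ideal_def trunc_ideal_def J_def)

lemma affine_times_0: "affine_times 0 X = X"
  by (cases X) (auto simp: affine_times_def amb_points_def)

lemma carrier_J_0: "carrier (dg_hom J 0 P Q) = SmCor P Q"
  by (auto simp: J_simps Suslin_def Suslin'_def affine_times_0)

lemma J_nonpos:
  fixes C :: "('k::field_char_0 variety, 'k cycle) dgcat"
  assumes "dg_category C" "C = J"
  shows "nonpos_dg_category C"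
  using assms by (intro nonpos_dg_category.intro nonpos_dg_category_axioms.intro) (auto simp: J_simps Suslin_def)

text \<open>The opposite of the category of complexes is formed without signs, so its composition
  and differential unfold directly to the equations of \<open>cpx_functor\<close>.\<close>

lemma nonpos_functor_opp:
  assumes "abelian_category A" and F: "dg_functor C (dg_opp (complexes A)) F"
    and pos: "\<And>P Q i f. P \<in> dg_obj C \<Longrightarrow> Q \<in> dg_obj C \<Longrightarrow> i > 0 \<Longrightarrow> f \<in> carrier (dg_hom C i P Q) \<Longrightarrow>
      f = \<one>\<^bsub>dg_hom C i P Q\<^esub>"
  shows "nonpos_functor A C F"
proof -
  interpret A: abelian A using assms(1) by (simp add: abelian_def)
  interpret F: dg_functor C "dg_opp (complexes A)" F by (rule F)
  have hom: "fun_hom F i P Q f n \<in> A.Hom (fst (fun_obj F Q) n) (fst (fun_obj F P) (n + i))"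
    if "P \<in> dg_obj C" "Q \<in> dg_obj C" "f \<in> carrier (dg_hom C i P Q)" for P Q i f n
    using hom_in_carrier[OF F.hom_hom[OF that(1,2)] that(3)] by (simp add: dg_opp_def complexes_def)
  have cpx: "is_complex A (fun_obj F P)" if "P \<in> dg_obj C" for P
    using F.obj_closed[OF that] by (simp add: dg_opp_def complexes_def)
  show ?thesis
  proof (intro nonpos_functor.intro cpx_functor.intro cpx_functor_axioms.intro nonpos_functor_axioms.intro)
    show "abelian A" by (rule A.abelian_axioms)
    show "\<And>P Q i. P \<in> dg_obj C \<Longrightarrow> Q \<in> dg_obj C \<Longrightarrow> comm_group (dg_hom C i P Q)" by (rule F.C.hom_group)
    show "\<And>P. P \<in> dg_obj C \<Longrightarrow> dg_id C P \<in> carrier (dg_hom C 0 P P)" by (rule F.C.id_closed)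
    show "\<And>P. P \<in> dg_obj C \<Longrightarrow> is_complex A (fun_obj F P)" by (rule cpx)
    show "\<And>P n. P \<in> dg_obj C \<Longrightarrow> fun_hom F 0 P P (dg_id C P) n = cat_id A (fst (fun_obj F P) n)"
      using F.pres_id by (simp add: dg_opp_def complexes_def)
    fix P Q i f n assume *: "P \<in> dg_obj C" "Q \<in> dg_obj C" "f \<in> carrier (dg_hom C i P Q)"
    show "dg_diff C i P Q f \<in> carrier (dg_hom C (i + 1) P Q)" by (rule hom_in_carrier[OF F.C.diff_hom[OF *(1,2)] *(3)])
    show "fun_hom F i P Q f n \<in> A.Hom (fst (fun_obj F Q) n) (fst (fun_obj F P) (n + i))" by (rule hom[OF *])
    show "i > 0 \<Longrightarrow> f = \<one>\<^bsub>dg_hom C i P Q\<^esub>" by (rule pos[OF *(1,2) _ *(3)])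
    have "fun_hom F i P Q f (n + 1) \<star>\<^bsub>A\<^esub> snd (fun_obj F Q) n \<in> A.Hom (fst (fun_obj F Q) n) (fst (fun_obj F P) (n + i + 1))"
      using hom[OF *, of "n + 1"] cpx[OF *(2)] by (auto simp: A.Hom_iff algebra_simps)
    then show "fun_hom F (i + 1) P Q (dg_diff C i P Q f) n = cat_add A (snd (fun_obj F P) (n + i) \<star>\<^bsub>A\<^esub> fun_hom F i P Q f n)
        (A.sg (i + 1) (fun_hom F i P Q f (n + 1) \<star>\<^bsub>A\<^esub> snd (fun_obj F Q) n))"
      using F.pres_diff[OF *] by (simp add: dg_opp_def complexes_def A.signed_hom)
    { fix g assume g: "g \<in> carrier (dg_hom C i P Q)"
      show "fun_hom F i P Q (f \<otimes>\<^bsub>dg_hom C i P Q\<^esub> g) n = cat_add A (fun_hom F i P Q f n) (fun_hom F i P Q g n)"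
        using hom_mult[OF F.hom_hom[OF *(1,2)] *(3) g] by (simp add: dg_opp_def complexes_def) }
    fix R j g assume R: "R \<in> dg_obj C" and g: "g \<in> carrier (dg_hom C j Q R)"
    show "dg_comp C j i P Q R g f \<in> carrier (dg_hom C (j + i) P R)" by (rule F.C.comp_closed[OF *(1,2) R g *(3)])
    show "fun_hom F (j + i) P R (dg_comp C j i P Q R g f) n = fun_hom F i P Q f (n + j) \<star>\<^bsub>A\<^esub> fun_hom F j Q R g n"
      using F.pres_comp[OF *(1,2) R g *(3)] by (simp add: dg_opp_def complexes_def)
  qed
qed

text \<open>The morphisms of degree 0 in \<open>J\<close> are all the finite correspondences, as the
  condition on faces is empty in degree 0; so the hypothesis on weights applies to each of
  them.\<close>

lemma J_weight_functor:
  assumes "abelian_category A" "dg_functor J (dg_opp (complexes A)) F" "no_maps_between_weights A F"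
  shows "weight_functor A J F"
proof -
  interpret F: nonpos_functor A J F by (rule nonpos_functor_opp[OF assms(1,2)]) (simp add: J_simps Suslin_def)
  show ?thesis
  proof (intro weight_functor.intro weight_functor_axioms.intro F.nonpos_functor_axioms)
    fix P P' Q Q' f g w w' \<phi>
    assume *: "P \<in> dg_obj J" "P' \<in> dg_obj J" "Q \<in> dg_obj J" "Q' \<in> dg_obj J" "f \<in> carrier (dg_hom J 0 P P')"
      "g \<in> carrier (dg_hom J 0 Q Q')" "w \<noteq> w'" "F.arr \<phi>"
      "F.src \<phi> = F.src (F.ker (cohom_map A w (fun_obj F P') (fun_obj F P) (fun_hom F 0 P P' f)))"
      "F.tgt \<phi> = F.tgt (F.cok (cohom_map A w' (fun_obj F Q') (fun_obj F Q) (fun_hom F 0 Q Q' g)))"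
    then have "\<phi> \<in> F.Hom (F.src \<phi>) (F.tgt \<phi>)" by (auto simp: F.Hom_iff)
    also have "\<dots> = {F.zr (F.src \<phi>) (F.tgt \<phi>)}"
      using assms(3) *(1-7,9,10) unfolding no_maps_between_weights_def pullback_def Let_def J_simps(1) carrier_J_0 by metis
    finally show "F.nul \<phi>" using *(8) by (simp add: F.nul_def)
  qed
qed

theorem mainTheorem16:
  fixes A :: "('o, 'a) addcat"
    and F :: "('k::field_char_0 variety, 'k cycle, 'o, 'a) cpx_fun"
  assumes "abelian_category A"
    and "dg_functor J (dg_opp (complexes A)) F"
    and "no_maps_between_weights A F"
  shows "(\<forall>M\<in>cat_obj (Tr J). S_degenerates A J F M \<and> (\<forall>b N. SN_degenerates A J F b N M)) \<and>
    (\<forall>j b (N::nat). \<exists>\<eta>.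
       natural_iso (Tr J) A (W_quot A J F j b (b - int N - 1))
         (cohom_Tr A J (fun_trunc A (b - int N) b F) j) \<eta> \<and>
       (\<forall>M\<in>cat_obj (Tr J).
          \<eta> M \<star>\<^bsub>A\<^esub> G_to_W_quot A J F j b (b - int N - 1) M =
          G_to_trunc A J F j b (b - int N - 1) M)) \<and>
    (\<forall>j b (N::nat). \<exists>\<Phi> \<theta>.
       contra_functor (Tr (JN N)) A \<Phi> \<and>
       natural_iso (Tr J) A (W_quot A J F j b (b - int N - 1)) (funct_comp \<Phi> (tN N)) \<theta>)"
proof -
  interpret F: weight_functor A J F by (rule J_weight_functor[OF assms])
  interpret Jc: nonpos_dg_category "J :: ('k variety, 'k cycle) dgcat"
    using assms(2) by (intro J_nonpos) (simp_all add: dg_functor_def)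
  have deg: "S_degenerates A J F M \<and> (\<forall>b N. SN_degenerates A J F b N M)" if M: "M \<in> cat_obj (Tr J)" for M
  proof -
    interpret weight_cpx A J F M by (rule F.weight_cpx) (use M in \<open>simp add: Tr_obj_iff\<close>)
    show ?thesis using S_deg SN_deg by blast
  qed
  have fac: "\<exists>\<Phi> \<theta>. contra_functor (Tr (JN N)) A \<Phi> \<and>
       natural_iso (Tr J) A (W_quot A J F j b (b - int N - 1)) (funct_comp \<Phi> (tN N)) \<theta>" for j b N
  proof -
    let ?T = "fun_trunc A (b - int N) b F"
    interpret T: nonpos_functor A J ?T by (rule F.fun_trunc_nonpos)
    \<comment> \<open>The canonical truncation to degrees \<open>b - N\<close> to \<open>b\<close>
      kills \<open>J_ideal N\<close>, so it factors through \<open>JN N\<close>; the cohomology of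
      the factored functor is the functor sought on \<open>Tr (JN N)\<close>.\<close>
    interpret Q: quot_fun A J ?T "J_ideal N"
      unfolding J_ideal_eq
      by (intro quot_fun.intro quot_fun_axioms.intro T.cpx_functor_axioms Jc.trunc_ideal F.fun_trunc_kill)
    have t: "Q.tD = tN N"
      by (auto simp: Q.tD_def tN_def tN_obj_def fun_eq_iff Q.Q.qtw_def Q.Q.qmat_def[abs_def] J_class_def JN_def)
    have "contra_functor (Tr (JN N)) A (cohom_Tr A (JN N) Q.QF j)"
      unfolding JN_def by (rule Q.QF.contra_functor_cohom_Tr)
    \<comment> \<open>The comparison of weight quotients with truncations is followed by the
      isomorphism between total complexes over \<open>J\<close> and over its quotient.\<close>
    moreover have "natural_iso (Tr J) A (W_quot A J F j b (b - int N - 1)) (funct_comp (cohom_Tr A (JN N) Q.QF j) (tN N))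
      (\<lambda>X. Q.\<zeta> j X \<star>\<^bsub>A\<^esub> desc_arr A (G_to_W_quot A J F j b (b - int N - 1) X) (G_to_trunc A J F j b (b - int N - 1) X))"
      by (rule F.natural_iso_trans[OF F.W_quot_iso(1) Q.tD_natural_iso[unfolded t JN_def[symmetric]]])
    ultimately show ?thesis by blast
  qed
  have iso: "\<exists>\<eta>. natural_iso (Tr J) A (W_quot A J F j b (b - int N - 1)) (cohom_Tr A J (fun_trunc A (b - int N) b F) j) \<eta> \<and>
       (\<forall>M\<in>cat_obj (Tr J). \<eta> M \<star>\<^bsub>A\<^esub> G_to_W_quot A J F j b (b - int N - 1) M = G_to_trunc A J F j b (b - int N - 1) M)" for j b N
    using F.W_quot_iso[where s = j and b = b and N = N] by (intro exI conjI ballI) (auto simp: Tr_obj_iff)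
  show ?thesis using deg iso fac by blast
qed

end
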